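(* Let $k$ be an algebraically closed field of characteristic $p\ge3$, let $r\ge1$, and let $\mathcal{P}(2r)$ be the restricted Poisson algebra in $2r$ variables with toral center. Then $$S(\mathcal{P}(2r))\simeq\mathrm{GL}_r(\mathbb{F}_p)\ltimes(\mathbb{F}_p)^r.$$ Moreover, for any torus $\mathfrak{t}\subseteq\mathcal{P}(2r)$ of maximal dimension, we have $$S(\mathcal{P}(2r),\mathfrak{t})=\{g\in\mathrm{Aut}_p(\mathfrak{t}) : g(1)=1\}.$$
   Context: $\mathcal{P}(2r)$ is the truncated polynomial ring $k[X_1,\dots,X_{2r}]/(X_1^p,\dots,X_{2r}^p)$ (generators $x_1,\dots,x_{2r}$) with Lie bracket the Poisson bracket $\{\,,\,\}$: the bi-derivation of the associative structure with $\{x_i,x_{i+r}\}=1=-\{x_{i+r},x_i\}$ for $1\le i\le r$ and all other $\{x_i,x_j\}=0$. Its center is $k=k\cdot1$. It carries the $p$-map determined on monomials $x^a=x_1^{a_1}\cdots x_{2r}^{a_{2r}}$ ($0\le a_i\le p-1$) by $(x^a)^{[p]}=x^a$ if $a\in\{0,\varepsilon_i+\varepsilon_{i+r}: 1\le i\le r\}$ and $(x^a)^{[p]}=0$ otherwise, where $\varepsilon_j$ is the $j$-th unit vector; in particular $1^{[p]}=1$, so the center is a torus. The semidirect product is with respect to the natural action of $\mathrm{GL}_r(\mathbb{F}_p)$ on $(\mathbb{F}_p)^r$. A torus of a restricted Lie algebra $(\mathfrak{g},[p])$ is an abelian $p$-subalgebra consisting of semisimple elements ($x$ is semisimple if it lies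 in the $p$-subalgebra generated by $x^{[p]}$); "maximal dimension" means dimension $\mu(\mathfrak{g})$, the maximum of the dimensions of all tori. (A torus of maximal dimension of $\mathcal{P}(2r)$ contains $1$.) For such a torus $\mathfrak{t}\subseteq\mathfrak{g}$, let $\mathcal{T}_{\mathfrak{g}}(k)$ be the (smooth affine) variety of injective homomorphisms $\mathfrak{t}\to\mathfrak{g}$ of restricted Lie algebras and $\mathcal{X}_{\mathfrak{t}}(k)$ its irreducible (equivalently, connected) component containing the inclusion. The finite group $\mathrm{Aut}_p(\mathfrak{t})$ of automorphisms of the restricted Lie algebra $\mathfrak{t}$ acts by $h\cdot\varphi=\varphi\circ h^{-1}$, and $S(\mathfrak{g})=S(\mathfrak{g},\mathfrak{t})=\mathrm{Stab}_{\mathrm{Aut}_p(\mathfrak{t})}(\mathcal{X}_{\mathfrak{t}}(k))$, which up to isomorphism is independent of $\mathfrak{t}$. *)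

theory Defs
  imports
    "HOL-Analysis.Function_Topology"
    "HOL-Analysis.Abstract_Topology_2"
    "HOL-Algebra.Bij"
    "HOL-Algebra.Group_Action"
    "HOL-Computational_Algebra.Polynomial"
    "HOL-Library.Poly_Mapping"
    "Jordan_Normal_Form.Matrix"
begin

section \<open>Restricted Lie algebras\<close>

text \<open>
  The underlying vector space of a restricted Lie algebra is the subspace \<open>carrier L\<close> of an ambient
  vector space: addition is that of the type \<open>'v\<close>, scalar multiplication is \<open>scl L\<close>.
  Subalgebras are obtained by shrinking the carrier. The record carries no axioms.
\<close>

record ('v, 'k) restricted_lie = "'v partial_object" +
  scl :: "'k \<Rightarrow> 'v \<Rightarrow> 'v"
  brk :: "'v \<Rightarrow> 'v \<Rightarrow> 'v"
  pop :: "'v \<Rightarrow> 'v"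

text \<open>
  \<open>ad_coeff br x y n j\<close> is the coefficient of \<open>T ^ j\<close> in \<open>(ad (T x + y)) ^ n (x)\<close>, where \<open>T\<close> is an
  indeterminate. Jacobson's terms \<open>s_i(x, y)\<close> are defined by
  \<open>(ad (T x + y)) ^ (p - 1) (x) = (\<Sum>i = 1..p - 1. i s_i(x, y) T ^ (i - 1))\<close>.
\<close>

fun ad_coeff :: "('v \<Rightarrow> 'v \<Rightarrow> 'v) \<Rightarrow> 'v \<Rightarrow> 'v \<Rightarrow> nat \<Rightarrow> nat \<Rightarrow> 'v::ab_group_add" where
  "ad_coeff br x y 0 j = (if j = 0 then x else 0)"
| "ad_coeff br x y (Suc n) j =
     br y (ad_coeff br x y n j) + (if j = 0 then 0 else br x (ad_coeff br x y n (j - 1)))"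

definition jacobson_term :: "('v::ab_group_add, 'k::field) restricted_lie \<Rightarrow> nat \<Rightarrow> 'v \<Rightarrow> 'v \<Rightarrow> 'v" where
  "jacobson_term L i x y =
     scl L (inverse (of_nat i)) (ad_coeff (brk L) x y (CHAR('k) - 1) (i - 1))"

definition is_p_map :: "('v::ab_group_add, 'k::field) restricted_lie \<Rightarrow> bool" where
  "is_p_map L \<longleftrightarrow>
     (\<forall>x\<in>carrier L. pop L x \<in> carrier L) \<and>
     (\<forall>x\<in>carrier L. \<forall>y\<in>carrier L. brk L (pop L x) y = (brk L x ^^ CHAR('k)) y) \<and>
     (\<forall>c. \<forall>x\<in>carrier L. pop L (scl L c x) = scl L (c ^ CHAR('k)) (pop L x)) \<and>
     (\<forall>x\<in>carrier L. \<forall>y\<in>carrier L.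
        pop L (x + y) = pop L x + pop L y + (\<Sum>i = 1..CHAR('k) - 1. jacobson_term L i x y))"

definition p_subalgebra :: "('v::ab_group_add, 'k::field) restricted_lie \<Rightarrow> 'v set \<Rightarrow> bool" where
  "p_subalgebra L h \<longleftrightarrow>
     h \<subseteq> carrier L \<and> module.subspace (scl L) h \<and>
     (\<forall>x\<in>h. \<forall>y\<in>h. brk L x y \<in> h) \<and> (\<forall>x\<in>h. pop L x \<in> h)"

definition p_subalgebra_generated :: "('v::ab_group_add, 'k::field) restricted_lie \<Rightarrow> 'v set \<Rightarrow> 'v set" where
  "p_subalgebra_generated L A = \<Inter>{h. p_subalgebra L h \<and> A \<subseteq> h}"

definition semisimple :: "('v::ab_group_add, 'k::field) restricted_lie \<Rightarrow> 'v \<Rightarrow> bool" where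
  "semisimple L x \<longleftrightarrow> x \<in> carrier L \<and> x \<in> p_subalgebra_generated L {pop L x}"

definition torus :: "('v::ab_group_add, 'k::field) restricted_lie \<Rightarrow> 'v set \<Rightarrow> bool" where
  "torus L t \<longleftrightarrow>
     p_subalgebra L t \<and> (\<forall>x\<in>t. \<forall>y\<in>t. brk L x y = 0) \<and> (\<forall>x\<in>t. semisimple L x)"

definition max_torus_dim :: "('v::ab_group_add, 'k::field) restricted_lie \<Rightarrow> nat" where
  "max_torus_dim L = Max {vector_space.dim (scl L) t |t. torus L t}"

definition max_dim_torus :: "('v::ab_group_add, 'k::field) restricted_lie \<Rightarrow> 'v set \<Rightarrow> bool" where
  "max_dim_torus L t \<longleftrightarrow> torus L t \<and> vector_space.dim (scl L) t = max_torus_dim L"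

definition rlie_hom ::
  "('v::ab_group_add, 'k::field) restricted_lie \<Rightarrow> ('w::ab_group_add, 'k) restricted_lie \<Rightarrow> ('v \<Rightarrow> 'w) set" where
  "rlie_hom L M = {\<phi> \<in> carrier L \<rightarrow>\<^sub>E carrier M.
     (\<forall>x\<in>carrier L. \<forall>y\<in>carrier L. \<phi> (x + y) = \<phi> x + \<phi> y) \<and>
     (\<forall>c. \<forall>x\<in>carrier L. \<phi> (scl L c x) = scl M c (\<phi> x)) \<and>
     (\<forall>x\<in>carrier L. \<forall>y\<in>carrier L. \<phi> (brk L x y) = brk M (\<phi> x) (\<phi> y)) \<and>
     (\<forall>x\<in>carrier L. \<phi> (pop L x) = pop M (\<phi> x))}"


section \<open>The variety of embeddings of a torus and the group \<open>S(g, t)\<close>\<close>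

definition torus_embeddings ::
  "('v::ab_group_add, 'k::field) restricted_lie \<Rightarrow> 'v set \<Rightarrow> ('v \<Rightarrow> 'v) set" where
  "torus_embeddings L t = {\<phi> \<in> rlie_hom (L\<lparr>carrier := t\<rparr>) L. inj_on \<phi> t}"

text \<open>
  Polynomial functions on the space of linear maps from \<open>t\<close> to \<open>carrier L\<close>: for finite-dimensional
  \<open>t\<close> and \<open>L\<close>, its dual is spanned by the functions \<open>\<phi> \<mapsto> \<xi> (\<phi> x)\<close>, with \<open>x \<in> t\<close> and \<open>\<xi>\<close> a linear form
  (every linear form on \<open>carrier L\<close> extends to the ambient space).
\<close>

inductive_set hom_poly_funs ::
  "('v::ab_group_add, 'k::field) restricted_lie \<Rightarrow> 'v set \<Rightarrow> (('v \<Rightarrow> 'v) \<Rightarrow> 'k) set"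
  for L :: "('v::ab_group_add, 'k::field) restricted_lie" and t :: "'v set" where
  const: "(\<lambda>\<phi>. c) \<in> hom_poly_funs L t"
| coord: "Vector_Spaces.linear (scl L) (*) \<xi> \<Longrightarrow> x \<in> t \<Longrightarrow> (\<lambda>\<phi>. \<xi> (\<phi> x)) \<in> hom_poly_funs L t"
| add: "f \<in> hom_poly_funs L t \<Longrightarrow> g \<in> hom_poly_funs L t \<Longrightarrow> (\<lambda>\<phi>. f \<phi> + g \<phi>) \<in> hom_poly_funs L t"
| mult: "f \<in> hom_poly_funs L t \<Longrightarrow> g \<in> hom_poly_funs L t \<Longrightarrow> (\<lambda>\<phi>. f \<phi> * g \<phi>) \<in> hom_poly_funs L t"

text \<open>The Zariski topology, generated by the principal open subsets.\<close>

definition zariski_topology ::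
  "('v::ab_group_add, 'k::field) restricted_lie \<Rightarrow> 'v set \<Rightarrow> ('v \<Rightarrow> 'v) topology" where
  "zariski_topology L t =
     topology_generated_by ((\<lambda>f. {\<phi> \<in> torus_embeddings L t. f \<phi> \<noteq> 0}) ` hom_poly_funs L t)"

lemma topspace_zariski_topology [simp]: "topspace (zariski_topology L t) = torus_embeddings L t"
proof -
  have "torus_embeddings L t \<in> (\<lambda>f. {\<phi> \<in> torus_embeddings L t. f \<phi> \<noteq> 0}) ` hom_poly_funs L t"
    by (rule image_eqI[OF _ hom_poly_funs.const[of 1]]) simp
  then show ?thesis
    unfolding zariski_topology_def topology_generated_by_topspace by blast
qed

text \<open>
  The component containing the inclusion; as the variety is smooth, its connected components are its
  irreducible components.
\<close>

definition inclusion_component ::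
  "('v::ab_group_add, 'k::field) restricted_lie \<Rightarrow> 'v set \<Rightarrow> ('v \<Rightarrow> 'v) set" where
  "inclusion_component L t = connected_component_of_set (zariski_topology L t) (\<lambda>x\<in>t. x)"

definition Aut_p :: "('v::ab_group_add, 'k::field) restricted_lie \<Rightarrow> 'v set \<Rightarrow> ('v \<Rightarrow> 'v) monoid" where
  "Aut_p L t = (BijGroup t)
     \<lparr>carrier := {h \<in> rlie_hom (L\<lparr>carrier := t\<rparr>) (L\<lparr>carrier := t\<rparr>). bij_betw h t t}\<rparr>"

definition aut_action :: "'v set \<Rightarrow> ('v \<Rightarrow> 'v) \<Rightarrow> ('v \<Rightarrow> 'w) \<Rightarrow> ('v \<Rightarrow> 'w)" where
  "aut_action t h \<phi> = compose t \<phi> (inv_into t h)"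

definition S_set :: "('v::ab_group_add, 'k::field) restricted_lie \<Rightarrow> 'v set \<Rightarrow> ('v \<Rightarrow> 'v) set" where
  "S_set L t = stabilizer (Aut_p L t) (\<lambda>h X. aut_action t h ` X) (inclusion_component L t)"

definition S_group :: "('v::ab_group_add, 'k::field) restricted_lie \<Rightarrow> 'v set \<Rightarrow> ('v \<Rightarrow> 'v) monoid" where
  "S_group L t = (Aut_p L t)\<lparr>carrier := S_set L t\<rparr>"


section \<open>The group \<open>GL\<^sub>r(F\<^sub>p) \<ltimes> F\<^sub>p\<^sup>r\<close>\<close>

definition semidirect_product ::
  "('h, 'c) monoid_scheme \<Rightarrow> ('n, 'd) monoid_scheme \<Rightarrow> ('h \<Rightarrow> 'n \<Rightarrow> 'n) \<Rightarrow> ('h \<times> 'n) monoid" where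
  "semidirect_product H N act =
     \<lparr>carrier = carrier H \<times> carrier N,
      monoid.mult = (\<lambda>(h, n) (h', n'). (h \<otimes>\<^bsub>H\<^esub> h', n \<otimes>\<^bsub>N\<^esub> act h n')),
      one = (\<one>\<^bsub>H\<^esub>, \<one>\<^bsub>N\<^esub>)\<rparr>"

text \<open>The field with \<open>p\<close> elements is realised inside \<open>'k\<close>, as its prime field.\<close>

definition prime_field :: "'k::field set" where
  "prime_field = \<int>"

definition GL_Fp :: "nat \<Rightarrow> 'k::field mat monoid" where
  "GL_Fp r = units_of
     \<lparr>carrier = {A \<in> carrier_mat r r. elements_mat A \<subseteq> prime_field}, monoid.mult = (*), one = 1\<^sub>m r\<rparr>"

definition vec_Fp :: "nat \<Rightarrow> 'k::field vec monoid" where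
  "vec_Fp r = \<lparr>carrier = {v \<in> carrier_vec r. set\<^sub>v v \<subseteq> prime_field}, monoid.mult = (+), one = 0\<^sub>v r\<rparr>"

definition GL_Fp_semidirect :: "nat \<Rightarrow> ('k::field mat \<times> 'k vec) monoid" where
  "GL_Fp_semidirect r = semidirect_product (GL_Fp r) (vec_Fp r) (*\<^sub>v)"


section \<open>The Poisson algebra \<open>P(2r)\<close>\<close>

text \<open>
  Polynomials in \<open>X_0, X_1, \<dots>\<close> are finitely supported functions on the exponent vectors.
  A class of the truncated polynomial ring \<open>k[X_1,\<dots>,X_{2r}]/(X_1^p,\<dots>,X_{2r}^p)\<close> is represented
  by its unique representative in which all exponents are smaller than \<open>p\<close>.
\<close>

type_synonym 'k mpoly = "(nat \<Rightarrow>\<^sub>0 nat) \<Rightarrow>\<^sub>0 'k"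

abbreviation (input) pvar :: "nat \<Rightarrow> nat \<Rightarrow>\<^sub>0 nat" where
  "pvar j \<equiv> Poly_Mapping.single j 1"

abbreviation pmonom :: "(nat \<Rightarrow>\<^sub>0 nat) \<Rightarrow> 'k::field mpoly" where
  "pmonom a \<equiv> Poly_Mapping.single a 1"

definition trunc_exps :: "nat \<Rightarrow> nat \<Rightarrow> (nat \<Rightarrow>\<^sub>0 nat) set" where
  "trunc_exps p n = {a. Poly_Mapping.keys a \<subseteq> {1..n} \<and> (\<forall>j. Poly_Mapping.lookup a j < p)}"

definition trunc_polys :: "nat \<Rightarrow> 'k::field mpoly set" where
  "trunc_polys n = {f. Poly_Mapping.keys f \<subseteq> trunc_exps CHAR('k) n}"

definition pscale :: "'k::field \<Rightarrow> 'k mpoly \<Rightarrow> 'k mpoly" where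
  "pscale c f = Poly_Mapping.single 0 c * f"

text \<open>Reduction modulo the ideal generated by the \<open>X_j ^ p\<close>.\<close>

definition ptrunc :: "'k::field mpoly \<Rightarrow> 'k mpoly" where
  "ptrunc f = (\<Sum>a | a \<in> Poly_Mapping.keys f \<and> (\<forall>j. Poly_Mapping.lookup a j < CHAR('k)).
     Poly_Mapping.single a (Poly_Mapping.lookup f a))"

definition tmult :: "'k::field mpoly \<Rightarrow> 'k mpoly \<Rightarrow> 'k mpoly" where
  "tmult f g = ptrunc (f * g)"

definition partial_deriv :: "nat \<Rightarrow> 'k::field mpoly \<Rightarrow> 'k mpoly" where
  "partial_deriv j f = (\<Sum>a \<in> Poly_Mapping.keys f.
     Poly_Mapping.single (a - pvar j) (of_nat (Poly_Mapping.lookup a j) * Poly_Mapping.lookup f a))"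

text \<open>
  The Poisson bracket in coordinates; lemmas below show that it is the bi-derivation with
  \<open>{x_i, x_{i+r}} = 1 = - {x_{i+r}, x_i}\<close> and with all other brackets of generators zero.
\<close>

definition poisson_bracket :: "nat \<Rightarrow> 'k::field mpoly \<Rightarrow> 'k mpoly \<Rightarrow> 'k mpoly" where
  "poisson_bracket r f g = ptrunc (\<Sum>i = 1..r.
     partial_deriv i f * partial_deriv (i + r) g - partial_deriv (i + r) f * partial_deriv i g)"

definition poisson_algebra :: "nat \<Rightarrow> ('k mpoly \<Rightarrow> 'k mpoly) \<Rightarrow> ('k::field mpoly, 'k) restricted_lie" where
  "poisson_algebra r pm =
     \<lparr>carrier = trunc_polys (2 * r), scl = pscale, brk = poisson_bracket r, pop = pm\<rparr>"

text \<open>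
  A \<open>p\<close>-map is determined by its values on a basis, so this determines \<open>pm\<close> on \<open>trunc_polys (2 * r)\<close>.
\<close>

definition poisson_p_map :: "nat \<Rightarrow> ('k::field mpoly \<Rightarrow> 'k mpoly) \<Rightarrow> bool" where
  "poisson_p_map r pm \<longleftrightarrow>
     is_p_map (poisson_algebra r pm) \<and>
     (\<forall>a \<in> trunc_exps CHAR('k) (2 * r).
        pm (pmonom a) =
          (if a \<in> {0} \<union> {pvar i + pvar (i + r) |i. 1 \<le> i \<and> i \<le> r} then pmonom a else 0))"


subsection \<open>Properties of the bracket\<close>

lemma vector_space_pscale: "vector_space (pscale :: 'k::field \<Rightarrow> _)"
  by unfold_locales
     (simp_all add: pscale_def distrib_left distrib_right single_add mult_single mult.assoc[symmetric])

lemma mpoly_induct [case_names single add]: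
  fixes f :: "'a \<Rightarrow>\<^sub>0 'b::comm_monoid_add"
  assumes "\<And>a c. P (Poly_Mapping.single a c)" "\<And>f g. P f \<Longrightarrow> P g \<Longrightarrow> P (f + g)"
  shows "P f"
proof (induction f rule: update_induct)
  case const
  then show ?case using assms(1)[of undefined 0] by simp
next
  case (update f a c)
  have "Poly_Mapping.update a c f = f + Poly_Mapping.single a c"
    using update.hyps
    by (intro poly_mapping_eqI)
       (auto simp: lookup_update lookup_add lookup_single when_def in_keys_iff)
  then show ?case using assms update.IH by metis
qed

lemma lookup_ptrunc:
  "Poly_Mapping.lookup (ptrunc (f :: 'k::field mpoly)) a =
     (if \<forall>j. Poly_Mapping.lookup a j < CHAR('k) then Poly_Mapping.lookup f a else 0)"
  by (simp add: ptrunc_def lookup_sum lookup_single when_def sum.delta in_keys_iff)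

lemma ptrunc_add: "ptrunc (f + g) = ptrunc f + ptrunc g"
  by (rule poly_mapping_eqI) (simp add: lookup_ptrunc lookup_add)

lemma ptrunc_diff: "ptrunc (f - g) = ptrunc f - ptrunc g"
  by (rule poly_mapping_eqI) (simp add: lookup_ptrunc lookup_minus)

lemma ptrunc_zero [simp]: "ptrunc 0 = 0"
  by (rule poly_mapping_eqI) (simp add: lookup_ptrunc)

lemma ptrunc_sum: "ptrunc (\<Sum>i\<in>I. f i) = (\<Sum>i\<in>I. ptrunc (f i))"
  by (induction I rule: infinite_finite_induct) (simp_all add: ptrunc_add)

lemma ptrunc_single:
  "ptrunc (Poly_Mapping.single a (c :: 'k::field)) =
     (if \<forall>j. Poly_Mapping.lookup a j < CHAR('k) then Poly_Mapping.single a c else 0)"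
  by (rule poly_mapping_eqI) (auto simp: lookup_ptrunc lookup_single when_def)

lemma ptrunc_mult_left: "ptrunc (ptrunc f * g) = ptrunc (f * (g :: 'k::field mpoly))"
proof (induction f rule: mpoly_induct)
  case (single a c)
  show ?case
  proof (induction g rule: mpoly_induct)
    case (single b d)
    have "\<forall>j. Poly_Mapping.lookup a j < CHAR('k)"
      if "\<forall>j. Poly_Mapping.lookup (a + b) j < CHAR('k)"
      using that by (auto simp: lookup_add intro: le_less_trans[OF le_add1])
    then show ?case by (auto simp: ptrunc_single mult_single)
  qed (simp add: distrib_left ptrunc_add)
qed (simp add: distrib_right ptrunc_add)

lemma ptrunc_mult_right: "ptrunc (f * ptrunc g) = ptrunc (f * g)"
  by (metis ptrunc_mult_left mult.commute)

lemma lookup_partial_deriv: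
  "Poly_Mapping.lookup (partial_deriv j f) b =
     of_nat (Poly_Mapping.lookup b j + 1) * Poly_Mapping.lookup f (b + pvar j)"
proof -
  have "Poly_Mapping.lookup (partial_deriv j f) b =
    (\<Sum>a\<in>Poly_Mapping.keys f. if a = b + pvar j
        then of_nat (Poly_Mapping.lookup a j) * Poly_Mapping.lookup f a else 0)"
    unfolding partial_deriv_def lookup_sum
  proof (rule sum.cong)
    fix a
    have *: "a = b + pvar j" if "a - pvar j = b" "Poly_Mapping.lookup a j \<noteq> 0"
    proof (rule poly_mapping_eqI)
      fix i
      show "Poly_Mapping.lookup a i = Poly_Mapping.lookup (b + pvar j) i"
        using that by (auto simp: lookup_add lookup_minus lookup_single when_def)
    qed
    show "Poly_Mapping.lookup (Poly_Mapping.single (a - pvar j)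
          (of_nat (Poly_Mapping.lookup a j) * Poly_Mapping.lookup f a)) b =
        (if a = b + pvar j then of_nat (Poly_Mapping.lookup a j) * Poly_Mapping.lookup f a else 0)"
    proof (cases "a = b + pvar j")
      case True
      then show ?thesis by simp
    next
      case False
      then have "a - pvar j \<noteq> b \<or> Poly_Mapping.lookup a j = 0" using * by blast
      then show ?thesis using False by (auto simp: lookup_single)
    qed
  qed simp
  also have "\<dots> = of_nat (Poly_Mapping.lookup b j + 1) * Poly_Mapping.lookup f (b + pvar j)"
    by (auto simp: lookup_add in_keys_iff sum.delta')
  finally show ?thesis .
qed

lemma partial_deriv_add: "partial_deriv j (f + g) = partial_deriv j f + partial_deriv j g"
  by (rule poly_mapping_eqI) (simp add: lookup_partial_deriv lookup_add algebra_simps)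

lemma partial_deriv_single:
  "partial_deriv j (Poly_Mapping.single a (c :: 'k::field)) =
     Poly_Mapping.single (a - pvar j) (of_nat (Poly_Mapping.lookup a j) * c)"
  by (simp add: partial_deriv_def)

lemma partial_deriv_mult:
  "partial_deriv j (f * g) = partial_deriv j f * g + f * partial_deriv j (g :: 'k::field mpoly)"
proof (induction f rule: mpoly_induct)
  case (single a c)
  show ?case
  proof (induction g rule: mpoly_induct)
    case (single b d)
    have 1: "a - pvar j + b = a + b - pvar j" if "Poly_Mapping.lookup a j \<noteq> 0"
      using that by (intro poly_mapping_eqI) (auto simp: lookup_add lookup_minus lookup_single when_def)
    have 2: "a + (b - pvar j) = a + b - pvar j" if "Poly_Mapping.lookup b j \<noteq> 0"
      using that by (intro poly_mapping_eqI) (auto simp: lookup_add lookup_minus lookup_single when_def)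
    have e1: "Poly_Mapping.single (a - pvar j + b) (of_nat (Poly_Mapping.lookup a j) * c * d) =
        Poly_Mapping.single (a + b - pvar j) (of_nat (Poly_Mapping.lookup a j) * c * d)"
      by (cases "Poly_Mapping.lookup a j = 0") (simp, metis 1)
    have e2: "Poly_Mapping.single (a + (b - pvar j)) (c * (of_nat (Poly_Mapping.lookup b j) * d)) =
        Poly_Mapping.single (a + b - pvar j) (c * (of_nat (Poly_Mapping.lookup b j) * d))"
      by (cases "Poly_Mapping.lookup b j = 0") (simp, metis 2)
    show ?case
      unfolding mult_single partial_deriv_single e1 e2 lookup_add single_add[symmetric]
      by (simp add: algebra_simps)
  qed (simp add: distrib_left partial_deriv_add)
qed (simp add: distrib_right partial_deriv_add)

lemma ptrunc_partial_deriv_ptrunc: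
  "ptrunc (partial_deriv j (ptrunc f)) = ptrunc (partial_deriv j (f :: 'k::field mpoly))"
proof (rule poly_mapping_eqI)
  fix b :: "nat \<Rightarrow>\<^sub>0 nat"
  have "of_nat (Poly_Mapping.lookup b j + 1) = (0 :: 'k)"
    if "\<forall>i. Poly_Mapping.lookup b i < CHAR('k)"
      "\<not> (\<forall>i. Poly_Mapping.lookup (b + pvar j) i < CHAR('k))"
  proof -
    from that obtain i where "Poly_Mapping.lookup (b + pvar j) i \<ge> CHAR('k)"
      by (auto simp: not_less)
    moreover have "Poly_Mapping.lookup b i < CHAR('k)" using that(1) by blast
    ultimately have "Poly_Mapping.lookup b j + 1 = CHAR('k)"
      by (auto simp: lookup_add lookup_single when_def split: if_splits)
    then show ?thesis by (metis of_nat_CHAR)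
  qed
  note z = this
  show "Poly_Mapping.lookup (ptrunc (partial_deriv j (ptrunc f))) b =
      Poly_Mapping.lookup (ptrunc (partial_deriv j f)) b"
  proof (cases "\<forall>i. Poly_Mapping.lookup (b + pvar j) i < CHAR('k)")
    case True
    then show ?thesis by (simp only: lookup_ptrunc lookup_partial_deriv if_True simp_thms)
  next
    case False
    then show ?thesis
      unfolding lookup_ptrunc lookup_partial_deriv using z by (metis mult_zero_left)
  qed
qed

lemma ptrunc_partial_deriv_mult_left:
  "ptrunc (partial_deriv j (ptrunc f) * g) = ptrunc (partial_deriv j f * g)"
  by (metis ptrunc_mult_left ptrunc_partial_deriv_ptrunc)

lemma poisson_bracket_antisym: "poisson_bracket r g f = - poisson_bracket r f g"
proof -
  have "poisson_bracket r g f + poisson_bracket r f g = 0"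
    unfolding poisson_bracket_def ptrunc_add[symmetric] sum.distrib[symmetric]
    by (simp add: algebra_simps)
  then show ?thesis by (simp add: eq_neg_iff_add_eq_0)
qed

lemma poisson_bracket_add_left:
  "poisson_bracket r (f + g) h = poisson_bracket r f h + poisson_bracket r g h"
  unfolding poisson_bracket_def ptrunc_add[symmetric] sum.distrib[symmetric]
  by (simp add: partial_deriv_add algebra_simps)

lemma poisson_bracket_add_right:
  "poisson_bracket r h (f + g) = poisson_bracket r h f + poisson_bracket r h g"
  by (simp only: poisson_bracket_antisym[of r h] poisson_bracket_add_left minus_add_distrib)

lemma lookup_pscale: "Poly_Mapping.lookup (pscale c f) a = c * Poly_Mapping.lookup f a"
proof (induction f rule: mpoly_induct)
  case (single b d)
  show ?case by (simp add: pscale_def mult_single lookup_single mult_when)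
next
  case (add f g)
  then show ?case by (simp add: pscale_def distrib_left lookup_add)
qed

lemma ptrunc_pscale: "ptrunc (pscale c f) = pscale c (ptrunc f)"
  by (rule poly_mapping_eqI) (simp add: lookup_pscale lookup_ptrunc)

lemma poisson_bracket_pscale_left:
  "poisson_bracket r (pscale c f) g = pscale c (poisson_bracket r f g)"
proof -
  have d: "partial_deriv j (pscale c f) = pscale c (partial_deriv j f)" for j
    by (rule poly_mapping_eqI) (simp add: lookup_pscale lookup_partial_deriv)
  show ?thesis
    unfolding poisson_bracket_def ptrunc_pscale[symmetric] d
    unfolding pscale_def sum_distrib_left right_diff_distrib mult.assoc ..
qed

lemma poisson_bracket_tmult_left:
  "poisson_bracket r (tmult f g) h =
     tmult f (poisson_bracket r g h) + tmult g (poisson_bracket r f h)"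
proof -
  have "poisson_bracket r (tmult f g) h = ptrunc (\<Sum>i = 1..r.
     partial_deriv i (f * g) * partial_deriv (i + r) h - partial_deriv (i + r) (f * g) * partial_deriv i h)"
    by (simp add: poisson_bracket_def tmult_def ptrunc_sum ptrunc_diff ptrunc_partial_deriv_mult_left)
  also have "\<dots> = tmult f (poisson_bracket r g h) + tmult g (poisson_bracket r f h)"
    unfolding poisson_bracket_def tmult_def ptrunc_mult_right
      ptrunc_add[symmetric] sum_distrib_left sum.distrib[symmetric]
    by (simp add: partial_deriv_mult algebra_simps)
  finally show ?thesis .
qed

lemma poisson_bracket_tmult_right:
  "poisson_bracket r h (tmult f g) =
     tmult f (poisson_bracket r h g) + tmult g (poisson_bracket r h f)"
proof -
  have neg: "tmult a (- b) = - tmult a b" for a b :: "'a mpoly"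
    using ptrunc_diff[of 0 "a * b"] by (simp add: tmult_def)
  show ?thesis
    unfolding poisson_bracket_antisym[of r h] poisson_bracket_tmult_left neg by simp
qed

lemma poisson_bracket_generators:
  assumes "CHAR('k::field) > 0" "j \<in> {1..2 * r}" "l \<in> {1..2 * r}"
  shows "poisson_bracket r (pmonom (pvar j) :: 'k mpoly) (pmonom (pvar l)) =
     (if l = j + r then 1 else if j = l + r then - 1 else 0)"
proof -
  have d: "partial_deriv i (pmonom (pvar m) :: 'k mpoly) = (if i = m then 1 else 0)" for i m
    by (auto simp: partial_deriv_single lookup_single when_def)
  have one: "ptrunc (1 :: 'k mpoly) = 1"
    using assms(1) ptrunc_single[of 0 "1 :: 'k"] by simp
  have "poisson_bracket r (pmonom (pvar j) :: 'k mpoly) (pmonom (pvar l)) =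
      ptrunc ((\<Sum>i = 1..r. if i = j then (if l = j + r then 1 else 0) else 0) -
        (\<Sum>i = 1..r. if i = l then (if j = l + r then 1 else 0) else 0))"
    unfolding poisson_bracket_def d sum_subtractf[symmetric]
    by (intro arg_cong[where f = ptrunc] sum.cong) auto
  also have "\<dots> = (if l = j + r then 1 else if j = l + r then - 1 else 0)"
    using assms(2,3) one ptrunc_diff[of 0 "1 :: 'k mpoly"] by (auto simp: sum.delta)
  finally show ?thesis .
qed

end

theory Submission
  imports Defs "HOL-Number_Theory.Cong" "Jordan_Normal_Form.Determinant"
begin

text \<open>
  A torus has a basis of toral elements. Hence an embedding of a torus \<open>t\<close> of maximal dimension is given by a family
  of commuting independent toral elements, a \<open>toral_frame\<close>, and the embeddings with a given image form an orbit of the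
  finite group \<open>Aut_p L t\<close>.

  This group acts transitively on the components of the variety of embeddings, for every finite-dimensional
  restricted Lie algebra (\<open>Aut_p_transitive_on_components\<close>). Join generic elements of two maximal tori by a line. The
  high powers of almost every point of the line span a torus of maximal dimension, and the embeddings with this image
  correspond to tuples of roots of a polynomial that depends rationally on the point. Power sums of the roots are
  again rational, so the sum of a polynomial function over the embeddings with a given image is rational along the
  line. Therefore an open set of embeddings that meets one image meets almost all of them, so there are finitely
  many components, and each of them meets almost all images.

  For the Poisson algebra, put \<open>x_i = X_{i+1}\<close> and \<open>y_i = X_{i+1+r}\<close> for \<open>i < r\<close>. Its tori have dimension at most \<open>r + 1\<close>
  (\<open>torus_dim_le\<close>): the linear parts of a torus form an isotropic subspace of a symplectic space of dimension \<open>2 r\<close>, and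
  every nonzero weight of the remaining torus on linear parts allows one to enlarge this subspace. A torus of maximal
  dimension therefore contains the central element \<open>1\<close>. The embeddings that map a given toral element to \<open>1\<close> form
  a set that is open and closed, so the elements of \<open>S_set L t\<close> fix \<open>1\<close>.

  Conversely, let \<open>g\<close> fix \<open>1\<close>. By transitivity it is enough to find one embedding in the same component as its
  composition with \<open>g\<close>. The operator \<open>\<Sum>i<r. y_0^(p-1) \<dots> y_(i-1)^(p-1) \<partial>/\<partial>y_i\<close> on the functions of the \<open>y_i\<close> is, up to
  factorials, a nilpotent Jordan block of size \<open>p ^ r\<close>, and it can be deformed to the companion matrices of the additive
  polynomials \<open>T ^ (p ^ r) - \<Sum>i<r. a i T ^ (p ^ i)\<close>. These operators are brackets with elements that are linear in the
  \<open>x_i\<close>. It follows that there are elements \<open>X\<close> of the Poisson algebra, depending polynomially on the parameters \<open>a\<close> and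
  \<open>b\<close>, with \<open>X^[p]^r = \<Sum>i<r. a i X^[p]^i + b\<close> (\<open>companion_element_relation\<close>). Given \<open>z_0, \<dots>, z_(r-1)\<close> that are independent
  over the prime field and any \<open>z_r\<close>, choose the polynomial with the roots \<open>z_0, \<dots>, z_(r-1)\<close> as \<open>a\<close>, and its value at
  \<open>z_r\<close> as \<open>b\<close>. Then \<open>X = \<Sum>i<r. z_i e_i + z_r\<close> with toral elements \<open>e_i\<close>, which form a frame together with \<open>1\<close> and
  depend rationally on \<open>z\<close>. All these frames are connected to each other, since the points \<open>z\<close> form an open subset of
  an affine space. But an affine transformation of \<open>z\<close> over the prime field changes neither \<open>a\<close> nor \<open>b\<close>, hence not \<open>X\<close>,
  so it transforms the frame by the automorphism with the transposed matrix, and every automorphism that fixes \<open>1\<close>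
  is of this form (\<open>frame_embedding_stable\<close>).

  In the coordinates of a toral basis that contains \<open>1\<close>, the automorphisms that fix \<open>1\<close> are the affine maps over the
  prime field (\<open>affine_group_iso\<close>).
\<close>

section \<open>Additive polynomials in characteristic p\<close>

lemma frobenius_sum:
  fixes f :: "'a \<Rightarrow> 'k::field"
  assumes "CHAR('k) > 0"
  shows "(\<Sum>i\<in>A. f i) ^ (CHAR('k) ^ n) = (\<Sum>i\<in>A. f i ^ (CHAR('k) ^ n))"
  using assms by (intro freshmans_dream_sum') (auto intro: prime_CHAR_semidom)

lemma frobenius_add:
  fixes x y :: "'k::field"
  assumes "CHAR('k) > 0"
  shows "(x + y) ^ (CHAR('k) ^ n) = x ^ (CHAR('k) ^ n) + y ^ (CHAR('k) ^ n)"
  using assms by (intro freshmans_dream') (auto intro: prime_CHAR_semidom)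

lemma CHAR_gt_1: "CHAR('k::field) > 0 \<Longrightarrow> CHAR('k) > 1"
  using prime_CHAR_semidom prime_gt_1_nat by blast

lemma Ints_eq_image_of_nat:
  assumes "CHAR('k::field) > 0"
  shows "(\<int> :: 'k set) = of_nat ` {..<CHAR('k)}"
proof
  show "(\<int> :: 'k set) \<subseteq> of_nat ` {..<CHAR('k)}"
  proof
    fix x :: 'k assume "x \<in> \<int>"
    then obtain m where m: "x = of_int m" by (auto elim: Ints_cases)
    let ?p = "CHAR('k)"
    have "(of_int m :: 'k) = of_int (m mod int ?p + int ?p * (m div int ?p))" by simp
    also have "\<dots> = of_int (m mod int ?p)" by (simp only: of_int_add of_int_mult) simp
    also have "\<dots> = of_nat (nat (m mod int ?p))" using assms by simp
    finally have "x = of_nat (nat (m mod int ?p))" using m by simp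
    moreover have "nat (m mod int ?p) < ?p" using assms by (simp add: nat_less_iff)
    ultimately show "x \<in> of_nat ` {..<?p}" by blast
  qed
qed (auto simp: Ints_of_nat)

lemma finite_Ints_card:
  assumes "CHAR('k::field) > 0"
  shows "finite (\<int> :: 'k set)" "card (\<int> :: 'k set) = CHAR('k)"
proof -
  have "inj_on (of_nat :: nat \<Rightarrow> 'k) {..<CHAR('k)}"
    by (rule inj_onI) (simp add: of_nat_eq_iff_cong_CHAR cong_def)
  then show "finite (\<int> :: 'k set)" "card (\<int> :: 'k set) = CHAR('k)"
    unfolding Ints_eq_image_of_nat[OF assms] by (auto simp: card_image)
qed

lemma frobenius_fixed_Ints:
  assumes "CHAR('k::field) > 0" "(c :: 'k) \<in> \<int>"
  shows "c ^ (CHAR('k) ^ n) = c"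
proof -
  have "(of_nat m :: 'k) ^ (CHAR('k) ^ n) = of_nat m" for m
    by (induction m) (use assms(1) CHAR_gt_1[OF assms(1)] in \<open>auto simp: frobenius_add zero_power\<close>)
  then show ?thesis using assms by (auto simp: Ints_eq_image_of_nat)
qed

text \<open>
  The prime field supplies \<open>p\<close> roots of \<open>X ^ p - X\<close>.
\<close>

lemma frobenius_fixed_iff:
  assumes "CHAR('k::field) > 0"
  shows "(c :: 'k) ^ CHAR('k) = c \<longleftrightarrow> c \<in> \<int>"
proof
  assume c: "c ^ CHAR('k) = c"
  let ?Q = "monom 1 CHAR('k) - monom 1 1 :: 'k poly"
  have p: "CHAR('k) > 1" using CHAR_gt_1 assms by blast
  have "coeff ?Q CHAR('k) = 1" using p by simp
  then have Q0: "?Q \<noteq> 0" by (metis coeff_0 zero_neq_one)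
  have deg: "degree ?Q \<le> CHAR('k)"
    using p by (intro degree_diff_le degree_monom_le order.trans[OF degree_monom_le]) auto
  have root: "poly ?Q x = 0 \<longleftrightarrow> x ^ CHAR('k) = x" for x by (simp add: poly_monom)
  have sub: "\<int> \<subseteq> {x. poly ?Q x = 0}"
    using frobenius_fixed_Ints[OF assms, of _ 1] root by auto
  have "card {x. poly ?Q x = 0} \<le> CHAR('k)"
    using card_poly_roots_bound[OF Q0] deg by linarith
  then have "{x. poly ?Q x = 0} = \<int>"
    using card_seteq[OF poly_roots_finite[OF Q0] sub] finite_Ints_card[OF assms] by simp
  then show "c \<in> \<int>" using c root by blast
qed (use frobenius_fixed_Ints[OF assms, of c 1] in simp)

definition Fp_independent :: "nat \<Rightarrow> (nat \<Rightarrow> 'k::field) \<Rightarrow> bool" where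
  "Fp_independent n z \<longleftrightarrow>
     (\<forall>c. (\<forall>i<n. c i \<in> \<int>) \<longrightarrow> (\<Sum>i<n. c i * z i) = 0 \<longrightarrow> (\<forall>i<n. c i = 0))"

definition Fp_span :: "nat \<Rightarrow> (nat \<Rightarrow> 'k::field) \<Rightarrow> 'k set" where
  "Fp_span n z = (\<lambda>c. \<Sum>i<n. c i * z i) ` ({..<n} \<rightarrow>\<^sub>E \<int>)"

lemma Fp_span_altdef: "Fp_span n z = {(\<Sum>i<n. c i * z i) |c. \<forall>i<n. c i \<in> \<int>}"
proof -
  have "(\<Sum>i<n. c i * z i) \<in> Fp_span n z" if "\<forall>i<n. c i \<in> \<int>" for c
  proof -
    have "restrict c {..<n} \<in> {..<n} \<rightarrow>\<^sub>E \<int>" using that by auto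
    moreover have "(\<Sum>i<n. c i * z i) = (\<Sum>i<n. restrict c {..<n} i * z i)"
      by (intro sum.cong) auto
    ultimately show ?thesis unfolding Fp_span_def by (simp only: image_eqI)
  qed
  moreover have "\<exists>c. v = (\<Sum>i<n. c i * z i) \<and> (\<forall>i<n. c i \<in> \<int>)" if "v \<in> Fp_span n z" for v
    using that by (auto simp: Fp_span_def)
  ultimately show ?thesis by blast
qed

lemma card_Fp_span:
  assumes "CHAR('k::field) > 0" "Fp_independent n (z :: nat \<Rightarrow> 'k)"
  shows "card (Fp_span n z) = CHAR('k) ^ n"
proof -
  have "inj_on (\<lambda>c. \<Sum>i<n. c i * z i) ({..<n} \<rightarrow>\<^sub>E \<int>)"
  proof (rule inj_onI)
    fix c d assume c: "c \<in> {..<n} \<rightarrow>\<^sub>E (\<int> :: 'k set)" and d: "d \<in> {..<n} \<rightarrow>\<^sub>E (\<int> :: 'k set)"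
      and "(\<Sum>i<n. c i * z i) = (\<Sum>i<n. d i * z i)"
    then have "(\<Sum>i<n. (c i - d i) * z i) = 0" by (simp add: left_diff_distrib sum_subtractf)
    moreover have "\<forall>i<n. c i - d i \<in> \<int>" using c d by (auto intro!: Ints_diff)
    ultimately have "\<forall>i<n. c i - d i = 0" using assms(2)[unfolded Fp_independent_def, rule_format, of "\<lambda>i. c i - d i"] by blast
    then show "c = d" using c d by (intro PiE_ext[of _ "{..<n}" "\<lambda>_. \<int>"]) auto
  qed
  then show ?thesis
    unfolding Fp_span_def using finite_Ints_card[OF assms(1)] by (simp add: card_image card_PiE)
qed

text \<open>
  These polynomials are additive functions, and linear over the prime field.
\<close>

definition additive_poly :: "nat \<Rightarrow> (nat \<Rightarrow> 'k::field) \<Rightarrow> 'k poly" where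
  "additive_poly n a = (\<Sum>j\<le>n. monom (a j) (CHAR('k) ^ j))"

lemma poly_additive_poly: "poly (additive_poly n a) (x :: 'k::field) = (\<Sum>j\<le>n. a j * x ^ (CHAR('k) ^ j))"
  by (simp add: additive_poly_def poly_sum poly_monom)

lemma coeff_additive_poly:
  assumes "CHAR('k::field) > 0" "j \<le> n"
  shows "coeff (additive_poly n (a :: nat \<Rightarrow> 'k)) (CHAR('k) ^ j) = a j"
proof -
  have "CHAR('k) ^ i = CHAR('k) ^ j \<longleftrightarrow> i = j" for i
    using CHAR_gt_1[OF assms(1)] by simp
  then show ?thesis using assms(2) by (simp add: additive_poly_def coeff_sum)
qed

lemma degree_additive_poly_le:
  assumes "CHAR('k::field) > 0"
  shows "degree (additive_poly n (a :: nat \<Rightarrow> 'k)) \<le> CHAR('k) ^ n"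
  unfolding additive_poly_def
  using CHAR_gt_1[OF assms]
  by (intro degree_sum_le order.trans[OF degree_monom_le] power_increasing) auto

lemma additive_poly_linear:
  assumes "CHAR('k::field) > 0" "\<And>i. i < m \<Longrightarrow> (c i :: 'k) \<in> \<int>"
  shows "poly (additive_poly n a) (\<Sum>i<m. c i * z i) = (\<Sum>i<m. c i * poly (additive_poly n a) (z i))"
proof -
  have "(\<Sum>i<m. c i * z i) ^ (CHAR('k) ^ j) = (\<Sum>i<m. c i * z i ^ (CHAR('k) ^ j))" for j
    unfolding frobenius_sum[OF assms(1)] power_mult_distrib
    using assms by (intro sum.cong) (auto simp: frobenius_fixed_Ints)
  then have "poly (additive_poly n a) (\<Sum>i<m. c i * z i) = (\<Sum>j\<le>n. \<Sum>i<m. a j * (c i * z i ^ (CHAR('k) ^ j)))"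
    by (simp add: poly_additive_poly sum_distrib_left)
  also have "\<dots> = (\<Sum>i<m. \<Sum>j\<le>n. a j * (c i * z i ^ (CHAR('k) ^ j)))" by (rule sum.swap)
  finally show ?thesis by (simp add: poly_additive_poly sum_distrib_left mult_ac)
qed

text \<open>
  A nonzero additive polynomial of degree less than \<open>p ^ n\<close> cannot vanish at \<open>n\<close> elements that are
  independent over the prime field, as it would vanish on their span. This is the nonvanishing of
  the Moore determinant.
\<close>

lemma Moore_nonsingular:
  fixes z a :: "nat \<Rightarrow> 'k::field"
  assumes "CHAR('k) > 0" "Fp_independent n z"
    and zero: "\<And>i. i < n \<Longrightarrow> (\<Sum>j<n. a j * z i ^ (CHAR('k) ^ j)) = 0"
    and "j < n"
  shows "a j = 0"
proof -
  obtain m where n: "n = Suc m" using \<open>j < n\<close> by (cases n) auto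
  have eq: "{..<n} = {..m}" using n by auto
  have van: "poly (additive_poly m a) v = 0" if "v \<in> Fp_span n z" for v
  proof -
    obtain c where c: "v = (\<Sum>i<n. c i * z i)" "\<forall>i<n. c i \<in> \<int>" using \<open>v \<in> _\<close> unfolding Fp_span_altdef by auto
    then have "poly (additive_poly m a) v = (\<Sum>i<n. c i * poly (additive_poly m a) (z i))"
      by (simp add: additive_poly_linear[OF assms(1)])
    also have "\<dots> = 0" using zero by (simp add: poly_additive_poly eq[symmetric])
    finally show ?thesis .
  qed
  have "additive_poly m a = 0"
  proof (rule ccontr)
    assume nz: "additive_poly m a \<noteq> 0"
    have "CHAR('k) ^ n = card (Fp_span n z)" using card_Fp_span[OF assms(1,2)] by simp
    also have "\<dots> \<le> card {x. poly (additive_poly m a) x = 0}"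
      using van by (intro card_mono poly_roots_finite nz) auto
    also have "\<dots> \<le> CHAR('k) ^ m"
      using card_poly_roots_bound[OF nz] degree_additive_poly_le[OF assms(1), of m a] by linarith
    finally show False using CHAR_gt_1[OF assms(1)] n by simp
  qed
  then show ?thesis using coeff_additive_poly[OF assms(1), of j m a] \<open>j < n\<close> n by simp
qed

lemma infinite_alg_closed: "infinite (UNIV :: 'k::alg_closed_field set)"
proof
  assume fin: "finite (UNIV :: 'k set)"
  let ?Q = "(\<Prod>x\<in>(UNIV :: 'k set). [:-x, 1:]) + 1"
  have "degree (\<Prod>x\<in>(UNIV :: 'k set). [:-x, 1:]) = card (UNIV :: 'k set)"
    by (subst degree_prod_eq_sum_degree) auto
  moreover have "card (UNIV :: 'k set) > 0" using fin by (simp add: card_gt_0_iff)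
  ultimately have "degree ?Q > 0" by (subst degree_add_eq_left) auto
  then obtain x where "poly ?Q x = 0" using alg_closed_imp_poly_has_root by blast
  moreover have "poly (\<Prod>x\<in>(UNIV :: 'k set). [:-x, 1:]) x = 0"
    using fin by (auto simp: poly_prod intro!: prod_zero bexI[of _ x])
  ultimately show False by simp
qed

lemma Fp_independent_Suc:
  fixes z :: "nat \<Rightarrow> 'k::field"
  assumes char: "CHAR('k) > 0" and z: "Fp_independent n z" and y: "y \<notin> Fp_span n z"
  shows "Fp_independent (Suc n) (z(n := y))"
  unfolding Fp_independent_def
proof (intro allI impI)
  fix c :: "nat \<Rightarrow> 'k" and i
  assume c: "\<forall>i<Suc n. c i \<in> \<int>" and "(\<Sum>i<Suc n. c i * (z(n := y)) i) = 0" and i: "i < Suc n"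
  then have 0: "(\<Sum>i<n. c i * z i) + c n * y = 0" by simp
  show "c i = 0"
  proof (cases "c n = 0")
    case True
    then show ?thesis
      using 0 z c i unfolding Fp_independent_def by (cases "i = n") auto
  next
    case False
    have "inverse (c n) \<in> \<int>"
      using frobenius_fixed_iff[OF char] c by (metis lessI power_inverse)
    then have "\<forall>i<n. - c i * inverse (c n) \<in> \<int>" using c by (auto intro!: Ints_mult Ints_minus)
    moreover have "y = - (\<Sum>i<n. c i * z i) * inverse (c n)"
      using 0 False by (simp add: field_simps eq_neg_iff_add_eq_0)
    then have "y = (\<Sum>i<n. (- c i * inverse (c n)) * z i)"
      by (simp add: sum_distrib_left sum_negf mult_ac)
    ultimately have "y \<in> Fp_span n z"
      unfolding Fp_span_altdef by (intro CollectI exI[of _ "\<lambda>i. - c i * inverse (c n)"] conjI)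
    then show ?thesis using y by blast
  qed
qed

lemma Fp_independentD:
  "Fp_independent n z \<Longrightarrow> (\<And>i. i < n \<Longrightarrow> c i \<in> \<int>) \<Longrightarrow> (\<Sum>i<n. c i * z i) = 0 \<Longrightarrow> j < n \<Longrightarrow> c j = 0"
  by (simp add: Fp_independent_def)

lemma Fp_independent_frobenius:
  assumes char: "CHAR('k::field) > 0" and z: "Fp_independent n (z :: nat \<Rightarrow> 'k)"
  shows "Fp_independent n (\<lambda>i. z i ^ (CHAR('k) ^ m))"
  unfolding Fp_independent_def
proof (intro allI impI)
  fix c :: "nat \<Rightarrow> 'k" and i
  assume c: "\<forall>i<n. c i \<in> \<int>" "(\<Sum>i<n. c i * z i ^ (CHAR('k) ^ m)) = 0" "i < n"
  have "(\<Sum>i<n. c i * z i) ^ (CHAR('k) ^ m) = (\<Sum>i<n. c i ^ (CHAR('k) ^ m) * z i ^ (CHAR('k) ^ m))"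
    unfolding frobenius_sum[OF char] power_mult_distrib ..
  also have "\<dots> = (\<Sum>i<n. c i * z i ^ (CHAR('k) ^ m))"
    using c(1) frobenius_fixed_Ints[OF char] by (intro sum.cong) auto
  finally have "(\<Sum>i<n. c i * z i) = 0" using c(2) by simp
  then show "c i = 0" using z c(1,3) unfolding Fp_independent_def by blast
qed

text \<open>
  The span of finitely many elements over the prime field is finite, while \<open>k\<close> is infinite.
\<close>

lemma exists_Fp_independent:
  assumes char: "CHAR('k::alg_closed_field) > 0"
  shows "\<exists>z :: nat \<Rightarrow> 'k. Fp_independent n z"
proof (induction n)
  case 0
  show ?case by (simp add: Fp_independent_def)
next
  case (Suc n)
  then obtain z :: "nat \<Rightarrow> 'k" where z: "Fp_independent n z" by blast
  have "finite (Fp_span n z)"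
    unfolding Fp_span_def by (intro finite_imageI finite_PiE) (auto simp: finite_Ints_card[OF char])
  then obtain y where "y \<notin> Fp_span n z" using infinite_alg_closed by (metis UNIV_I ex_new_if_finite)
  then show ?case using Fp_independent_Suc[OF char z] by blast
qed

text \<open>
  By Lagrange interpolation at the roots of \<open>F\<close>, the top coefficient of a polynomial \<open>G\<close> of degree
  less than \<open>deg F\<close> is the sum of \<open>G z / F' z\<close> over the roots, times the leading coefficient of \<open>F\<close>.
  As the derivative of an additive polynomial is constant, its roots have very simple power sums.
\<close>

lemma power_sum_roots:
  fixes F :: "'k::alg_closed_field poly"
  assumes F': "pderiv F = [:-1:]" and deg: "degree F = q" and q: "q > 0" and j: "j < q"
  shows "(\<Sum>z | poly F z = 0. z ^ j) = (if j = q - 1 then - inverse (lead_coeff F) else 0)"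
proof -
  have F0: "F \<noteq> 0" using deg q by auto
  obtain A where A: "size A = degree F" "F = Polynomial.smult (lead_coeff F) (\<Prod>x\<in>#A. [:-x, 1:])"
    using alg_closed_imp_factorization[OF F0] by blast
  let ?V = "{z. poly F z = 0}"
  have finV: "finite ?V" using poly_roots_finite[OF F0] .
  have simple: "count A z \<le> 1" for z
  proof (rule ccontr)
    assume "\<not> count A z \<le> 1"
    then have "{#z, z#} \<subseteq># A" by (auto simp: subseteq_mset_def)
    then obtain B where "A = {#z, z#} + B" by (metis mset_subset_eq_exists_conv)
    then have "F = [:-z, 1:] * ([:-z, 1:] * Polynomial.smult (lead_coeff F) (\<Prod>x\<in>#B. [:-x, 1:]))"
      using A(2) by (simp add: mult_ac)
    then obtain H where H: "F = [:-z, 1:] * ([:-z, 1:] * H)" by blast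
    have "poly (pderiv F) z = 0" unfolding H by (subst pderiv_mult) (simp del: mult_pCons_left)
    then show False using F' by simp
  qed
  have setA: "set_mset A = ?V"
    by (subst A(2)) (use F0 in \<open>auto simp: poly_prod_mset prod_mset_zero_iff\<close>)
  have Aeq: "A = mset_set ?V"
  proof (rule multiset_eqI)
    fix z show "count A z = count (mset_set ?V) z"
      using simple[of z] setA finV by (cases "z \<in> ?V") (auto simp: le_Suc_eq not_in_iff[symmetric] count_eq_zero_iff)
  qed
  have Feq: "F = Polynomial.smult (lead_coeff F) (\<Prod>x\<in>?V. [:-x, 1:])"
    using A(2) unfolding Aeq prod_unfold_prod_mset .
  have card: "card ?V = q" using A(1) Aeq deg by simp
  let ?Pi = "\<lambda>z. \<Prod>x\<in>?V - {z}. [:-x, 1:]"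
  have Fz: "F = Polynomial.smult (lead_coeff F) ([:-z, 1:] * ?Pi z)" if "z \<in> ?V" for z
    using Feq prod.remove[OF finV that, of "\<lambda>x. [:-x, 1:]"] by simp
  have Pz: "lead_coeff F * poly (?Pi z) z = -1" if "z \<in> ?V" for z
  proof -
    have "pderiv F = Polynomial.smult (lead_coeff F) (pderiv ([:-z, 1:] * ?Pi z))"
      by (subst Fz[OF that]) (simp only: pderiv_smult)
    also have "pderiv ([:-z, 1:] * ?Pi z) = [:-z, 1:] * pderiv (?Pi z) + ?Pi z * [:1:]"
      by (subst pderiv_mult) (simp add: pderiv_pCons del: mult_pCons_left mult_pCons_right)
    finally have "poly (pderiv F) z = lead_coeff F * poly (?Pi z) z" by simp
    then show ?thesis using F' by simp
  qed
  have degP: "degree (?Pi z) = q - 1" and leadP: "coeff (?Pi z) (q - 1) = 1" if "z \<in> ?V" for z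
  proof -
    have "degree (?Pi z) = card (?V - {z})" by (subst degree_prod_eq_sum_degree) auto
    then show d: "degree (?Pi z) = q - 1" using that card finV by simp
    have "lead_coeff (?Pi z) = 1" by (subst lead_coeff_prod) auto
    then show "coeff (?Pi z) (q - 1) = 1" using d by simp
  qed
  let ?G = "monom 1 j :: 'k poly"
  let ?L = "\<Sum>z\<in>?V. Polynomial.smult (- lead_coeff F * z ^ j) (?Pi z)"
  have "?G = ?L"
  proof (rule poly_eqI_degree[of ?V])
    fix y assume y: "y \<in> ?V"
    have "poly (?Pi z) y = 0" if "z \<in> ?V" "z \<noteq> y" for z
      using that y finV by (auto simp: poly_prod prod_zero_iff)
    then have "poly ?L y = (\<Sum>z\<in>?V. if z = y then - lead_coeff F * y ^ j * poly (?Pi y) y else 0)"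
      unfolding poly_sum poly_smult by (intro sum.cong) auto
    also have "\<dots> = y ^ j" using y finV Pz[OF y] by (simp add: sum.delta mult_ac)
    finally show "poly ?G y = poly ?L y" by (simp add: poly_monom)
  next
    show "degree ?G < card ?V" using j card by (simp add: degree_monom_eq)
    have "degree ?L \<le> q - 1"
      by (intro degree_sum_le finV) (auto intro!: order.trans[OF degree_smult_le] simp: degP)
    then show "degree ?L < card ?V" using q card by simp
  qed
  moreover have "coeff ?L (q - 1) = (\<Sum>z\<in>?V. - lead_coeff F * z ^ j)"
    unfolding coeff_sum coeff_smult
  proof (rule sum.cong[OF refl])
    fix z assume "z \<in> ?V"
    then show "- lead_coeff F * z ^ j * coeff (?Pi z) (q - 1) = - lead_coeff F * z ^ j"
      using leadP[of z] by simp
  qed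
  ultimately have "coeff ?G (q - 1) = (\<Sum>z\<in>?V. - lead_coeff F * z ^ j)" by simp
  also have "\<dots> = - lead_coeff F * (\<Sum>z\<in>?V. z ^ j)" by (simp add: sum_distrib_left)
  finally have "lead_coeff F * (\<Sum>z\<in>?V. z ^ j) = - coeff ?G (q - 1)" by simp
  then have "lead_coeff F * (\<Sum>z\<in>?V. z ^ j) = (if j = q - 1 then - 1 else 0)" by auto
  then show ?thesis using F0 by (auto simp: field_simps)
qed

section \<open>Finite families of vectors\<close>

locale ambient_space = vector_space scale
  for scale :: "'a::field \<Rightarrow> 'b::ab_group_add \<Rightarrow> 'b"
begin

definition family_span :: "nat \<Rightarrow> (nat \<Rightarrow> 'b) \<Rightarrow> 'b set" where
  "family_span n v = {(\<Sum>i<n. scale (c i) (v i)) |c. True}"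

definition family_independent :: "nat \<Rightarrow> (nat \<Rightarrow> 'b) \<Rightarrow> bool" where
  "family_independent n v \<longleftrightarrow> (\<forall>c. (\<Sum>i<n. scale (c i) (v i)) = 0 \<longrightarrow> (\<forall>i<n. c i = 0))"

lemma family_spanI: "(\<Sum>i<n. scale (c i) (v i)) \<in> family_span n v"
  by (auto simp: family_span_def)

lemma family_span_eq: "family_span n v = span (v ` {..<n})"
proof
  show "family_span n v \<subseteq> span (v ` {..<n})"
    unfolding family_span_def by (auto intro!: span_sum span_scale intro: span_base)
  have "subspace (family_span n v)"
  proof (rule subspaceI)
    show "0 \<in> family_span n v" using family_spanI[of "\<lambda>_. 0"] by simp
  next
    fix x y assume "x \<in> family_span n v" "y \<in> family_span n v"
    then obtain c d where "x = (\<Sum>i<n. scale (c i) (v i))" "y = (\<Sum>i<n. scale (d i) (v i))"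
      by (auto simp: family_span_def)
    then show "x + y \<in> family_span n v"
      using family_spanI[of "\<lambda>i. c i + d i"] by (simp add: scale_left_distrib sum.distrib)
  next
    fix a x assume "x \<in> family_span n v"
    then obtain c where "x = (\<Sum>i<n. scale (c i) (v i))" by (auto simp: family_span_def)
    then show "scale a x \<in> family_span n v"
      using family_spanI[of "\<lambda>i. a * c i"] by (simp add: scale_sum_right)
  qed
  moreover have "v i \<in> family_span n v" if "i < n" for i
  proof -
    have "(\<Sum>j<n. scale (if j = i then 1 else 0) (v j)) = (\<Sum>j<n. if j = i then v j else 0)"
      by (intro sum.cong) auto
    also have "\<dots> = v i" using that by simp
    finally show ?thesis using family_spanI by metis
  qed
  ultimately show "span (v ` {..<n}) \<subseteq> family_span n v" by (intro span_minimal) auto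
qed

lemma subspace_family_span: "subspace (family_span n v)"
  by (simp add: family_span_eq)

lemma family_span_base: "i < n \<Longrightarrow> v i \<in> family_span n v"
  by (auto simp: family_span_eq intro: span_base)

lemma family_span_minimal: "subspace S \<Longrightarrow> (\<And>i. i < n \<Longrightarrow> v i \<in> S) \<Longrightarrow> family_span n v \<subseteq> S"
  unfolding family_span_eq by (intro span_minimal) auto

lemma family_independent_iff:
  "family_independent n v \<longleftrightarrow> inj_on v {..<n} \<and> independent (v ` {..<n})"
proof
  assume ind: "family_independent n v"
  have inj: "inj_on v {..<n}"
  proof (rule inj_onI)
    fix i j assume ij: "i \<in> {..<n}" "j \<in> {..<n}" "v i = v j"
    show "i = j"
    proof (rule ccontr)
      assume "i \<noteq> j"
      let ?c = "\<lambda>l. if l = i then 1 else if l = j then -1 else (0 :: 'a)"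
      have "(\<Sum>l<n. scale (?c l) (v l)) = (\<Sum>l<n. (if l = i then v i else 0) - (if l = j then v j else 0))"
        using \<open>i \<noteq> j\<close> by (intro sum.cong) auto
      also have "\<dots> = 0" using ij by (simp add: sum_subtractf)
      finally have "\<forall>l<n. ?c l = 0" by (rule ind[unfolded family_independent_def, THEN spec, THEN mp])
      then have "?c i = 0" using ij by blast
      then show False by simp
    qed
  qed
  moreover have "independent (v ` {..<n})"
  proof (rule independent_if_scalars_zero)
    fix f x assume 0: "(\<Sum>x\<in>v ` {..<n}. scale (f x) x) = 0" and x: "x \<in> v ` {..<n}"
    then have "(\<Sum>i<n. scale (f (v i)) (v i)) = 0" using inj by (simp add: sum.reindex)
    then have "\<forall>i<n. f (v i) = 0"
      by (rule ind[unfolded family_independent_def, THEN spec[of _ "\<lambda>i. f (v i)"], THEN mp])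
    then show "f x = 0" using x by blast
  qed simp
  ultimately show "inj_on v {..<n} \<and> independent (v ` {..<n})" by simp
next
  assume r: "inj_on v {..<n} \<and> independent (v ` {..<n})"
  show "family_independent n v"
    unfolding family_independent_def
  proof (intro allI impI)
    fix c i assume 0: "(\<Sum>i<n. scale (c i) (v i)) = 0" and i: "i < n"
    let ?f = "\<lambda>x. c (the_inv_into {..<n} v x)"
    have "(\<Sum>x\<in>v ` {..<n}. scale (?f x) x) = 0"
      using r 0 by (simp add: sum.reindex the_inv_into_f_f)
    then have "?f (v i) = 0"
      using r i independentD[of "v ` {..<n}" "v ` {..<n}" ?f "v i"] by auto
    then show "c i = 0" using r i by (simp add: the_inv_into_f_f)
  qed
qed

lemma family_independentD:
  "family_independent n v \<Longrightarrow> (\<Sum>i<n. scale (c i) (v i)) = (\<Sum>i<n. scale (d i) (v i)) \<Longrightarrow> i < n \<Longrightarrow> c i = d i"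
  unfolding family_independent_def
  by (drule spec[of _ "\<lambda>i. c i - d i"]) (simp add: scale_left_diff_distrib sum_subtractf)

lemma family_independent_bound:
  assumes "family_independent m w" "\<And>i. i < m \<Longrightarrow> w i \<in> family_span n v"
  shows "m \<le> n"
proof -
  have "card (w ` {..<m}) \<le> card (v ` {..<n})"
    using assms unfolding family_independent_iff family_span_eq
    by (intro independent_span_bound[THEN conjunct2]) auto
  also have "\<dots> \<le> n" using card_image_le[of "{..<n}" v] by simp
  finally show ?thesis using assms(1) by (simp add: family_independent_iff card_image)
qed

lemma family_independent_Suc:
  assumes "family_independent n v" "w \<notin> family_span n v"
  shows "family_independent (Suc n) (v(n := w))"
proof -
  have im: "v(n := w) ` {..<Suc n} = insert w (v ` {..<n})" by (auto simp: less_Suc_eq)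
  have "w \<notin> v ` {..<n}" using assms(2) family_span_base by auto
  then show ?thesis
    using assms independent_insertI[of w "v ` {..<n}"] unfolding family_independent_iff im family_span_eq
    by (auto simp: inj_on_def less_Suc_eq)
qed

lemma family_span_full:
  assumes "family_independent n w" "\<And>i. i < n \<Longrightarrow> w i \<in> family_span n v"
  shows "family_span n w = family_span n v"
proof
  show "family_span n w \<subseteq> family_span n v" using assms(2) by (intro family_span_minimal subspace_family_span)
  show "family_span n v \<subseteq> family_span n w"
  proof (rule ccontr)
    assume "\<not> ?thesis"
    then obtain u where u: "u \<in> family_span n v" "u \<notin> family_span n w" by blast
    have "(w(n := u)) i \<in> family_span n v" if "i < Suc n" for i
      using that assms(2) u(1) by (auto simp: less_Suc_eq)
    then have "Suc n \<le> n" by (rule family_independent_bound[OF family_independent_Suc[OF assms(1) u(2)]])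
    then show False by simp
  qed
qed

lemma family_independent_if_spans:
  assumes v: "family_independent n v" and sub: "\<And>i. i < n \<Longrightarrow> v i \<in> family_span n w"
  shows "family_independent n w"
proof -
  obtain B where B: "B \<subseteq> w ` {..<n}" "independent B" "w ` {..<n} \<subseteq> span B"
    by (rule maximal_independent_subset[of "w ` {..<n}"])
  have fin: "finite B" using B(1) by (rule finite_subset) simp
  have "span (w ` {..<n}) \<subseteq> span B" using B(3) by (rule span_minimal) simp
  then have "v ` {..<n} \<subseteq> span B" using sub by (auto simp: family_span_eq)
  then have "card (v ` {..<n}) \<le> card B"
    using v fin by (intro independent_span_bound[THEN conjunct2]) (auto simp: family_independent_iff)
  then have n: "n \<le> card B" using v by (simp add: family_independent_iff card_image)
  have c1: "card B \<le> card (w ` {..<n})" using B(1) by (intro card_mono) auto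
  have c2: "card (w ` {..<n}) \<le> n" using card_image_le[of "{..<n}" w] by simp
  have "inj_on w {..<n}" using n c1 c2 by (intro eq_card_imp_inj_on) auto
  moreover have "B = w ` {..<n}" using n c2 B(1) by (intro card_seteq) auto
  ultimately show ?thesis using B(2) by (simp add: family_independent_iff)
qed

lemma dim_family_span: "family_independent n v \<Longrightarrow> dim (family_span n v) = n"
  by (auto simp: family_span_eq family_independent_iff dim_eq_card_independent card_image)

lemma exists_family_basis:
  assumes "subspace S" "S \<subseteq> span B" "finite B"
  shows "\<exists>v. family_independent (dim S) v \<and> S = family_span (dim S) v \<and> (\<forall>i<dim S. v i \<in> S)"
proof -
  obtain A where A: "A \<subseteq> S" "independent A" "S \<subseteq> span A" "card A = dim S"
    using basis_exists[of S] by blast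
  have "finite A" using independent_span_bound[OF assms(3) A(2)] A(1) assms(2) by auto
  then obtain v where v: "bij_betw v {..<card A} A"
    using ex_bij_betw_nat_finite by (metis atLeast0LessThan)
  then have im: "v ` {..<dim S} = A" "inj_on v {..<dim S}" using A(4) by (auto simp: bij_betw_def)
  have "S = span A" using A assms(1) by (simp add: span_minimal subset_antisym)
  then show ?thesis using im A by (intro exI[of _ v]) (auto simp: family_independent_iff family_span_eq)
qed

lemma exists_dual_family:
  assumes "family_independent n v"
  shows "\<exists>\<xi>. \<forall>i. Vector_Spaces.linear scale (*) (\<xi> i) \<and> (\<forall>j<n. \<xi> i (v j) = (if i = j then 1 else 0))"
proof -
  have f: "vector_space ((*) :: 'a \<Rightarrow> 'a \<Rightarrow> 'a)" by unfold_locales (auto simp: algebra_simps)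
  interpret vp: vector_space_pair scale "(*) :: 'a \<Rightarrow> 'a \<Rightarrow> 'a"
    using f by (simp add: vector_space_pair_def vector_space_axioms)
  have inj: "inj_on v {..<n}" and ind: "independent (v ` {..<n})"
    using assms by (auto simp: family_independent_iff)
  have "\<exists>g. Vector_Spaces.linear scale (*) g \<and> (\<forall>j<n. g (v j) = (if i = j then 1 else 0))" for i
  proof -
    obtain g where g: "Vector_Spaces.linear scale (*) g"
      "\<forall>x\<in>v ` {..<n}. g x = (if i = the_inv_into {..<n} v x then 1 else 0)"
      using vp.linear_independent_extend[OF ind, of "\<lambda>x. if i = the_inv_into {..<n} v x then 1 else 0"] by blast
    then show ?thesis using inj by (intro exI[of _ g]) (auto simp: the_inv_into_f_f)
  qed
  then show ?thesis by metis
qed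

end

section \<open>Functions of one parameter that are regular at a point\<close>

text \<open>
  \<open>regular_at s0 \<rho>\<close>: near \<open>s0\<close> the function \<open>\<rho>\<close> is a quotient of polynomials, where "near" refers to the
  cofinite topology on the affine line.
\<close>

definition regular_at :: "'k::field \<Rightarrow> ('k \<Rightarrow> 'k) \<Rightarrow> bool" where
  "regular_at s0 \<rho> \<longleftrightarrow> (\<exists>P Q. poly Q s0 \<noteq> 0 \<and> (\<forall>s. poly Q s \<noteq> 0 \<longrightarrow> \<rho> s * poly Q s = poly P s))"

lemma regular_at_poly: "regular_at s0 (poly P)"
  unfolding regular_at_def by (intro exI[of _ P] exI[of _ 1]) simp

lemma regular_at_const: "regular_at s0 (\<lambda>_. c)"
  using regular_at_poly[of s0 "[:c:]"] by (rule back_subst[of "regular_at s0"]) auto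

lemma regular_at_id: "regular_at s0 (\<lambda>s. s)"
  using regular_at_poly[of s0 "[:0, 1:]"] by (rule back_subst[of "regular_at s0"]) auto

lemma regular_at_add:
  assumes "regular_at s0 f" "regular_at s0 g" shows "regular_at s0 (\<lambda>s. f s + g s)"
proof -
  obtain P Q P' Q' where "poly Q s0 \<noteq> 0" "\<forall>s. poly Q s \<noteq> 0 \<longrightarrow> f s * poly Q s = poly P s"
    "poly Q' s0 \<noteq> 0" "\<forall>s. poly Q' s \<noteq> 0 \<longrightarrow> g s * poly Q' s = poly P' s"
    using assms unfolding regular_at_def by blast
  then show ?thesis unfolding regular_at_def
    by (intro exI[of _ "P * Q' + P' * Q"] exI[of _ "Q * Q'"]) (auto simp: algebra_simps)
qed

lemma regular_at_mult:
  assumes "regular_at s0 f" "regular_at s0 g" shows "regular_at s0 (\<lambda>s. f s * g s)"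
proof -
  obtain P Q P' Q' where "poly Q s0 \<noteq> 0" "\<forall>s. poly Q s \<noteq> 0 \<longrightarrow> f s * poly Q s = poly P s"
    "poly Q' s0 \<noteq> 0" "\<forall>s. poly Q' s \<noteq> 0 \<longrightarrow> g s * poly Q' s = poly P' s"
    using assms unfolding regular_at_def by blast
  then have "poly (Q * Q') s0 \<noteq> 0 \<and> (\<forall>s. poly (Q * Q') s \<noteq> 0 \<longrightarrow> f s * g s * poly (Q * Q') s = poly (P * P') s)"
    by (auto simp: algebra_simps) (metis (no_types, lifting) mult.assoc mult.left_commute)
  then show ?thesis unfolding regular_at_def by blast
qed

lemma regular_at_uminus: "regular_at s0 f \<Longrightarrow> regular_at s0 (\<lambda>s. - f s)"
  using regular_at_mult[OF regular_at_const[of s0 "-1"]] by simp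

lemma regular_at_diff: "regular_at s0 f \<Longrightarrow> regular_at s0 g \<Longrightarrow> regular_at s0 (\<lambda>s. f s - g s)"
  using regular_at_add[OF _ regular_at_uminus] by simp

lemma regular_at_sum: "(\<And>i. i \<in> A \<Longrightarrow> regular_at s0 (f i)) \<Longrightarrow> regular_at s0 (\<lambda>s. \<Sum>i\<in>A. f i s)"
  by (induction A rule: infinite_finite_induct) (auto intro: regular_at_const regular_at_add)

lemma regular_at_prod: "(\<And>i. i \<in> A \<Longrightarrow> regular_at s0 (f i)) \<Longrightarrow> regular_at s0 (\<lambda>s. \<Prod>i\<in>A. f i s)"
  by (induction A rule: infinite_finite_induct) (auto intro: regular_at_const regular_at_mult)

lemma regular_at_power: "regular_at s0 f \<Longrightarrow> regular_at s0 (\<lambda>s. f s ^ n)"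
  by (induction n) (auto intro: regular_at_const regular_at_mult)

lemma regular_at_inverse:
  assumes "regular_at s0 f" "f s0 \<noteq> 0" shows "regular_at s0 (\<lambda>s. inverse (f s))"
proof -
  obtain P Q where PQ: "poly Q s0 \<noteq> 0" "\<forall>s. poly Q s \<noteq> 0 \<longrightarrow> f s * poly Q s = poly P s"
    using assms(1) unfolding regular_at_def by blast
  have "poly P s0 \<noteq> 0" using PQ assms(2) by (metis mult_eq_0_iff)
  moreover have "inverse (f s) * poly (P * Q) s = poly (Q * Q) s" if "poly (P * Q) s \<noteq> 0" for s
  proof -
    have "f s * poly Q s = poly P s" "f s \<noteq> 0" using PQ(2) that by auto
    then show ?thesis by (simp add: field_simps)
  qed
  ultimately show ?thesis using PQ(1) unfolding regular_at_def
    by (intro exI[of _ "Q * Q"] exI[of _ "P * Q"]) auto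
qed

lemma regular_at_cong_cofinite:
  assumes f: "regular_at s0 f" and E: "finite E" "s0 \<notin> E" and eq: "\<And>s. s \<notin> E \<Longrightarrow> f s = g s"
  shows "regular_at s0 g"
proof -
  obtain P Q where PQ: "poly Q s0 \<noteq> 0" "\<forall>s. poly Q s \<noteq> 0 \<longrightarrow> f s * poly Q s = poly P s"
    using f unfolding regular_at_def by blast
  let ?R = "\<Prod>e\<in>E. [:-e, 1:]"
  have R: "poly ?R s = 0 \<longleftrightarrow> s \<in> E" for s
    using E(1) by (auto simp: poly_prod prod_zero_iff)
  then show ?thesis unfolding regular_at_def using PQ eq E(2)
    by (intro exI[of _ "P * ?R"] exI[of _ "Q * ?R"]) auto
qed

lemma regular_at_nonzero_cofinite:
  assumes "regular_at s0 f" "f s0 \<noteq> 0"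
  shows "\<exists>E. finite E \<and> s0 \<notin> E \<and> (\<forall>s. s \<notin> E \<longrightarrow> f s \<noteq> 0)"
proof -
  obtain P Q where PQ: "poly Q s0 \<noteq> 0" "\<forall>s. poly Q s \<noteq> 0 \<longrightarrow> f s * poly Q s = poly P s"
    using assms(1) unfolding regular_at_def by blast
  have "poly P s0 \<noteq> 0" using PQ assms(2) by (metis mult_eq_0_iff)
  then have "P * Q \<noteq> 0" using PQ(1) by auto
  then show ?thesis
    using poly_roots_finite[of "P * Q"] \<open>poly P s0 \<noteq> 0\<close> PQ
    by (intro exI[of _ "{s. poly (P * Q) s = 0}"]) auto
qed

lemma regular_at_det:
  assumes "\<And>i j. i < n \<Longrightarrow> j < n \<Longrightarrow> regular_at s0 (\<lambda>s. B s i j)"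
  shows "regular_at s0 (\<lambda>s. det (mat n n (\<lambda>(i, j). B s i j)))"
proof -
  have "det (mat n n (\<lambda>(i, j). B s i j)) =
      (\<Sum>\<pi>\<in>{\<pi>. \<pi> permutes {0..<n}}. signof \<pi> * (\<Prod>i = 0..<n. B s i (\<pi> i)))" for s
    by (auto simp: det_def intro!: sum.cong prod.cong)
  then show ?thesis
    using assms by (auto intro!: regular_at_sum regular_at_mult regular_at_prod regular_at_const)
qed

text \<open>Cramer's rule: the inverse of a regular matrix that is invertible at \<open>s0\<close> is regular.\<close>

lemma regular_at_inverse_matrix:
  fixes B :: "'k::field \<Rightarrow> nat \<Rightarrow> nat \<Rightarrow> 'k"
  assumes B: "\<And>i j. i < n \<Longrightarrow> j < n \<Longrightarrow> regular_at s0 (\<lambda>s. B s i j)"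
    and det: "det (mat n n (\<lambda>(i, j). B s0 i j)) \<noteq> 0"
  shows "\<exists>C E. (\<forall>i<n. \<forall>j<n. regular_at s0 (\<lambda>s. C s i j)) \<and> finite E \<and> s0 \<notin> E \<and>
     (\<forall>s. s \<notin> E \<longrightarrow> (\<forall>i<n. \<forall>l<n. (\<Sum>j<n. C s i j * B s j l) = (if i = l then 1 else 0)))"
proof -
  let ?B = "\<lambda>s. mat n n (\<lambda>(i, j). B s i j)"
  let ?d = "\<lambda>s. det (?B s)"
  let ?C = "\<lambda>s i j. inverse (?d s) * adj_mat (?B s) $$ (i, j)"
  have d: "regular_at s0 ?d" using B by (rule regular_at_det)
  have adj: "adj_mat (?B s) $$ (i, j) = (-1) ^ (j + i) * det (mat (n - 1) (n - 1)
      (\<lambda>(i', j'). B s (if i' < j then i' else Suc i') (if j' < i then j' else Suc j')))" if "i < n" "j < n" for s i j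
    using that by (auto simp: adj_mat_def cofactor_def mat_delete_def intro!: arg_cong[where f = det] eq_matI)
  obtain E where E: "finite E" "s0 \<notin> E" "\<forall>s. s \<notin> E \<longrightarrow> ?d s \<noteq> 0"
    using regular_at_nonzero_cofinite[OF d det] by blast
  have "regular_at s0 (\<lambda>s. ?C s i j)" if "i < n" "j < n" for i j
    unfolding adj[OF that]
    by (intro regular_at_mult regular_at_inverse[OF d det] regular_at_const regular_at_det B)
       (use that in auto)
  moreover have "(\<Sum>j<n. ?C s i j * B s j l) = (if i = l then 1 else 0)" if "s \<notin> E" "i < n" "l < n" for s i l
  proof -
    have "(adj_mat (?B s) * ?B s) $$ (i, l) = ?d s * (if i = l then 1 else 0)"
      using adj_mat(3)[of "?B s" n] that by simp
    then have "(\<Sum>j<n. adj_mat (?B s) $$ (i, j) * B s j l) = ?d s * (if i = l then 1 else 0)"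
      using that adj_mat(1)[of "?B s" n] by (simp add: scalar_prod_def atLeast0LessThan)
    then show ?thesis using E(3) that by (simp add: mult.assoc flip: sum_distrib_left)
  qed
  ultimately show ?thesis using E by (intro exI[of _ ?C] exI[of _ E]) auto
qed

lemma regular_at_coeff_mult:
  assumes "\<And>i. regular_at s0 (\<lambda>s. coeff (P s) i)" "\<And>i. regular_at s0 (\<lambda>s. coeff (Q s) i)"
  shows "regular_at s0 (\<lambda>s. coeff (P s * Q s) i)"
  unfolding coeff_mult by (intro regular_at_sum regular_at_mult assms)

lemma regular_at_coeff_power:
  assumes "\<And>i. regular_at s0 (\<lambda>s. coeff (P s) i)"
  shows "regular_at s0 (\<lambda>s. coeff (P s ^ n) i)"
proof (induction n arbitrary: i)
  case 0
  show ?case by (simp add: regular_at_const)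
next
  case (Suc n)
  show ?case unfolding power_Suc by (intro regular_at_coeff_mult assms Suc)
qed

section \<open>Inverses of Moore matrices\<close>

text \<open>
  Matrices are families of entries here, because the parameter-dependent inverses are constructed entrywise.
\<close>

definition left_inverse_matrix :: "nat \<Rightarrow> (nat \<Rightarrow> nat \<Rightarrow> 'k::field) \<Rightarrow> (nat \<Rightarrow> nat \<Rightarrow> 'k) \<Rightarrow> bool" where
  "left_inverse_matrix n C B \<longleftrightarrow> (\<forall>i<n. \<forall>l<n. (\<Sum>j<n. C i j * B j l) = (if i = l then 1 else 0))"

lemma left_inverse_matrixD:
  "left_inverse_matrix n C B \<Longrightarrow> i < n \<Longrightarrow> l < n \<Longrightarrow> (\<Sum>j<n. C i j * B j l) = (if i = l then 1 else 0)"
  by (simp add: left_inverse_matrix_def)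

lemma left_inverse_matrix_commute:
  assumes "left_inverse_matrix n C B" shows "left_inverse_matrix n B C"
proof -
  let ?C = "mat n n (\<lambda>(i, j). C i j)" and ?B = "mat n n (\<lambda>(i, j). B i j)"
  have "?C * ?B = 1\<^sub>m n"
    using assms by (intro eq_matI) (simp_all add: left_inverse_matrix_def scalar_prod_def atLeast0LessThan)
  then have BC: "?B * ?C = 1\<^sub>m n" by (intro mat_mult_left_right_inverse[of ?C n ?B]) auto
  have "(\<Sum>j<n. B i j * C j l) = (if i = l then 1 else 0)" if "i < n" "l < n" for i l
  proof -
    have "(?B * ?C) $$ (i, l) = (\<Sum>j<n. B i j * C j l)" using that by (simp add: scalar_prod_def atLeast0LessThan)
    then show ?thesis unfolding BC using that by simp
  qed
  then show ?thesis by (simp add: left_inverse_matrix_def)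
qed

lemma Moore_det_nonzero:
  fixes z :: "nat \<Rightarrow> 'k::field"
  assumes char: "CHAR('k) > 0" and z: "Fp_independent n z"
  shows "det (mat n n (\<lambda>(j, l). z l ^ (CHAR('k) ^ j))) \<noteq> 0"
proof
  let ?M = "mat n n (\<lambda>(l, j). z l ^ (CHAR('k) ^ j))"
  assume "det (mat n n (\<lambda>(j, l). z l ^ (CHAR('k) ^ j))) = 0"
  moreover have "transpose_mat ?M = mat n n (\<lambda>(j, l). z l ^ (CHAR('k) ^ j))" by (rule eq_matI) auto
  ultimately have "det ?M = 0" using det_transpose[of ?M n] by simp
  then obtain v where v: "v \<in> carrier_vec n" "v \<noteq> 0\<^sub>v n" "?M *\<^sub>v v = 0\<^sub>v n"
    using det_0_iff_vec_prod_zero[of ?M n] by auto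
  have "(\<Sum>j<n. v $ j * z l ^ (CHAR('k) ^ j)) = 0" if "l < n" for l
  proof -
    have "(?M *\<^sub>v v) $ l = (\<Sum>j<n. v $ j * z l ^ (CHAR('k) ^ j))"
      using v(1) that by (auto simp: scalar_prod_def atLeast0LessThan mult.commute intro!: sum.cong)
    then show ?thesis using v(3) that by simp
  qed
  then have "v $ j = 0" if "j < n" for j by (rule Moore_nonsingular[OF char z _ that])
  then show False using v(1,2) by (auto intro!: eq_vecI)
qed

lemma Moore_inverse_exists:
  fixes z :: "nat \<Rightarrow> 'k::field"
  assumes "CHAR('k) > 0" and "Fp_independent n z"
  shows "\<exists>C. left_inverse_matrix n C (\<lambda>j l. z l ^ (CHAR('k) ^ j))"
proof -
  have "\<exists>C E. (\<forall>i<n. \<forall>j<n. regular_at 0 (\<lambda>s. C s i j)) \<and> finite E \<and> 0 \<notin> E \<and>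
     (\<forall>s. s \<notin> E \<longrightarrow> (\<forall>i<n. \<forall>l<n. (\<Sum>j<n. C s i j * z l ^ (CHAR('k) ^ j)) = (if i = l then 1 else 0)))"
    by (rule regular_at_inverse_matrix[OF regular_at_const Moore_det_nonzero[OF assms]])
  then show ?thesis unfolding left_inverse_matrix_def by blast
qed

text \<open>
  A relation over the prime field between the \<open>z i\<close> is also one between their \<open>p ^ j\<close>-th powers.
\<close>

lemma Fp_independent_if_Moore_inverse:
  fixes z :: "nat \<Rightarrow> 'k::field"
  assumes char: "CHAR('k) > 0" and C: "left_inverse_matrix n C (\<lambda>j l. z l ^ (CHAR('k) ^ j))"
  shows "Fp_independent n z"
  unfolding Fp_independent_def
proof (intro allI impI)
  fix c i assume c: "\<forall>i<n. c i \<in> \<int>" "(\<Sum>i<n. c i * z i) = 0" and i: "i < n"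
  have z: "(\<Sum>l<n. z l ^ (CHAR('k) ^ j) * c l) = 0" for j
  proof -
    have "(\<Sum>l<n. z l ^ (CHAR('k) ^ j) * c l) = (\<Sum>l<n. (c l * z l) ^ (CHAR('k) ^ j))"
      using c(1) by (intro sum.cong) (auto simp: power_mult_distrib frobenius_fixed_Ints[OF char] mult.commute)
    also have "\<dots> = 0" unfolding frobenius_sum[OF char, symmetric] c(2) using char by (simp add: zero_power)
    finally show ?thesis .
  qed
  have "c i = (\<Sum>l<n. (if i = l then 1 else 0) * c l)" using i by (simp add: if_distrib[of "\<lambda>x. x * _"] sum.delta cong: if_cong)
  also have "\<dots> = (\<Sum>l<n. \<Sum>j<n. C i j * (z l ^ (CHAR('k) ^ j) * c l))"
    using left_inverse_matrixD[OF C i] by (intro sum.cong) (auto simp: sum_distrib_right mult.assoc[symmetric] simp flip: sum_distrib_right)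
  also have "\<dots> = (\<Sum>j<n. C i j * (\<Sum>l<n. z l ^ (CHAR('k) ^ j) * c l))"
    by (subst sum.swap) (simp add: sum_distrib_left)
  also have "\<dots> = 0" by (simp add: z)
  finally show "c i = 0" .
qed

lemma (in ambient_space) invert_linear_system:
  fixes n :: nat
  assumes C: "left_inverse_matrix n C B" and w: "\<And>j. j < n \<Longrightarrow> w j = (\<Sum>l<n. scale (B j l) (u l))" and i: "i < n"
  shows "(\<Sum>j<n. scale (C i j) (w j)) = u i"
proof -
  have "(\<Sum>j<n. scale (C i j) (w j)) = (\<Sum>j<n. \<Sum>l<n. scale (C i j * B j l) (u l))"
    using w by (intro sum.cong) (auto simp: scale_sum_right)
  also have "\<dots> = (\<Sum>l<n. scale (\<Sum>j<n. C i j * B j l) (u l))"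
    by (subst sum.swap) (simp add: scale_sum_left)
  also have "\<dots> = (\<Sum>l<n. if i = l then u l else 0)"
    using left_inverse_matrixD[OF C i] by (intro sum.cong) auto
  also have "\<dots> = u i" using i by simp
  finally show ?thesis .
qed

section \<open>Fixed vectors of a p-semilinear map on a cyclic subspace\<close>

text \<open>
  Let a p-semilinear map send \<open>X j\<close> to \<open>X (j + 1)\<close> for \<open>j < n - 1\<close> and \<open>X (n - 1)\<close> to
  \<open>\<Sum>j<n. a j X j\<close>. Comparing coefficients, a vector \<open>\<Sum>j<n. c j X j\<close> is fixed if and only if
  \<open>c j = orbit_coeff a j z\<close> where \<open>z = c (n - 1)\<close>. So fixed vectors correspond to the roots of
  \<open>orbit_poly a (n - 1) - X\<close>.
\<close>

primrec orbit_poly :: "(nat \<Rightarrow> 'k::field) \<Rightarrow> nat \<Rightarrow> 'k poly" where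
  "orbit_poly a 0 = monom (a 0) CHAR('k)"
| "orbit_poly a (Suc j) = orbit_poly a j ^ CHAR('k) + monom (a (Suc j)) CHAR('k)"

definition orbit_coeff :: "(nat \<Rightarrow> 'k::field) \<Rightarrow> nat \<Rightarrow> 'k \<Rightarrow> 'k" where
  "orbit_coeff a j z = poly (orbit_poly a j) z"

lemma orbit_coeff_simps:
  "orbit_coeff a 0 z = a 0 * z ^ CHAR('k)"
  "orbit_coeff a (Suc j) (z :: 'k::field) = orbit_coeff a j z ^ CHAR('k) + a (Suc j) * z ^ CHAR('k)"
  by (simp_all add: orbit_coeff_def poly_monom poly_power)

lemma degree_orbit_poly:
  assumes "CHAR('k::field) > 0" "a 0 \<noteq> (0 :: 'k)"
  shows "degree (orbit_poly a j) = CHAR('k) ^ Suc j"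
    "lead_coeff (orbit_poly a j) = a 0 ^ (CHAR('k) ^ j)"
proof (induction j)
  case 0
  { case 1 show ?case using assms by (simp add: degree_monom_eq)
  next case 2 show ?case using assms by (simp add: degree_monom_eq) }
next
  case (Suc j)
  have p: "CHAR('k) > 1" using CHAR_gt_1[OF assms(1)] .
  have nz: "orbit_poly a j \<noteq> 0" using Suc(1) p by auto
  have d: "degree (orbit_poly a j ^ CHAR('k)) = CHAR('k) ^ Suc (Suc j)"
    using nz Suc(1) by (simp add: degree_power_eq)
  have lt: "degree (monom (a (Suc j)) CHAR('k)) < degree (orbit_poly a j ^ CHAR('k))"
  proof -
    have "degree (monom (a (Suc j)) CHAR('k)) \<le> CHAR('k)" by (rule degree_monom_le)
    also have "\<dots> < CHAR('k) ^ Suc (Suc j)"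
      using p power_strict_increasing[of 1 "Suc (Suc j)" "CHAR('k)"] by simp
    finally show ?thesis using d by simp
  qed
  { case 1 show ?case using lt d by (simp add: degree_add_eq_left)
  next
    case 2
    have "coeff (monom (a (Suc j)) CHAR('k)) (degree (orbit_poly a j ^ CHAR('k))) = 0"
      using lt by (rule coeff_eq_0)
    then have "lead_coeff (orbit_poly a (Suc j)) = lead_coeff (orbit_poly a j ^ CHAR('k))"
      unfolding orbit_poly.simps(2) degree_add_eq_left[OF lt] coeff_add by simp
    also have "\<dots> = a 0 ^ (CHAR('k) ^ Suc j)" using Suc(2) by (simp add: lead_coeff_power power_mult[symmetric] mult.commute)
    finally show ?case . }
qed

definition fixed_poly :: "(nat \<Rightarrow> 'k::field) \<Rightarrow> nat \<Rightarrow> 'k poly" where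
  "fixed_poly a n = orbit_poly a (n - 1) - [:0, 1:]"

lemma poly_fixed_poly: "poly (fixed_poly a n) z = 0 \<longleftrightarrow> orbit_coeff a (n - 1) z = z"
  by (simp add: fixed_poly_def orbit_coeff_def)

lemma pderiv_fixed_poly: "pderiv (fixed_poly a n :: 'k::field poly) = [:-1:]"
proof -
  have "pderiv (orbit_poly a j) = 0" for j
    by (cases j) (simp_all add: pderiv_add pderiv_power pderiv_monom)
  then show ?thesis by (simp add: fixed_poly_def pderiv_diff pderiv_pCons)
qed

lemma degree_fixed_poly:
  assumes "CHAR('k::field) > 0" "a 0 \<noteq> (0 :: 'k)" "n > 0"
  shows "degree (fixed_poly a n) = CHAR('k) ^ n" "lead_coeff (fixed_poly a n) = a 0 ^ (CHAR('k) ^ (n - 1))"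
proof -
  have d: "degree (orbit_poly a (n - 1)) = CHAR('k) ^ n" using degree_orbit_poly(1)[of a "n - 1", OF assms(1,2)] assms(3) by (cases n) auto
  have "CHAR('k) ^ n > 1" using one_less_power[OF CHAR_gt_1[OF assms(1)] assms(3)] .
  then have lt: "degree [:0, 1 :: 'k:] < degree (orbit_poly a (n - 1))" using d by simp
  then show dd: "degree (fixed_poly a n) = CHAR('k) ^ n"
    unfolding fixed_poly_def diff_conv_add_uminus using d by (subst degree_add_eq_left) auto
  have "coeff (fixed_poly a n) (CHAR('k) ^ n) = coeff (orbit_poly a (n - 1)) (CHAR('k) ^ n)"
    using lt d by (simp add: fixed_poly_def coeff_eq_0)
  then show "lead_coeff (fixed_poly a n) = a 0 ^ (CHAR('k) ^ (n - 1))"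
    using dd d degree_orbit_poly(2)[of a "n - 1", OF assms(1,2)] by simp
qed

lemma regular_at_coeff_orbit_poly:
  fixes a :: "'k::field \<Rightarrow> nat \<Rightarrow> 'k"
  assumes "\<And>i. i \<le> j \<Longrightarrow> regular_at s0 (\<lambda>s. a s i)"
  shows "regular_at s0 (\<lambda>s. coeff (orbit_poly (a s) j) i)"
  using assms
proof (induction j arbitrary: i)
  case 0
  then show ?case by (cases "CHAR('k) = i") (simp_all add: regular_at_const)
next
  case (Suc j)
  have "regular_at s0 (\<lambda>s. coeff (monom (a s (Suc j)) CHAR('k)) i)"
    using Suc.prems by (cases "CHAR('k) = i") (simp_all add: regular_at_const)
  then show ?case
    using Suc by (auto intro!: regular_at_add regular_at_coeff_power)
qed

text \<open>
  The polynomial \<open>fixed_poly a n\<close> has degree at least \<open>p\<close>, and \<open>0\<close> is a simple root, as the derivative is \<open>-1\<close>.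
\<close>

lemma exists_nonzero_fixed_root:
  fixes a :: "nat \<Rightarrow> 'k::alg_closed_field"
  assumes "CHAR('k) > 0" "a 0 \<noteq> 0" "n > 0"
  shows "\<exists>z. z \<noteq> 0 \<and> orbit_coeff a (n - 1) z = z"
proof -
  let ?F = "fixed_poly a n"
  have deg: "degree ?F > 1"
    using degree_fixed_poly(1)[of a n, OF assms] one_less_power[OF CHAR_gt_1[OF assms(1)] assms(3)] by simp
  have "orbit_coeff a j 0 = 0" for j
    using assms(1) by (induction j) (simp_all add: orbit_coeff_simps power_0_left)
  then have "poly ?F 0 = 0" by (simp add: poly_fixed_poly)
  then obtain H where H: "?F = [:0, 1:] * H" by (metis dvdE poly_eq_0_iff_dvd minus_zero)
  then have "H \<noteq> 0" using deg by auto
  then have "degree H > 0" using deg unfolding H by (subst (asm) degree_mult_eq) auto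
  then obtain z where z: "poly H z = 0" using alg_closed_imp_poly_has_root by blast
  have "poly (pderiv ?F) 0 = poly H 0" unfolding H by (subst pderiv_mult) (simp add: pderiv_pCons del: mult_pCons_left)
  then have "poly H 0 = -1" by (simp add: pderiv_fixed_poly)
  then show ?thesis using z H poly_fixed_poly[of a n z] by (metis mult_zero_right poly_mult neg_equal_0_iff_equal zero_neq_one)
qed

section \<open>Traces over tuples of roots\<close>

lemma regular_at_power_sum:
  fixes F :: "'k::alg_closed_field \<Rightarrow> 'k poly"
  assumes coeffs: "\<And>i. regular_at s0 (\<lambda>s. coeff (F s) i)"
    and E: "finite E" "s0 \<notin> E"
    and F: "\<And>s. s \<notin> E \<Longrightarrow> pderiv (F s) = [:-1:] \<and> degree (F s) = q" and q: "q > 0"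
  shows "regular_at s0 (\<lambda>s. \<Sum>z | poly (F s) z = 0. z ^ m)"
proof (induction m rule: less_induct)
  case (less m)
  have lead: "coeff (F s) q \<noteq> 0" if "s \<notin> E" for s
    using F[OF that] q by (metis leading_coeff_0_iff degree_0 less_irrefl)
  have inv: "regular_at s0 (\<lambda>s. - inverse (coeff (F s) q))"
    by (intro regular_at_uminus regular_at_inverse coeffs lead E)
  show ?case
  proof (cases "m < q")
    case True
    have "regular_at s0 (\<lambda>s. if m = q - 1 then - inverse (coeff (F s) q) else 0)"
      using inv by (cases "m = q - 1") (simp_all add: regular_at_const)
    then show ?thesis
    proof (rule regular_at_cong_cofinite[OF _ E])
      fix s assume "s \<notin> E"
      then show "(if m = q - 1 then - inverse (coeff (F s) q) else 0) = (\<Sum>z | poly (F s) z = 0. z ^ m)"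
        using F[of s] power_sum_roots[of "F s" q m] q True by simp
    qed
  next
    case False
    have "regular_at s0 (\<lambda>s. - inverse (coeff (F s) q) *
        (\<Sum>i<q. coeff (F s) i * (\<Sum>z | poly (F s) z = 0. z ^ (m - q + i))))"
      using False q by (intro regular_at_mult inv regular_at_sum coeffs less) auto
    then show ?thesis
    proof (rule regular_at_cong_cofinite[OF _ E])
      fix s assume s: "s \<notin> E"
      have zm: "z ^ m = - inverse (coeff (F s) q) * (\<Sum>i<q. coeff (F s) i * z ^ (m - q + i))"
        if "poly (F s) z = 0" for z
      proof -
        have "(\<Sum>i<q. coeff (F s) i * z ^ i) + coeff (F s) q * z ^ q = 0"
          using that F[OF s] by (simp add: poly_altdef atMost_Suc lessThan_Suc_atMost[symmetric] flip: lessThan_Suc)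
        then have "z ^ q = - inverse (coeff (F s) q) * (\<Sum>i<q. coeff (F s) i * z ^ i)"
          using lead[OF s] by (simp add: field_simps eq_neg_iff_add_eq_0)
        then have "z ^ (m - q) * z ^ q = - inverse (coeff (F s) q) * (z ^ (m - q) * (\<Sum>i<q. coeff (F s) i * z ^ i))"
          by simp
        moreover have "z ^ (m - q) * z ^ q = z ^ m" using False by (simp flip: power_add)
        moreover have "z ^ (m - q) * (\<Sum>i<q. coeff (F s) i * z ^ i) = (\<Sum>i<q. coeff (F s) i * z ^ (m - q + i))"
          by (simp add: sum_distrib_left power_add mult_ac)
        ultimately show ?thesis by simp
      qed
      have "(\<Sum>z | poly (F s) z = 0. z ^ m) =
          (\<Sum>z | poly (F s) z = 0. - inverse (coeff (F s) q) * (\<Sum>i<q. coeff (F s) i * z ^ (m - q + i)))"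
        by (intro sum.cong) (auto simp: zm)
      also have "\<dots> = - inverse (coeff (F s) q) * (\<Sum>z | poly (F s) z = 0. \<Sum>i<q. coeff (F s) i * z ^ (m - q + i))"
        by (simp add: sum_distrib_left)
      also have "\<dots> = - inverse (coeff (F s) q) * (\<Sum>i<q. \<Sum>z | poly (F s) z = 0. coeff (F s) i * z ^ (m - q + i))"
        by (subst sum.swap) simp
      finally show "- inverse (coeff (F s) q) * (\<Sum>i<q. coeff (F s) i * (\<Sum>z | poly (F s) z = 0. z ^ (m - q + i)))
          = (\<Sum>z | poly (F s) z = 0. z ^ m)" by (simp add: sum_distrib_left)
    qed
  qed
qed

text \<open>Polynomials in \<open>n\<close> variables whose coefficients are functions regular at \<open>s0\<close>.\<close>

inductive_set regular_polys :: "'k::field \<Rightarrow> nat \<Rightarrow> ('k \<Rightarrow> (nat \<Rightarrow> 'k) \<Rightarrow> 'k) set"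
  for s0 n where
  const: "regular_at s0 \<rho> \<Longrightarrow> (\<lambda>s z. \<rho> s) \<in> regular_polys s0 n"
| scale: "regular_at s0 \<rho> \<Longrightarrow> H \<in> regular_polys s0 n \<Longrightarrow> (\<lambda>s z. \<rho> s * H s z) \<in> regular_polys s0 n"
| shift: "i < n \<Longrightarrow> H \<in> regular_polys s0 n \<Longrightarrow> (\<lambda>s z. z i * H s z) \<in> regular_polys s0 n"
| add: "G \<in> regular_polys s0 n \<Longrightarrow> H \<in> regular_polys s0 n \<Longrightarrow> (\<lambda>s z. G s z + H s z) \<in> regular_polys s0 n"

lemma regular_polys_mult:
  assumes "G \<in> regular_polys s0 n" "H \<in> regular_polys s0 n"
  shows "(\<lambda>s z. G s z * H s z) \<in> regular_polys s0 n"
  using assms(1)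
proof induction
  case (const \<rho>)
  then show ?case using assms(2) by (intro regular_polys.scale)
next
  case (scale \<rho> G)
  then show ?case by (simp add: mult.assoc regular_polys.scale)
next
  case (shift i G)
  then show ?case by (simp add: mult.assoc regular_polys.shift)
next
  case (add G G')
  then show ?case by (simp add: distrib_right regular_polys.add)
qed

lemma regular_polys_var: "i < n \<Longrightarrow> (\<lambda>s z. z i) \<in> regular_polys s0 n"
  using regular_polys.shift[OF _ regular_polys.const[OF regular_at_const[of s0 1]]] by simp

lemma regular_polys_sum:
  "(\<And>i. i \<in> A \<Longrightarrow> H i \<in> regular_polys s0 n) \<Longrightarrow> (\<lambda>s z. \<Sum>i\<in>A. H i s z) \<in> regular_polys s0 n"
  by (induction A rule: infinite_finite_induct)
     (auto intro: regular_polys.const regular_at_const regular_polys.add)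

lemma regular_polys_prod:
  "(\<And>i. i \<in> A \<Longrightarrow> H i \<in> regular_polys s0 n) \<Longrightarrow> (\<lambda>s z. \<Prod>i\<in>A. H i s z) \<in> regular_polys s0 n"
  by (induction A rule: infinite_finite_induct)
     (auto intro: regular_polys.const regular_at_const regular_polys_mult)

lemma regular_polys_power: "H \<in> regular_polys s0 n \<Longrightarrow> (\<lambda>s z. H s z ^ m) \<in> regular_polys s0 n"
  by (induction m) (auto intro: regular_polys.const regular_at_const regular_polys_mult)

lemma regular_polys_det:
  assumes "\<And>i j. i < m \<Longrightarrow> j < m \<Longrightarrow> B i j \<in> regular_polys s0 n"
  shows "(\<lambda>s z. det (mat m m (\<lambda>(i, j). B i j s z))) \<in> regular_polys s0 n"
proof -
  have "det (mat m m (\<lambda>(i, j). B i j s z)) =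
      (\<Sum>\<pi>\<in>{\<pi>. \<pi> permutes {0..<m}}. signof \<pi> * (\<Prod>i = 0..<m. B i (\<pi> i) s z))" for s z
    by (auto simp: det_def intro!: sum.cong prod.cong)
  then show ?thesis
    using assms by (auto intro!: regular_polys_sum regular_polys_mult regular_polys_prod
        regular_polys.const regular_at_const)
qed

lemma regular_polys_orbit_coeff:
  fixes a :: "'k::field \<Rightarrow> nat \<Rightarrow> 'k"
  assumes "\<And>i. i \<le> j \<Longrightarrow> regular_at s0 (\<lambda>s. a s i)" "l < n"
  shows "(\<lambda>s z. orbit_coeff (a s) j (z l)) \<in> regular_polys s0 n"
  using assms(1)
proof (induction j)
  case 0
  then show ?case unfolding orbit_coeff_simps
    using assms(2) by (intro regular_polys.scale regular_polys_power regular_polys_var) auto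
next
  case (Suc j)
  then show ?case unfolding orbit_coeff_simps
    using assms(2)
    by (intro regular_polys.add regular_polys.scale regular_polys_power regular_polys_var Suc) auto
qed

text \<open>
  The sum of a polynomial over all tuples of roots is a combination of products of power sums of the
  roots, hence regular.
\<close>

lemma regular_at_trace:
  fixes V :: "'k::field \<Rightarrow> 'k set"
  assumes H: "H \<in> regular_polys s0 n"
    and S: "\<And>m. regular_at s0 (\<lambda>s. \<Sum>z\<in>V s. z ^ m)" and fin: "\<And>s. finite (V s)"
  shows "regular_at s0 (\<lambda>s. \<Sum>z\<in>{..<n} \<rightarrow>\<^sub>E V s. H s z)"
proof -
  have "regular_at s0 (\<lambda>s. \<Sum>z\<in>{..<n} \<rightarrow>\<^sub>E V s. H s z * (\<Prod>i<n. z i ^ m i))" for m :: "nat \<Rightarrow> nat"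
    using H
  proof (induction arbitrary: m)
    case (const \<rho>)
    have "(\<Sum>z\<in>{..<n} \<rightarrow>\<^sub>E V s. \<rho> s * (\<Prod>i<n. z i ^ m i)) = \<rho> s * (\<Prod>i<n. \<Sum>z\<in>V s. z ^ m i)" for s
      using fin by (simp add: prod_sum_PiE sum_distrib_left)
    then show ?case using const S by (auto intro!: regular_at_mult regular_at_prod)
  next
    case (scale \<rho> H)
    have "(\<Sum>z\<in>{..<n} \<rightarrow>\<^sub>E V s. \<rho> s * H s z * (\<Prod>i<n. z i ^ m i)) =
        \<rho> s * (\<Sum>z\<in>{..<n} \<rightarrow>\<^sub>E V s. H s z * (\<Prod>i<n. z i ^ m i))" for s
      by (simp add: sum_distrib_left mult.assoc)
    then show ?case using scale by (auto intro!: regular_at_mult)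
  next
    case (shift i H)
    have "z i * (\<Prod>l<n. z l ^ m l) = (\<Prod>l<n. z l ^ (m(i := Suc (m i))) l)" for z :: "nat \<Rightarrow> 'k"
    proof -
      have "(\<Prod>l<n. z l ^ (m(i := Suc (m i))) l) = (\<Prod>l<n. (if l = i then z i else 1) * z l ^ m l)"
        by (intro prod.cong) auto
      also have "\<dots> = z i * (\<Prod>l<n. z l ^ m l)" using shift(1) by (simp add: prod.distrib)
      finally show ?thesis by simp
    qed
    then have "z i * H s z * (\<Prod>l<n. z l ^ m l) = H s z * (\<Prod>l<n. z l ^ (m(i := Suc (m i))) l)" for s z
      by (metis mult.assoc mult.commute)
    then show ?case using shift(3)[of "m(i := Suc (m i))"] by (simp only:)
  next
    case (add G H)
    then show ?case by (auto simp: distrib_right sum.distrib intro!: regular_at_add)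
  qed
  from this[of "\<lambda>_. 0"] show ?thesis by simp
qed

section \<open>Spaces with boundedly many disjoint open sets\<close>

text \<open>
  A space that is not connected splits into two open pieces, and each of them admits fewer disjoint
  open sets than the whole. So after finitely many splittings the pieces are connected.
\<close>

lemma open_connected_neighbourhood:
  assumes "\<And>\<F>. finite \<F> \<Longrightarrow> (\<And>U. U \<in> \<F> \<Longrightarrow> openin X U \<and> U \<noteq> {}) \<Longrightarrow> disjoint \<F> \<Longrightarrow> card \<F> \<le> k"
    and "x \<in> topspace X"
  shows "\<exists>C. openin X C \<and> connectedin X C \<and> x \<in> C"
  using assms
proof (induction k arbitrary: X)
  case 0
  have "card {topspace X} \<le> 0" using 0(2) by (intro 0(1)) (auto simp: disjoint_def)
  then show ?case by simp
next
  case (Suc k)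
  show ?case
  proof (cases "connected_space X")
    case True
    then show ?thesis using Suc.prems(2) by (intro exI[of _ "topspace X"]) (auto simp: connectedin_topspace)
  next
    case False
    then obtain E1 E2 where E: "openin X E1" "openin X E2" "E1 \<union> E2 = topspace X" "E1 \<inter> E2 = {}"
      "E1 \<noteq> {}" "E2 \<noteq> {}"
      unfolding connected_space_eq by blast
    have *: "\<exists>C. openin X C \<and> connectedin X C \<and> x \<in> C"
      if U: "openin X U" "openin X W" "U \<inter> W = {}" "W \<noteq> {}" "x \<in> U" for U W
    proof -
      have "card \<F> \<le> k" if \<F>: "finite \<F>" "\<And>S. S \<in> \<F> \<Longrightarrow> openin (subtopology X U) S \<and> S \<noteq> {}" "disjoint \<F>" for \<F>
      proof -
        have sub: "openin X S \<and> S \<subseteq> U" if "S \<in> \<F>" for S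
          using \<F>(2)[OF that] U(1) by (simp add: openin_open_subtopology)
        then have nin: "W \<notin> \<F>" using U(3,4) by blast
        have "disjoint (insert W \<F>)" using \<F>(3) sub U(3) by (fastforce simp: disjoint_def)
        then have "card (insert W \<F>) \<le> Suc k"
          using \<F>(1,2) sub U(2,4) by (intro Suc.prems(1)) auto
        then show ?thesis using nin \<F>(1) by simp
      qed
      moreover have "x \<in> topspace (subtopology X U)" using U(1,5) openin_subset by fastforce
      ultimately obtain C where "openin (subtopology X U) C" "connectedin (subtopology X U) C" "x \<in> C"
        using Suc.IH[of "subtopology X U"] by blast
      then show ?thesis using U(1) by (auto simp: openin_open_subtopology connectedin_subtopology)
    qed
    have "x \<in> E1 \<or> x \<in> E2" using Suc.prems(2) E(3) by blast
    then show ?thesis using *[of E1 E2] *[of E2 E1] E by (auto simp: Int_commute)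
  qed
qed

section \<open>The Zariski topology on the variety of embeddings\<close>

lemma openin_principal_open:
  "f \<in> hom_poly_funs L t \<Longrightarrow> openin (zariski_topology L t) {\<phi> \<in> torus_embeddings L t. f \<phi> \<noteq> 0}"
  unfolding zariski_topology_def by (intro topology_generated_by_Basis) auto

lemma zariski_open_basis:
  assumes "openin (zariski_topology L t) U" "\<phi> \<in> U"
  shows "\<exists>f\<in>hom_poly_funs L t. f \<phi> \<noteq> 0 \<and> {\<psi> \<in> torus_embeddings L t. f \<psi> \<noteq> 0} \<subseteq> U"
proof -
  have "generate_topology_on ((\<lambda>f. {\<phi> \<in> torus_embeddings L t. f \<phi> \<noteq> 0}) ` hom_poly_funs L t) U"
    using assms(1) unfolding zariski_topology_def by (rule openin_topology_generated_by)
  then show ?thesis using assms(2)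
  proof (induction arbitrary: \<phi>)
    case (Int A B)
    then obtain f g where "f \<in> hom_poly_funs L t" "f \<phi> \<noteq> 0" "{\<psi> \<in> torus_embeddings L t. f \<psi> \<noteq> 0} \<subseteq> A"
      "g \<in> hom_poly_funs L t" "g \<phi> \<noteq> 0" "{\<psi> \<in> torus_embeddings L t. g \<psi> \<noteq> 0} \<subseteq> B" by blast
    then show ?case
      by (intro bexI[of _ "\<lambda>\<phi>. f \<phi> * g \<phi>"] hom_poly_funs.mult) auto
  next
    case (UN K)
    then show ?case by blast
  qed auto
qed

text \<open>
  Composition with a fixed map is linear in \<open>\<phi>\<close>.
\<close>

lemma hom_poly_funs_compose:
  assumes "f \<in> hom_poly_funs L t" "h \<in> t \<rightarrow> t"
  shows "(\<lambda>\<phi>. f (compose t \<phi> h)) \<in> hom_poly_funs L t"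
  using assms(1)
proof induction
  case (coord \<xi> x)
  then have "(\<lambda>\<phi>. \<xi> (compose t \<phi> h x)) = (\<lambda>\<phi>. \<xi> (\<phi> (h x)))" by (auto simp: compose_def)
  then show ?case using coord assms(2) by (auto intro!: hom_poly_funs.coord)
qed (auto intro: hom_poly_funs.const hom_poly_funs.add hom_poly_funs.mult)

text \<open>Reparametrisation of the torus by an endomorphism is a morphism of varieties.\<close>

lemma continuous_map_compose_zariski:
  assumes h: "h \<in> t \<rightarrow> t" and T: "\<And>\<phi>. \<phi> \<in> torus_embeddings L t \<Longrightarrow> compose t \<phi> h \<in> torus_embeddings L t"
  shows "continuous_map (zariski_topology L t) (zariski_topology L t) (\<lambda>\<phi>. compose t \<phi> h)"
  unfolding continuous_map_def
proof (intro conjI allI impI)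
  show "(\<lambda>\<phi>. compose t \<phi> h) \<in> topspace (zariski_topology L t) \<rightarrow> topspace (zariski_topology L t)"
    using T by auto
next
  fix U assume U: "openin (zariski_topology L t) U"
  show "openin (zariski_topology L t) {\<phi> \<in> topspace (zariski_topology L t). compose t \<phi> h \<in> U}"
  proof (subst openin_subopen, intro ballI)
    fix \<phi> assume \<phi>: "\<phi> \<in> {\<phi> \<in> topspace (zariski_topology L t). compose t \<phi> h \<in> U}"
    then obtain f where f: "f \<in> hom_poly_funs L t" "f (compose t \<phi> h) \<noteq> 0"
      "{\<psi> \<in> torus_embeddings L t. f \<psi> \<noteq> 0} \<subseteq> U" using zariski_open_basis[OF U] by blast
    let ?W = "{\<psi> \<in> torus_embeddings L t. f (compose t \<psi> h) \<noteq> 0}"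
    have "openin (zariski_topology L t) ?W"
      using openin_principal_open[OF hom_poly_funs_compose[OF f(1) h]] by simp
    then show "\<exists>T. openin (zariski_topology L t) T \<and> \<phi> \<in> T \<and>
        T \<subseteq> {\<phi> \<in> topspace (zariski_topology L t). compose t \<phi> h \<in> U}"
      using \<phi> f T by (intro exI[of _ ?W]) auto
  qed
qed

lemma connected_component_of_compose:
  assumes h: "h \<in> t \<rightarrow> t" and T: "\<And>\<phi>. \<phi> \<in> torus_embeddings L t \<Longrightarrow> compose t \<phi> h \<in> torus_embeddings L t"
    and "connected_component_of (zariski_topology L t) \<phi> \<psi>"
  shows "connected_component_of (zariski_topology L t) (compose t \<phi> h) (compose t \<psi> h)"
  using assms(3) connectedin_continuous_map_image[OF continuous_map_compose_zariski[OF h T]]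
  unfolding connected_component_of_def by blast

text \<open>
  The affine line is irreducible: in the image of a cofinite part of it under a rational map, any two
  nonempty open sets meet.
\<close>

lemma connected_rational_curve:
  fixes \<phi> :: "'k::alg_closed_field \<Rightarrow> 'v::ab_group_add \<Rightarrow> 'v"
  assumes E: "finite E" and T: "\<And>s. s \<notin> E \<Longrightarrow> \<phi> s \<in> torus_embeddings L t"
    and reg: "\<And>\<xi> x s0. Vector_Spaces.linear (scl L) (*) \<xi> \<Longrightarrow> x \<in> t \<Longrightarrow> s0 \<notin> E \<Longrightarrow> regular_at s0 (\<lambda>s. \<xi> (\<phi> s x))"
    and s: "s1 \<notin> E" "s2 \<notin> E"
  shows "connected_component_of (zariski_topology L t) (\<phi> s1) (\<phi> s2)"
proof -
  have regf: "regular_at s0 (\<lambda>s. f (\<phi> s))" if "f \<in> hom_poly_funs L t" "s0 \<notin> E" for f s0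
    using that by induction (auto intro: regular_at_const reg regular_at_add regular_at_mult)
  have "connectedin (zariski_topology L t) (\<phi> ` (- E))"
    unfolding connectedin
  proof (intro conjI notI)
    show "\<phi> ` (- E) \<subseteq> topspace (zariski_topology L t)" using T by auto
    assume "\<exists>E1 E2. openin (zariski_topology L t) E1 \<and> openin (zariski_topology L t) E2 \<and>
       \<phi> ` (- E) \<subseteq> E1 \<union> E2 \<and> E1 \<inter> E2 \<inter> \<phi> ` (- E) = {} \<and> E1 \<inter> \<phi> ` (- E) \<noteq> {} \<and> E2 \<inter> \<phi> ` (- E) \<noteq> {}"
    then obtain E1 E2 a b where o: "openin (zariski_topology L t) E1" "openin (zariski_topology L t) E2"
      "E1 \<inter> E2 \<inter> \<phi> ` (- E) = {}" and ab: "a \<notin> E" "\<phi> a \<in> E1" "b \<notin> E" "\<phi> b \<in> E2" by blast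
    obtain f where f: "f \<in> hom_poly_funs L t" "f (\<phi> a) \<noteq> 0" "{\<psi> \<in> torus_embeddings L t. f \<psi> \<noteq> 0} \<subseteq> E1"
      using zariski_open_basis[OF o(1) ab(2)] by blast
    obtain g where g: "g \<in> hom_poly_funs L t" "g (\<phi> b) \<noteq> 0" "{\<psi> \<in> torus_embeddings L t. g \<psi> \<noteq> 0} \<subseteq> E2"
      using zariski_open_basis[OF o(2) ab(4)] by blast
    obtain A where A: "finite A" "\<forall>s. s \<notin> A \<longrightarrow> f (\<phi> s) \<noteq> 0"
      using regular_at_nonzero_cofinite[OF regf[OF f(1) ab(1)]] f(2) by blast
    obtain B where B: "finite B" "\<forall>s. s \<notin> B \<longrightarrow> g (\<phi> s) \<noteq> 0"
      using regular_at_nonzero_cofinite[OF regf[OF g(1) ab(3)]] g(2) by blast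
    have "finite (A \<union> B \<union> E)" using A B E by simp
    then obtain s where "s \<notin> A \<union> B \<union> E" using infinite_alg_closed by (metis ex_new_if_finite)
    then have "\<phi> s \<in> E1 \<inter> E2 \<inter> \<phi> ` (- E)" using A B f(3) g(3) T by blast
    then show False using o(3) by blast
  qed
  then show ?thesis unfolding connected_component_of_def using s by blast
qed

section \<open>Finite-dimensional restricted Lie algebras\<close>

text \<open>
  The ambient space may be infinite-dimensional, like the space of all polynomials; only the carrier is
  finite-dimensional, and the axioms are relative to it.
\<close>

locale fin_dim_restricted_lie =
  fixes L :: "('v::ab_group_add, 'k::alg_closed_field) restricted_lie"
  assumes vector_space_scl: "vector_space (scl L)"
    and carrier_subspace: "module.subspace (scl L) (carrier L)"
    and carrier_finite_dim: "\<exists>B. finite B \<and> carrier L \<subseteq> module.span (scl L) B"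
    and char_pos: "CHAR('k) > 0"
    and brk_closed: "x \<in> carrier L \<Longrightarrow> y \<in> carrier L \<Longrightarrow> brk L x y \<in> carrier L"
    and brk_add_left: "x \<in> carrier L \<Longrightarrow> y \<in> carrier L \<Longrightarrow> z \<in> carrier L \<Longrightarrow>
      brk L (x + y) z = brk L x z + brk L y z"
    and brk_scale_left: "x \<in> carrier L \<Longrightarrow> y \<in> carrier L \<Longrightarrow> brk L (scl L c x) y = scl L c (brk L x y)"
    and brk_antisym: "x \<in> carrier L \<Longrightarrow> y \<in> carrier L \<Longrightarrow> brk L y x = - brk L x y"
    and brk_self: "x \<in> carrier L \<Longrightarrow> brk L x x = 0"
    and p_map: "is_p_map L"

sublocale fin_dim_restricted_lie \<subseteq> ambient_space "scl L"
  by (simp add: ambient_space_def vector_space_scl)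

lemma sum_lessThan_add:
  fixes f :: "nat \<Rightarrow> 'a::comm_monoid_add"
  shows "(\<Sum>i<w + m. f i) = (\<Sum>i<w. f i) + (\<Sum>j<m. f (w + j))"
  by (induction m) (simp_all add: add.assoc)

lemma exists_pth_root:
  assumes "CHAR('k::alg_closed_field) > 0" shows "\<exists>y :: 'k. y ^ (CHAR('k) ^ n) = x"
proof -
  let ?q = "CHAR('k) ^ n"
  have q: "?q > 0" using assms by simp
  have "degree (monom 1 ?q - [:x:]) = ?q"
    unfolding diff_conv_add_uminus using q by (subst degree_add_eq_left) (auto simp: degree_monom_eq)
  then have "degree (monom 1 ?q - [:x:]) > 0" using q by simp
  then obtain y where "poly (monom 1 ?q - [:x:]) y = 0"
    using alg_closed_imp_poly_has_root by blast
  then show ?thesis by (auto simp: poly_monom)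
qed

lemma exists_Artin_Schreier_root:
  assumes "CHAR('k::alg_closed_field) > 0" shows "\<exists>y :: 'k. y = y ^ CHAR('k) + x"
proof -
  let ?p = "CHAR('k)"
  have p: "?p > 1" using CHAR_gt_1[OF assms] .
  have "degree (monom 1 ?p + [:x, -1:]) = ?p"
    using p by (subst degree_add_eq_left) (auto simp: degree_monom_eq)
  then have "degree (monom 1 ?p + [:x, -1:]) > 0" using p by simp
  then obtain y where "poly (monom 1 ?p + [:x, -1:]) y = 0"
    using alg_closed_imp_poly_has_root by blast
  then have "y ^ ?p + x - y = 0" by (simp add: poly_monom algebra_simps)
  then show ?thesis by (intro exI[of _ y]) simp
qed

context fin_dim_restricted_lie
begin

lemma p_gt_1: "CHAR('k) > 1"
  using CHAR_gt_1 char_pos .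

lemma carrier_0 [simp]: "0 \<in> carrier L"
  using carrier_subspace by (rule subspace_0)

lemma carrier_add: "x \<in> carrier L \<Longrightarrow> y \<in> carrier L \<Longrightarrow> x + y \<in> carrier L"
  using carrier_subspace by (rule subspace_add)

lemma carrier_scale: "x \<in> carrier L \<Longrightarrow> scl L c x \<in> carrier L"
  using carrier_subspace by (rule subspace_scale)

lemma brk_0_left [simp]: "x \<in> carrier L \<Longrightarrow> brk L 0 x = 0"
  using brk_scale_left[of 0 x 0] by simp

lemma brk_0_right [simp]: "x \<in> carrier L \<Longrightarrow> brk L x 0 = 0"
  using brk_antisym[of 0 x] by simp

lemma brk_add_right:
  "x \<in> carrier L \<Longrightarrow> y \<in> carrier L \<Longrightarrow> z \<in> carrier L \<Longrightarrow> brk L x (y + z) = brk L x y + brk L x z"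
  by (simp add: brk_antisym[of _ x] brk_add_left carrier_add)

lemma brk_scale_right:
  "x \<in> carrier L \<Longrightarrow> y \<in> carrier L \<Longrightarrow> brk L x (scl L c y) = scl L c (brk L x y)"
  by (simp add: brk_antisym[of _ x] brk_scale_left carrier_scale)

lemma brk_commute_0: "x \<in> carrier L \<Longrightarrow> y \<in> carrier L \<Longrightarrow> brk L x y = 0 \<Longrightarrow> brk L y x = 0"
  by (simp add: brk_antisym[of x y])

lemma subspace_centralizer: "x \<in> carrier L \<Longrightarrow> subspace {y \<in> carrier L. brk L x y = 0}"
  by (rule subspaceI) (auto simp: brk_add_right brk_scale_right carrier_add carrier_scale)

lemma pop_closed: "x \<in> carrier L \<Longrightarrow> pop L x \<in> carrier L"
  using p_map by (simp add: is_p_map_def)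

lemma pop_scale: "x \<in> carrier L \<Longrightarrow> pop L (scl L c x) = scl L (c ^ CHAR('k)) (pop L x)"
  using p_map by (simp add: is_p_map_def)

lemma brk_pop: "x \<in> carrier L \<Longrightarrow> y \<in> carrier L \<Longrightarrow> brk L (pop L x) y = (brk L x ^^ CHAR('k)) y"
  using p_map by (simp add: is_p_map_def)

lemma pop_0 [simp]: "pop L 0 = 0"
  using pop_scale[of 0 0] p_gt_1 by (simp add: zero_power)

lemma ad_coeff_commuting:
  assumes "x \<in> carrier L" "y \<in> carrier L" "brk L x y = 0"
  shows "ad_coeff (brk L) x y (Suc n) j = 0"
proof (induction n arbitrary: j)
  case 0
  show ?case using assms by (auto simp: brk_self brk_commute_0)
next
  case (Suc n)
  show ?case
    by (subst ad_coeff.simps(2)) (use assms in \<open>simp add: Suc del: ad_coeff.simps\<close>)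
qed

lemma pop_add_commuting:
  assumes "x \<in> carrier L" "y \<in> carrier L" "brk L x y = 0"
  shows "pop L (x + y) = pop L x + pop L y"
proof -
  obtain m where m: "CHAR('k) - 1 = Suc m" using p_gt_1 by (metis Suc_diff_1 zero_less_diff)
  have "jacobson_term L i x y = 0" for i
    unfolding jacobson_term_def m by (simp add: ad_coeff_commuting[OF assms] del: ad_coeff.simps)
  then show ?thesis using p_map assms by (simp add: is_p_map_def)
qed

definition abelian_p_subalgebra :: "'v set \<Rightarrow> bool" where
  "abelian_p_subalgebra A \<longleftrightarrow> p_subalgebra L A \<and> (\<forall>x\<in>A. \<forall>y\<in>A. brk L x y = 0)"

lemma torus_abelian: "torus L t \<Longrightarrow> abelian_p_subalgebra t"
  by (simp add: torus_def abelian_p_subalgebra_def)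

lemma abelian_p_subalgebraD:
  assumes "abelian_p_subalgebra A"
  shows "A \<subseteq> carrier L" "subspace A" "x \<in> A \<Longrightarrow> pop L x \<in> A" "x \<in> A \<Longrightarrow> y \<in> A \<Longrightarrow> brk L x y = 0"
  using assms by (auto simp: abelian_p_subalgebra_def p_subalgebra_def)

lemma abelian_pow:
  "abelian_p_subalgebra A \<Longrightarrow> x \<in> A \<Longrightarrow> (pop L ^^ j) x \<in> A"
  by (induction j) (auto dest: abelian_p_subalgebraD)

lemma pop_sum:
  fixes n :: nat
  assumes A: "abelian_p_subalgebra A" and v: "\<And>i. i < n \<Longrightarrow> v i \<in> A"
  shows "pop L (\<Sum>i<n. scl L (c i) (v i)) = (\<Sum>i<n. scl L (c i ^ CHAR('k)) (pop L (v i)))"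
  using v
proof (induction n)
  case (Suc n)
  have 1: "(\<Sum>i<n. scl L (c i) (v i)) \<in> A" "scl L (c n) (v n) \<in> A"
    using abelian_p_subalgebraD(2)[OF A] Suc.prems by (auto intro!: subspace_sum subspace_scale)
  then have "pop L ((\<Sum>i<n. scl L (c i) (v i)) + scl L (c n) (v n)) =
      pop L (\<Sum>i<n. scl L (c i) (v i)) + pop L (scl L (c n) (v n))"
    using abelian_p_subalgebraD[OF A] by (intro pop_add_commuting) auto
  moreover have "v n \<in> carrier L" using Suc.prems abelian_p_subalgebraD(1)[OF A] by auto
  ultimately show ?case using Suc by (simp add: pop_scale)
qed simp

lemma pop_add_abelian:
  "abelian_p_subalgebra A \<Longrightarrow> x \<in> A \<Longrightarrow> y \<in> A \<Longrightarrow> pop L (x + y) = pop L x + pop L y"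
  using abelian_p_subalgebraD by (intro pop_add_commuting) blast+

lemma carrier_family_bound:
  assumes "family_independent n v" "\<And>i. i < n \<Longrightarrow> v i \<in> carrier L"
  shows "n \<le> dim (carrier L)"
proof -
  obtain B where "finite B" "carrier L \<subseteq> span B" using carrier_finite_dim by blast
  then obtain w where "carrier L = family_span (dim (carrier L)) w"
    using exists_family_basis[OF carrier_subspace] by blast
  then show ?thesis using family_independent_bound assms by blast
qed

lemma exists_basis_of_subspace:
  assumes "subspace S" "S \<subseteq> carrier L"
  shows "\<exists>v. family_independent (dim S) v \<and> S = family_span (dim S) v \<and> (\<forall>i<dim S. v i \<in> S)"
proof -
  obtain B where B: "finite B" "carrier L \<subseteq> span B" using carrier_finite_dim by blast
  then have "S \<subseteq> span B" using assms(2) by blast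
  then show ?thesis using exists_family_basis[OF assms(1) _ B(1)] by blast
qed

lemma subspace_family_bound:
  assumes "subspace S" "S \<subseteq> carrier L" "family_independent n v" "\<And>i. i < n \<Longrightarrow> v i \<in> S"
  shows "n \<le> dim S"
proof -
  obtain w where w: "S = family_span (dim S) w" using exists_basis_of_subspace[OF assms(1,2)] by blast
  have "v i \<in> family_span (dim S) w" if "i < n" for i using assms(4)[OF that] w by blast
  then show ?thesis by (rule family_independent_bound[OF assms(3)])
qed

lemma dim_le_carrier: "subspace S \<Longrightarrow> S \<subseteq> carrier L \<Longrightarrow> dim S \<le> dim (carrier L)"
proof -
  assume S: "subspace S" "S \<subseteq> carrier L"
  obtain v where "family_independent (dim S) v" "\<forall>i<dim S. v i \<in> S"
    using exists_basis_of_subspace[OF S] by blast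
  then show "dim S \<le> dim (carrier L)" using S(2) by (intro carrier_family_bound) blast+
qed

subsection \<open>Orbits of the p-map\<close>

lemma pop_orbit_sum:
  assumes A: "abelian_p_subalgebra A" and v: "v \<in> A" and rA: "w \<in> A"
    and rel: "(pop L ^^ Suc m) v = w + (\<Sum>i<Suc m. scl L (a i) ((pop L ^^ i) v))"
    and z: "orbit_coeff a m z = z"
  shows "pop L (\<Sum>j<Suc m. scl L (orbit_coeff a j z) ((pop L ^^ j) v)) =
     scl L (z ^ CHAR('k)) w + (\<Sum>j<Suc m. scl L (orbit_coeff a j z) ((pop L ^^ j) v))"
proof -
  have "pop L (\<Sum>j<Suc m. scl L (orbit_coeff a j z) ((pop L ^^ j) v)) =
      (\<Sum>j<Suc m. scl L (orbit_coeff a j z ^ CHAR('k)) ((pop L ^^ Suc j) v))"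
    using pop_sum[OF A, of "Suc m" "\<lambda>j. (pop L ^^ j) v"] abelian_pow[OF A v] by simp
  also have "\<dots> = (\<Sum>j<m. scl L (orbit_coeff a j z ^ CHAR('k)) ((pop L ^^ Suc j) v)) + scl L (z ^ CHAR('k)) ((pop L ^^ Suc m) v)"
    using z by simp
  also have "scl L (z ^ CHAR('k)) ((pop L ^^ Suc m) v) =
      scl L (z ^ CHAR('k)) w + (\<Sum>i<Suc m. scl L (a i * z ^ CHAR('k)) ((pop L ^^ i) v))"
    unfolding rel scale_right_distrib scale_sum_right by (simp add: mult.commute)
  also have "(\<Sum>i<Suc m. scl L (a i * z ^ CHAR('k)) ((pop L ^^ i) v)) =
      scl L (a 0 * z ^ CHAR('k)) v + (\<Sum>j<m. scl L (a (Suc j) * z ^ CHAR('k)) ((pop L ^^ Suc j) v))"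
    by (subst sum.lessThan_Suc_shift) simp
  finally have e: "pop L (\<Sum>j<Suc m. scl L (orbit_coeff a j z) ((pop L ^^ j) v)) =
      scl L (z ^ CHAR('k)) w + (scl L (orbit_coeff a 0 z) v +
        (\<Sum>j<m. scl L (orbit_coeff a (Suc j) z) ((pop L ^^ Suc j) v)))"
    by (simp add: orbit_coeff_simps scale_left_distrib sum.distrib algebra_simps)
  show ?thesis by (subst e, subst sum.lessThan_Suc_shift) simp
qed

lemma fixed_orbit_sum:
  assumes A: "abelian_p_subalgebra A" and v: "v \<in> A"
    and rel: "(pop L ^^ Suc m) v = (\<Sum>i<Suc m. scl L (a i) ((pop L ^^ i) v))"
    and ind: "family_independent (Suc m) (\<lambda>j. (pop L ^^ j) v)"
    and fixed: "pop L (\<Sum>j<Suc m. scl L (c j) ((pop L ^^ j) v)) = (\<Sum>j<Suc m. scl L (c j) ((pop L ^^ j) v))"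
    and j: "j < Suc m"
  shows "c j = orbit_coeff a j (c m)"
proof -
  have "pop L (\<Sum>j<Suc m. scl L (c j) ((pop L ^^ j) v)) = (\<Sum>j<Suc m. scl L (c j ^ CHAR('k)) ((pop L ^^ Suc j) v))"
    using pop_sum[OF A, of "Suc m" "\<lambda>j. (pop L ^^ j) v"] abelian_pow[OF A v] by simp
  also have "\<dots> = (\<Sum>j<m. scl L (c j ^ CHAR('k)) ((pop L ^^ Suc j) v)) + scl L (c m ^ CHAR('k)) ((pop L ^^ Suc m) v)"
    by simp
  also have "scl L (c m ^ CHAR('k)) ((pop L ^^ Suc m) v) = (\<Sum>i<Suc m. scl L (a i * c m ^ CHAR('k)) ((pop L ^^ i) v))"
    unfolding rel scale_sum_right by (simp add: mult.commute)
  also have "(\<Sum>i<Suc m. scl L (a i * c m ^ CHAR('k)) ((pop L ^^ i) v)) =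
      scl L (a 0 * c m ^ CHAR('k)) v + (\<Sum>j<m. scl L (a (Suc j) * c m ^ CHAR('k)) ((pop L ^^ Suc j) v))"
    by (subst sum.lessThan_Suc_shift) simp
  finally have "pop L (\<Sum>j<Suc m. scl L (c j) ((pop L ^^ j) v)) =
      scl L (a 0 * c m ^ CHAR('k)) v + (\<Sum>j<m. scl L (c j ^ CHAR('k) + a (Suc j) * c m ^ CHAR('k)) ((pop L ^^ Suc j) v))"
    by (simp add: scale_left_distrib sum.distrib algebra_simps)
  also have "\<dots> = (\<Sum>j<Suc m. scl L (case j of 0 \<Rightarrow> a 0 * c m ^ CHAR('k) | Suc j \<Rightarrow> c j ^ CHAR('k) + a (Suc j) * c m ^ CHAR('k)) ((pop L ^^ j) v))"
    by (subst sum.lessThan_Suc_shift) simp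
  finally have eq: "c j = (case j of 0 \<Rightarrow> a 0 * c m ^ CHAR('k) | Suc j \<Rightarrow> c j ^ CHAR('k) + a (Suc j) * c m ^ CHAR('k))" if "j < Suc m" for j
    unfolding fixed by (rule family_independentD[OF ind _ that])
  show ?thesis using j
  proof (induction j)
    case 0
    then show ?case using eq[of 0] by (simp add: orbit_coeff_simps)
  next
    case (Suc j)
    then show ?case using eq[of "Suc j"] by (simp add: orbit_coeff_simps)
  qed
qed

text \<open>
  If the coefficient of the lowest term in a shortest relation vanished, then the relation would be
  the \<open>p\<close>-th power of a shorter one, as \<open>k\<close> is perfect.
\<close>

lemma shortest_relation_coeff_nonzero:
  assumes A: "abelian_p_subalgebra A" and inj: "\<And>x. x \<in> A \<Longrightarrow> pop L x = 0 \<Longrightarrow> x = 0"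
    and e: "\<And>i. i < w \<Longrightarrow> e i \<in> A \<and> pop L (e i) = e i" and v: "v \<in> A"
    and ind: "family_independent (w + Suc m) (\<lambda>i. if i < w then e i else (pop L ^^ (i - w)) v)"
    and rel: "(pop L ^^ Suc m) v = (\<Sum>i<w. scl L (c i) (e i)) + (\<Sum>i<Suc m. scl L (a i) ((pop L ^^ i) v))"
  shows "a 0 \<noteq> 0"
proof
  assume a0: "a 0 = 0"
  let ?g = "\<lambda>i. if i < w then e i else (pop L ^^ (i - w)) v"
  define root :: "'k \<Rightarrow> 'k" where "root x = (SOME y. y ^ CHAR('k) = x)" for x
  have root: "root x ^ CHAR('k) = x" for x
    unfolding root_def by (rule someI_ex) (use exists_pth_root[OF char_pos, of 1 x] in simp)
  define d where "d i = (if i < w then root (- c i) else if i < w + m then root (- a (Suc (i - w))) else 1)" for i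
  have gA: "?g i \<in> A" for i using e[of i] abelian_pow[OF A v, of "i - w"] by simp
  have "pop L (\<Sum>i<w + Suc m. scl L (d i) (?g i)) = (\<Sum>i<w + Suc m. scl L (d i ^ CHAR('k)) (pop L (?g i)))"
    using gA by (intro pop_sum[OF A]) auto
  also have "\<dots> = (\<Sum>i<w. scl L (- c i) (e i)) + (\<Sum>j<m. scl L (- a (Suc j)) ((pop L ^^ Suc j) v)) + (pop L ^^ Suc m) v"
  proof -
    have 1: "(\<Sum>i<w. scl L (d i ^ CHAR('k)) (pop L (?g i))) = (\<Sum>i<w. scl L (- c i) (e i))"
    proof (rule sum.cong[OF refl])
      fix i assume "i \<in> {..<w}"
      then have "i < w" by simp
      then show "scl L (d i ^ CHAR('k)) (pop L (?g i)) = scl L (- c i) (e i)"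
        using e[of i] by (simp add: d_def root)
    qed
    have 2: "(\<Sum>j<m. scl L (d (w + j) ^ CHAR('k)) (pop L (?g (w + j)))) = (\<Sum>j<m. scl L (- a (Suc j)) ((pop L ^^ Suc j) v))"
      by (rule sum.cong[OF refl]) (simp add: d_def root)
    have 3: "scl L (d (w + m) ^ CHAR('k)) (pop L (?g (w + m))) = (pop L ^^ Suc m) v"
      by (simp add: d_def)
    show ?thesis unfolding sum_lessThan_add sum.lessThan_Suc 1 2 3 by (simp add: add.assoc)
  qed
  also have "\<dots> = 0"
    unfolding rel sum.lessThan_Suc_shift by (simp add: a0 sum_negf)
  finally have "pop L (\<Sum>i<w + Suc m. scl L (d i) (?g i)) = 0" .
  moreover have "(\<Sum>i<w + Suc m. scl L (d i) (?g i)) \<in> A"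
    using gA abelian_p_subalgebraD(2)[OF A] by (intro subspace_sum subspace_scale) auto
  ultimately have "(\<Sum>i<w + Suc m. scl L (d i) (?g i)) = 0" by (rule inj[rotated])
  then have "\<forall>i<w + Suc m. d i = 0" by (rule ind[unfolded family_independent_def, THEN spec, THEN mp])
  then have "d (w + m) = 0" by simp
  then show False by (simp add: d_def)
qed

text \<open>
  The vectors \<open>e i\<close> are passed along, so that the relation can be used modulo their span.
\<close>

lemma exists_shortest_relation:
  assumes A: "abelian_p_subalgebra A" and ind: "family_independent w e" and e: "\<And>i. i < w \<Longrightarrow> e i \<in> A"
    and v: "v \<in> A" "v \<notin> family_span w e"
  shows "\<exists>m c a. family_independent (w + Suc m) (\<lambda>i. if i < w then e i else (pop L ^^ (i - w)) v) \<and>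
     (pop L ^^ Suc m) v = (\<Sum>i<w. scl L (c i) (e i)) + (\<Sum>i<Suc m. scl L (a i) ((pop L ^^ i) v))"
proof -
  let ?g = "\<lambda>i. if i < w then e i else (pop L ^^ (i - w)) v"
  have step: "family_independent (w + Suc m) ?g"
    if "family_independent (w + m) ?g" "(pop L ^^ m) v \<notin> family_span (w + m) ?g" for m
  proof -
    have "family_independent (Suc (w + m)) (?g(w + m := (pop L ^^ m) v))"
      using family_independent_Suc[OF that] .
    moreover have "?g(w + m := (pop L ^^ m) v) = ?g" by (auto simp: fun_eq_iff)
    ultimately show ?thesis by simp
  qed
  have ew: "(\<Sum>i<w. scl L (c i) (?g i)) = (\<Sum>i<w. scl L (c i) (e i))" for c by (intro sum.cong) auto
  have "family_independent w ?g" using ind unfolding family_independent_def ew .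
  moreover have "family_span w ?g = family_span w e" unfolding family_span_def ew ..
  ultimately have 0: "family_independent (w + Suc 0) ?g" using step[of 0] v(2) by simp
  have "\<exists>m. family_independent (w + Suc m) ?g \<and> \<not> family_independent (w + Suc (Suc m)) ?g"
  proof (rule ccontr)
    assume "\<not> ?thesis"
    then have "family_independent (w + Suc m) ?g" for m by (induction m) (use 0 in auto)
    moreover have "?g i \<in> carrier L" for i
      using e abelian_pow[OF A v(1)] abelian_p_subalgebraD(1)[OF A] by auto
    ultimately have "w + Suc m \<le> dim (carrier L)" for m using carrier_family_bound by blast
    from this[of "dim (carrier L)"] show False by simp
  qed
  then obtain m where m: "family_independent (w + Suc m) ?g" "(pop L ^^ Suc m) v \<in> family_span (w + Suc m) ?g"
    using step by blast
  then obtain d where "(pop L ^^ Suc m) v = (\<Sum>i<w + Suc m. scl L (d i) (?g i))"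
    by (auto simp: family_span_def)
  also have "\<dots> = (\<Sum>i<w. scl L (d i) (e i)) + (\<Sum>j<Suc m. scl L (d (w + j)) ((pop L ^^ j) v))"
    unfolding sum_lessThan_add ew by (intro arg_cong2[where f = "(+)"] refl sum.cong) auto
  finally show ?thesis using m(1) by (intro exI[of _ m] exI[of _ d] exI[of _ "\<lambda>j. d (w + j)"]) simp
qed

subsection \<open>Toral elements\<close>

definition toral_elements :: "'v set \<Rightarrow> 'v set" where
  "toral_elements t = {x \<in> t. pop L x = x}"

lemma p_subalgebra_0: "p_subalgebra L {0}"
  using brk_0_left[OF carrier_0] carrier_0 pop_0 subspace_single_0 by (simp add: p_subalgebra_def)

lemma torus_pop_injective:
  assumes t: "torus L t" and x: "x \<in> t" "pop L x = 0"
  shows "x = 0"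
proof -
  have "x \<in> p_subalgebra_generated L {0}" using t x by (auto simp: torus_def semisimple_def)
  then show ?thesis using p_subalgebra_0 by (auto simp: p_subalgebra_generated_def)
qed

text \<open>
  Lang's theorem for the additive group: an injective \<open>p\<close>-semilinear map of a finite-dimensional space
  over an algebraically closed field has a basis of fixed vectors. If \<open>v\<close> is outside the span of the
  fixed vectors \<open>e i\<close>, then a root of \<open>fixed_poly\<close> gives a vector that is fixed up to a combination of
  the \<open>e i\<close>, and this error is removed by solving Artin-Schreier equations.
\<close>

lemma torus_eq_span_toral:
  assumes t: "torus L t"
  shows "span (toral_elements t) = t"
proof (rule ccontr)
  have A: "abelian_p_subalgebra t" using torus_abelian[OF t] .
  note At = abelian_p_subalgebraD[OF A]
  let ?W = "span (toral_elements t)"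
  assume "?W \<noteq> t"
  moreover have "?W \<subseteq> t" using At(2) by (intro span_minimal) (auto simp: toral_elements_def)
  ultimately obtain v where v: "v \<in> t" "v \<notin> ?W" by blast
  obtain C where C: "C \<subseteq> toral_elements t" "independent C" "toral_elements t \<subseteq> span C"
    using maximal_independent_subset by blast
  obtain B where B: "finite B" "carrier L \<subseteq> span B" using carrier_finite_dim by blast
  have "C \<subseteq> carrier L" using C(1) At(1) by (auto simp: toral_elements_def)
  then have "finite C" using independent_span_bound[OF B(1) C(2)] B(2) by auto
  then obtain e where e: "bij_betw e {..<card C} C"
    using ex_bij_betw_nat_finite by (metis atLeast0LessThan)
  let ?w = "card C"
  have im: "e ` {..<?w} = C" "inj_on e {..<?w}" using e by (auto simp: bij_betw_def)
  have ind: "family_independent ?w e" using C(2) im by (simp add: family_independent_iff)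
  have spanC: "family_span ?w e = ?W"
    unfolding family_span_eq im(1) using C(1,3) by (metis span_mono span_span span_minimal subspace_span subset_antisym)
  have eC: "e i \<in> t \<and> pop L (e i) = e i" if "i < ?w" for i
    using that im C(1) by (auto simp: toral_elements_def)
  obtain m c a where rel: "family_independent (?w + Suc m) (\<lambda>i. if i < ?w then e i else (pop L ^^ (i - ?w)) v)"
    "(pop L ^^ Suc m) v = (\<Sum>i<?w. scl L (c i) (e i)) + (\<Sum>i<Suc m. scl L (a i) ((pop L ^^ i) v))"
    using exists_shortest_relation[OF A ind _ v(1)] v(2) eC spanC by blast
  \<comment> \<open>by injectivity of the \<open>p\<close>-map, so that the polynomial for fixed vectors has a nonzero root\<close>
  have "a 0 \<noteq> 0"
    using shortest_relation_coeff_nonzero[OF A torus_pop_injective[OF t] eC v(1) rel] by blast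
  then obtain z where z: "z \<noteq> 0" "orbit_coeff a m z = z"
    using exists_nonzero_fixed_root[OF char_pos, of a "Suc m"] by auto
  let ?y = "\<Sum>j<Suc m. scl L (orbit_coeff a j z) ((pop L ^^ j) v)"
  have cA: "(\<Sum>i<?w. scl L (c i) (e i)) \<in> t" using eC At(2) by (intro subspace_sum subspace_scale) auto
  have yt: "?y \<in> t" using abelian_pow[OF A v(1)] At(2) by (intro subspace_sum subspace_scale) auto
  have y: "pop L ?y = scl L (z ^ CHAR('k)) (\<Sum>i<?w. scl L (c i) (e i)) + ?y"
    using pop_orbit_sum[OF A v(1) cA rel(2) z(2)] .
  have "\<forall>i. \<exists>d. d = d ^ CHAR('k) + z ^ CHAR('k) * c i" using exists_Artin_Schreier_root[OF char_pos] by blast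
  then obtain d where d: "\<And>i. d i = d i ^ CHAR('k) + z ^ CHAR('k) * c i" by metis
  \<comment> \<open>adding this combination to \<open>?y\<close> gives a fixed vector\<close>
  let ?u = "\<Sum>i<?w. scl L (d i) (e i)"
  have ut: "?u \<in> t" using eC At(2) by (intro subspace_sum subspace_scale) auto
  have "pop L ?u = (\<Sum>i<?w. scl L (d i ^ CHAR('k)) (e i))"
    using pop_sum[OF A, of ?w e d] eC by simp
  then have "pop L (?u + ?y) = (\<Sum>i<?w. scl L (d i ^ CHAR('k)) (e i)) + (scl L (z ^ CHAR('k)) (\<Sum>i<?w. scl L (c i) (e i)) + ?y)"
    using pop_add_abelian[OF A ut yt] y by simp
  also have "\<dots> = (\<Sum>i<?w. scl L (d i ^ CHAR('k) + z ^ CHAR('k) * c i) (e i)) + ?y"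
    by (simp add: scale_sum_right scale_left_distrib sum.distrib add.assoc)
  also have "\<dots> = ?u + ?y" using d by simp
  finally have "?u + ?y \<in> toral_elements t"
    using ut yt At(2) by (auto simp: toral_elements_def intro: subspace_add)
  then have "?u + ?y \<in> ?W" by (rule span_base)
  moreover have "?u \<in> ?W" using spanC family_spanI by blast
  ultimately have "?y \<in> ?W" by (metis add_diff_cancel_left' span_diff)
  then obtain b where b: "?y = (\<Sum>i<?w. scl L (b i) (e i))" unfolding spanC[symmetric] by (auto simp: family_span_def)
  let ?g = "\<lambda>i. if i < ?w then e i else (pop L ^^ (i - ?w)) v"
  let ?f = "\<lambda>i. if i < ?w then - b i else orbit_coeff a (i - ?w) z"
  have "(\<Sum>i<?w + Suc m. scl L (?f i) (?g i)) = (\<Sum>i<?w. scl L (- b i) (e i)) + ?y"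
    unfolding sum_lessThan_add by (intro arg_cong2[where f = "(+)"] sum.cong) auto
  also have "\<dots> = 0" unfolding b by (simp add: sum_negf)
  finally have "\<forall>i<?w + Suc m. ?f i = 0" by (rule rel(1)[unfolded family_independent_def, THEN spec, THEN mp])
  from this[rule_format, of "?w + m"] show False using z by simp
qed

text \<open>
  A toral basis can be made to contain prescribed toral elements, such as \<open>1\<close> in the Poisson algebra.
\<close>

lemma torus_toral_basis_extend:
  assumes t: "torus L t" and S: "S \<subseteq> toral_elements t" "independent S"
  shows "\<exists>B. S \<subseteq> B \<and> B \<subseteq> toral_elements t \<and> independent B \<and> span B = t \<and> finite B \<and> card B = dim t"
proof -
  obtain B where B: "S \<subseteq> B" "B \<subseteq> toral_elements t" "independent B" "toral_elements t \<subseteq> span B"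
    by (rule maximal_independent_subset_extend[OF S])
  have sp: "span B = t"
    using torus_eq_span_toral[OF t] B(2,4) by (metis span_mono span_span subset_antisym)
  obtain C where C: "finite C" "carrier L \<subseteq> span C" using carrier_finite_dim by blast
  have "t \<subseteq> carrier L" using abelian_p_subalgebraD(1)[OF torus_abelian[OF t]] .
  then have "B \<subseteq> span C" using C(2) sp span_superset by blast
  then have "finite B" using independent_span_bound[OF C(1) B(3)] by blast
  moreover have "card B = dim t" using sp B(3) dim_span_eq_card_independent by metis
  ultimately show ?thesis using B sp by blast
qed

lemma torus_toral_basis:
  assumes t: "torus L t"
  shows "\<exists>e. family_independent (dim t) e \<and> t = family_span (dim t) e \<and> (\<forall>i<dim t. e i \<in> t \<and> pop L (e i) = e i)"
proof -
  obtain B where B: "B \<subseteq> toral_elements t" "independent B" "span B = t" "finite B" "card B = dim t"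
    using torus_toral_basis_extend[OF t empty_subsetI independent_empty]
    by (elim exE conjE) (rule that, assumption+)
  then obtain e where "bij_betw e {..<dim t} B"
    using ex_bij_betw_nat_finite by (metis atLeast0LessThan)
  then have im: "e ` {..<dim t} = B" "inj_on e {..<dim t}" by (auto simp: bij_betw_def)
  then show ?thesis using B by (intro exI[of _ e]) (auto simp: family_independent_iff family_span_eq toral_elements_def)
qed

text \<open>In coordinates with respect to a toral basis the \<open>p\<close>-map is the Frobenius map.\<close>

lemma toral_iff_coordinates:
  assumes A: "abelian_p_subalgebra A" and ind: "family_independent n e"
    and e: "\<And>i. i < n \<Longrightarrow> e i \<in> A \<and> pop L (e i) = e i"
  shows "pop L (\<Sum>i<n. scl L (c i) (e i)) = (\<Sum>i<n. scl L (c i) (e i)) \<longleftrightarrow> (\<forall>i<n. c i \<in> \<int>)"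
proof -
  have "pop L (\<Sum>i<n. scl L (c i) (e i)) = (\<Sum>i<n. scl L (c i ^ CHAR('k)) (pop L (e i)))"
    using e by (intro pop_sum[OF A]) auto
  also have "\<dots> = (\<Sum>i<n. scl L (c i ^ CHAR('k)) (e i))"
    using e by (intro sum.cong) auto
  finally have "pop L (\<Sum>i<n. scl L (c i) (e i)) = (\<Sum>i<n. scl L (c i ^ CHAR('k)) (e i))" .
  then show ?thesis
    using family_independentD[OF ind, of "\<lambda>i. c i ^ CHAR('k)" c] frobenius_fixed_iff[OF char_pos]
    by (auto intro!: sum.cong)
qed

text \<open>
  If the \<open>p\<close>-map is injective, then \<open>y\<close> occurs in the shortest relation between its powers, and so is a combination of
  the higher ones.
\<close>

lemma semisimple_if_injective:
  assumes A: "abelian_p_subalgebra A" and inj: "\<And>x. x \<in> A \<Longrightarrow> pop L x = 0 \<Longrightarrow> x = 0" and y: "y \<in> A"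
  shows "semisimple L y"
proof -
  have yc: "y \<in> carrier L" using y abelian_p_subalgebraD(1)[OF A] by blast
  have "y \<in> p_subalgebra_generated L {pop L y}"
  proof (cases "y = 0")
    case True
    then show ?thesis by (auto simp: p_subalgebra_generated_def p_subalgebra_def subspace_0)
  next
    case False
    have nin: "y \<notin> family_span 0 (\<lambda>_. 0)" using False by (simp add: family_span_def)
    have ind: "family_independent 0 (\<lambda>_. 0)" by (simp add: family_independent_def)
    have "\<exists>m c a. family_independent (0 + Suc m) (\<lambda>i. if i < 0 then 0 else (pop L ^^ (i - 0)) y) \<and>
      (pop L ^^ Suc m) y = (\<Sum>i<(0 :: nat). scl L (c i) 0) + (\<Sum>i<Suc m. scl L (a i) ((pop L ^^ i) y))"
      by (rule exists_shortest_relation[of A 0 "\<lambda>_. 0" y, OF A ind _ y nin]) simp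
    then obtain m c a where rel: "family_independent (0 + Suc m) (\<lambda>i. if i < 0 then 0 else (pop L ^^ (i - 0)) y)"
      "(pop L ^^ Suc m) y = (\<Sum>i<(0 :: nat). scl L (c i) 0) + (\<Sum>i<Suc m. scl L (a i) ((pop L ^^ i) y))"
      by (elim exE conjE) (rule that, assumption+)
    have a0: "a 0 \<noteq> 0" using shortest_relation_coeff_nonzero[OF A inj _ y rel] by simp
    have "scl L (a 0) y = (pop L ^^ Suc m) y - (\<Sum>i<m. scl L (a (Suc i)) ((pop L ^^ Suc i) y))"
      using rel(2) unfolding sum.lessThan_Suc_shift by simp
    then have "y = scl L (inverse (a 0)) ((pop L ^^ Suc m) y - (\<Sum>i<m. scl L (a (Suc i)) ((pop L ^^ Suc i) y)))"
      using a0 by (metis scale_scale scale_one left_inverse)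
    moreover have "scl L (inverse (a 0)) ((pop L ^^ Suc m) y - (\<Sum>i<m. scl L (a (Suc i)) ((pop L ^^ Suc i) y))) \<in> h"
      if h: "p_subalgebra L h" "{pop L y} \<subseteq> h" for h
    proof -
      have "(pop L ^^ Suc j) y \<in> h" for j
        using h by (induction j) (auto simp: p_subalgebra_def)
      then show ?thesis using h(1)
        by (intro subspace_scale subspace_diff subspace_sum) (auto simp: p_subalgebra_def simp del: funpow.simps)
    qed
    ultimately show ?thesis unfolding p_subalgebra_generated_def by auto
  qed
  then show ?thesis using yc by (simp add: semisimple_def)
qed

lemma torusI_injective:
  assumes "abelian_p_subalgebra A" "\<And>x. x \<in> A \<Longrightarrow> pop L x = 0 \<Longrightarrow> x = 0"
  shows "torus L A"
  using assms semisimple_if_injective by (auto simp: torus_def abelian_p_subalgebra_def)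

lemma abelian_p_subalgebra_family_span:
  assumes v: "\<And>i. i < n \<Longrightarrow> v i \<in> carrier L" "\<And>i j. i < n \<Longrightarrow> j < n \<Longrightarrow> brk L (v i) (v j) = 0"
    and pop: "\<And>i. i < n \<Longrightarrow> pop L (v i) \<in> family_span n v"
  shows "abelian_p_subalgebra (family_span n v)"
proof -
  have sub: "family_span n v \<subseteq> carrier L" using v(1) by (intro family_span_minimal carrier_subspace)
  have 1: "brk L (v i) y = 0" if "i < n" "y \<in> family_span n v" for i y
    using family_span_minimal[OF subspace_centralizer[OF v(1)[OF that(1)]], of n v] v that by auto
  have 2: "brk L y x = 0" if x: "x \<in> family_span n v" and y: "y \<in> family_span n v" for x y
  proof -
    have yc: "y \<in> carrier L" using y sub by blast
    have "family_span n v \<subseteq> {z \<in> carrier L. brk L y z = 0}"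
      using 1[OF _ y] v(1) brk_commute_0[OF v(1) yc] by (intro family_span_minimal subspace_centralizer yc) auto
    then show ?thesis using x by blast
  qed
  have 3: "(\<Sum>i<m. scl L (c i) (v i)) \<in> family_span n v \<and> pop L (\<Sum>i<m. scl L (c i) (v i)) \<in> family_span n v" if "m \<le> n" for m c
    using that
  proof (induction m)
    case 0
    then show ?case by (simp add: subspace_0[OF subspace_family_span])
  next
    case (Suc m)
    have m: "scl L (c m) (v m) \<in> family_span n v" using Suc by (auto intro!: subspace_scale subspace_family_span family_span_base)
    then have "pop L ((\<Sum>i<m. scl L (c i) (v i)) + scl L (c m) (v m)) =
        pop L (\<Sum>i<m. scl L (c i) (v i)) + scl L (c m ^ CHAR('k)) (pop L (v m))"
      using Suc sub 2 v by (subst pop_add_commuting) (auto simp: pop_scale)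
    then show ?case using Suc pop m by (auto intro!: subspace_add subspace_scale subspace_family_span)
  qed
  show ?thesis
    using sub 2 3[of n] by (auto simp: abelian_p_subalgebra_def p_subalgebra_def subspace_family_span subspace_0)
      (auto simp: family_span_def)
qed

lemma torus_family_span:
  assumes v: "\<And>i. i < n \<Longrightarrow> v i \<in> carrier L" "\<And>i j. i < n \<Longrightarrow> j < n \<Longrightarrow> brk L (v i) (v j) = 0"
    and pop: "\<And>i. i < n \<Longrightarrow> pop L (v i) = v i" and ind: "family_independent n v"
  shows "torus L (family_span n v)"
proof -
  have A: "abelian_p_subalgebra (family_span n v)"
    using pop by (intro abelian_p_subalgebra_family_span v) (auto intro: family_span_base)
  moreover have "x = 0" if x: "x \<in> family_span n v" "pop L x = 0" for x
  proof -
    obtain c where c: "x = (\<Sum>i<n. scl L (c i) (v i))" using x(1) by (auto simp: family_span_def)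
    have "(\<Sum>i<n. scl L (c i ^ CHAR('k)) (v i)) = 0"
      using x(2) pop_sum[OF A, of n v c] pop unfolding c by (simp add: family_span_base)
    then have "\<forall>i<n. c i ^ CHAR('k) = 0" by (rule ind[unfolded family_independent_def, THEN spec, THEN mp])
    then show ?thesis unfolding c by (intro sum.neutral) auto
  qed
  ultimately show ?thesis by (rule torusI_injective)
qed

text \<open>
  The dimension of the carrier bounds the set whose maximum is taken.
\<close>

lemma dim_torus_le_max: "torus L t \<Longrightarrow> dim t \<le> max_torus_dim L"
proof -
  assume t: "torus L t"
  have "dim u \<le> dim (carrier L)" if "torus L u" for u
    using dim_le_carrier abelian_p_subalgebraD(1,2)[OF torus_abelian[OF that]] by blast
  then have "{dim t |t. torus L t} \<subseteq> {..dim (carrier L)}" by auto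
  then have "finite {dim t |t. torus L t}" by (rule finite_subset) simp
  then show ?thesis unfolding max_torus_dim_def using t by (intro Max_ge) auto
qed

subsection \<open>The torus of a single element\<close>

lemma pow_closed: "x \<in> carrier L \<Longrightarrow> (pop L ^^ j) x \<in> carrier L"
  by (induction j) (auto intro: pop_closed)

lemma ad_pow_closed: "x \<in> carrier L \<Longrightarrow> y \<in> carrier L \<Longrightarrow> (brk L x ^^ j) y \<in> carrier L"
  by (induction j) (auto intro: brk_closed)

lemma ad_pow_0: "x \<in> carrier L \<Longrightarrow> (brk L x ^^ j) 0 = 0"
  by (induction j) auto

lemma brk_pow:
  assumes x: "x \<in> carrier L" and y: "y \<in> carrier L"
  shows "brk L ((pop L ^^ j) x) y = (brk L x ^^ (CHAR('k) ^ j)) y"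
  using y
proof (induction j arbitrary: y)
  case (Suc j)
  have it: "(brk L ((pop L ^^ j) x) ^^ n) u = (brk L x ^^ (CHAR('k) ^ j * n)) u" if "u \<in> carrier L" for n u
  proof (induction n)
    case (Suc n)
    have "(brk L ((pop L ^^ j) x) ^^ Suc n) u = brk L ((pop L ^^ j) x) ((brk L x ^^ (CHAR('k) ^ j * n)) u)"
      using Suc by simp
    also have "\<dots> = (brk L x ^^ (CHAR('k) ^ j)) ((brk L x ^^ (CHAR('k) ^ j * n)) u)"
      using Suc.IH \<open>\<And>y. y \<in> carrier L \<Longrightarrow> brk L ((pop L ^^ j) x) y = (brk L x ^^ (CHAR('k) ^ j)) y\<close>
        ad_pow_closed[OF x that] by blast
    also have "\<dots> = (brk L x ^^ (CHAR('k) ^ j * Suc n)) u" by (simp add: funpow_add)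
    finally show ?case .
  qed simp
  have "brk L ((pop L ^^ Suc j) x) y = (brk L ((pop L ^^ j) x) ^^ CHAR('k)) y"
    using brk_pop[OF pow_closed[OF x] Suc.prems] by simp
  also have "\<dots> = (brk L x ^^ (CHAR('k) ^ Suc j)) y" by (simp add: it[OF Suc.prems] mult.commute)
  finally show ?case .
qed simp

lemma brk_powers_commute:
  assumes x: "x \<in> carrier L"
  shows "brk L ((pop L ^^ i) x) ((pop L ^^ j) x) = 0"
proof -
  have vanish: "(brk L x ^^ (CHAR('k) ^ l)) u = 0" if "brk L x u = 0" for l u
  proof -
    obtain m where "CHAR('k) ^ l = Suc m" using char_pos by (metis gr0_implies_Suc zero_less_power)
    then show ?thesis using that ad_pow_0[OF x] by (simp add: funpow_Suc_right del: funpow.simps)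
  qed
  have "brk L ((pop L ^^ j) x) x = 0" using brk_pow[OF x x] vanish[OF brk_self[OF x]] by simp
  then have "brk L x ((pop L ^^ j) x) = 0" using brk_commute_0 pow_closed[OF x] x by blast
  then show ?thesis using brk_pow[OF x pow_closed[OF x]] vanish by simp
qed

lemma pop_sum_commuting:
  fixes n :: nat
  assumes v: "\<And>i. i < n \<Longrightarrow> v i \<in> carrier L" "\<And>i j. i < n \<Longrightarrow> j < n \<Longrightarrow> brk L (v i) (v j) = 0"
  shows "pop L (\<Sum>i<n. scl L (c i) (v i)) = (\<Sum>i<n. scl L (c i ^ CHAR('k)) (pop L (v i)))"
  using v
proof (induction n)
  case (Suc n)
  have vn: "v n \<in> carrier L" using Suc.prems(1) by simp
  have S: "(\<Sum>i<n. scl L (c i) (v i)) \<in> {y \<in> carrier L. brk L (v n) y = 0}"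
    using Suc.prems by (intro subspace_sum subspace_scale subspace_centralizer vn) auto
  then have "brk L (\<Sum>i<n. scl L (c i) (v i)) (scl L (c n) (v n)) = 0"
    using vn brk_commute_0[OF vn] by (simp add: brk_scale_right)
  then have "pop L ((\<Sum>i<n. scl L (c i) (v i)) + scl L (c n) (v n)) =
      pop L (\<Sum>i<n. scl L (c i) (v i)) + pop L (scl L (c n) (v n))"
    using S vn by (intro pop_add_commuting carrier_scale) auto
  then show ?case using Suc vn by (simp add: pop_scale)
qed simp

text \<open>
  Jacobson's formula when \<open>y\<close> commutes with its whole orbit under \<open>ad x\<close>: in \<open>(ad (T x + y))^(p-1) (x)\<close>
  only the first factor can contribute \<open>ad y\<close>.
\<close>

lemma pop_add_semicommuting:
  assumes x: "x \<in> carrier L" and y: "y \<in> carrier L" and com: "\<And>m. brk L y ((brk L x ^^ m) y) = 0"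
  shows "pop L (x + y) = pop L x + pop L y + (brk L x ^^ (CHAR('k) - 1)) y"
proof -
  have neg: "brk L x (- u) = - brk L x u" "brk L y (- u) = - brk L y u" if "u \<in> carrier L" for u
    using brk_scale_right[OF x that, of "-1"] brk_scale_right[OF y that, of "-1"] by simp_all
  have zero: "brk L x 0 = 0" "brk L y 0 = 0" using x y by simp_all
  have xy: "brk L y x = - brk L x y" by (rule brk_antisym[OF x y])
  have ad: "ad_coeff (brk L) x y (Suc n) j = (if j = n then - (brk L x ^^ Suc n) y else 0)" for n j
  proof (induction n arbitrary: j)
    case 0
    show ?case using brk_self[OF x] xy zero by auto
  next
    case (Suc n)
    have "ad_coeff (brk L) x y (Suc (Suc n)) j = brk L y (ad_coeff (brk L) x y (Suc n) j) +
        (if j = 0 then 0 else brk L x (ad_coeff (brk L) x y (Suc n) (j - 1)))" by (rule ad_coeff.simps(2))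
    also have "brk L y (ad_coeff (brk L) x y (Suc n) j) = 0"
    proof (cases "j = n")
      case True
      have "brk L y (- (brk L x ^^ Suc n) y) = 0"
        by (simp only: neg(2)[OF ad_pow_closed[OF x y, of "Suc n"]] com[of "Suc n"] minus_zero)
      then show ?thesis by (simp only: Suc True if_True simp_thms)
    next
      case False
      then show ?thesis by (simp only: Suc if_False zero)
    qed
    also have "(if j = 0 then 0 else brk L x (ad_coeff (brk L) x y (Suc n) (j - 1))) =
        (if j = Suc n then - (brk L x ^^ Suc (Suc n)) y else 0)"
    proof (cases j)
      case (Suc i)
      have "brk L x (- (brk L x ^^ Suc n) y) = - (brk L x ^^ Suc (Suc n)) y"
        by (simp only: neg(1)[OF ad_pow_closed[OF x y]] funpow.simps(2)[of "Suc n"] o_apply)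
      then show ?thesis unfolding Suc.IH Suc using zero by simp
    qed simp
    finally show ?case by simp
  qed
  obtain m where m: "CHAR('k) = Suc (Suc m)" by (rule that[of "CHAR('k) - 2"]) (use p_gt_1 in simp)
  \<comment> \<open>only the Jacobson term with index \<open>p - 1\<close> survives, where the factor \<open>1 / i\<close> is \<open>-1\<close>\<close>
  have "of_nat (Suc m) = (- 1 :: 'k)"
  proof -
    have "of_nat (Suc (Suc m)) = (0 :: 'k)" using of_nat_CHAR[where 'a = 'k] unfolding m .
    then have "of_nat (Suc m) + 1 = (0 :: 'k)" by simp
    then show ?thesis by (simp only: eq_neg_iff_add_eq_0)
  qed
  then have inv: "inverse (of_nat (Suc m)) = (- 1 :: 'k)" by (simp only: inverse_minus_eq inverse_1)
  have j: "jacobson_term L i x y = (if i = Suc m then (brk L x ^^ Suc m) y else 0)" if "i \<in> {1..Suc m}" for i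
  proof -
    have "i - 1 = m \<longleftrightarrow> i = Suc m" using that by auto
    then show ?thesis unfolding jacobson_term_def m diff_Suc_1 ad using inv by auto
  qed
  have "(\<Sum>i = 1..CHAR('k) - 1. jacobson_term L i x y) = (\<Sum>i = 1..Suc m. if i = Suc m then (brk L x ^^ Suc m) y else 0)"
    unfolding m diff_Suc_1 by (rule sum.cong[OF refl]) (rule j)
  also have "\<dots> = (brk L x ^^ (CHAR('k) - 1)) y" unfolding m diff_Suc_1 by (subst sum.delta) auto
  finally show ?thesis using p_map x y by (simp add: is_p_map_def)
qed

lemma power_relation:
  fixes n :: nat
  assumes x: "x \<in> carrier L" and rel: "(pop L ^^ h) x = (\<Sum>i<n. scl L (b i) ((pop L ^^ f i) x))"
  shows "(pop L ^^ (h + k)) x = (\<Sum>i<n. scl L (b i ^ (CHAR('k) ^ k)) ((pop L ^^ (f i + k)) x))"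
proof (induction k)
  case (Suc k)
  have "(pop L ^^ (h + Suc k)) x = pop L (\<Sum>i<n. scl L (b i ^ (CHAR('k) ^ k)) ((pop L ^^ (f i + k)) x))"
    using Suc by simp
  also have "\<dots> = (\<Sum>i<n. scl L ((b i ^ (CHAR('k) ^ k)) ^ CHAR('k)) (pop L ((pop L ^^ (f i + k)) x)))"
    by (rule pop_sum_commuting) (use x in \<open>auto intro: pow_closed brk_powers_commute\<close>)
  finally show ?case by (simp add: power_mult[symmetric] mult.commute)
qed (simp add: rel)

text \<open>
  After \<open>dim (carrier L)\<close> steps the nilpotent part of the \<open>p\<close>-map has died out on the orbit of \<open>x\<close>.
\<close>

definition stem :: "'v \<Rightarrow> 'v" where
  "stem x = (pop L ^^ dim (carrier L)) x"

definition eventual_torus :: "'v \<Rightarrow> 'v set" where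
  "eventual_torus x = family_span (dim (carrier L)) (\<lambda>j. (pop L ^^ j) (stem x))"

lemma pow_stem: "(pop L ^^ j) (stem x) = (pop L ^^ (dim (carrier L) + j)) x"
  by (simp add: stem_def funpow_add[symmetric] add.commute flip: comp_apply[of "pop L ^^ j"])

text \<open>
  The powers of \<open>x\<close> are dependent. The lowest term of a dependence shows that high powers are
  combinations of still higher ones; hence the \<open>p\<close>-map is bijective on the span of the high powers.
\<close>

lemma torus_eventual_torus:
  assumes x: "x \<in> carrier L"
  shows "torus L (eventual_torus x)" and "(pop L ^^ j) (stem x) \<in> eventual_torus x"
proof -
  define N where "N = dim (carrier L)"
  define X where "X j = (pop L ^^ j) x" for j
  define T where "T = family_span N (\<lambda>j. X (N + j))"
  have T: "eventual_torus x = T" unfolding eventual_torus_def T_def X_def N_def pow_stem ..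
  have Xc: "X j \<in> carrier L" for j unfolding X_def by (rule pow_closed[OF x])
  have popX: "pop L (X j) = X (Suc j)" for j by (simp add: X_def)
  have "\<not> family_independent (Suc N) X"
    using carrier_family_bound[of "Suc N" X] Xc unfolding N_def by auto
  then obtain c where c0: "(\<Sum>i<Suc N. scl L (c i) (X i)) = 0" and cn: "\<exists>i. i < Suc N \<and> c i \<noteq> 0"
    unfolding family_independent_def by blast
  have solve: "X l = (\<Sum>i<Suc N. scl L (if i = l then 0 else - c i * inverse (c l)) (X i))"
    if l: "l < Suc N" "c l \<noteq> 0" for l
  proof -
    have "0 = scl L (inverse (c l)) (\<Sum>i<Suc N. scl L (c i) (X i))" using c0 by simp
    also have "\<dots> = (\<Sum>i<Suc N. scl L (inverse (c l) * c i) (X i))" by (simp add: scale_sum_right del: sum.lessThan_Suc)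
    also have "\<dots> = (\<Sum>i<Suc N. (if i = l then X l else 0) - scl L (if i = l then 0 else - c i * inverse (c l)) (X i))"
      using l by (intro sum.cong) (auto simp: mult.commute)
    also have "\<dots> = X l - (\<Sum>i<Suc N. scl L (if i = l then 0 else - c i * inverse (c l)) (X i))"
      using l by (simp add: sum_subtractf del: sum.lessThan_Suc)
    finally show ?thesis by simp
  qed
  \<comment> \<open>solving for the highest term shows that the first powers after the stem span all later ones\<close>
  define h where "h = Max {i. i < Suc N \<and> c i \<noteq> 0}"
  have "finite {i. i < Suc N \<and> c i \<noteq> 0}" by simp
  then have h: "h < Suc N" "c h \<noteq> 0" and hmax: "\<And>i. i < Suc N \<Longrightarrow> c i \<noteq> 0 \<Longrightarrow> i \<le> h"
    using Max_in[of "{i. i < Suc N \<and> c i \<noteq> 0}"] cn unfolding h_def by (auto intro: Max_ge)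
  \<comment> \<open>solving for the lowest term shows that the \<open>p\<close>-map is surjective on their span\<close>
  define l where "l = (LEAST i. i < Suc N \<and> c i \<noteq> 0)"
  have l: "l < Suc N" "c l \<noteq> 0" using LeastI_ex[OF cn] unfolding l_def by auto
  have lmin: "l \<le> i" if "i < Suc N" "c i \<noteq> 0" for i unfolding l_def by (rule Least_le) (use that in simp)
  have rel: "X (m + k) = (\<Sum>i<Suc N. scl L ((if i = m then 0 else - c i * inverse (c m)) ^ (CHAR('k) ^ k)) (X (i + k)))"
    if "m < Suc N" "c m \<noteq> 0" for m k
    using power_relation[OF x, of m "\<lambda>i. if i = m then 0 else - c i * inverse (c m)" "\<lambda>i. i" "Suc N" k] solve[OF that]
    unfolding X_def by blast
  have subT: "subspace T" unfolding T_def by (rule subspace_family_span)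
  have XT: "X (N + j) \<in> T" for j
  proof (induction j rule: less_induct)
    case (less j)
    show ?case
    proof (cases "j < N")
      case True
      then show ?thesis unfolding T_def by (rule family_span_base[of j N "\<lambda>j. X (N + j)"])
    next
      case False
      define k where "k = N + j - h"
      have k: "N + j = h + k" using h(1) False by (simp add: k_def)
      show ?thesis unfolding k rel[OF h]
      proof (intro subspace_sum subT)
        fix i assume i: "i \<in> {..<Suc N}"
        show "scl L ((if i = h then 0 else - c i * inverse (c h)) ^ (CHAR('k) ^ k)) (X (i + k)) \<in> T"
        proof (cases "i = h \<or> c i = 0")
          case True
          then have z: "(if i = h then 0 else - c i * inverse (c h)) ^ (CHAR('k) ^ k) = 0"
            using char_pos by (auto simp: power_0_left)
          show ?thesis unfolding z using subT by (simp add: subspace_0)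
        next
          case nz: False
          then have "i < h" using hmax[of i] i by auto
          then have "i + k < N + j" "N \<le> i + k" using False h(1) k by auto
          then have "X (i + k) \<in> T" using less[of "i + k - N"] by simp
          then show ?thesis using subT by (rule subspace_scale[rotated])
        qed
      qed
    qed
  qed
  have A: "abelian_p_subalgebra T"
    unfolding T_def
  proof (rule abelian_p_subalgebra_family_span)
    fix i j assume "i < N"
    then show "X (N + i) \<in> carrier L" "pop L (X (N + i)) \<in> family_span N (\<lambda>j. X (N + j))"
      using Xc XT[of "Suc i"] by (auto simp: popX T_def)
    show "brk L (X (N + i)) (X (N + j)) = 0" unfolding X_def by (rule brk_powers_commute[OF x])
  qed
  obtain v where v: "family_independent (dim T) v" "T = family_span (dim T) v" "\<forall>i<dim T. v i \<in> T"
    using exists_basis_of_subspace[OF subT] abelian_p_subalgebraD(1)[OF A] by blast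
  let ?w = "\<lambda>i. pop L (v i)"
  have popT: "pop L y \<in> family_span (dim T) ?w" if "y \<in> T" for y
  proof -
    have "y \<in> family_span (dim T) v" by (subst v(2)[symmetric]) (rule that)
    then obtain c where y: "y = (\<Sum>i<dim T. scl L (c i) (v i))" by (auto simp: family_span_def)
    show ?thesis unfolding y using v(3) by (subst pop_sum[OF A]) (auto intro: family_spanI)
  qed
  have "X (N + j) \<in> family_span (dim T) ?w" for j
  proof -
    define k where "k = N + j - l"
    have k: "N + j = l + k" using l(1) by (simp add: k_def)
    show ?thesis unfolding k rel[OF l]
    proof (intro subspace_sum subspace_family_span)
      fix i assume i: "i \<in> {..<Suc N}"
      show "scl L ((if i = l then 0 else - c i * inverse (c l)) ^ (CHAR('k) ^ k)) (X (i + k)) \<in> family_span (dim T) ?w"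
      proof (cases "i = l \<or> c i = 0")
        case True
        then have z: "(if i = l then 0 else - c i * inverse (c l)) ^ (CHAR('k) ^ k) = 0"
          using char_pos by (auto simp: power_0_left)
        show ?thesis unfolding z by (simp add: subspace_0[OF subspace_family_span])
      next
        case nz: False
        then have "l < i" using lmin[of i] i by auto
        then have e: "i + k = Suc (N + (i + k - Suc N))" using k by simp
        have "X (i + k) \<in> family_span (dim T) ?w"
          by (subst e, subst popX[symmetric], rule popT[OF XT])
        then show ?thesis by (rule subspace_scale[OF subspace_family_span])
      qed
    qed
  qed
  then have Tw: "T \<subseteq> family_span (dim T) ?w"
    unfolding T_def by (intro family_span_minimal subspace_family_span)
  have ind: "family_independent (dim T) ?w"
    by (rule family_independent_if_spans[OF v(1)]) (use Tw v(3) in blast)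
  have "y = 0" if y: "y \<in> T" "pop L y = 0" for y
  proof -
    have "y \<in> family_span (dim T) v" by (subst v(2)[symmetric]) (rule y(1))
    then obtain c where c: "y = (\<Sum>i<dim T. scl L (c i) (v i))" by (auto simp: family_span_def)
    have "pop L y = (\<Sum>i<dim T. scl L (c i ^ CHAR('k)) (pop L (v i)))"
      unfolding c by (rule pop_sum[OF A]) (use v(3) in blast)
    then have "\<forall>i<dim T. c i ^ CHAR('k) = 0"
      using y(2) by (intro ind[unfolded family_independent_def, THEN spec[of _ "\<lambda>i. c i ^ CHAR('k)"], THEN mp]) simp
    then show ?thesis unfolding c by (intro sum.neutral) auto
  qed
  then show "torus L (eventual_torus x)" unfolding T by (rule torusI_injective[OF A])
  show "(pop L ^^ j) (stem x) \<in> eventual_torus x"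
    using XT unfolding T pow_stem X_def N_def .
qed

lemma eventual_torus_eq_family_span:
  assumes x: "x \<in> carrier L" and ind: "family_independent (max_torus_dim L) (\<lambda>j. (pop L ^^ j) (stem x))"
  shows "eventual_torus x = family_span (max_torus_dim L) (\<lambda>j. (pop L ^^ j) (stem x))"
proof -
  let ?T = "eventual_torus x" and ?n = "max_torus_dim L"
  have t: "torus L ?T" using torus_eventual_torus(1)[OF x] .
  note T = abelian_p_subalgebraD(1,2)[OF torus_abelian[OF t]]
  have "?n \<le> dim ?T" by (rule subspace_family_bound[OF T(2,1) ind]) (rule torus_eventual_torus(2)[OF x])
  then have n: "dim ?T = ?n" using dim_torus_le_max[OF t] by simp
  obtain v where v: "?T = family_span ?n v"
    using exists_basis_of_subspace[OF T(2,1)] unfolding n by blast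
  show ?thesis unfolding v by (rule family_span_full[OF ind, symmetric]) (use torus_eventual_torus(2)[OF x] v in blast)
qed

lemma eventual_torus_relation:
  assumes x: "x \<in> carrier L" and n: "max_torus_dim L = Suc m"
    and ind: "family_independent (Suc m) (\<lambda>j. (pop L ^^ j) (stem x))"
  shows "\<exists>a. (pop L ^^ Suc m) (stem x) = (\<Sum>i<Suc m. scl L (a i) ((pop L ^^ i) (stem x))) \<and> a 0 \<noteq> 0"
proof -
  have t: "torus L (eventual_torus x)" using torus_eventual_torus(1)[OF x] .
  have A: "abelian_p_subalgebra (eventual_torus x)" using torus_abelian[OF t] .
  have "(pop L ^^ Suc m) (stem x) \<in> family_span (Suc m) (\<lambda>j. (pop L ^^ j) (stem x))"
    using torus_eventual_torus(2)[OF x] eventual_torus_eq_family_span[OF x] ind n by metis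
  then obtain a where a: "(pop L ^^ Suc m) (stem x) = (\<Sum>i<Suc m. scl L (a i) ((pop L ^^ i) (stem x)))"
    by (auto simp: family_span_def)
  have st: "stem x \<in> eventual_torus x" using torus_eventual_torus(2)[OF x, of 0] by simp
  have "a 0 \<noteq> 0"
    by (rule shortest_relation_coeff_nonzero[where w = 0 and e = "\<lambda>_. 0" and c = "\<lambda>_. 0" and m = m and v = "stem x",
          OF A torus_pop_injective[OF t]])
       (use st ind a in simp_all)
  then show ?thesis using a by blast
qed

lemma pow_of_toral_combination:
  fixes n :: nat
  assumes e: "\<And>i. i < n \<Longrightarrow> e i \<in> carrier L \<and> pop L (e i) = e i"
    and com: "\<And>i j. i < n \<Longrightarrow> j < n \<Longrightarrow> brk L (e i) (e j) = 0"
  shows "(pop L ^^ j) (\<Sum>i<n. scl L (z i) (e i)) = (\<Sum>i<n. scl L (z i ^ (CHAR('k) ^ j)) (e i))"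
proof (induction j)
  case (Suc j)
  have "(pop L ^^ Suc j) (\<Sum>i<n. scl L (z i) (e i)) = pop L (\<Sum>i<n. scl L (z i ^ (CHAR('k) ^ j)) (e i))"
    using Suc by simp
  also have "\<dots> = (\<Sum>i<n. scl L ((z i ^ (CHAR('k) ^ j)) ^ CHAR('k)) (pop L (e i)))"
    by (rule pop_sum_commuting) (use e com in auto)
  also have "\<dots> = (\<Sum>i<n. scl L (z i ^ (CHAR('k) ^ Suc j)) (e i))"
    using e by (intro sum.cong) (auto simp: power_mult[symmetric] mult.commute)
  finally show ?case .
qed simp

text \<open>By the nonvanishing of the Moore determinant, a torus contains elements whose powers span it.\<close>

lemma generic_powers_independent:
  assumes e: "\<And>i. i < n \<Longrightarrow> e i \<in> carrier L \<and> pop L (e i) = e i"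
    and com: "\<And>i j. i < n \<Longrightarrow> j < n \<Longrightarrow> brk L (e i) (e j) = 0"
    and ind: "family_independent n e" and z: "Fp_independent n z"
  shows "family_independent n (\<lambda>j. (pop L ^^ j) (\<Sum>i<n. scl L (z i) (e i)))"
  unfolding family_independent_def
proof (intro allI impI)
  fix c j assume c: "(\<Sum>j<n. scl L (c j) ((pop L ^^ j) (\<Sum>i<n. scl L (z i) (e i)))) = 0" and j: "j < n"
  have "(\<Sum>j<n. scl L (c j) ((pop L ^^ j) (\<Sum>i<n. scl L (z i) (e i)))) =
      (\<Sum>j<n. \<Sum>i<n. scl L (c j * z i ^ (CHAR('k) ^ j)) (e i))"
    by (simp add: pow_of_toral_combination[OF e com] scale_sum_right)
  also have "\<dots> = (\<Sum>i<n. \<Sum>j<n. scl L (c j * z i ^ (CHAR('k) ^ j)) (e i))" by (rule sum.swap)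
  also have "\<dots> = (\<Sum>i<n. scl L (\<Sum>j<n. c j * z i ^ (CHAR('k) ^ j)) (e i))" by (simp add: scale_sum_left)
  finally have "(\<Sum>i<n. scl L (\<Sum>j<n. c j * z i ^ (CHAR('k) ^ j)) (e i)) = 0" using c by simp
  then have "\<forall>i<n. (\<Sum>j<n. c j * z i ^ (CHAR('k) ^ j)) = 0"
    by (rule ind[unfolded family_independent_def, THEN spec, THEN mp])
  then show "c j = 0" using Moore_nonsingular[OF char_pos z _ j] by blast
qed

text \<open>
  The \<open>p\<close>-map raises the coordinates of a toral combination to the power \<open>p\<close>, which keeps them independent over the
  prime field.
\<close>

lemma generic_stem_independent:
  assumes e: "\<And>i. i < n \<Longrightarrow> e i \<in> carrier L \<and> pop L (e i) = e i"
    and com: "\<And>i j. i < n \<Longrightarrow> j < n \<Longrightarrow> brk L (e i) (e j) = 0"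
    and ind: "family_independent n e" and z: "Fp_independent n z"
  shows "family_independent n (\<lambda>j. (pop L ^^ j) (stem (\<Sum>i<n. scl L (z i) (e i))))"
proof -
  have "stem (\<Sum>i<n. scl L (z i) (e i)) = (\<Sum>i<n. scl L (z i ^ (CHAR('k) ^ dim (carrier L))) (e i))"
    unfolding stem_def by (rule pow_of_toral_combination[OF e com])
  then show ?thesis
    using generic_powers_independent[OF e com ind Fp_independent_frobenius[OF char_pos z]] by simp
qed

subsection \<open>Regular curves\<close>

inductive regular_curve :: "'k \<Rightarrow> ('k \<Rightarrow> 'v) \<Rightarrow> bool" for s0 where
  const: "x \<in> carrier L \<Longrightarrow> regular_curve s0 (\<lambda>s. x)"
| scale: "regular_at s0 \<rho> \<Longrightarrow> regular_curve s0 f \<Longrightarrow> regular_curve s0 (\<lambda>s. scl L (\<rho> s) (f s))"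
| add: "regular_curve s0 f \<Longrightarrow> regular_curve s0 g \<Longrightarrow> regular_curve s0 (\<lambda>s. f s + g s)"

lemma regular_curve_closed: "regular_curve s0 f \<Longrightarrow> f s \<in> carrier L"
  by (induction rule: regular_curve.induct) (auto intro: carrier_add carrier_scale)

lemma regular_curve_sum: "(\<And>i. i \<in> A \<Longrightarrow> regular_curve s0 (f i)) \<Longrightarrow> regular_curve s0 (\<lambda>s. \<Sum>i\<in>A. f i s)"
  by (induction A rule: infinite_finite_induct) (auto intro: regular_curve.const regular_curve.add)

lemma regular_curve_brk:
  assumes f: "regular_curve s0 f" and g: "regular_curve s0 g"
  shows "regular_curve s0 (\<lambda>s. brk L (f s) (g s))"
  using f
proof induction
  case (const x)
  show ?case using g
  proof induction
    case (const y)
    then show ?case using \<open>x \<in> carrier L\<close> by (intro regular_curve.const brk_closed)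
  next
    case (scale \<rho> g)
    then show ?case using \<open>x \<in> carrier L\<close> regular_curve_closed regular_curve.scale[OF scale.hyps(1) scale.IH]
      by (simp add: brk_scale_right)
  next
    case (add g h)
    then show ?case using \<open>x \<in> carrier L\<close> regular_curve_closed regular_curve.add[OF add.IH]
      by (simp add: brk_add_right)
  qed
next
  case (scale \<rho> f)
  then show ?case using regular_curve_closed g regular_curve.scale[OF scale.hyps(1) scale.IH]
    by (simp add: brk_scale_left)
next
  case (add f h)
  then show ?case using regular_curve_closed g regular_curve.add[OF add.IH]
    by (simp add: brk_add_left)
qed

text \<open>Jacobson's formula makes the \<open>p\<close>-map a polynomial map, which preserves regularity of curves.\<close>

lemma regular_curve_pop:
  assumes "regular_curve s0 f" shows "regular_curve s0 (\<lambda>s. pop L (f s))"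
  using assms
proof induction
  case (const x)
  then show ?case by (intro regular_curve.const pop_closed)
next
  case (scale \<rho> f)
  then show ?case using regular_curve.scale[OF regular_at_power[OF scale.hyps(1)] scale.IH] regular_curve_closed by (simp add: pop_scale)
next
  case (add f g)
  have ad: "regular_curve s0 (\<lambda>s. ad_coeff (brk L) (f s) (g s) n j)" for n j
  proof (induction n arbitrary: j)
    case 0
    show ?case using add.hyps(1) by (cases "j = 0") (auto intro: regular_curve.const)
  next
    case (Suc n)
    show ?case
      using Suc regular_curve_brk[OF add.hyps(2) Suc] regular_curve_brk[OF add.hyps(1) Suc]
      by (cases "j = 0") (auto intro!: regular_curve.add regular_curve.const)
  qed
  have "regular_curve s0 (\<lambda>s. jacobson_term L i (f s) (g s))" for i
    unfolding jacobson_term_def by (intro regular_curve.scale regular_at_const ad)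
  then have "regular_curve s0 (\<lambda>s. pop L (f s) + pop L (g s) + (\<Sum>i = 1..CHAR('k) - 1. jacobson_term L i (f s) (g s)))"
    using add.IH by (intro regular_curve.add regular_curve_sum)
  moreover have "pop L (f s + g s) = pop L (f s) + pop L (g s) + (\<Sum>i = 1..CHAR('k) - 1. jacobson_term L i (f s) (g s))" for s
    using p_map regular_curve_closed add.hyps unfolding is_p_map_def by blast
  ultimately show ?case by simp
qed

lemma regular_curve_pow: "regular_curve s0 f \<Longrightarrow> regular_curve s0 (\<lambda>s. (pop L ^^ j) (f s))"
  by (induction j) (auto intro: regular_curve_pop)

lemma regular_at_regular_curve:
  assumes "regular_curve s0 f" "Vector_Spaces.linear (scl L) (*) \<xi>"
  shows "regular_at s0 (\<lambda>s. \<xi> (f s))"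
  using assms(1)
proof induction
  case (const x)
  show ?case by (rule regular_at_const)
next
  case (scale \<rho> f)
  have "\<xi> (scl L (\<rho> s) (f s)) = \<rho> s * \<xi> (f s)" for s
    using assms(2) by (simp add: Vector_Spaces.linear_iff)
  then show ?case using scale by (simp add: regular_at_mult)
next
  case (add f g)
  have "\<xi> (f s + g s) = \<xi> (f s) + \<xi> (g s)" for s
    using assms(2) by (simp add: Vector_Spaces.linear_iff)
  then show ?case using add by (simp add: regular_at_add)
qed

subsection \<open>Embeddings of a torus as toral frames\<close>

definition coords :: "nat \<Rightarrow> (nat \<Rightarrow> 'v) \<Rightarrow> 'v \<Rightarrow> nat \<Rightarrow> 'k" where
  "coords n e x = (SOME c. x = (\<Sum>i<n. scl L (c i) (e i)))"

definition linear_ext :: "nat \<Rightarrow> (nat \<Rightarrow> 'v) \<Rightarrow> (nat \<Rightarrow> 'v) \<Rightarrow> 'v \<Rightarrow> 'v" where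
  "linear_ext n e y = (\<lambda>x\<in>family_span n e. \<Sum>i<n. scl L (coords n e x i) (y i))"

text \<open>
  Toral frames are the coordinates of embeddings: an embedding of the span of a toral frame is given by the images
  of the frame, and these form again a toral frame.
\<close>

definition toral_frame :: "nat \<Rightarrow> (nat \<Rightarrow> 'v) \<Rightarrow> bool" where
  "toral_frame n y \<longleftrightarrow> (\<forall>i<n. y i \<in> carrier L \<and> pop L (y i) = y i) \<and>
     (\<forall>i<n. \<forall>j<n. brk L (y i) (y j) = 0) \<and> family_independent n y"

lemma sum_coords: "x \<in> family_span n e \<Longrightarrow> (\<Sum>i<n. scl L (coords n e x i) (e i)) = x"
  unfolding coords_def family_span_def by (rule someI2_ex[of "\<lambda>c. x = (\<Sum>i<n. scl L (c i) (e i))"]) auto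

lemma coords_sum:
  assumes "family_independent n e" "i < n"
  shows "coords n e (\<Sum>i<n. scl L (c i) (e i)) i = c i"
  by (rule family_independentD[OF assms(1) sum_coords[OF family_spanI] assms(2)])

lemma linear_ext_sum:
  assumes "family_independent n e"
  shows "linear_ext n e y (\<Sum>i<n. scl L (c i) (e i)) = (\<Sum>i<n. scl L (c i) (y i))"
  using coords_sum[OF assms] by (simp add: linear_ext_def family_spanI)

lemma family_member_sum:
  fixes n :: nat
  assumes "i < n" shows "(\<Sum>j<n. scl L (if j = i then 1 else 0) (e j)) = e i"
proof -
  have "(\<Sum>j<n. scl L (if j = i then 1 else 0) (e j)) = (\<Sum>j<n. if j = i then e j else 0)"
    by (intro sum.cong) auto
  then show ?thesis using assms by simp
qed

lemma linear_ext_base: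
  assumes "family_independent n e" "i < n" shows "linear_ext n e y (e i) = y i"
  using linear_ext_sum[OF assms(1), of y "\<lambda>j. if j = i then 1 else 0"]
  unfolding family_member_sum[OF assms(2)] .

lemma torus_of_frame: "toral_frame n y \<Longrightarrow> torus L (family_span n y)"
  unfolding toral_frame_def by (intro torus_family_span) auto

lemma frame_of_torus:
  assumes t: "torus L t"
  shows "\<exists>e. toral_frame (dim t) e \<and> t = family_span (dim t) e"
proof -
  obtain e where e: "family_independent (dim t) e" "t = family_span (dim t) e" "\<forall>i<dim t. e i \<in> t \<and> pop L (e i) = e i"
    using torus_toral_basis[OF t] by (elim exE conjE) (rule that, assumption+)
  have "toral_frame (dim t) e"
    using e(1,3) abelian_p_subalgebraD[OF torus_abelian[OF t]] unfolding toral_frame_def by blast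
  then show ?thesis using e(2) by blast
qed

lemma linear_ext_image:
  assumes "family_independent n e"
  shows "linear_ext n e y ` family_span n e = family_span n y"
  unfolding family_span_def using linear_ext_sum[OF assms] by (auto simp: image_iff) metis

lemma pop_frame_sum:
  assumes "toral_frame n y"
  shows "pop L (\<Sum>i<n. scl L (c i) (y i)) = (\<Sum>i<n. scl L (c i ^ CHAR('k)) (y i))"
proof -
  have "pop L (\<Sum>i<n. scl L (c i) (y i)) = (\<Sum>i<n. scl L (c i ^ CHAR('k)) (pop L (y i)))"
    using assms unfolding toral_frame_def by (intro pop_sum_commuting) auto
  also have "\<dots> = (\<Sum>i<n. scl L (c i ^ CHAR('k)) (y i))"
    using assms unfolding toral_frame_def by (intro sum.cong) auto
  finally show ?thesis .
qed

text \<open>An embedding of a torus amounts to the choice of a toral frame, the image of a toral basis.\<close>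

lemma linear_ext_embedding:
  assumes e: "toral_frame n e" and y: "toral_frame n y"
  shows "linear_ext n e y \<in> torus_embeddings L (family_span n e)"
proof -
  let ?t = "family_span n e" and ?\<phi> = "linear_ext n e y"
  have ind: "family_independent n e" "family_independent n y" using e y by (auto simp: toral_frame_def)
  have tA: "abelian_p_subalgebra ?t" "abelian_p_subalgebra (family_span n y)"
    using torus_abelian torus_of_frame e y by blast+
  have img: "?\<phi> ` ?t = family_span n y" using linear_ext_image[OF ind(1)] .
  have car: "family_span n y \<subseteq> carrier L" using abelian_p_subalgebraD(1)[OF tA(2)] .
  have sub: "subspace ?t" by (rule subspace_family_span)
  note ext = linear_ext_sum[OF ind(1)]
  have "?\<phi> \<in> rlie_hom (L\<lparr>carrier := ?t\<rparr>) L"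
    unfolding rlie_hom_def
  proof (intro CollectI conjI ballI allI)
    show "?\<phi> \<in> carrier (L\<lparr>carrier := ?t\<rparr>) \<rightarrow>\<^sub>E carrier L"
      using img car by (auto simp: linear_ext_def)
  next
    fix x x' assume "x \<in> carrier (L\<lparr>carrier := ?t\<rparr>)" "x' \<in> carrier (L\<lparr>carrier := ?t\<rparr>)"
    then obtain c c' where x: "x = (\<Sum>i<n. scl L (c i) (e i))" "x' = (\<Sum>i<n. scl L (c' i) (e i))"
      by (auto simp: family_span_def)
    have "x + x' = (\<Sum>i<n. scl L (c i + c' i) (e i))" by (simp add: x scale_left_distrib sum.distrib)
    then show "?\<phi> (x + x') = ?\<phi> x + ?\<phi> x'" by (simp only: x ext) (simp add: scale_left_distrib sum.distrib)
    have "x \<in> ?t" "x' \<in> ?t" by (simp_all only: x family_spanI)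
    then have 0: "brk L x x' = 0" "brk L (?\<phi> x) (?\<phi> x') = 0"
      using abelian_p_subalgebraD(4)[OF tA(1)] abelian_p_subalgebraD(4)[OF tA(2)] img by blast+
    have "?\<phi> 0 = 0" using ext[of y "\<lambda>_. 0"] by simp
    then show "?\<phi> (brk (L\<lparr>carrier := ?t\<rparr>) x x') = brk L (?\<phi> x) (?\<phi> x')" using 0 by simp
  next
    fix a x assume "x \<in> carrier (L\<lparr>carrier := ?t\<rparr>)"
    then obtain c where x: "x = (\<Sum>i<n. scl L (c i) (e i))" by (auto simp: family_span_def)
    have "scl L a x = (\<Sum>i<n. scl L (a * c i) (e i))" by (simp add: x scale_sum_right)
    then show "?\<phi> (scl (L\<lparr>carrier := ?t\<rparr>) a x) = scl L a (?\<phi> x)"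
      by (simp only: x ext restricted_lie.simps partial_object.simps) (simp add: ext scale_sum_right)
  next
    fix x assume "x \<in> carrier (L\<lparr>carrier := ?t\<rparr>)"
    then obtain c where x: "x = (\<Sum>i<n. scl L (c i) (e i))" by (auto simp: family_span_def)
    have "?\<phi> (pop L x) = pop L (?\<phi> x)"
      unfolding x ext pop_frame_sum[OF e] pop_frame_sum[OF y] ..
    then show "?\<phi> (pop (L\<lparr>carrier := ?t\<rparr>) x) = pop L (?\<phi> x)" by simp
  qed
  moreover have "inj_on ?\<phi> ?t"
  proof (rule inj_onI)
    fix x x' assume "x \<in> ?t" "x' \<in> ?t" and eq: "?\<phi> x = ?\<phi> x'"
    then obtain c c' where x: "x = (\<Sum>i<n. scl L (c i) (e i))" "x' = (\<Sum>i<n. scl L (c' i) (e i))"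
      by (auto simp: family_span_def)
    have "c i = c' i" if "i < n" for i
      using eq unfolding x ext by (rule family_independentD[OF ind(2) _ that])
    then show "x = x'" unfolding x by (intro sum.cong) auto
  qed
  ultimately show ?thesis by (simp add: torus_embeddings_def)
qed

lemma embeddingD:
  assumes "\<phi> \<in> torus_embeddings L t"
  shows "x \<in> t \<Longrightarrow> \<phi> x \<in> carrier L" "x \<in> t \<Longrightarrow> y \<in> t \<Longrightarrow> \<phi> (x + y) = \<phi> x + \<phi> y"
    "x \<in> t \<Longrightarrow> \<phi> (scl L c x) = scl L c (\<phi> x)" "x \<in> t \<Longrightarrow> y \<in> t \<Longrightarrow> \<phi> (brk L x y) = brk L (\<phi> x) (\<phi> y)"
    "x \<in> t \<Longrightarrow> \<phi> (pop L x) = pop L (\<phi> x)" "inj_on \<phi> t" "\<phi> \<in> extensional t"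
  using assms by (auto simp: torus_embeddings_def rlie_hom_def PiE_def)

lemma embedding_sum:
  fixes n :: nat
  assumes \<phi>: "\<phi> \<in> torus_embeddings L t" and t: "subspace t" and e: "\<And>i. i < n \<Longrightarrow> e i \<in> t"
  shows "\<phi> (\<Sum>i<n. scl L (c i) (e i)) = (\<Sum>i<n. scl L (c i) (\<phi> (e i)))"
  using e
proof (induction n)
  case 0
  show ?case using embeddingD(3)[OF \<phi> subspace_0[OF t], of 0] by simp
next
  case (Suc n)
  have "(\<Sum>i<n. scl L (c i) (e i)) \<in> t" "scl L (c n) (e n) \<in> t"
    using Suc.prems t by (auto intro!: subspace_sum subspace_scale)
  then show ?case using Suc embeddingD(2,3)[OF \<phi>] by simp
qed

lemma embedding_frame:
  assumes e: "toral_frame n e" and \<phi>: "\<phi> \<in> torus_embeddings L (family_span n e)"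
  shows "toral_frame n (\<lambda>i. \<phi> (e i))" "\<phi> = linear_ext n e (\<lambda>i. \<phi> (e i))"
    "\<phi> ` family_span n e = family_span n (\<lambda>i. \<phi> (e i))"
proof -
  let ?t = "family_span n e"
  have et: "e i \<in> ?t" if "i < n" for i using that by (rule family_span_base)
  have sum: "\<phi> (\<Sum>i<n. scl L (c i) (e i)) = (\<Sum>i<n. scl L (c i) (\<phi> (e i)))" for c
    by (rule embedding_sum[OF \<phi> subspace_family_span et])
  have ind: "family_independent n e" using e by (simp add: toral_frame_def)
  have \<phi>0: "\<phi> 0 = 0" using sum[of "\<lambda>_. 0"] by simp
  show 2: "\<phi> = linear_ext n e (\<lambda>i. \<phi> (e i))"
  proof
    fix x show "\<phi> x = linear_ext n e (\<lambda>i. \<phi> (e i)) x"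
    proof (cases "x \<in> ?t")
      case True
      then obtain c where x: "x = (\<Sum>i<n. scl L (c i) (e i))" by (auto simp: family_span_def)
      show ?thesis unfolding x linear_ext_sum[OF ind] by (rule sum)
    next
      case False
      then show ?thesis using embeddingD(7)[OF \<phi>] by (simp add: linear_ext_def extensional_def)
    qed
  qed
  show "\<phi> ` family_span n e = family_span n (\<lambda>i. \<phi> (e i))"
    using linear_ext_image[OF ind, of "\<lambda>i. \<phi> (e i)"] 2 by simp
  show "toral_frame n (\<lambda>i. \<phi> (e i))"
    unfolding toral_frame_def
  proof (intro conjI allI impI)
    fix i assume i: "i < n"
    show "\<phi> (e i) \<in> carrier L" using embeddingD(1)[OF \<phi> et[OF i]] .
    have "pop L (e i) = e i" using e i by (simp add: toral_frame_def)
    then show "pop L (\<phi> (e i)) = \<phi> (e i)" using embeddingD(5)[OF \<phi> et[OF i]] by simp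
    fix j assume j: "j < n"
    have "brk L (e i) (e j) = 0" using e i j by (simp add: toral_frame_def)
    then show "brk L (\<phi> (e i)) (\<phi> (e j)) = 0" using embeddingD(4)[OF \<phi> et[OF i] et[OF j]] \<phi>0 by simp
  next
    show "family_independent n (\<lambda>i. \<phi> (e i))"
      unfolding family_independent_def
    proof (intro allI impI)
      fix c i assume c: "(\<Sum>i<n. scl L (c i) (\<phi> (e i))) = 0" and i: "i < n"
      have "\<phi> (\<Sum>i<n. scl L (c i) (e i)) = \<phi> 0" using c sum \<phi>0 by simp
      then have "(\<Sum>i<n. scl L (c i) (e i)) = 0"
        using inj_onD[OF embeddingD(6)[OF \<phi>] _ family_spanI subspace_0[OF subspace_family_span]] by blast
      then show "c i = 0" using ind i by (simp add: family_independent_def)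
    qed
  qed
qed

subsection \<open>Automorphisms of a torus\<close>

lemma Aut_pD:
  assumes "g \<in> carrier (Aut_p L t)"
  shows "g \<in> t \<rightarrow> t" "bij_betw g t t" "g \<in> extensional t"
    "x \<in> t \<Longrightarrow> y \<in> t \<Longrightarrow> g (x + y) = g x + g y" "x \<in> t \<Longrightarrow> g (scl L c x) = scl L c (g x)"
    "x \<in> t \<Longrightarrow> y \<in> t \<Longrightarrow> g (brk L x y) = brk L (g x) (g y)" "x \<in> t \<Longrightarrow> g (pop L x) = pop L (g x)"
  using assms by (auto simp: Aut_p_def rlie_hom_def PiE_def)

lemma Aut_pI:
  assumes "\<And>x. x \<in> t \<Longrightarrow> g x \<in> t" "g \<in> extensional t" "bij_betw g t t"
    "\<And>x y. x \<in> t \<Longrightarrow> y \<in> t \<Longrightarrow> g (x + y) = g x + g y" "\<And>x c. x \<in> t \<Longrightarrow> g (scl L c x) = scl L c (g x)"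
    "\<And>x y. x \<in> t \<Longrightarrow> y \<in> t \<Longrightarrow> g (brk L x y) = brk L (g x) (g y)" "\<And>x. x \<in> t \<Longrightarrow> g (pop L x) = pop L (g x)"
  shows "g \<in> carrier (Aut_p L t)"
  using assms by (auto simp: Aut_p_def rlie_hom_def PiE_def)

lemma embedding_compose:
  assumes t: "p_subalgebra L t" and \<phi>: "\<phi> \<in> torus_embeddings L t" and g: "g \<in> carrier (Aut_p L t)"
  shows "compose t \<phi> g \<in> torus_embeddings L t"
proof -
  have gt: "g x \<in> t" if "x \<in> t" for x using Aut_pD(1)[OF g] that by auto
  have cl: "x \<in> t \<Longrightarrow> y \<in> t \<Longrightarrow> x + y \<in> t" "x \<in> t \<Longrightarrow> scl L c x \<in> t" "x \<in> t \<Longrightarrow> y \<in> t \<Longrightarrow> brk L x y \<in> t"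
    "x \<in> t \<Longrightarrow> pop L x \<in> t" for x y c
    using t by (auto simp: p_subalgebra_def intro: subspace_add subspace_scale)
  have "inj_on (compose t \<phi> g) t"
    using inj_on_compose[OF _ inj_on_subset[OF embeddingD(6)[OF \<phi>]], of g t] Aut_pD(1,2)[OF g] by (auto simp: bij_betw_def)
  then show ?thesis
    unfolding torus_embeddings_def rlie_hom_def
    using embeddingD(1-5)[OF \<phi>] Aut_pD(4-7)[OF g] gt cl
    by (auto simp: compose_def)
qed

text \<open>
  The embeddings with a given image form one orbit of the automorphism group.
\<close>

lemma embeddings_same_image:
  assumes t: "p_subalgebra L t" and \<phi>: "\<phi> \<in> torus_embeddings L t" and \<psi>: "\<psi> \<in> torus_embeddings L t"
    and img: "\<phi> ` t = \<psi> ` t"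
  shows "\<exists>g\<in>carrier (Aut_p L t). \<psi> = compose t \<phi> g"
proof -
  let ?g = "\<lambda>x\<in>t. inv_into t \<phi> (\<psi> x)"
  have inj: "inj_on \<phi> t" "inj_on \<psi> t" using embeddingD(6) \<phi> \<psi> by blast+
  have g: "?g x \<in> t" "\<phi> (?g x) = \<psi> x" if "x \<in> t" for x
  proof -
    have m: "\<psi> x \<in> \<phi> ` t" using img that by blast
    show "?g x \<in> t" using inv_into_into[OF m] that by simp
    show "\<phi> (?g x) = \<psi> x" using f_inv_into_f[OF m] that by simp
  qed
  have uniq: "?g x = y" if "x \<in> t" "y \<in> t" "\<phi> y = \<psi> x" for x y
    using inj_onD[OF inj(1)] g[OF that(1)] that by metis
  have cl: "x \<in> t \<Longrightarrow> y \<in> t \<Longrightarrow> x + y \<in> t" "x \<in> t \<Longrightarrow> scl L c x \<in> t" "x \<in> t \<Longrightarrow> y \<in> t \<Longrightarrow> brk L x y \<in> t"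
    "x \<in> t \<Longrightarrow> pop L x \<in> t" for x y c
    using t by (auto simp: p_subalgebra_def intro: subspace_add subspace_scale)
  have "?g \<in> carrier (Aut_p L t)"
  proof (rule Aut_pI)
    show "bij_betw ?g t t"
    proof (rule bij_betw_imageI)
      show "inj_on ?g t"
      proof (rule inj_onI)
        fix x y assume xy: "x \<in> t" "y \<in> t" "?g x = ?g y"
        have "\<psi> x = \<psi> y" using g(2)[OF xy(1)] g(2)[OF xy(2)] unfolding xy(3) by simp
        then show "x = y" using inj_onD[OF inj(2)] xy(1,2) by blast
      qed
      show "?g ` t = t"
      proof
        show "?g ` t \<subseteq> t" using g(1) by blast
        show "t \<subseteq> ?g ` t"
        proof
          fix y assume y: "y \<in> t"
          then obtain x where x: "x \<in> t" "\<phi> y = \<psi> x" using img by blast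
          have "?g x = y" by (rule uniq[OF x(1) y x(2)])
          then show "y \<in> ?g ` t" using x(1) by blast
        qed
      qed
    qed
  next
    fix x y assume xy: "x \<in> t" "y \<in> t"
    show "?g (x + y) = ?g x + ?g y"
      by (rule uniq) (use xy g cl embeddingD(2)[OF \<phi>] embeddingD(2)[OF \<psi>] in \<open>auto simp del: restrict_apply\<close>)
    show "?g (brk L x y) = brk L (?g x) (?g y)"
      by (rule uniq) (use xy g cl embeddingD(4)[OF \<phi>] embeddingD(4)[OF \<psi>] in \<open>auto simp del: restrict_apply\<close>)
  next
    fix x c assume x: "x \<in> t"
    show "?g x \<in> t" by (rule g(1)[OF x])
    show "?g (scl L c x) = scl L c (?g x)"
      by (rule uniq) (use x g cl embeddingD(3)[OF \<phi>] embeddingD(3)[OF \<psi>] in \<open>auto simp del: restrict_apply\<close>)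
    show "?g (pop L x) = pop L (?g x)"
      by (rule uniq) (use x g cl embeddingD(5)[OF \<phi>] embeddingD(5)[OF \<psi>] in \<open>auto simp del: restrict_apply\<close>)
  qed simp
  moreover have "\<psi> = compose t \<phi> ?g"
    using g(2) embeddingD(7)[OF \<psi>] by (auto simp: fun_eq_iff compose_def extensional_def)
  ultimately show ?thesis by blast
qed

lemma inclusion_embedding: "p_subalgebra L t \<Longrightarrow> (\<lambda>x\<in>t. x) \<in> torus_embeddings L t"
  unfolding torus_embeddings_def rlie_hom_def p_subalgebra_def
  by (auto intro: subspace_add subspace_scale)

lemma finite_toral_elements:
  assumes "toral_frame n e"
  shows "finite (toral_elements (family_span n e))"
proof -
  have A: "abelian_p_subalgebra (family_span n e)" using torus_abelian torus_of_frame assms by blast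
  have "toral_elements (family_span n e) \<subseteq> (\<lambda>c. \<Sum>i<n. scl L (c i) (e i)) ` ({..<n} \<rightarrow>\<^sub>E \<int>)"
  proof
    fix x assume "x \<in> toral_elements (family_span n e)"
    then obtain c where x: "x = (\<Sum>i<n. scl L (c i) (e i))" "pop L x = x"
      by (auto simp: toral_elements_def family_span_def)
    have "\<forall>i<n. c i \<in> \<int>"
      using x(2) toral_iff_coordinates[OF A, of n e c] assms family_span_base[of _ n e] unfolding x(1) toral_frame_def by blast
    then have "restrict c {..<n} \<in> {..<n} \<rightarrow>\<^sub>E \<int>" by auto
    moreover have "x = (\<Sum>i<n. scl L (restrict c {..<n} i) (e i))" unfolding x(1) by (intro sum.cong) auto
    ultimately show "x \<in> (\<lambda>c. \<Sum>i<n. scl L (c i) (e i)) ` ({..<n} \<rightarrow>\<^sub>E \<int>)" by (simp only: image_eqI)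
  qed
  then show ?thesis
    by (rule finite_subset) (intro finite_imageI finite_PiE, auto simp: finite_Ints_card[OF char_pos])
qed

lemma finite_Aut_p:
  assumes t: "torus L t" shows "finite (carrier (Aut_p L t))"
proof -
  obtain e where e: "toral_frame (dim t) e" "t = family_span (dim t) e" using frame_of_torus[OF t] by blast
  have ps: "p_subalgebra L t" using t by (simp add: torus_def)
  have fin: "finite (toral_elements t)" using finite_toral_elements[OF e(1)] e(2) by simp
  have et: "e i \<in> t \<and> pop L (e i) = e i" if "i < dim t" for i
    using e that family_span_base[OF that, of e] by (auto simp: toral_frame_def)
  let ?r = "\<lambda>g. restrict (\<lambda>i. g (e i)) {..<dim t}"
  have "?r ` carrier (Aut_p L t) \<subseteq> {..<dim t} \<rightarrow>\<^sub>E toral_elements t"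
  proof
    fix h assume "h \<in> ?r ` carrier (Aut_p L t)"
    then obtain g where g: "g \<in> carrier (Aut_p L t)" "h = ?r g" by blast
    have "g (e i) \<in> toral_elements t" if "i < dim t" for i
      using et[OF that] Aut_pD(1,7)[OF g(1)] by (auto simp: toral_elements_def) metis
    then show "h \<in> {..<dim t} \<rightarrow>\<^sub>E toral_elements t" using g(2) by auto
  qed
  moreover have "inj_on ?r (carrier (Aut_p L t))"
  proof (rule inj_onI)
    fix g h assume g: "g \<in> carrier (Aut_p L t)" and h: "h \<in> carrier (Aut_p L t)" and eq: "?r g = ?r h"
    have ge: "g (e i) = h (e i)" if "i < dim t" for i using fun_cong[OF eq, of i] that by simp
    have emb: "compose t (\<lambda>x\<in>t. x) f \<in> torus_embeddings L t" if "f \<in> carrier (Aut_p L t)" for f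
      using embedding_compose[OF ps inclusion_embedding[OF ps] that] .
    have id: "compose t (\<lambda>x\<in>t. x) f = f" if "f \<in> carrier (Aut_p L t)" for f
      using Aut_pD(1,3)[OF that] by (auto simp: compose_def fun_eq_iff extensional_def)
    have "g = linear_ext (dim t) e (\<lambda>i. g (e i))" "h = linear_ext (dim t) e (\<lambda>i. h (e i))"
      using embedding_frame(2)[OF e(1)] emb g h id e(2) by (metis (no_types, lifting))+
    moreover have "linear_ext (dim t) e (\<lambda>i. g (e i)) = linear_ext (dim t) e (\<lambda>i. h (e i))"
      unfolding linear_ext_def by (intro restrict_ext sum.cong) (auto simp: ge)
    ultimately show "g = h" by simp
  qed
  ultimately show ?thesis
    using inj_on_finite finite_PiE[of "{..<dim t}" "\<lambda>_. toral_elements t"] fin by (metis finite_lessThan)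
qed

lemma Aut_p_sum:
  fixes n :: nat
  assumes g: "g \<in> carrier (Aut_p L t)" and t: "subspace t" and y: "\<And>i. i < n \<Longrightarrow> y i \<in> t"
  shows "g (\<Sum>i<n. scl L (c i) (y i)) = (\<Sum>i<n. scl L (c i) (g (y i)))"
  using y
proof (induction n)
  case 0
  have "g (scl L 0 0) = scl L 0 (g 0)" by (rule Aut_pD(5)[OF g subspace_0[OF t]])
  then show ?case by simp
next
  case (Suc n)
  then have "(\<Sum>i<n. scl L (c i) (y i)) \<in> t" "scl L (c n) (y n) \<in> t"
    using t by (auto intro!: subspace_sum subspace_scale)
  then show ?case using Suc Aut_pD(4)[OF g] Aut_pD(5)[OF g, of "y n" "c n"] by simp
qed

lemma coords_frame_member:
  assumes "family_independent n y" "l < n" "i < n"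
  shows "coords n y (y l) i = (if i = l then 1 else 0)"
  using coords_sum[OF assms(1,3), of "\<lambda>j. if j = l then 1 else 0"] family_member_sum[OF assms(2), of y] by simp

definition Aut_inv :: "'v set \<Rightarrow> ('v \<Rightarrow> 'v) \<Rightarrow> 'v \<Rightarrow> 'v" where
  "Aut_inv t g = (\<lambda>x\<in>t. inv_into t g x)"

lemma Aut_inv_simps:
  assumes "g \<in> carrier (Aut_p L t)" "x \<in> t"
  shows "Aut_inv t g x \<in> t" "g (Aut_inv t g x) = x" "Aut_inv t g (g x) = x"
  using Aut_pD(1,2)[OF assms(1)] assms(2) bij_betw_inv_into_right[of g t t x] bij_betw_inv_into_left[of g t t x]
    bij_betw_apply[OF bij_betw_inv_into[of g t t]]
  by (auto simp: Aut_inv_def)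

lemma Aut_inv_closed:
  assumes t: "p_subalgebra L t" and g: "g \<in> carrier (Aut_p L t)"
  shows "Aut_inv t g \<in> carrier (Aut_p L t)"
proof -
  have sub: "subspace t" and brk: "\<And>x y. x \<in> t \<Longrightarrow> y \<in> t \<Longrightarrow> brk L x y \<in> t" and pop: "\<And>x. x \<in> t \<Longrightarrow> pop L x \<in> t"
    using t by (auto simp: p_subalgebra_def)
  note inv = Aut_inv_simps[OF g]
  show ?thesis
  proof (rule Aut_pI)
    fix x assume x: "x \<in> t"
    let ?x = "Aut_inv t g x"
    show "?x \<in> t" using inv(1)[OF x] .
    have "Aut_inv t g (g (scl L c ?x)) = scl L c ?x" for c by (rule inv(3)) (rule subspace_scale[OF sub inv(1)[OF x]])
    then show "Aut_inv t g (scl L c x) = scl L c ?x" for c by (simp only: Aut_pD(5)[OF g inv(1)[OF x]] inv(2)[OF x])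
    have "Aut_inv t g (g (pop L ?x)) = pop L ?x" by (rule inv(3)) (rule pop[OF inv(1)[OF x]])
    then show "Aut_inv t g (pop L x) = pop L ?x" by (simp only: Aut_pD(7)[OF g inv(1)[OF x]] inv(2)[OF x])
    fix y assume y: "y \<in> t"
    let ?y = "Aut_inv t g y"
    have "Aut_inv t g (g (?x + ?y)) = ?x + ?y" by (rule inv(3)) (rule subspace_add[OF sub inv(1)[OF x] inv(1)[OF y]])
    then show "Aut_inv t g (x + y) = ?x + ?y" by (simp only: Aut_pD(4)[OF g inv(1)[OF x] inv(1)[OF y]] inv(2)[OF x] inv(2)[OF y])
    have "Aut_inv t g (g (brk L ?x ?y)) = brk L ?x ?y" by (rule inv(3)) (rule brk[OF inv(1)[OF x] inv(1)[OF y]])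
    then show "Aut_inv t g (brk L x y) = brk L ?x ?y" by (simp only: Aut_pD(6)[OF g inv(1)[OF x] inv(1)[OF y]] inv(2)[OF x] inv(2)[OF y])
  next
    show "Aut_inv t g \<in> extensional t" by (simp add: Aut_inv_def)
    show "bij_betw (Aut_inv t g) t t"
      by (rule bij_betw_byWitness[where f' = g]) (use inv Aut_pD(1)[OF g] in auto)
  qed
qed

lemma Aut_compose_closed:
  assumes g: "g \<in> carrier (Aut_p L t)" and f: "f \<in> carrier (Aut_p L t)" and t: "p_subalgebra L t"
  shows "compose t g f \<in> carrier (Aut_p L t)"
proof -
  have sub: "subspace t" and brk: "\<And>x y. x \<in> t \<Longrightarrow> y \<in> t \<Longrightarrow> brk L x y \<in> t" and pop: "\<And>x. x \<in> t \<Longrightarrow> pop L x \<in> t"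
    using t by (auto simp: p_subalgebra_def)
  have fx: "f x \<in> t" if "x \<in> t" for x using Aut_pD(1)[OF f] that by blast
  have gx: "g x \<in> t" if "x \<in> t" for x using Aut_pD(1)[OF g] that by blast
  show ?thesis
  proof (rule Aut_pI)
    show "bij_betw (compose t g f) t t" by (rule bij_betw_compose[OF Aut_pD(2)[OF f] Aut_pD(2)[OF g]])
  qed (use fx gx sub brk pop Aut_pD(4-7)[OF f] Aut_pD(4-7)[OF g] in \<open>auto simp: compose_eq subspace_add subspace_scale\<close>)
qed

lemma Aut_inv_eq:
  assumes g: "g \<in> carrier (Aut_p L t)" and f: "f \<in> extensional t" "\<And>x. x \<in> t \<Longrightarrow> f x \<in> t \<and> g (f x) = x"
  shows "Aut_inv t g = f"
proof
  fix x
  show "Aut_inv t g x = f x"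
  proof (cases "x \<in> t")
    case True
    then show ?thesis using Aut_inv_simps(3)[OF g, of "f x"] f(2) by simp
  next
    case False
    then show ?thesis using f(1) by (simp add: Aut_inv_def extensional_def)
  qed
qed

lemma Aut_inv_inv:
  assumes "p_subalgebra L t" and g: "g \<in> carrier (Aut_p L t)" shows "Aut_inv t (Aut_inv t g) = g"
  by (rule Aut_inv_eq[OF Aut_inv_closed[OF assms]]) (use Aut_pD(1,3)[OF g] Aut_inv_simps[OF g] in auto)

lemma Aut_inv_compose:
  assumes t: "p_subalgebra L t" and g: "g \<in> carrier (Aut_p L t)" and f: "f \<in> carrier (Aut_p L t)"
  shows "Aut_inv t (compose t g f) = compose t (Aut_inv t f) (Aut_inv t g)"
  by (rule Aut_inv_eq[OF Aut_compose_closed[OF g f t]])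
     (use Aut_inv_simps[OF g] Aut_inv_simps[OF f] in \<open>auto simp: compose_eq compose_extensional\<close>)

lemma aut_action_eq: "aut_action t h \<phi> = compose t \<phi> (Aut_inv t h)"
  by (auto simp: aut_action_def compose_def Aut_inv_def)

subsection \<open>Embeddings in a family of tori\<close>

lemma linear_functional_sum:
  assumes "Vector_Spaces.linear (scl L) (*) \<xi>"
  shows "\<xi> (\<Sum>i\<in>I. scl L (c i) (v i)) = (\<Sum>i\<in>I. c i * \<xi> (v i))"
proof (induction I rule: infinite_finite_induct)
  case (infinite A)
  have "\<xi> (scl L 0 0) = 0 * \<xi> 0" using assms unfolding Vector_Spaces.linear_iff by blast
  then show ?case using infinite by simp
next
  case empty
  have "\<xi> (scl L 0 0) = 0 * \<xi> 0" using assms unfolding Vector_Spaces.linear_iff by blast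
  then show ?case by simp
next
  case (insert i I)
  then show ?case using assms by (simp add: Vector_Spaces.linear_iff)
qed

lemma independent_if_dual_det_nonzero:
  assumes \<xi>: "\<And>i. Vector_Spaces.linear (scl L) (*) (\<xi> i)"
    and det: "det (mat n n (\<lambda>(i, j). \<xi> i (y j))) \<noteq> 0"
  shows "family_independent n y"
  unfolding family_independent_def
proof (intro allI impI)
  fix c i assume c: "(\<Sum>i<n. scl L (c i) (y i)) = 0" and i: "i < n"
  let ?M = "mat n n (\<lambda>(i, j). \<xi> i (y j))" and ?v = "vec n c"
  have "?M *\<^sub>v ?v = 0\<^sub>v n"
  proof (rule eq_vecI)
    fix l assume l: "l < dim_vec (0\<^sub>v n :: 'k vec)"
    have "(?M *\<^sub>v ?v) $ l = (\<Sum>j<n. c j * \<xi> l (y j))"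
      using l by (auto simp: scalar_prod_def atLeast0LessThan intro!: sum.cong)
    also have "\<dots> = \<xi> l (\<Sum>j<n. scl L (c j) (y j))" by (rule linear_functional_sum[OF \<xi>, symmetric])
    also have "\<dots> = 0" unfolding c using linear_functional_sum[OF \<xi>, of l "\<lambda>_. 0" "\<lambda>_. 0" "{}"] by simp
    finally show "(?M *\<^sub>v ?v) $ l = 0\<^sub>v n $ l" using l by simp
  qed simp
  then have "?v = 0\<^sub>v n"
    using det_0_iff_vec_prod_zero[OF mat_carrier, of n "\<lambda>(i, j). \<xi> i (y j)"] det vec_carrier[of n c] by blast
  then show "c i = 0" using i by (metis index_vec index_zero_vec(1))
qed

lemma dual_det_nonzero_if_independent:
  assumes \<xi>: "\<And>i. Vector_Spaces.linear (scl L) (*) (\<xi> i)" "\<And>i j. i < n \<Longrightarrow> j < n \<Longrightarrow> \<xi> i (X j) = (if i = j then 1 else 0)"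
    and ind: "family_independent n y" and y: "\<And>i. i < n \<Longrightarrow> y i \<in> family_span n X"
  shows "det (mat n n (\<lambda>(i, j). \<xi> i (y j))) \<noteq> 0"
proof
  let ?M = "mat n n (\<lambda>(i, j). \<xi> i (y j))"
  assume "det ?M = 0"
  then obtain v where v: "v \<in> carrier_vec n" "v \<noteq> 0\<^sub>v n" "?M *\<^sub>v v = 0\<^sub>v n"
    using det_0_iff_vec_prod_zero[of ?M n] by auto
  let ?w = "\<Sum>j<n. scl L (v $ j) (y j)"
  have "?w \<in> family_span n X" using y by (intro subspace_sum subspace_scale subspace_family_span) auto
  then obtain d where d: "?w = (\<Sum>j<n. scl L (d j) (X j))" by (auto simp: family_span_def)
  have "d i = 0" if i: "i < n" for i
  proof -
    have "(\<Sum>j<n. d j * \<xi> i (X j)) = (\<Sum>j<n. if j = i then d i else 0)"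
      using \<xi>(2)[OF i] by (intro sum.cong) auto
    then have "d i = (\<Sum>j<n. d j * \<xi> i (X j))" using i by simp
    also have "\<dots> = \<xi> i ?w" unfolding d linear_functional_sum[OF \<xi>(1)] ..
    also have "\<dots> = (?M *\<^sub>v v) $ i"
      using i v(1) unfolding linear_functional_sum[OF \<xi>(1)]
      by (auto simp: scalar_prod_def atLeast0LessThan intro!: sum.cong)
    finally show ?thesis using v(3) i by simp
  qed
  then have "?w = 0" unfolding d by (intro sum.neutral) auto
  then have "\<forall>j<n. v $ j = 0" by (rule ind[unfolded family_independent_def, THEN spec, THEN mp])
  then show False using v(1,2) by (auto intro!: eq_vecI)
qed

lemma linear_ext_cong: "(\<And>i. i < n \<Longrightarrow> y i = y' i) \<Longrightarrow> linear_ext n e y = linear_ext n e y'"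
  unfolding linear_ext_def by (intro restrict_ext sum.cong) auto

lemma regular_polys_hom_poly_fun:
  assumes f: "f \<in> hom_poly_funs L (family_span n e)"
    and y: "\<And>\<xi> i. Vector_Spaces.linear (scl L) (*) \<xi> \<Longrightarrow> i < n \<Longrightarrow> (\<lambda>s z. \<xi> (y s z i)) \<in> regular_polys s0 m"
  shows "(\<lambda>s z. f (linear_ext n e (y s z))) \<in> regular_polys s0 m"
  using f
proof induction
  case (const c)
  show ?case by (intro regular_polys.const regular_at_const)
next
  case (coord \<xi> x)
  have "\<xi> (linear_ext n e (y s z) x) = (\<Sum>i<n. coords n e x i * \<xi> (y s z i))" for s z
    using coord(2) linear_functional_sum[OF coord(1)] by (simp add: linear_ext_def)
  then show ?case
    by (simp only:) (rule regular_polys_sum, rule regular_polys.scale[OF regular_at_const y[OF coord(1)]], simp)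
next
  case (add f g)
  then show ?case by (intro regular_polys.add)
next
  case (mult f g)
  then show ?case by (intro regular_polys_mult)
qed

text \<open>
  Consider the tori \<open>eventual_torus (x s)\<close> along a curve that is regular everywhere. Summing a polynomial function
  \<open>f\<close> over the embeddings with image \<open>eventual_torus (x s)\<close> gives a regular function of \<open>s\<close>, as it is
  a trace over tuples of roots of \<open>fixed_poly\<close>. Multiplying \<open>f\<close> by a polynomial \<open>h\<close> that singles
  out one embedding at \<open>s0\<close>, and by a determinant that vanishes on degenerate tuples, one sees that a
  function that does not vanish at one point over \<open>s0\<close> is nonzero somewhere over almost all \<open>s\<close>.
\<close>

lemma embeddings_generically_nonzero:
  assumes e: "toral_frame n e" and n: "max_torus_dim L = n" "n > 0"
    and x: "\<And>s0. regular_curve s0 x" and ind0: "family_independent n (\<lambda>j. (pop L ^^ j) (stem (x s0)))"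
    and \<phi>: "\<phi> \<in> torus_embeddings L (family_span n e)" "\<phi> ` family_span n e = eventual_torus (x s0)"
    and f: "f \<in> hom_poly_funs L (family_span n e)" "f \<phi> \<noteq> 0"
  shows "\<exists>E. finite E \<and> (\<forall>s. s \<notin> E \<longrightarrow> (\<exists>\<psi>\<in>torus_embeddings L (family_span n e).
      \<psi> ` family_span n e = eventual_torus (x s) \<and> f \<psi> \<noteq> 0 \<and>
      family_independent n (\<lambda>j. (pop L ^^ j) (stem (x s)))))"
proof -
  obtain m where m: "n = Suc m" using n(2) by (cases n) auto
  define X where "X s j = (pop L ^^ j) (stem (x s))" for s j
  have xc: "x s \<in> carrier L" for s using regular_curve_closed[OF x] .
  have curve: "regular_curve s0 (\<lambda>s. X s j)" for s0 j
    unfolding X_def stem_def by (intro regular_curve_pow x)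
  have ind0: "family_independent n (X s0)" using ind0 unfolding X_def .
  obtain \<xi> where \<xi>: "\<And>i. Vector_Spaces.linear (scl L) (*) (\<xi> i)"
    and dual: "\<And>i j. j < n \<Longrightarrow> \<xi> i (X s0 j) = (if i = j then 1 else 0)"
    using exists_dual_family[OF ind0] by blast
  \<comment> \<open>at \<open>s0\<close> this matrix is the identity, so it is invertible for almost all \<open>s\<close>\<close>
  define B where "B s i j = \<xi> i (X s j)" for s i j
  have Breg: "regular_at s0 (\<lambda>s. B s i j)" for i j
    unfolding B_def by (rule regular_at_regular_curve[OF curve \<xi>])
  have "mat n n (\<lambda>(i, j). B s0 i j) = 1\<^sub>m n" by (rule eq_matI) (auto simp: B_def dual)
  then have det0: "det (mat n n (\<lambda>(i, j). B s0 i j)) \<noteq> 0" by simp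
  obtain C E where Creg: "\<forall>i<n. \<forall>j<n. regular_at s0 (\<lambda>s. C s i j)" and E: "finite E" "s0 \<notin> E"
    and C: "\<forall>s. s \<notin> E \<longrightarrow> (\<forall>i<n. \<forall>l<n. (\<Sum>j<n. C s i j * B s j l) = (if i = l then 1 else 0))"
    using regular_at_inverse_matrix[where B = B, OF Breg det0] by (elim exE conjE) (rule that, assumption+)
  have Csolve: "(\<Sum>j<n. C s i j * \<xi> j (\<Sum>l<n. scl L (d l) (X s l))) = d i" if "s \<notin> E" "i < n" for s i d
  proof -
    have "(\<Sum>j<n. C s i j * \<xi> j (\<Sum>l<n. scl L (d l) (X s l))) = (\<Sum>j<n. \<Sum>l<n. d l * (C s i j * B s j l))"
      unfolding linear_functional_sum[OF \<xi>] B_def by (simp add: sum_distrib_left mult_ac)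
    also have "\<dots> = (\<Sum>l<n. \<Sum>j<n. d l * (C s i j * B s j l))" by (rule sum.swap)
    also have "\<dots> = (\<Sum>l<n. d l * (if i = l then 1 else 0))"
      using C that by (intro sum.cong) (auto simp: sum_distrib_left[symmetric])
    also have "\<dots> = d i" using that(2) by (simp add: if_distrib cong: if_cong)
    finally show ?thesis .
  qed
  have ind: "family_independent n (X s)" if "s \<notin> E" for s
    unfolding family_independent_def
  proof (intro allI impI)
    fix d i assume d: "(\<Sum>l<n. scl L (d l) (X s l)) = 0" and i: "i < n"
    have "\<xi> j 0 = 0" for j using linear_functional_sum[OF \<xi>, of j "\<lambda>_. 0" "\<lambda>_. 0" "{}"] by simp
    then show "d i = 0" using Csolve[OF that i, of d] unfolding d by simp
  qed
  \<comment> \<open>the coefficients of the relation between the powers, which determine the polynomial \<open>F s\<close>\<close>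
  define a where "a s i = (\<Sum>j<n. C s i j * \<xi> j (X s n))" for s i
  have areg: "regular_at s0 (\<lambda>s. a s i)" if "i < n" for i
    unfolding a_def using Creg that
    by (intro regular_at_sum regular_at_mult regular_at_regular_curve[OF curve \<xi>]) auto
  have rel: "X s n = (\<Sum>i<n. scl L (a s i) (X s i))" and a0: "a s 0 \<noteq> 0" if s: "s \<notin> E" for s
  proof -
    have "\<exists>a. (pop L ^^ Suc m) (stem (x s)) = (\<Sum>i<Suc m. scl L (a i) ((pop L ^^ i) (stem (x s)))) \<and> a 0 \<noteq> 0"
      by (rule eventual_torus_relation[OF xc]) (use n m ind[OF s] in \<open>simp_all add: X_def[abs_def]\<close>)
    then obtain a' where a': "(pop L ^^ Suc m) (stem (x s)) = (\<Sum>i<Suc m. scl L (a' i) ((pop L ^^ i) (stem (x s))))"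
      "a' 0 \<noteq> 0" by blast
    have r: "X s n = (\<Sum>i<n. scl L (a' i) (X s i))" using a'(1) unfolding X_def m .
    have eq: "a s i = a' i" if "i < n" for i
      unfolding a_def r by (rule Csolve[OF s that])
    show "X s n = (\<Sum>i<n. scl L (a s i) (X s i))" unfolding r by (intro sum.cong) (auto simp: eq)
    show "a s 0 \<noteq> 0" using eq[OF n(2)] a'(2) by simp
  qed
  define F where "F s = fixed_poly (a s) n" for s
  have Freg: "regular_at s0 (\<lambda>s. coeff (F s) i)" for i
    unfolding F_def fixed_poly_def coeff_diff
    by (intro regular_at_diff regular_at_coeff_orbit_poly areg regular_at_const) (use n(2) in auto)
  have Fprop: "pderiv (F s) = [:-1:] \<and> degree (F s) = CHAR('k) ^ n" if "s \<notin> E" for s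
    using pderiv_fixed_poly degree_fixed_poly(1)[of "a s" n, OF char_pos a0[OF that] n(2)] by (simp add: F_def)
  define V where "V s = {z. poly (F s) z = 0}" for s
  have finV: "finite (V s)" for s
  proof -
    have "pderiv (F s) \<noteq> 0" using pderiv_fixed_poly[of "a s" n] by (simp add: F_def)
    then have "F s \<noteq> 0" by auto
    then show ?thesis unfolding V_def by (rule poly_roots_finite)
  qed
  have Vreg: "regular_at s0 (\<lambda>s. \<Sum>z\<in>V s. z ^ l)" for l
    unfolding V_def using char_pos by (intro regular_at_power_sum[OF Freg E Fprop]) auto
  have Viff: "z \<in> V s \<longleftrightarrow> orbit_coeff (a s) m z = z" for s z
    by (simp add: V_def F_def poly_fixed_poly m)
  \<comment> \<open>the toral elements that belong to a tuple \<open>z\<close> of roots of \<open>F s\<close>\<close>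
  define y where "y s z i = (\<Sum>j<n. scl L (orbit_coeff (a s) j (z i)) (X s j))" for s and z :: "nat \<Rightarrow> 'k" and i
  have yreg: "(\<lambda>s z. \<eta> (y s z i)) \<in> regular_polys s0 n"
    if \<eta>: "Vector_Spaces.linear (scl L) (*) \<eta>" and i: "i < n" for \<eta> i
  proof -
    have "(\<lambda>s z. \<eta> (X s j) * orbit_coeff (a s) j (z i)) \<in> regular_polys s0 n" if "j < n" for j
      using that i areg
      by (intro regular_polys.scale regular_polys_orbit_coeff regular_at_regular_curve[OF curve \<eta>]) auto
    then have "(\<lambda>s z. \<Sum>j<n. \<eta> (X s j) * orbit_coeff (a s) j (z i)) \<in> regular_polys s0 n"
      by (intro regular_polys_sum) auto
    then show ?thesis unfolding y_def linear_functional_sum[OF \<eta>] by (simp add: mult.commute)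
  qed
  have A: "abelian_p_subalgebra (eventual_torus (x s))" for s
    by (intro torus_abelian torus_eventual_torus xc)
  have XT: "X s j \<in> eventual_torus (x s)" for s j unfolding X_def by (rule torus_eventual_torus(2)[OF xc])
  have stemT: "stem (x s) \<in> eventual_torus (x s)" for s using XT[of s 0] by (simp add: X_def)
  have yT: "y s z i \<in> eventual_torus (x s)" for s z i
    unfolding y_def using abelian_p_subalgebraD(2)[OF A] XT by (intro subspace_sum subspace_scale) auto
  have span: "eventual_torus (x s) = family_span n (X s)" if "s \<notin> E" for s
    using eventual_torus_eq_family_span[OF xc] ind[OF that] n(1) unfolding X_def by metis
  have frame: "toral_frame n (y s z)"
    if s: "s \<notin> E" and z: "\<And>i. i < n \<Longrightarrow> z i \<in> V s" and indy: "family_independent n (y s z)" for s z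
    unfolding toral_frame_def
  proof (intro conjI allI impI indy)
    fix i assume i: "i < n"
    show "y s z i \<in> carrier L" using yT abelian_p_subalgebraD(1)[OF A] by blast
    have "pop L (y s z i) = scl L (z i ^ CHAR('k)) 0 + y s z i"
      unfolding y_def m X_def
      by (rule pop_orbit_sum[OF A stemT]) (use rel[OF s] z[OF i] Viff subspace_0 abelian_p_subalgebraD(2)[OF A] in \<open>auto simp: X_def m\<close>)
    then show "pop L (y s z i) = y s z i" by simp
    fix j show "brk L (y s z i) (y s z j) = 0" using abelian_p_subalgebraD(4)[OF A yT yT] .
  qed
  \<comment> \<open>nonzero only if the tuple gives an independent family\<close>
  define \<delta> where "\<delta> s z = det (mat n n (\<lambda>(i, j). \<xi> i (y s z j)))" for s z
  have \<delta>reg: "\<delta> \<in> regular_polys s0 n"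
    unfolding \<delta>_def by (intro regular_polys_det yreg \<xi>)
  \<comment> \<open>the tuple of roots that corresponds to \<open>\<phi>\<close>\<close>
  have fr: "toral_frame n (\<lambda>i. \<phi> (e i))" using embedding_frame(1)[OF e \<phi>(1)] .
  have "\<forall>i. \<exists>c. i < n \<longrightarrow> \<phi> (e i) = (\<Sum>j<n. scl L (c j) (X s0 j))"
  proof
    fix i
    have "\<phi> (e i) \<in> family_span n (X s0)" if "i < n"
      using span[OF E(2)] \<phi>(2) family_span_base[OF that, of e] by blast
    then show "\<exists>c. i < n \<longrightarrow> \<phi> (e i) = (\<Sum>j<n. scl L (c j) (X s0 j))" by (auto simp: family_span_def)
  qed
  then obtain c where c: "\<And>i. i < n \<Longrightarrow> \<phi> (e i) = (\<Sum>j<n. scl L (c i j) (X s0 j))" by metis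
  define z0 where "z0 = (\<lambda>i\<in>{..<n}. c i m)"
  have coeff: "c i j = orbit_coeff (a s0) j (c i m)" if i: "i < n" and j: "j < n" for i j
  proof (rule fixed_orbit_sum[OF A stemT, where m = m and a = "a s0"])
    show "(pop L ^^ Suc m) (stem (x s0)) = (\<Sum>i<Suc m. scl L (a s0 i) ((pop L ^^ i) (stem (x s0))))"
      using rel[OF E(2)] unfolding X_def m .
    show "family_independent (Suc m) (\<lambda>j. (pop L ^^ j) (stem (x s0)))" using ind0 unfolding X_def m .
    have "pop L (\<phi> (e i)) = \<phi> (e i)" using fr i by (simp add: toral_frame_def)
    then show "pop L (\<Sum>j<Suc m. scl L (c i j) ((pop L ^^ j) (stem (x s0)))) =
        (\<Sum>j<Suc m. scl L (c i j) ((pop L ^^ j) (stem (x s0))))"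
      using c[OF i] unfolding X_def m by simp
    show "j < Suc m" using j m by simp
  qed
  have z0V: "z0 i \<in> V s0" if "i < n" for i
    using coeff[OF that, of m] that by (simp add: Viff z0_def m)
  have y0: "y s0 z0 i = \<phi> (e i)" if "i < n" for i
    unfolding y_def c[OF that] using coeff[OF that] that by (intro sum.cong) (auto simp: z0_def)
  have \<phi>0: "linear_ext n e (y s0 z0) = \<phi>"
    using linear_ext_cong[of n "y s0 z0" "\<lambda>i. \<phi> (e i)" e] y0 embedding_frame(2)[OF e \<phi>(1)] by simp
  have "det (mat n n (\<lambda>(i, j). \<xi> i (\<phi> (e j)))) \<noteq> 0"
  proof (rule dual_det_nonzero_if_independent[OF \<xi>, where X = "X s0"])
    show "\<xi> i (X s0 j) = (if i = j then 1 else 0)" if "i < n" "j < n" for i j using dual that by simp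
    show "family_independent n (\<lambda>i. \<phi> (e i))" using fr by (simp add: toral_frame_def)
    show "\<phi> (e i) \<in> family_span n (X s0)" if "i < n" for i unfolding c[OF that] by (rule family_spanI)
  qed
  moreover have "mat n n (\<lambda>(i, j). \<xi> i (y s0 z0 j)) = mat n n (\<lambda>(i, j). \<xi> i (\<phi> (e j)))"
    by (rule eq_matI) (auto simp: y0)
  ultimately have \<delta>0: "\<delta> s0 z0 \<noteq> 0" by (simp add: \<delta>_def)
  \<comment> \<open>nonzero at the tuple \<open>z0\<close> only, among the tuples of roots over \<open>s0\<close>\<close>
  define h where "h z = (\<Prod>i<n. \<Prod>v\<in>V s0 - {z0 i}. z i - v)" for z :: "nat \<Rightarrow> 'k"
  have "(\<lambda>s z. z i - v) \<in> regular_polys s0 n" if "i < n" for i v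
    using regular_polys.add[OF regular_polys_var[OF that] regular_polys.const[OF regular_at_const[of s0 "- v"]]] by simp
  then have hreg: "(\<lambda>s z. h z) \<in> regular_polys s0 n"
    unfolding h_def by (intro regular_polys_prod) auto
  have h0: "h z0 \<noteq> 0" using finV by (auto simp: h_def prod_zero_iff)
  have hz: "h z = 0" if z: "z \<in> {..<n} \<rightarrow>\<^sub>E V s0" "z \<noteq> z0" for z
  proof -
    have "\<exists>i<n. z i \<noteq> z0 i"
    proof (rule ccontr)
      assume "\<not> ?thesis"
      then have "z = z0" using z(1) by (auto simp: fun_eq_iff z0_def PiE_def extensional_def)
      then show False using z(2) by simp
    qed
    then obtain i where i: "i < n" "z i \<noteq> z0 i" by blast
    then have "z i \<in> V s0 - {z0 i}" using z(1) by auto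
    then have "(\<Prod>v\<in>V s0 - {z0 i}. z i - v) = 0" using finV by (intro prod_zero) auto
    then show ?thesis using i(1) by (auto simp: h_def intro!: prod_zero)
  qed
  define H where "H s z = f (linear_ext n e (y s z)) * (\<delta> s z * h z)" for s z
  have "H \<in> regular_polys s0 n"
    unfolding H_def by (intro regular_polys_mult regular_polys_hom_poly_fun f(1) yreg \<delta>reg hreg)
  then have tr: "regular_at s0 (\<lambda>s. \<Sum>z\<in>{..<n} \<rightarrow>\<^sub>E V s. H s z)"
    by (rule regular_at_trace[OF _ Vreg finV])
  have z0PiE: "z0 \<in> {..<n} \<rightarrow>\<^sub>E V s0" using z0V by (auto simp: z0_def)
  have fin: "finite ({..<n} \<rightarrow>\<^sub>E V s0)" using finV by (intro finite_PiE) auto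
  have "(\<Sum>z\<in>{..<n} \<rightarrow>\<^sub>E V s0. H s0 z) = (\<Sum>z\<in>{z0}. H s0 z)"
    by (rule sum.mono_neutral_right[OF fin]) (use z0PiE hz in \<open>auto simp: H_def\<close>)
  also have "\<dots> \<noteq> 0" using f(2) \<delta>0 h0 \<phi>0 by (simp add: H_def)
  finally obtain E' where E': "finite E'" "\<forall>s. s \<notin> E' \<longrightarrow> (\<Sum>z\<in>{..<n} \<rightarrow>\<^sub>E V s. H s z) \<noteq> 0"
    using regular_at_nonzero_cofinite[OF tr] by blast
  have "\<exists>\<psi>\<in>torus_embeddings L (family_span n e). \<psi> ` family_span n e = eventual_torus (x s) \<and> f \<psi> \<noteq> 0 \<and>
      family_independent n (\<lambda>j. (pop L ^^ j) (stem (x s)))" if s: "s \<notin> E \<union> E'" for s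
  proof -
    have "(\<Sum>z\<in>{..<n} \<rightarrow>\<^sub>E V s. H s z) \<noteq> 0" using E'(2) s by blast
    then obtain z where z: "z \<in> {..<n} \<rightarrow>\<^sub>E V s" "H s z \<noteq> 0" by (meson sum.not_neutral_contains_not_neutral)
    then have nz: "f (linear_ext n e (y s z)) \<noteq> 0" "\<delta> s z \<noteq> 0" by (auto simp: H_def)
    have indy: "family_independent n (y s z)"
      by (rule independent_if_dual_det_nonzero[OF \<xi>]) (use nz(2) in \<open>simp add: \<delta>_def\<close>)
    have fr: "toral_frame n (y s z)" by (rule frame[OF _ _ indy]) (use s z(1) in auto)
    have "linear_ext n e (y s z) ` family_span n e = family_span n (y s z)"
      using e by (intro linear_ext_image) (simp add: toral_frame_def)
    also have "\<dots> = family_span n (X s)"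
      by (rule family_span_full[OF indy]) (use yT span s in blast)
    also have "\<dots> = eventual_torus (x s)" using span s by blast
    finally show ?thesis
      using linear_ext_embedding[OF e fr] nz(1) ind[of s] s unfolding X_def by blast
  qed
  then show ?thesis using E(1) E'(1) by (intro exI[of _ "E \<union> E'"]) auto
qed

subsection \<open>Components of the variety of embeddings\<close>

text \<open>
  A generic element of a torus of maximal dimension recovers this torus as the span of its powers.
\<close>

lemma image_embedding_eq_eventual_torus:
  assumes e: "toral_frame n e" and n: "max_torus_dim L = n" and \<phi>: "\<phi> \<in> torus_embeddings L (family_span n e)"
    and z: "Fp_independent n z"
  shows "(\<Sum>i<n. scl L (z i) (\<phi> (e i))) \<in> carrier L"
    and "family_independent n (\<lambda>j. (pop L ^^ j) (stem (\<Sum>i<n. scl L (z i) (\<phi> (e i)))))"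
    and "\<phi> ` family_span n e = eventual_torus (\<Sum>i<n. scl L (z i) (\<phi> (e i)))"
proof -
  have fr: "toral_frame n (\<lambda>i. \<phi> (e i))" using embedding_frame(1)[OF e \<phi>] .
  let ?x = "\<Sum>i<n. scl L (z i) (\<phi> (e i))"
  show xc: "?x \<in> carrier L"
    using fr by (intro subspace_sum subspace_scale carrier_subspace) (auto simp: toral_frame_def)
  show ind: "family_independent n (\<lambda>j. (pop L ^^ j) (stem ?x))"
    by (rule generic_stem_independent[OF _ _ _ z]) (use fr in \<open>auto simp: toral_frame_def\<close>)
  have "(pop L ^^ j) (stem ?x) \<in> family_span n (\<lambda>i. \<phi> (e i))" for j
  proof -
    have "(pop L ^^ l) ?x = (\<Sum>i<n. scl L (z i ^ (CHAR('k) ^ l)) (\<phi> (e i)))" for l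
      by (rule pow_of_toral_combination) (use fr in \<open>auto simp: toral_frame_def\<close>)
    then show ?thesis unfolding pow_stem by (simp add: family_spanI)
  qed
  then have "family_span n (\<lambda>j. (pop L ^^ j) (stem ?x)) = family_span n (\<lambda>i. \<phi> (e i))"
    by (intro family_span_full[OF ind])
  moreover have "eventual_torus ?x = family_span n (\<lambda>j. (pop L ^^ j) (stem ?x))"
    using eventual_torus_eq_family_span[OF xc] ind n by simp
  ultimately show "\<phi> ` family_span n e = eventual_torus ?x"
    using embedding_frame(3)[OF e \<phi>] by simp
qed

text \<open>
  The automorphism group of a torus of maximal dimension acts transitively on the components of its
  variety of embeddings. Indeed, join generic elements of the images of \<open>\<phi>\<close> and \<open>\<psi>\<close> by a line. The
  embeddings whose images are the tori of points of this line form a space in which every nonempty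
  open set meets almost all fibres. As the fibres are orbits of a finite group, this space has only
  finitely many components, and the components of \<open>\<phi>\<close> and \<open>\<psi>\<close> meet a common fibre.
\<close>

theorem Aut_p_transitive_on_components:
  assumes t: "max_dim_torus L t" and pos: "max_torus_dim L > 0"
    and \<phi>: "\<phi> \<in> torus_embeddings L t" and \<psi>: "\<psi> \<in> torus_embeddings L t"
  shows "\<exists>g\<in>carrier (Aut_p L t). connected_component_of (zariski_topology L t) \<phi> (compose t \<psi> g)"
proof -
  define n where "n = max_torus_dim L"
  have tor: "torus L t" and dt: "dim t = n" using t by (auto simp: max_dim_torus_def n_def)
  have ps: "p_subalgebra L t" using tor by (simp add: torus_def)
  obtain e where e: "toral_frame n e" "t = family_span n e" using frame_of_torus[OF tor] dt by blast
  obtain z :: "nat \<Rightarrow> 'k" where z: "Fp_independent n z" using exists_Fp_independent[OF char_pos] by blast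
  define x0 where "x0 = (\<Sum>i<n. scl L (z i) (\<phi> (e i)))"
  define x1 where "x1 = (\<Sum>i<n. scl L (z i) (\<psi> (e i)))"
  note x0 = image_embedding_eq_eventual_torus[OF e(1) n_def[symmetric] \<phi>[unfolded e(2)] z, folded x0_def e(2)]
  note x1 = image_embedding_eq_eventual_torus[OF e(1) n_def[symmetric] \<psi>[unfolded e(2)] z, folded x1_def e(2)]
  define x where "x s = x0 + scl L s (x1 - x0)" for s
  have xends: "x 0 = x0" "x 1 = x1" by (simp_all add: x_def)
  have curve: "regular_curve s0 x" for s0
    unfolding x_def
    by (intro regular_curve.add regular_curve.scale regular_at_id regular_curve.const x0(1) subspace_diff carrier_subspace x1(1))
  let ?Z = "zariski_topology L t"
  \<comment> \<open>the embeddings whose images are the tori of the points of the line\<close>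
  define Y where "Y = {\<chi> \<in> torus_embeddings L t. \<exists>s. \<chi> ` t = eventual_torus (x s) \<and>
      family_independent n (\<lambda>j. (pop L ^^ j) (stem (x s)))}"
  have \<phi>Y: "\<phi> \<in> Y" using \<phi> x0(2,3) unfolding Y_def by (auto intro!: exI[of _ 0] simp: xends)
  have \<psi>Y: "\<psi> \<in> Y" using \<psi> x1(2,3) unfolding Y_def by (auto intro!: exI[of _ 1] simp: xends)
  \<comment> \<open>a nonempty open subset of \<open>Y\<close> meets almost all fibres\<close>
  have meets: "\<exists>E. finite E \<and> (\<forall>s. s \<notin> E \<longrightarrow> (\<exists>\<chi>\<in>U. \<chi> \<in> torus_embeddings L t \<and> \<chi> ` t = eventual_torus (x s)))"
    if U: "openin (subtopology ?Z Y) U" "U \<noteq> {}" for U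
  proof -
    obtain W where W: "openin ?Z W" "U = W \<inter> Y" using U(1) by (auto simp: openin_subtopology)
    obtain \<chi> where \<chi>: "\<chi> \<in> W" "\<chi> \<in> Y" using U(2) W(2) by blast
    obtain f where f: "f \<in> hom_poly_funs L t" "f \<chi> \<noteq> 0" "{\<psi> \<in> torus_embeddings L t. f \<psi> \<noteq> 0} \<subseteq> W"
      using zariski_open_basis[OF W(1) \<chi>(1)] by blast
    obtain s0 where s0: "\<chi> \<in> torus_embeddings L t" "\<chi> ` t = eventual_torus (x s0)"
      "family_independent n (\<lambda>j. (pop L ^^ j) (stem (x s0)))" using \<chi>(2) by (auto simp: Y_def)
    have "\<exists>E. finite E \<and> (\<forall>s. s \<notin> E \<longrightarrow> (\<exists>\<psi>\<in>torus_embeddings L (family_span n e).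
        \<psi> ` family_span n e = eventual_torus (x s) \<and> f \<psi> \<noteq> 0 \<and>
        family_independent n (\<lambda>j. (pop L ^^ j) (stem (x s)))))"
      by (rule embeddings_generically_nonzero[OF e(1) n_def[symmetric] _ curve s0(3)])
         (use pos s0 f(1,2) e(2) in \<open>auto simp: n_def\<close>)
    then obtain E where E: "finite E" "\<And>s. s \<notin> E \<Longrightarrow> \<exists>\<psi>\<in>torus_embeddings L t.
        \<psi> ` t = eventual_torus (x s) \<and> f \<psi> \<noteq> 0 \<and> family_independent n (\<lambda>j. (pop L ^^ j) (stem (x s)))"
      unfolding e(2)[symmetric] by blast
    have "\<exists>\<chi>\<in>U. \<chi> \<in> torus_embeddings L t \<and> \<chi> ` t = eventual_torus (x s)" if "s \<notin> E" for s
      using E(2)[OF that] f(3) unfolding W(2) Y_def by blast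
    then show ?thesis using E(1) by blast
  qed
  \<comment> \<open>a fibre has at most as many elements as the automorphism group, which bounds the number of disjoint open sets\<close>
  have bound: "card \<F> \<le> card (carrier (Aut_p L t))"
    if \<F>: "finite \<F>" "\<And>U. U \<in> \<F> \<Longrightarrow> openin (subtopology ?Z Y) U \<and> U \<noteq> {}" "disjoint \<F>" for \<F>
  proof -
    obtain E where E: "\<And>U. U \<in> \<F> \<Longrightarrow> finite (E U)"
      "\<And>U s. U \<in> \<F> \<Longrightarrow> s \<notin> E U \<Longrightarrow> \<exists>\<chi>\<in>U. \<chi> \<in> torus_embeddings L t \<and> \<chi> ` t = eventual_torus (x s)"
      using meets \<F>(2) by metis
    have "finite (\<Union>U\<in>\<F>. E U)" using \<F>(1) E(1) by blast
    then obtain s where s: "s \<notin> (\<Union>U\<in>\<F>. E U)" using infinite_alg_closed by (metis ex_new_if_finite)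
    have "\<forall>U. \<exists>\<chi>. U \<in> \<F> \<longrightarrow> \<chi> \<in> U \<and> \<chi> \<in> torus_embeddings L t \<and> \<chi> ` t = eventual_torus (x s)"
      using E(2) s by blast
    then obtain \<chi> where \<chi>: "\<And>U. U \<in> \<F> \<Longrightarrow> \<chi> U \<in> U \<and> \<chi> U \<in> torus_embeddings L t \<and> \<chi> U ` t = eventual_torus (x s)"
      by metis
    show ?thesis
    proof (cases "\<F> = {}")
      case False
      then obtain U0 where U0: "U0 \<in> \<F>" by blast
      have "\<chi> ` \<F> \<subseteq> (\<lambda>g. compose t (\<chi> U0) g) ` carrier (Aut_p L t)"
        using embeddings_same_image[OF ps, of "\<chi> U0"] \<chi> U0 by blast
      then have "card (\<chi> ` \<F>) \<le> card (carrier (Aut_p L t))"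
        using finite_Aut_p[OF tor] by (meson card_image_le card_mono finite_imageI le_trans)
      moreover have "inj_on \<chi> \<F>"
      proof (rule inj_onI)
        fix U U' assume "U \<in> \<F>" "U' \<in> \<F>" "\<chi> U = \<chi> U'"
        then show "U = U'" using \<F>(3) \<chi>[of U] \<chi>[of U'] unfolding disjoint_def by auto
      qed
      ultimately show ?thesis by (simp add: card_image)
    qed simp
  qed
  have top: "topspace (subtopology ?Z Y) = Y" by (auto simp: Y_def)
  have nbhd: "\<exists>C. openin (subtopology ?Z Y) C \<and> connectedin (subtopology ?Z Y) C \<and> \<chi> \<in> C" if "\<chi> \<in> Y" for \<chi>
    by (rule open_connected_neighbourhood[where k = "card (carrier (Aut_p L t))"]) (use bound top that in auto)
  obtain C where C: "openin (subtopology ?Z Y) C" "connectedin (subtopology ?Z Y) C" "\<phi> \<in> C"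
    using nbhd[OF \<phi>Y] by blast
  obtain D where D: "openin (subtopology ?Z Y) D" "connectedin (subtopology ?Z Y) D" "\<psi> \<in> D"
    using nbhd[OF \<psi>Y] by blast
  obtain E where E: "finite E" "\<And>s. s \<notin> E \<Longrightarrow> \<exists>\<chi>\<in>C. \<chi> \<in> torus_embeddings L t \<and> \<chi> ` t = eventual_torus (x s)"
    using meets[OF C(1)] C(3) by blast
  obtain E' where E': "finite E'" "\<And>s. s \<notin> E' \<Longrightarrow> \<exists>\<chi>\<in>D. \<chi> \<in> torus_embeddings L t \<and> \<chi> ` t = eventual_torus (x s)"
    using meets[OF D(1)] D(3) by blast
  obtain s where s: "s \<notin> E \<union> E'" using infinite_alg_closed E(1) E'(1) by (metis ex_new_if_finite finite_UnI)
  obtain \<chi> where \<chi>: "\<chi> \<in> C" "\<chi> \<in> torus_embeddings L t" "\<chi> ` t = eventual_torus (x s)" using E(2) s by blast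
  obtain \<chi>' where \<chi>': "\<chi>' \<in> D" "\<chi>' \<in> torus_embeddings L t" "\<chi>' ` t = eventual_torus (x s)" using E'(2) s by blast
  obtain g where g: "g \<in> carrier (Aut_p L t)" "\<chi> = compose t \<chi>' g"
    using embeddings_same_image[OF ps \<chi>'(2) \<chi>(2)] \<chi>(3) \<chi>'(3) by auto
  have "connected_component_of ?Z \<phi> \<chi>"
    using C \<chi>(1) unfolding connected_component_of_def by (auto simp: connectedin_subtopology)
  moreover have "connected_component_of ?Z \<psi> \<chi>'"
    using D \<chi>'(1) unfolding connected_component_of_def by (auto simp: connectedin_subtopology)
  then have "connected_component_of ?Z (compose t \<psi> g) (compose t \<chi>' g)"
    by (rule connected_component_of_compose[OF Aut_pD(1)[OF g(1)], rotated]) (rule embedding_compose[OF ps _ g(1)])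
  ultimately have "connected_component_of ?Z \<phi> (compose t \<psi> g)"
    unfolding g(2) using connected_component_of_trans connected_component_of_sym by metis
  then show ?thesis using g(1) by blast
qed

end

section \<open>The Poisson bracket on polynomials\<close>

abbreviation lookup where "lookup \<equiv> Poly_Mapping.lookup"
abbreviation keys where "keys \<equiv> Poly_Mapping.keys"

definition polys_in :: "nat \<Rightarrow> 'k::field mpoly set" where
  "polys_in n = {f. \<forall>a\<in>keys f. keys a \<subseteq> {1..n}}"

lemma trunc_polys_altdef: "f \<in> trunc_polys n \<longleftrightarrow> f \<in> polys_in n \<and> ptrunc f = (f :: 'k::field mpoly)"
proof
  assume f: "f \<in> trunc_polys n"
  have "ptrunc f = f"
  proof (rule poly_mapping_eqI)
    fix a show "lookup (ptrunc f) a = lookup f a"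
      using f by (auto simp: lookup_ptrunc trunc_polys_def trunc_exps_def in_keys_iff)
  qed
  then show "f \<in> polys_in n \<and> ptrunc f = f" using f by (auto simp: polys_in_def trunc_polys_def trunc_exps_def)
next
  assume f: "f \<in> polys_in n \<and> ptrunc f = f"
  have "lookup a j < CHAR('k)" if "a \<in> keys f" for a j
    using that f lookup_ptrunc[of f a] by (auto simp: in_keys_iff split: if_splits)
  then show "f \<in> trunc_polys n" using f by (auto simp: polys_in_def trunc_polys_def trunc_exps_def)
qed

lemma ptrunc_idem: "ptrunc (ptrunc f) = ptrunc (f :: 'k::field mpoly)"
  by (rule poly_mapping_eqI) (simp add: lookup_ptrunc)

lemma keys_ptrunc: "keys (ptrunc f) \<subseteq> keys (f :: 'k::field mpoly)"
  by (auto simp: in_keys_iff lookup_ptrunc split: if_splits)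

lemma polys_in_ptrunc: "f \<in> polys_in n \<Longrightarrow> ptrunc f \<in> trunc_polys n"
  unfolding trunc_polys_altdef ptrunc_idem using keys_ptrunc[of f] by (auto simp: polys_in_def)

lemma polys_in_0 [simp]: "0 \<in> polys_in n"
  by (simp add: polys_in_def)

lemma polys_in_add: "f \<in> polys_in n \<Longrightarrow> g \<in> polys_in n \<Longrightarrow> f + g \<in> polys_in n"
  unfolding polys_in_def using keys_add[of f g] by blast

lemma polys_in_diff: "f \<in> polys_in n \<Longrightarrow> g \<in> polys_in n \<Longrightarrow> f - g \<in> polys_in n"
  unfolding polys_in_def using keys_diff[of f g] by blast

lemma polys_in_mult: "f \<in> polys_in n \<Longrightarrow> g \<in> polys_in n \<Longrightarrow> f * g \<in> polys_in n"
proof -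
  assume f: "f \<in> polys_in n" and g: "g \<in> polys_in n"
  have "keys c \<subseteq> {1..n}" if c: "c \<in> keys (f * g)" for c
  proof -
    obtain a b where ab: "c = a + b" "a \<in> keys f" "b \<in> keys g" using keys_mult[of f g] c by blast
    then have "keys c \<subseteq> keys a \<union> keys b" using keys_add[of a b] by simp
    then show ?thesis using f g ab by (auto simp: polys_in_def)
  qed
  then show ?thesis by (simp add: polys_in_def)
qed

lemma polys_in_sum: "(\<And>i. i \<in> I \<Longrightarrow> f i \<in> polys_in n) \<Longrightarrow> (\<Sum>i\<in>I. f i) \<in> polys_in n"
  by (induction I rule: infinite_finite_induct) (auto intro: polys_in_add)

lemma polys_in_partial_deriv: "f \<in> polys_in n \<Longrightarrow> partial_deriv j f \<in> polys_in n"
proof -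
  assume f: "f \<in> polys_in n"
  have "keys a \<subseteq> {1..n}" if "a \<in> keys (partial_deriv j f)" for a
  proof -
    have "a + pvar j \<in> keys f" using that by (auto simp: in_keys_iff lookup_partial_deriv)
    then have "keys (a + pvar j) \<subseteq> {1..n}" using f by (auto simp: polys_in_def)
    moreover have "keys a \<subseteq> keys (a + pvar j)" by (auto simp: in_keys_iff lookup_add)
    ultimately show ?thesis by blast
  qed
  then show ?thesis by (simp add: polys_in_def)
qed

text \<open>
  Identities are proved for this bracket of the full polynomial ring, where multiplication is that of
  a ring, and then carried over by truncation.
\<close>

definition full_bracket :: "nat \<Rightarrow> 'k::field mpoly \<Rightarrow> 'k mpoly \<Rightarrow> 'k mpoly" where
  "full_bracket r f g = (\<Sum>i = 1..r.
     partial_deriv i f * partial_deriv (i + r) g - partial_deriv (i + r) f * partial_deriv i g)"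

lemma poisson_bracket_full: "poisson_bracket r f g = ptrunc (full_bracket r f g)"
  by (simp add: poisson_bracket_def full_bracket_def)

lemma full_bracket_antisym: "full_bracket r g f = - full_bracket r f g"
  by (simp add: full_bracket_def sum_negf[symmetric] algebra_simps)

lemma full_bracket_add_left: "full_bracket r (f + g) h = full_bracket r f h + full_bracket r g h"
  unfolding full_bracket_def sum.distrib[symmetric] by (simp add: partial_deriv_add algebra_simps)

lemma full_bracket_add_right: "full_bracket r h (f + g) = full_bracket r h f + full_bracket r h g"
  by (simp only: full_bracket_antisym[of r h] full_bracket_add_left minus_add_distrib)

lemma full_bracket_mult_left:
  "full_bracket r (f * g) h = f * full_bracket r g h + g * full_bracket r f h"
  unfolding full_bracket_def sum_distrib_left sum.distrib[symmetric]
  by (simp add: partial_deriv_mult algebra_simps)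

lemma full_bracket_mult_right:
  "full_bracket r h (f * g) = f * full_bracket r h g + g * full_bracket r h f"
  by (simp add: full_bracket_antisym[of r h] full_bracket_mult_left)

lemma partial_deriv_const: "partial_deriv j (Poly_Mapping.single 0 c :: 'k::field mpoly) = 0"
  by (simp add: partial_deriv_single)

lemma full_bracket_const_left: "full_bracket r (Poly_Mapping.single 0 c) h = 0"
  by (simp add: full_bracket_def partial_deriv_const)

lemma full_bracket_const_right: "full_bracket r h (Poly_Mapping.single 0 c) = 0"
  by (simp add: full_bracket_def partial_deriv_const)

lemma full_bracket_0 [simp]: "full_bracket r 0 h = 0" "full_bracket r h 0 = 0"
  using full_bracket_const_left[of r 0 h] full_bracket_const_right[of r h 0] by simp_all

lemma single_sum: "(\<Sum>i\<in>I. Poly_Mapping.single a (c i)) = Poly_Mapping.single a (\<Sum>i\<in>I. c i)"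
  by (induction I rule: infinite_finite_induct) (simp_all add: single_add)

text \<open>
  Reduces an identity between derivations to the variables and the constants.
\<close>

lemma derivation_eq_0:
  fixes D :: "'k::field mpoly \<Rightarrow> 'k mpoly"
  assumes add: "\<And>f g. D (f + g) = D f + D g" and mult: "\<And>f g. D (f * g) = f * D g + g * D f"
    and const: "\<And>c. D (Poly_Mapping.single 0 c) = 0" and var: "\<And>j. D (pmonom (pvar j)) = 0"
  shows "D f = 0"
proof (induction f rule: mpoly_induct)
  case (single a c)
  have "D (pmonom a) = 0" for a
  proof (induction a rule: mpoly_induct)
    case (single j m)
    show ?case
    proof (induction m)
      case 0
      show ?case using const[of 1] by simp
    next
      case (Suc m)
      have "pmonom (Poly_Mapping.single j (Suc m)) = pmonom (pvar j) * (pmonom (Poly_Mapping.single j m) :: 'k mpoly)"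
        by (simp add: mult_single single_add[symmetric])
      then show ?case using Suc var by (simp add: mult)
    qed
  next
    case (add a b)
    have "pmonom (a + b) = pmonom a * (pmonom b :: 'k mpoly)" by (simp add: mult_single)
    then show ?case using add by (simp add: mult)
  qed
  moreover have "Poly_Mapping.single a c = Poly_Mapping.single 0 c * pmonom a" by (simp add: mult_single)
  ultimately show ?case using const by (simp add: mult)
qed (simp add: add)

text \<open>
  The Jacobiator is a derivation in each argument, so that it is enough to evaluate it at variables,
  whose brackets are constants.
\<close>

lemma full_bracket_jacobi:
  fixes f g h :: "'k::field mpoly"
  shows "full_bracket r f (full_bracket r g h) =
    full_bracket r (full_bracket r f g) h + full_bracket r g (full_bracket r f h)"
proof -
  let ?B = "full_bracket r"
  define J where "J f g h = ?B f (?B g h) - ?B (?B f g) h - ?B g (?B f h)" for f g h :: "'k mpoly"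
  note simps = full_bracket_add_left full_bracket_add_right full_bracket_mult_left full_bracket_mult_right
    full_bracket_const_left full_bracket_const_right
  have vars: "\<exists>c. ?B (pmonom (pvar i)) (pmonom (pvar j) :: 'k mpoly) = Poly_Mapping.single 0 c" for i j
  proof -
    have d: "partial_deriv i (pmonom (pvar j) :: 'k mpoly) = Poly_Mapping.single 0 (if i = j then 1 else 0)" for i j
      by (auto simp: partial_deriv_single lookup_single when_def)
    have "?B (pmonom (pvar i)) (pmonom (pvar j) :: 'k mpoly) = Poly_Mapping.single 0 (\<Sum>l = 1..r.
        (if l = i then 1 else 0) * (if l + r = j then 1 else 0) - (if l + r = i then 1 else 0) * (if l = j then 1 else 0))"
      unfolding full_bracket_def d mult_single single_diff[symmetric] add_0 by (rule single_sum)
    then show ?thesis by blast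
  qed
  have vars0: "?B u (?B (pmonom (pvar i)) (pmonom (pvar j))) = 0" "?B (?B (pmonom (pvar i)) (pmonom (pvar j))) u = 0"
    for i j and u :: "'k mpoly"
    using vars[of i j] by (auto simp: full_bracket_const_left full_bracket_const_right)
  have 0: "J (pmonom (pvar i)) (pmonom (pvar j)) (pmonom (pvar l)) = 0" for i j l
    by (simp add: J_def vars0 del: One_nat_def)
  have 1: "J f (pmonom (pvar j)) (pmonom (pvar l)) = 0" for f j l
  proof (rule derivation_eq_0[of "\<lambda>f. J f (pmonom (pvar j)) (pmonom (pvar l))"])
    show "J (pmonom (pvar i)) (pmonom (pvar j)) (pmonom (pvar l)) = 0" for i by (rule 0)
  qed (simp_all add: J_def simps vars0 full_bracket_antisym[of r "pmonom (pvar j)"] algebra_simps del: One_nat_def)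
  have 2: "J f g (pmonom (pvar l)) = 0" for f g l
  proof (rule derivation_eq_0[of "\<lambda>g. J f g (pmonom (pvar l))"])
    fix g h
    show "J f (g * h) (pmonom (pvar l)) = g * J f h (pmonom (pvar l)) + h * J f g (pmonom (pvar l))"
      by (simp add: J_def simps algebra_simps)
  next
    show "J f (pmonom (pvar j)) (pmonom (pvar l)) = 0" for j by (rule 1)
  qed (simp_all add: J_def simps algebra_simps del: One_nat_def)
  have "J f g h = 0"
  proof (rule derivation_eq_0[of "J f g"])
    show "J f g (pmonom (pvar l)) = 0" for l by (rule 2)
  qed (simp_all add: J_def simps algebra_simps del: One_nat_def)
  then show ?thesis by (simp add: J_def algebra_simps)
qed

lemma ptrunc_full_bracket_ptrunc:
  fixes f g :: "'k::field mpoly"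
  shows "ptrunc (full_bracket r (ptrunc f) g) = ptrunc (full_bracket r f g)"
  "ptrunc (full_bracket r g (ptrunc f)) = ptrunc (full_bracket r g f)"
proof -
  show 1: "ptrunc (full_bracket r (ptrunc f) g) = ptrunc (full_bracket r f g)" for f g :: "'k::field mpoly"
    by (simp add: full_bracket_def ptrunc_sum ptrunc_diff ptrunc_partial_deriv_mult_left)
  have neg: "ptrunc (- u) = - ptrunc u" for u :: "'k mpoly" using ptrunc_diff[of 0 u] by simp
  show "ptrunc (full_bracket r g (ptrunc f)) = ptrunc (full_bracket r g f)"
    unfolding full_bracket_antisym[of r g] neg 1 ..
qed

lemma poisson_bracket_jacobi:
  "poisson_bracket r f (poisson_bracket r g h) =
     poisson_bracket r (poisson_bracket r f g) h + poisson_bracket r g (poisson_bracket r f h)"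
  unfolding poisson_bracket_full ptrunc_full_bracket_ptrunc
  by (subst full_bracket_jacobi) (simp add: ptrunc_add)

lemma poisson_bracket_closed:
  assumes "f \<in> trunc_polys (2 * r)" "g \<in> trunc_polys (2 * r)"
  shows "poisson_bracket r f g \<in> trunc_polys (2 * r)"
  unfolding poisson_bracket_def using assms
  by (intro polys_in_ptrunc polys_in_sum polys_in_diff polys_in_mult polys_in_partial_deriv)
     (simp_all add: trunc_polys_altdef)

lemma poisson_bracket_self: "poisson_bracket r f f = 0"
  by (simp add: poisson_bracket_def mult.commute)

lemma finite_trunc_exps: "finite (trunc_exps p n)"
proof -
  have "inj_on lookup (trunc_exps p n)" by (simp add: inj_on_def lookup_inject)
  moreover have "lookup ` trunc_exps p n \<subseteq> {h. \<forall>j. (j \<in> {1..n} \<longrightarrow> h j \<in> {..<p}) \<and> (j \<notin> {1..n} \<longrightarrow> h j = 0)}"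
    by (auto simp: trunc_exps_def in_keys_iff)
  moreover have "finite {h :: nat \<Rightarrow> nat. \<forall>j. (j \<in> {1..n} \<longrightarrow> h j \<in> {..<p}) \<and> (j \<notin> {1..n} \<longrightarrow> h j = 0)}"
    by (rule finite_set_of_finite_funs) auto
  ultimately show ?thesis by (meson finite_imageD finite_subset)
qed

lemma mpoly_eq_sum_monomials: "f = (\<Sum>a\<in>keys f. pscale (lookup f a) (pmonom a))"
  by (rule poly_mapping_eqI)
     (auto simp: lookup_sum lookup_pscale lookup_single when_def in_keys_iff if_distrib sum.delta cong: if_cong)

lemma trunc_polys_subset_span:
  "(trunc_polys n :: 'k::field mpoly set) \<subseteq> module.span pscale (pmonom ` trunc_exps CHAR('k) n)"
proof
  interpret vector_space "pscale :: 'k \<Rightarrow> _" by (rule vector_space_pscale)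
  fix f :: "'k mpoly" assume f: "f \<in> trunc_polys n"
  have "(\<Sum>a\<in>keys f. pscale (lookup f a) (pmonom a)) \<in> span (pmonom ` trunc_exps CHAR('k) n)"
    using f by (intro span_sum span_scale span_base) (auto simp: trunc_polys_def)
  then show "f \<in> span (pmonom ` trunc_exps CHAR('k) n)" using mpoly_eq_sum_monomials[of f] by simp
qed

lemma subspace_trunc_polys: "module.subspace pscale (trunc_polys n :: 'k::field mpoly set)"
proof -
  interpret vector_space "pscale :: 'k \<Rightarrow> _" by (rule vector_space_pscale)
  show ?thesis
  proof (rule subspaceI)
    fix f g :: "'k mpoly" assume "f \<in> trunc_polys n" "g \<in> trunc_polys n"
    then show "f + g \<in> trunc_polys n" using keys_add[of f g] by (auto simp: trunc_polys_def)
  next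
    fix c and f :: "'k mpoly" assume "f \<in> trunc_polys n"
    then show "pscale c f \<in> trunc_polys n" by (auto simp: trunc_polys_def in_keys_iff lookup_pscale)
  qed (simp add: trunc_polys_def)
qed

locale restricted_poisson =
  fixes r :: nat and pm :: "'k::alg_closed_field mpoly \<Rightarrow> 'k mpoly"
  assumes char_ge_3: "CHAR('k) \<ge> 3" and r_pos: "r \<ge> 1" and p_map_pm: "poisson_p_map r pm"
begin

abbreviation L :: "('k mpoly, 'k) restricted_lie" where "L \<equiv> poisson_algebra r pm"

lemma poisson_simps:
  "carrier L = trunc_polys (2 * r)" "scl L = pscale" "brk L = poisson_bracket r" "pop L = pm"
  by (simp_all add: poisson_algebra_def)

end

sublocale restricted_poisson \<subseteq> fin_dim_restricted_lie "poisson_algebra r pm"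
proof (rule fin_dim_restricted_lie.intro)
  show "vector_space (scl (poisson_algebra r pm))" by (simp add: poisson_simps vector_space_pscale)
  show "module.subspace (scl (poisson_algebra r pm)) (carrier (poisson_algebra r pm))"
    by (simp add: poisson_simps subspace_trunc_polys)
  show "\<exists>B. finite B \<and> carrier (poisson_algebra r pm) \<subseteq> module.span (scl (poisson_algebra r pm)) B"
    unfolding poisson_simps
    by (intro exI[of _ "pmonom ` trunc_exps CHAR('k) (2 * r)"] conjI finite_imageI finite_trunc_exps trunc_polys_subset_span)
  show "CHAR('k) > 0" using char_ge_3 by simp
  show "is_p_map (poisson_algebra r pm)" using p_map_pm by (simp add: poisson_p_map_def)
  show "brk L g f = - brk L f g" for f g unfolding poisson_simps by (rule poisson_bracket_antisym)
qed (simp_all add: poisson_simps poisson_bracket_closed poisson_bracket_add_left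
    poisson_bracket_pscale_left poisson_bracket_self)

section \<open>Linear parts and orders of polynomials\<close>

definition lin :: "nat \<Rightarrow> 'k::field mpoly \<Rightarrow> 'k" where "lin j f = lookup f (pvar j)"

definition const_term :: "'k::field mpoly \<Rightarrow> 'k" where "const_term f = lookup f 0"

lemma const_term_add: "const_term (f + g) = const_term f + const_term g"
  by (simp add: const_term_def lookup_add)

lemma const_term_diff: "const_term (f - g) = const_term f - const_term g"
  by (simp add: const_term_def lookup_minus)

lemma const_term_sum: "const_term (\<Sum>i\<in>I. f i) = (\<Sum>i\<in>I. const_term (f i))"
  by (simp add: const_term_def lookup_sum)

lemma lin_add: "lin j (f + g) = lin j f + lin j g"
  by (simp add: lin_def lookup_add)

lemma lin_diff: "lin j (f - g) = lin j f - lin j g"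
  by (simp add: lin_def lookup_minus)

lemma lin_sum: "lin j (\<Sum>i\<in>I. f i) = (\<Sum>i\<in>I. lin j (f i))"
  by (simp add: lin_def lookup_sum)

lemma lin_pscale: "lin j (pscale c f) = c * lin j f"
  by (simp add: lin_def lookup_pscale)

lemma const_term_pscale: "const_term (pscale c f) = c * const_term f"
  by (simp add: const_term_def lookup_pscale)

lemma lin_partial: "lin j f = const_term (partial_deriv j f)"
  by (simp add: lin_def const_term_def lookup_partial_deriv)

lemma const_term_mult: "const_term (f * g) = const_term f * const_term (g :: 'k::field mpoly)"
proof (induction f rule: mpoly_induct)
  case (single a c)
  show ?case
  proof (induction g rule: mpoly_induct)
    case (single b d)
    have "a + b = 0 \<longleftrightarrow> a = 0 \<and> b = 0"
    proof
      assume "a + b = 0"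
      then have "lookup (a + b) j = 0" for j by simp
      then have "lookup a j = 0" "lookup b j = 0" for j by (simp_all add: lookup_add)
      then show "a = 0 \<and> b = 0" by (simp add: poly_mapping_eqI)
    qed simp
    then show ?case by (auto simp: const_term_def mult_single lookup_single when_def)
  qed (simp add: distrib_left const_term_add)
qed (simp add: distrib_right const_term_add)

lemma lin_mult: "lin j (f * g) = lin j f * const_term g + const_term f * lin j (g :: 'k::field mpoly)"
  unfolding lin_partial partial_deriv_mult const_term_add const_term_mult ..

lemma const_term_ptrunc: "CHAR('k::field) > 0 \<Longrightarrow> const_term (ptrunc f) = const_term (f :: 'k mpoly)"
  by (simp add: const_term_def lookup_ptrunc)

lemma lin_ptrunc: "CHAR('k::field) > 0 \<Longrightarrow> lin j (ptrunc f) = lin j (f :: 'k mpoly)"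
  using CHAR_gt_1[where ?'k = 'k] by (auto simp: lin_def lookup_ptrunc lookup_single when_def)

text \<open>
  The constant term of a bracket depends on the linear parts only, as their standard symplectic form.
\<close>

lemma const_term_bracket:
  assumes "CHAR('k::field) > 0"
  shows "const_term (poisson_bracket r f (g :: 'k mpoly)) =
    (\<Sum>i = 1..r. lin i f * lin (i + r) g - lin (i + r) f * lin i g)"
  unfolding poisson_bracket_def const_term_ptrunc[OF assms]
  by (simp add: const_term_sum const_term_diff const_term_mult lin_partial)

lemma lin_bracket:
  assumes "CHAR('k::field) > 0" "\<And>i. i \<in> {1..2 * r} \<Longrightarrow> lin i f = 0"
  shows "lin j (poisson_bracket r f (g :: 'k mpoly)) =
    (\<Sum>i = 1..r. lin j (partial_deriv i f) * lin (i + r) g - lin j (partial_deriv (i + r) f) * lin i g)"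
  unfolding poisson_bracket_def lin_ptrunc[OF assms(1)] lin_sum lin_diff lin_mult
  using assms(2) by (intro sum.cong) (auto simp: lin_partial[symmetric])

text \<open>The number of variables is a parameter of the degree, so that it is visibly additive.\<close>

definition tdeg :: "nat \<Rightarrow> (nat \<Rightarrow>\<^sub>0 nat) \<Rightarrow> nat" where
  "tdeg n a = (\<Sum>j = 1..n. lookup a j)"

definition ord_ge :: "nat \<Rightarrow> nat \<Rightarrow> 'k::field mpoly \<Rightarrow> bool" where
  "ord_ge n d f \<longleftrightarrow> (\<forall>a\<in>keys f. d \<le> tdeg n a)"

lemma tdeg_add: "tdeg n (a + b) = tdeg n a + tdeg n b"
  by (simp add: tdeg_def lookup_add sum.distrib)

lemma tdeg_pvar: "j \<in> {1..n} \<Longrightarrow> tdeg n (pvar j) = 1"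
  by (simp add: tdeg_def lookup_single when_def)

lemma ord_ge_diff: "ord_ge n d f \<Longrightarrow> ord_ge n d g \<Longrightarrow> ord_ge n d (f - g)"
  using keys_diff[of f g] by (auto simp: ord_ge_def)

lemma ord_ge_sum: "(\<And>i. i \<in> I \<Longrightarrow> ord_ge n d (f i)) \<Longrightarrow> ord_ge n d (\<Sum>i\<in>I. f i)"
proof (induction I rule: infinite_finite_induct)
  case (insert i I)
  then show ?case using keys_add[of "f i" "sum f I"] by (fastforce simp: ord_ge_def)
qed (auto simp: ord_ge_def)

lemma ord_ge_mult:
  assumes "ord_ge n d f" "ord_ge n e g" shows "ord_ge n (d + e) (f * g)"
  unfolding ord_ge_def
proof
  fix c assume "c \<in> keys (f * g)"
  then obtain a b where "c = a + b" "a \<in> keys f" "b \<in> keys g" using keys_mult[of f g] by blast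
  then show "d + e \<le> tdeg n c" using assms by (auto simp: ord_ge_def tdeg_add intro: add_mono)
qed

lemma ord_ge_partial:
  assumes "ord_ge n d f" "j \<in> {1..n}" shows "ord_ge n (d - 1) (partial_deriv j f)"
  unfolding ord_ge_def
proof
  fix a assume "a \<in> keys (partial_deriv j f)"
  then have "a + pvar j \<in> keys f" by (auto simp: in_keys_iff lookup_partial_deriv)
  then show "d - 1 \<le> tdeg n a" using assms by (auto simp: ord_ge_def tdeg_add tdeg_pvar simp del: One_nat_def dest!: bspec)
qed

lemma ord_ge_ptrunc: "ord_ge n d f \<Longrightarrow> ord_ge n d (ptrunc f)"
  using keys_ptrunc[of f] by (auto simp: ord_ge_def)

(* the exponent vectors pvar j contain the numeral 1, so it is kept as it is *)
declare One_nat_def [simp del]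

section \<open>The dimension of the tori of the Poisson algebra\<close>

context fin_dim_restricted_lie
begin

text \<open>
  An operator on a nonzero finite-dimensional space has an eigenvector: if \<open>q\<close> is the polynomial of a
  shortest relation between \<open>v, A v, A^2 v, \<dots>\<close> and \<open>q = (X - \<lambda>) q'\<close>, then \<open>q'(A) v\<close> is one.
\<close>

lemma exists_eigenvector:
  assumes S: "subspace S" "S \<subseteq> carrier L" and v: "v \<in> S" "v \<noteq> 0"
    and A: "\<And>x. x \<in> S \<Longrightarrow> A x \<in> S" "\<And>x y. x \<in> S \<Longrightarrow> y \<in> S \<Longrightarrow> A (x + y) = A x + A y"
      "\<And>x c. x \<in> S \<Longrightarrow> A (scl L c x) = scl L c (A x)"
  shows "\<exists>u\<in>S. u \<noteq> 0 \<and> (\<exists>\<mu>. A u = scl L \<mu> u)"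
proof -
  let ?g = "\<lambda>i. (A ^^ i) v"
  have gS: "?g i \<in> S" for i by (induction i) (auto intro: v(1) A(1))
  have Asum: "(\<Sum>i<n. scl L (c i) (?g i)) \<in> S \<and>
      A (\<Sum>i<n. scl L (c i) (?g i)) = (\<Sum>i<n. scl L (c i) (?g (Suc i)))" for n c
  proof (induction n)
    case 0
    show ?case using A(3)[OF subspace_0[OF S(1)], of 0] subspace_0[OF S(1)] by simp
  next
    case (Suc n)
    have "scl L (c n) (?g n) \<in> S" using gS S(1) by (auto intro: subspace_scale)
    then show ?case using Suc A(2,3) gS S(1) by (auto intro: subspace_add)
  qed
  have step: "family_independent (Suc m) ?g" if "family_independent m ?g" "?g m \<notin> family_span m ?g" for m
  proof -
    have "?g(m := ?g m) = ?g" by auto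
    then show ?thesis using family_independent_Suc[OF that] by simp
  qed
  have ind1: "family_independent (Suc 0) ?g" using v(2) by (auto simp: family_independent_def)
  have "\<exists>m. family_independent (Suc m) ?g \<and> \<not> family_independent (Suc (Suc m)) ?g"
  proof (rule ccontr)
    assume "\<not> ?thesis"
    then have "family_independent (Suc m) ?g" for m by (induction m) (use ind1 in auto)
    then have "Suc m \<le> dim (carrier L)" for m using gS S(2) by (intro carrier_family_bound) auto
    from this[of "dim (carrier L)"] show False by simp
  qed
  then obtain m where m: "family_independent (Suc m) ?g" "?g (Suc m) \<in> family_span (Suc m) ?g"
    using step by blast
  then obtain c where c: "?g (Suc m) = (\<Sum>i<Suc m. scl L (c i) (?g i))" by (auto simp: family_span_def)
  define q where "q = monom 1 (Suc m) - (\<Sum>i<Suc m. monom (c i) i)"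
  have coeff_q: "coeff q i = (if i = Suc m then 1 else if i < Suc m then - c i else 0)" for i
    by (auto simp: q_def coeff_sum simp del: sum.lessThan_Suc)
  have degq: "degree q = Suc m"
    by (rule antisym[OF degree_le le_degree]) (auto simp: coeff_q)
  then obtain \<mu> where "poly q \<mu> = 0" using alg_closed_imp_poly_has_root[of q] by auto
  then obtain q' where q': "q = [:-\<mu>, 1:] * q'" by (metis dvdE poly_eq_0_iff_dvd)
  have "q' \<noteq> 0" using degq q' by auto
  then have degq': "degree q' = m" using degq unfolding q' by (subst (asm) degree_mult_eq) auto
  have cq: "coeff q i = (case i of 0 \<Rightarrow> 0 | Suc j \<Rightarrow> coeff q' j) - \<mu> * coeff q' i" for i
    unfolding q' by (cases i) (simp_all add: coeff_pCons)
  have lead: "coeff q' m = 1"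
    using cq[of "Suc m"] coeff_q[of "Suc m"] coeff_eq_0[of q' "Suc m"] degq' by simp
  let ?u = "\<Sum>i<Suc m. scl L (coeff q' i) (?g i)"
  have "A ?u = (\<Sum>i<Suc m. scl L (coeff q' i) (?g (Suc i)))" using Asum by blast
  also have "\<dots> = (\<Sum>i<m. scl L (coeff q' i) (?g (Suc i))) + (\<Sum>i<Suc m. scl L (c i) (?g i))"
    unfolding sum.lessThan_Suc[of _ m] using lead c by simp
  also have "(\<Sum>i<m. scl L (coeff q' i) (?g (Suc i))) =
      (\<Sum>i<Suc m. scl L (case i of 0 \<Rightarrow> 0 | Suc j \<Rightarrow> coeff q' j) (?g i))"
    unfolding sum.lessThan_Suc_shift by simp
  also have "\<dots> + (\<Sum>i<Suc m. scl L (c i) (?g i)) =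
      (\<Sum>i<Suc m. scl L ((case i of 0 \<Rightarrow> 0 | Suc j \<Rightarrow> coeff q' j) + c i) (?g i))"
    unfolding sum.distrib[symmetric] scale_left_distrib ..
  also have "\<dots> = (\<Sum>i<Suc m. scl L (\<mu> * coeff q' i) (?g i))"
  proof (rule sum.cong[OF refl])
    fix i assume "i \<in> {..<Suc m}"
    then have "- c i = (case i of 0 \<Rightarrow> 0 | Suc j \<Rightarrow> coeff q' j) - \<mu> * coeff q' i"
      using cq[of i] coeff_q[of i] by simp
    then have "(case i of 0 \<Rightarrow> 0 | Suc j \<Rightarrow> coeff q' j) + c i = \<mu> * coeff q' i" by (simp add: algebra_simps)
    then show "scl L ((case i of 0 \<Rightarrow> 0 | Suc j \<Rightarrow> coeff q' j) + c i) (?g i) = scl L (\<mu> * coeff q' i) (?g i)" by simp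
  qed
  also have "\<dots> = scl L \<mu> ?u" by (simp add: scale_sum_right del: sum.lessThan_Suc)
  finally have eig: "A ?u = scl L \<mu> ?u" .
  have "?u \<noteq> 0"
  proof
    assume "?u = 0"
    then have "\<forall>i<Suc m. coeff q' i = 0" by (rule m(1)[unfolded family_independent_def, THEN spec, THEN mp])
    then show False using lead by simp
  qed
  then show ?thesis using Asum eig by blast
qed

text \<open>
  The eigenspace of one operator is invariant under the operators that commute with it.
\<close>

lemma exists_common_eigenvector:
  fixes m :: nat
  assumes "subspace S" "S \<subseteq> carrier L" "v \<in> S" "v \<noteq> 0"
    and A: "\<And>i x. i < m \<Longrightarrow> x \<in> S \<Longrightarrow> A i x \<in> S" "\<And>i x y. i < m \<Longrightarrow> x \<in> S \<Longrightarrow> y \<in> S \<Longrightarrow> A i (x + y) = A i x + A i y"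
      "\<And>i x c. i < m \<Longrightarrow> x \<in> S \<Longrightarrow> A i (scl L c x) = scl L c (A i x)"
      "\<And>i j x. i < m \<Longrightarrow> j < m \<Longrightarrow> x \<in> S \<Longrightarrow> A i (A j x) = A j (A i x)"
  shows "\<exists>u\<in>S. u \<noteq> 0 \<and> (\<forall>i<m. \<exists>\<mu>. A i u = scl L \<mu> u)"
  using assms
proof (induction m arbitrary: S v)
  case 0
  then show ?case by blast
next
  case (Suc m)
  have "\<exists>u\<in>S. u \<noteq> 0 \<and> (\<exists>\<mu>. A m u = scl L \<mu> u)"
    by (rule exists_eigenvector[OF Suc.prems(1-4)]) (use Suc.prems(5-7) in auto)
  then obtain u \<mu> where u: "u \<in> S" "u \<noteq> 0" "A m u = scl L \<mu> u" by blast
  let ?S = "{x \<in> S. A m x = scl L \<mu> x}"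
  have A0: "A m 0 = 0" using Suc.prems(7)[of m 0 0] subspace_0[OF Suc.prems(1)] by simp
  have sub: "subspace ?S"
    using Suc.prems(1) Suc.prems(6)[of m] Suc.prems(7)[of m] A0
    by (intro subspaceI) (auto intro: subspace_0 subspace_add subspace_scale simp: scale_right_distrib mult.commute)
  have "\<exists>w\<in>?S. w \<noteq> 0 \<and> (\<forall>i<m. \<exists>\<mu>. A i w = scl L \<mu> w)"
  proof (rule Suc.IH[OF sub])
    show "?S \<subseteq> carrier L" using Suc.prems(2) by blast
    show "u \<in> ?S" "u \<noteq> 0" using u by auto
  next
    fix i x assume i: "i < m" and x: "x \<in> ?S"
    have "A m (A i x) = A i (A m x)" by (rule Suc.prems(8)) (use i x in auto)
    also have "\<dots> = scl L \<mu> (A i x)" using x i Suc.prems(7)[of i x \<mu>] by simp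
    finally show "A i x \<in> ?S" using x i Suc.prems(5)[of i x] by simp
  qed (use Suc.prems(6-8) in auto)
  then show ?case using less_Suc_eq by auto
qed

end

context restricted_poisson
begin

lemmas pscale_left_distrib = scale_left_distrib[unfolded poisson_simps]
  and pscale_right_distrib = scale_right_distrib[unfolded poisson_simps]
  and pscale_right_diff_distrib = scale_right_diff_distrib[unfolded poisson_simps]
  and pscale_minus_left = scale_minus_left[unfolded poisson_simps]
  and pscale_minus_right = scale_minus_right[unfolded poisson_simps]
  and pscale_one = scale_one[unfolded poisson_simps]
  and pscale_pscale = scale_scale[unfolded poisson_simps]
  and pscale_sum_left = scale_sum_left[unfolded poisson_simps]
  and pscale_sum_right = scale_sum_right[unfolded poisson_simps]
  and pscale_zero_left = scale_zero_left[unfolded poisson_simps]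
  and pscale_zero_right = scale_zero_right[unfolded poisson_simps]
  and pscale_eq_0_iff = scale_eq_0_iff[unfolded poisson_simps]
  and trunc_polys_add = subspace_add[OF carrier_subspace, unfolded poisson_simps]
  and trunc_polys_diff = subspace_diff[OF carrier_subspace, unfolded poisson_simps]
  and trunc_polys_scale = subspace_scale[OF carrier_subspace, unfolded poisson_simps]
  and trunc_polys_sum = subspace_sum[OF carrier_subspace, unfolded poisson_simps]

definition linpart :: "'k mpoly \<Rightarrow> 'k mpoly" where
  "linpart f = (\<Sum>j = 1..2 * r. pscale (lin j f) (pmonom (pvar j)))"

lemma pvar_trunc: "j \<in> {1..2 * r} \<Longrightarrow> (pmonom (pvar j) :: 'k mpoly) \<in> trunc_polys (2 * r)"
  using char_ge_3 by (auto simp: trunc_polys_def trunc_exps_def lookup_single when_def)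

lemma pvar_eq_iff: "pvar i = pvar j \<longleftrightarrow> i = j"
proof
  assume "pvar i = pvar j"
  then have "lookup (pvar i) i = lookup (pvar j) i" by simp
  then show "i = j" by (simp add: lookup_single when_def split: if_splits)
qed simp

lemma lin_pvar: "lin i (pmonom (pvar j) :: 'k mpoly) = (if i = j then 1 else 0)"
  by (auto simp: lin_def lookup_single when_def pvar_eq_iff)

lemma lin_combination:
  assumes "finite I"
  shows "lin i (\<Sum>j\<in>I. pscale (\<alpha> j) (pmonom (pvar j)) :: 'k mpoly) = (if i \<in> I then \<alpha> i else 0)"
proof -
  have "lin i (\<Sum>j\<in>I. pscale (\<alpha> j) (pmonom (pvar j)) :: 'k mpoly) = (\<Sum>j\<in>I. if i = j then \<alpha> j else 0)"
    unfolding lin_sum lin_pscale lin_pvar by (intro sum.cong) auto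
  then show ?thesis using assms by simp
qed

lemma lin_linpart: "lin i (linpart f) = (if i \<in> {1..2 * r} then lin i f else 0)"
  unfolding linpart_def by (rule lin_combination) simp

lemma linpart_closed: "linpart f \<in> trunc_polys (2 * r)"
  unfolding linpart_def using carrier_subspace pvar_trunc
  by (intro subspace_sum[unfolded poisson_simps] subspace_scale[unfolded poisson_simps]) (auto simp: poisson_simps)

lemma linpart_cong: "(\<And>j. j \<in> {1..2 * r} \<Longrightarrow> lin j f = lin j g) \<Longrightarrow> linpart f = linpart g"
  unfolding linpart_def by (intro sum.cong) auto

lemma linpart_add: "linpart (f + g) = linpart f + linpart g"
  unfolding linpart_def lin_add sum.distrib[symmetric]
  by (intro sum.cong refl pscale_left_distrib)

lemma linpart_scale: "linpart (pscale c f) = pscale c (linpart f)"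
  unfolding linpart_def lin_pscale pscale_sum_right by (simp add: pscale_pscale)

lemma linpart_eq_0_iff: "linpart f = 0 \<longleftrightarrow> (\<forall>j\<in>{1..2 * r}. lin j f = 0)"
proof
  assume "linpart f = 0"
  then have "lin j (linpart f) = 0" for j by (simp add: lin_def)
  then show "\<forall>j\<in>{1..2 * r}. lin j f = 0" using lin_linpart by (metis (full_types))
next
  assume "\<forall>j\<in>{1..2 * r}. lin j f = 0"
  then show "linpart f = 0" unfolding linpart_def by (intro sum.neutral) (auto simp: pscale_zero_left)
qed

lemma linpart_0 [simp]: "linpart 0 = 0"
  by (simp add: linpart_eq_0_iff lin_def)

lemma linpart_idem: "linpart (linpart f) = linpart f"
  by (rule linpart_cong) (simp add: lin_linpart)

lemma index_shift: "i \<in> {1..r} \<Longrightarrow> i \<in> {1..2 * r} \<and> i + r \<in> {1..2 * r}"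
  by auto

lemma const_term_brk_linpart:
  "const_term (poisson_bracket r (linpart f) g) = const_term (poisson_bracket r f g)"
  "const_term (poisson_bracket r f (linpart g)) = const_term (poisson_bracket r f g)"
  unfolding const_term_bracket[OF char_pos] using index_shift by (auto simp: lin_linpart intro!: sum.cong)

lemma const_term_brk_no_linear:
  assumes "linpart f = 0"
  shows "const_term (poisson_bracket r f g) = 0" "const_term (poisson_bracket r g f) = 0"
  using assms index_shift unfolding const_term_bracket[OF char_pos] linpart_eq_0_iff by (auto intro!: sum.neutral)

lemma linpart_brk_linpart:
  assumes "linpart f = 0"
  shows "linpart (poisson_bracket r f (linpart g)) = linpart (poisson_bracket r f g)"
proof (rule linpart_cong)
  fix j
  have f: "\<And>i. i \<in> {1..2 * r} \<Longrightarrow> lin i f = 0" using assms by (simp add: linpart_eq_0_iff)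
  have *: "lin j (poisson_bracket r f h) =
      (\<Sum>i = 1..r. lin j (partial_deriv i f) * lin (i + r) h - lin j (partial_deriv (i + r) f) * lin i h)" for h
    by (rule lin_bracket[OF char_pos]) (rule f)
  show "lin j (poisson_bracket r f (linpart g)) = lin j (poisson_bracket r f g)"
    unfolding * using index_shift by (auto simp: lin_linpart intro!: sum.cong)
qed

text \<open>
  An isotropic family and a family that is dual to it under the symplectic form are jointly
  independent, in a space of dimension \<open>2 r\<close>.
\<close>

lemma isotropic_bound:
  assumes ind: "family_independent n w" and lin: "\<And>i. i < n \<Longrightarrow> linpart (w i) = w i"
    and iso: "\<And>i j. i < n \<Longrightarrow> j < n \<Longrightarrow> const_term (poisson_bracket r (w i) (w j)) = 0"
  shows "n \<le> r"
proof -
  obtain \<xi> where \<xi>: "\<And>i. Vector_Spaces.linear (scl L) (*) (\<xi> i)"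
    and dual: "\<And>i j. j < n \<Longrightarrow> \<xi> i (w j) = (if i = j then 1 else 0)"
    using exists_dual_family[OF ind] by blast
  define v where "v i = (\<Sum>j = 1..2 * r. pscale (if j \<le> r then \<xi> i (pmonom (pvar (j + r))) else - \<xi> i (pmonom (pvar (j - r)))) (pmonom (pvar j)))" for i
  have linv: "lin j (v i) = (if j \<in> {1..2 * r} then if j \<le> r then \<xi> i (pmonom (pvar (j + r))) else - \<xi> i (pmonom (pvar (j - r))) else 0)" for i j
    unfolding v_def by (rule lin_combination) simp
  \<comment> \<open>the form identifies the functional \<open>\<xi> i\<close> with the vector \<open>v i\<close>\<close>
  have vw: "const_term (poisson_bracket r (v i) (w l)) = (if i = l then 1 else 0)" if l: "l < n" for i l
  proof -
    have "const_term (poisson_bracket r (v i) (w l)) =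
        (\<Sum>j = 1..r. lin (j + r) (w l) * \<xi> i (pmonom (pvar (j + r))) + lin j (w l) * \<xi> i (pmonom (pvar j)))"
      unfolding const_term_bracket[OF char_pos] by (intro sum.cong) (auto simp: linv)
    also have "\<dots> = (\<Sum>j = 1..r. lin j (w l) * \<xi> i (pmonom (pvar j))) + (\<Sum>j = 1..r. lin (j + r) (w l) * \<xi> i (pmonom (pvar (j + r))))"
      by (simp add: sum.distrib add.commute)
    also have "(\<Sum>j = 1..r. lin (j + r) (w l) * \<xi> i (pmonom (pvar (j + r)))) = (\<Sum>j = Suc r..2 * r. lin j (w l) * \<xi> i (pmonom (pvar j)))"
      by (rule sum.reindex_bij_witness[of _ "\<lambda>j. j - r" "\<lambda>j. j + r"]) auto
    also have "(\<Sum>j = 1..r. lin j (w l) * \<xi> i (pmonom (pvar j))) + \<dots> = (\<Sum>j = 1..2 * r. lin j (w l) * \<xi> i (pmonom (pvar j)))"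
      using sum.ub_add_nat[of 1 r "\<lambda>j. lin j (w l) * \<xi> i (pmonom (pvar j))" r] by (simp add: mult_2 Suc_eq_plus1)
    also have "\<dots> = \<xi> i (linpart (w l))"
      unfolding linpart_def linear_functional_sum[OF \<xi>, unfolded poisson_simps] ..
    also have "\<dots> = (if i = l then 1 else 0)" using lin[OF l] dual[OF l] by simp
    finally show ?thesis .
  qed
  let ?g = "\<lambda>i. if i < n then w i else v (i - n)"
  have "family_independent (n + n) ?g"
    unfolding family_independent_def
  proof (intro allI impI)
    fix c i assume "(\<Sum>i<n + n. scl L (c i) (?g i)) = 0" and i: "i < n + n"
    then have 0: "(\<Sum>i<n. pscale (c i) (w i)) + (\<Sum>i<n. pscale (c (n + i)) (v i)) = 0"
      unfolding sum_lessThan_add poisson_simps by (simp cong: sum.cong_simp)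
    have ct: "const_term (poisson_bracket r (\<Sum>i<n. pscale (d i) (u i)) x) = (\<Sum>i<n. d i * const_term (poisson_bracket r (u i) x))"
      for d x and u :: "nat \<Rightarrow> 'k mpoly"
    proof (induction n)
      case 0
      show ?case by (simp add: poisson_bracket_def partial_deriv_def const_term_def)
    next
      case (Suc n)
      then show ?case by (simp add: poisson_bracket_add_left const_term_add poisson_bracket_pscale_left const_term_pscale)
    qed
    have cv: "c (n + l) = 0" if l: "l < n" for l
    proof -
      have "const_term (poisson_bracket r ((\<Sum>i<n. pscale (c i) (w i)) + (\<Sum>i<n. pscale (c (n + i)) (v i))) (w l)) =
          (\<Sum>i<n. c i * const_term (poisson_bracket r (w i) (w l))) + (\<Sum>i<n. c (n + i) * const_term (poisson_bracket r (v i) (w l)))"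
        by (simp add: poisson_bracket_add_left const_term_add ct)
      also have "\<dots> = (\<Sum>i<n. c (n + i) * (if i = l then 1 else 0))" using iso vw l by simp
      also have "\<dots> = c (n + l)" using l by (simp add: if_distrib cong: if_cong)
      finally show ?thesis unfolding 0 by (simp add: poisson_bracket_def partial_deriv_def const_term_def)
    qed
    then have "(\<Sum>i<n. scl L (c i) (w i)) = 0" using 0 by (simp add: poisson_simps pscale_zero_left)
    then have "\<forall>i<n. c i = 0" by (rule ind[unfolded family_independent_def, THEN spec, THEN mp])
    then show "c i = 0" using cv[of "i - n"] i by (cases "i < n") auto
  qed
  moreover have "?g i \<in> family_span (2 * r) (\<lambda>j. pmonom (pvar (Suc j)))" if "i < n + n" for i
  proof -
    have sp: "(\<Sum>j = 1..2 * r. pscale (d j) (pmonom (pvar j))) \<in> family_span (2 * r) (\<lambda>j. pmonom (pvar (Suc j)))" for d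
    proof -
      have "(\<Sum>j = 1..2 * r. pscale (d j) (pmonom (pvar j))) = (\<Sum>j<2 * r. scl L (d (Suc j)) (pmonom (pvar (Suc j))))"
        unfolding poisson_simps by (rule sum.reindex_bij_witness[of _ Suc "\<lambda>j. j - 1"]) auto
      then show ?thesis by (simp only: family_spanI)
    qed
    show ?thesis
    proof (cases "i < n")
      case True
      then show ?thesis using sp[of "\<lambda>j. lin j (w i)"] lin[OF True] by (simp add: linpart_def)
    next
      case False
      then show ?thesis using sp unfolding v_def by simp
    qed
  qed
  ultimately have "n + n \<le> 2 * r" by (rule family_independent_bound)
  then show ?thesis by simp
qed

subsection \<open>The action of a torus on linear parts\<close>

lemma partial_deriv_pvar: "partial_deriv i (pmonom (pvar j) :: 'k mpoly) = (if i = j then 1 else 0)"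
  by (auto simp: partial_deriv_single lookup_single when_def)

lemma brk_pvar:
  assumes "i \<in> {1..r}"
  shows "poisson_bracket r f (pmonom (pvar (i + r))) = ptrunc (partial_deriv i f :: 'k mpoly)"
    "poisson_bracket r f (pmonom (pvar i)) = - ptrunc (partial_deriv (i + r) f :: 'k mpoly)"
proof -
  have "(\<Sum>l = 1..r. partial_deriv l f * partial_deriv (l + r) (pmonom (pvar (i + r))) -
      partial_deriv (l + r) f * partial_deriv l (pmonom (pvar (i + r)))) = (\<Sum>l = 1..r. if l = i then partial_deriv l f else 0)"
    using assms by (intro sum.cong) (auto simp: partial_deriv_pvar)
  then show "poisson_bracket r f (pmonom (pvar (i + r))) = ptrunc (partial_deriv i f)"
    using assms by (simp add: poisson_bracket_def)
  have "(\<Sum>l = 1..r. partial_deriv l f * partial_deriv (l + r) (pmonom (pvar i)) -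
      partial_deriv (l + r) f * partial_deriv l (pmonom (pvar i))) = (\<Sum>l = 1..r. if l = i then 0 - partial_deriv (l + r) f else 0)"
    using assms by (intro sum.cong) (auto simp: partial_deriv_pvar)
  then show "poisson_bracket r f (pmonom (pvar i)) = - ptrunc (partial_deriv (i + r) f)"
    using assms ptrunc_diff[of 0 "partial_deriv (i + r) f"] by (simp add: poisson_bracket_def)
qed

lemma brk_pvar_cases:
  fixes f :: "'k mpoly"
  assumes "i \<in> {1..2 * r}"
  shows "\<exists>j\<in>{1..2 * r}. poisson_bracket r f (pmonom (pvar j)) = ptrunc (partial_deriv i f) \<or>
     poisson_bracket r f (pmonom (pvar j)) = - ptrunc (partial_deriv i f)"
proof (cases "i \<le> r")
  case True
  then show ?thesis using brk_pvar(1)[of i f] assms by (intro bexI[of _ "i + r"]) auto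
next
  case False
  then have "i - r \<in> {1..r}" "i - r + r = i" using assms by auto
  then show ?thesis using brk_pvar(2)[of "i - r" f] by (intro bexI[of _ "i - r"]) auto
qed

lemma exp_decompose:
  assumes "lookup a j > 0" shows "a = (a - pvar j) + pvar j"
  using assms by (intro poly_mapping_eqI) (auto simp: lookup_add lookup_minus lookup_single when_def)

lemma of_nat_nonzero: "0 < m \<Longrightarrow> m < CHAR('k) \<Longrightarrow> (of_nat m :: 'k) \<noteq> 0"
  by (simp add: of_nat_eq_0_iff_char_dvd nat_dvd_not_less)

text \<open>
  Brackets with the variables are partial derivatives, up to sign, and the exponents are less than \<open>p\<close>.
\<close>

lemma const_if_central:
  fixes f :: "'k mpoly"
  assumes f: "f \<in> trunc_polys (2 * r)" and c: "\<And>j. j \<in> {1..2 * r} \<Longrightarrow> poisson_bracket r f (pmonom (pvar j)) = 0"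
  shows "f = Poly_Mapping.single 0 (const_term f)"
proof (rule poly_mapping_eqI)
  fix a show "lookup f a = lookup (Poly_Mapping.single 0 (const_term f)) a"
  proof (cases "a = 0")
    case True
    then show ?thesis by (simp add: const_term_def)
  next
    case False
    have "lookup f a = 0"
    proof (rule ccontr)
      assume nz: "lookup f a \<noteq> 0"
      then have a: "keys a \<subseteq> {1..2 * r}" "\<And>j. lookup a j < CHAR('k)"
        using f by (auto simp: trunc_polys_def trunc_exps_def in_keys_iff)
      obtain i where i: "lookup a i > 0" using False poly_mapping_eqI[of a 0] by force
      then have "i \<in> keys a" by (simp add: in_keys_iff)
      then have "i \<in> {1..2 * r}" using a(1) by blast
      then obtain j where "j \<in> {1..2 * r}" "poisson_bracket r f (pmonom (pvar j)) = ptrunc (partial_deriv i f) \<or>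
          poisson_bracket r f (pmonom (pvar j)) = - ptrunc (partial_deriv i f)" using brk_pvar_cases by blast
      then have "ptrunc (partial_deriv i f) = 0" using c by auto
      then have "lookup (ptrunc (partial_deriv i f)) (a - pvar i) = 0" by simp
      moreover have "\<forall>j. lookup (a - pvar i) j < CHAR('k)"
        using a(2) by (auto simp: lookup_minus intro: le_less_trans[OF diff_le_self])
      ultimately have "of_nat (lookup (a - pvar i) i + 1) * lookup f a = 0"
        using exp_decompose[OF i] by (simp add: lookup_ptrunc lookup_partial_deriv)
      moreover have "lookup (a - pvar i) i + 1 = lookup a i" using i by (simp add: lookup_minus)
      ultimately show False using nz of_nat_nonzero[OF i a(2)] by simp
    qed
    then show ?thesis using False by (simp add: lookup_single when_def)
  qed
qed

lemma tdeg_0: "keys a \<subseteq> {1..n} \<Longrightarrow> tdeg n a = 0 \<Longrightarrow> a = 0"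
proof (rule poly_mapping_eqI, rule ccontr)
  fix j assume k: "keys a \<subseteq> {1..n}" and z: "tdeg n a = 0" and "lookup a j \<noteq> lookup 0 j"
  then have j: "lookup a j \<noteq> 0" by simp
  then have "j \<in> {1..n}" using k by (simp only: in_keys_iff[symmetric]) blast
  then show False using z j by (simp add: tdeg_def)
qed

lemma tdeg_Suc:
  assumes "keys a \<subseteq> {1..n}" "tdeg n a = Suc d"
  shows "\<exists>j\<in>{1..n}. \<exists>b. a = b + pvar j \<and> keys b \<subseteq> {1..n} \<and> tdeg n b = d"
proof -
  have "\<exists>j\<in>{1..n}. lookup a j \<noteq> 0"
  proof (rule ccontr)
    assume "\<not> ?thesis"
    then have "tdeg n a = 0" by (auto simp: tdeg_def)
    then show False using assms(2) by simp
  qed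
  then obtain j where j: "j \<in> {1..n}" "lookup a j > 0" by auto
  note dec = exp_decompose[OF j(2)]
  have "tdeg n (a - pvar j + pvar j) = tdeg n (a - pvar j) + 1" using tdeg_add[of n "a - pvar j" "pvar j"] tdeg_pvar[OF j(1)] by simp
  then have "tdeg n a = tdeg n (a - pvar j) + 1" by (simp only: dec[symmetric])
  moreover have "keys (a - pvar j) \<subseteq> keys a" by (auto simp: in_keys_iff lookup_minus)
  ultimately have "a = a - pvar j + pvar j \<and> keys (a - pvar j) \<subseteq> {1..n} \<and> tdeg n (a - pvar j) = d"
    using dec assms by (intro conjI) (assumption | simp | blast)+
  then show ?thesis using j(1) by blast
qed

text \<open>
  A toral element \<open>f\<close> without linear part that acts trivially on linear parts has no quadratic part
  either, so bracketing with \<open>f\<close> raises the order. But \<open>ad f\<close> equals all its \<open>p ^ m\<close>-th powers.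
\<close>

lemma toral_faithful_on_linear_parts:
  assumes f: "f \<in> trunc_polys (2 * r)" and tor: "pm f = f" and lin: "linpart f = 0"
    and triv: "\<And>v. linpart (poisson_bracket r f v) = 0"
  shows "f = Poly_Mapping.single 0 (const_term f)"
proof -
  let ?n = "2 * r"
  have quad: "lookup f (pvar j + pvar i) = 0" if ij: "i \<in> {1..?n}" "j \<in> {1..?n}" for i j
  proof -
    obtain l where l: "poisson_bracket r f (pmonom (pvar l)) = ptrunc (partial_deriv i f) \<or>
        poisson_bracket r f (pmonom (pvar l)) = - ptrunc (partial_deriv i f)" using brk_pvar_cases[OF ij(1)] by blast
    have "lin j (poisson_bracket r f (pmonom (pvar l))) = 0" using triv ij(2) by (simp add: linpart_eq_0_iff)
    moreover have "lin j (- u) = - lin j u" for u :: "'k mpoly" by (simp add: lin_def lookup_uminus)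
    ultimately have "lin j (partial_deriv i f) = 0" using l by (auto simp: lin_ptrunc[OF char_pos])
    then have "of_nat (lookup (pvar j) i + 1) * lookup f (pvar j + pvar i) = 0"
      by (simp add: lin_def lookup_partial_deriv)
    moreover have "(of_nat (lookup (pvar j) i + 1) :: 'k) \<noteq> 0"
      using char_ge_3 by (intro of_nat_nonzero) (auto simp: lookup_single when_def)
    ultimately show ?thesis by simp
  qed
  let ?h = "f - Poly_Mapping.single 0 (const_term f)"
  have ord3: "ord_ge ?n 3 ?h"
    unfolding ord_ge_def
  proof (rule ballI, rule ccontr)
    fix a assume a: "a \<in> keys ?h" and "\<not> 3 \<le> tdeg ?n a"
    then have "tdeg ?n a = 0 \<or> tdeg ?n a = Suc 0 \<or> tdeg ?n a = Suc (Suc 0)" by auto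
    have a0: "a \<noteq> 0" using a by (auto simp: in_keys_iff lookup_minus const_term_def)
    then have fa: "lookup f a \<noteq> 0" using a by (auto simp: in_keys_iff lookup_minus lookup_single when_def)
    then have ka: "keys a \<subseteq> {1..?n}" using f by (auto simp: trunc_polys_def trunc_exps_def in_keys_iff)
    show False using \<open>tdeg ?n a = 0 \<or> _\<close>
    proof (elim disjE)
      assume "tdeg ?n a = 0"
      then show False using tdeg_0[OF ka] a0 by simp
    next
      assume "tdeg ?n a = Suc 0"
      then obtain j b where j: "j \<in> {1..?n}" "a = b + pvar j" "keys b \<subseteq> {1..?n}" "tdeg ?n b = 0"
        using tdeg_Suc[OF ka] by blast
      then have "a = pvar j" using tdeg_0 by simp
      then show False using fa lin j(1) by (simp add: linpart_eq_0_iff lin_def)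
    next
      assume "tdeg ?n a = Suc (Suc 0)"
      then obtain i b where i: "i \<in> {1..?n}" "a = b + pvar i" "keys b \<subseteq> {1..?n}" "tdeg ?n b = Suc 0"
        using tdeg_Suc[OF ka] by blast
      then obtain j c where j: "j \<in> {1..?n}" "b = c + pvar j" "keys c \<subseteq> {1..?n}" "tdeg ?n c = 0"
        using tdeg_Suc[OF i(3)] by blast
      then have "a = pvar j + pvar i" using i(2) tdeg_0 by simp
      then show False using fa quad[OF i(1) j(1)] by simp
    qed
  qed
  have pd: "ord_ge ?n 2 (partial_deriv i f)" if "i \<in> {1..?n}" for i
  proof -
    have "f = ?h + Poly_Mapping.single 0 (const_term f)" by simp
    then have "partial_deriv i f = partial_deriv i ?h + partial_deriv i (Poly_Mapping.single 0 (const_term f))"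
      by (metis partial_deriv_add)
    then show ?thesis using ord_ge_partial[OF ord3 that] by (simp add: partial_deriv_const)
  qed
  have raise: "ord_ge ?n (Suc d) (poisson_bracket r f g)" if g: "ord_ge ?n d g" for d g
  proof -
    have 1: "ord_ge ?n (Suc d) (u * v)" if "ord_ge ?n 2 u" "ord_ge ?n (d - 1) v" for u v :: "'k mpoly"
      using ord_ge_mult[OF that] by (auto simp: ord_ge_def)
    show ?thesis
      unfolding poisson_bracket_def using index_shift
      by (intro ord_ge_ptrunc ord_ge_sum ord_ge_diff 1 pd ord_ge_partial g) auto
  qed
  have "poisson_bracket r f (pmonom (pvar j)) = 0" if j: "j \<in> {1..?n}" for j
  proof -
    let ?x = "pmonom (pvar j) :: 'k mpoly"
    have ordm: "ord_ge ?n m ((poisson_bracket r f ^^ m) ?x)" for m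
      by (induction m) (auto simp: ord_ge_def[of _ 0] intro: raise)
    \<comment> \<open>large enough for \<open>p ^ m\<close> to exceed the degrees of all truncated polynomials\<close>
    define m where "m = ?n * CHAR('k) + 1"
    have "(pop L ^^ m) f = f" by (induction m) (use tor in \<open>auto simp: poisson_simps\<close>)
    then have "poisson_bracket r f ?x = (poisson_bracket r f ^^ (CHAR('k) ^ m)) ?x"
      using brk_pow[of f ?x m] f pvar_trunc[OF j] by (simp add: poisson_simps)
    then have o: "ord_ge ?n (CHAR('k) ^ m) (poisson_bracket r f ?x)" using ordm by simp
    have "m < CHAR('k) ^ m" using p_gt_1 by (simp add: power_gt_expt)
    moreover have fx: "poisson_bracket r f ?x \<in> trunc_polys ?n" by (rule poisson_bracket_closed[OF f pvar_trunc[OF j]])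
    have "tdeg ?n a \<le> ?n * CHAR('k)" if "a \<in> keys (poisson_bracket r f ?x)" for a
    proof -
      have "lookup a i \<le> CHAR('k)" for i
        using fx that by (auto simp: trunc_polys_def trunc_exps_def less_imp_le)
      then have "tdeg ?n a \<le> (\<Sum>i = 1..?n. CHAR('k))" unfolding tdeg_def by (intro sum_mono) auto
      then show ?thesis by simp
    qed
    ultimately have "keys (poisson_bracket r f ?x) = {}"
      using o unfolding ord_ge_def m_def by fastforce
    then show ?thesis by simp
  qed
  then show ?thesis by (rule const_if_central[OF f])
qed

text \<open>
  The linear part of \<open>f\<close> is read off from the constant terms of its brackets with the variables. If it vanishes, then
  no bracket with \<open>f\<close> has a constant term, and \<open>ad (pm f)\<close> is a power of \<open>ad f\<close>.
\<close>

lemma linpart_pop: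
  assumes f: "f \<in> trunc_polys (2 * r)" and lin: "linpart f = 0"
  shows "linpart (pm f) = 0"
  unfolding linpart_eq_0_iff
proof
  fix i assume i: "i \<in> {1..2 * r}"
  obtain m where m: "CHAR('k) = Suc m" by (rule that[of "CHAR('k) - 1"]) (use char_pos in simp)
  obtain j where j: "j \<in> {1..2 * r}" "poisson_bracket r (pm f) (pmonom (pvar j)) = ptrunc (partial_deriv i (pm f)) \<or>
      poisson_bracket r (pm f) (pmonom (pvar j)) = - ptrunc (partial_deriv i (pm f))" using brk_pvar_cases[OF i] by blast
  have "poisson_bracket r (pm f) (pmonom (pvar j)) = (poisson_bracket r f ^^ CHAR('k)) (pmonom (pvar j))"
    using brk_pop[of f "pmonom (pvar j)"] f pvar_trunc[OF j(1)] by (simp add: poisson_simps)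
  then have "const_term (poisson_bracket r (pm f) (pmonom (pvar j))) = 0"
    using const_term_brk_no_linear(1)[OF lin] unfolding m by simp
  moreover have "const_term (- u) = - const_term u" for u :: "'k mpoly" by (simp add: const_term_def lookup_uminus)
  ultimately have "const_term (partial_deriv i (pm f)) = 0"
    using j(2) by (auto simp: const_term_ptrunc[OF char_pos])
  then show "lin i (pm f) = 0" by (simp add: lin_partial)
qed

lemma linpart_ad_pow:
  assumes "linpart f = 0"
  shows "linpart ((poisson_bracket r f ^^ m) v) = ((\<lambda>u. linpart (poisson_bracket r f u)) ^^ m) (linpart v)"
proof (induction m)
  case (Suc m)
  have "linpart ((poisson_bracket r f ^^ Suc m) v) = linpart (poisson_bracket r f (linpart ((poisson_bracket r f ^^ m) v)))"
    by (simp add: linpart_brk_linpart[OF assms])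
  then show ?case using Suc by simp
qed simp

text \<open>
  A torus \<open>t0\<close> without linear parts acts on the symplectic space of linear parts. If \<open>t0\<close> is not
  central, then it has a common eigenvector \<open>v\<close> of nonzero weight; by invariance of the form, \<open>v\<close> can be
  added to any isotropic subspace killed by \<open>t0\<close>, and the new subspace is killed by the kernel of
  the weight, which is a torus of codimension one in \<open>t0\<close>.
\<close>

lemma torus_isotropic_bound:
  fixes n :: nat and w :: "nat \<Rightarrow> 'k mpoly"
  assumes "torus L t0" "\<And>f. f \<in> t0 \<Longrightarrow> linpart f = 0"
    "family_independent n w" "\<And>i. i < n \<Longrightarrow> linpart (w i) = w i"
    "\<And>i j. i < n \<Longrightarrow> j < n \<Longrightarrow> const_term (poisson_bracket r (w i) (w j)) = 0"
    "\<And>f i. f \<in> t0 \<Longrightarrow> i < n \<Longrightarrow> linpart (poisson_bracket r f (w i)) = 0"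
  shows "dim t0 + n \<le> r + 1"
  using assms
proof (induction "dim t0" arbitrary: t0 n w rule: less_induct)
  case less
  note tor = less.prems(1) and lin0 = less.prems(2) and indw = less.prems(3) and linw = less.prems(4)
    and iso = less.prems(5) and kill = less.prems(6)
  have A: "abelian_p_subalgebra t0" using torus_abelian[OF tor] .
  note sub = abelian_p_subalgebraD(2)[OF A]
  have tc: "f \<in> trunc_polys (2 * r)" if "f \<in> t0" for f
    using abelian_p_subalgebraD(1)[OF A] that by (auto simp: poisson_simps)
  have nr: "n \<le> r" by (rule isotropic_bound[OF indw linw iso])
  let ?C = "family_span 1 (\<lambda>_. (1 :: 'k mpoly))"
  show ?case
  proof (cases "t0 \<subseteq> ?C")
    case True
    obtain b where "family_independent (dim t0) b" "\<forall>i<dim t0. b i \<in> t0"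
      using exists_basis_of_subspace[OF sub abelian_p_subalgebraD(1)[OF A]] by (elim exE conjE) (rule that, assumption+)
    then have "dim t0 \<le> 1" using True by (intro family_independent_bound) auto
    then show ?thesis using nr by simp
  next
    case False
    have "\<exists>f\<in>toral_elements t0. f \<notin> ?C"
    proof (rule ccontr)
      assume "\<not> ?thesis"
      then have "span (toral_elements t0) \<subseteq> ?C" by (intro span_minimal subspace_family_span) blast
      then show False using False torus_eq_span_toral[OF tor] by simp
    qed
    then obtain f where f: "f \<in> t0" "pm f = f" "f \<notin> ?C" by (auto simp: toral_elements_def poisson_simps)
    have constC: "Poly_Mapping.single 0 c \<in> ?C" for c :: 'k
      using family_spanI[of "\<lambda>_. c" "\<lambda>_. 1" 1] by (simp add: poisson_simps pscale_def)
    define A where "A g u = linpart (poisson_bracket r g u)" for g u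
    have A_add: "A g (u + v) = A g u + A g v" for g u v
      by (simp add: A_def poisson_bracket_add_right linpart_add)
    have brk_scale_r: "poisson_bracket r g (pscale c u) = pscale c (poisson_bracket r g u)" for g u :: "'k mpoly" and c
      using poisson_bracket_pscale_left[of r c u g] poisson_bracket_antisym[of r g u] poisson_bracket_antisym[of r g "pscale c u"]
      by (simp add: pscale_minus_right)
    have A_scale: "A g (pscale c u) = pscale c (A g u)" for g u c
      by (simp add: A_def brk_scale_r linpart_scale)
    have A_addl: "A (g + h) u = A g u + A h u" for g h u
      by (simp add: A_def poisson_bracket_add_left linpart_add)
    have A_scalel: "A (pscale c g) u = pscale c (A g u)" for g u c
      by (simp add: A_def poisson_bracket_pscale_left linpart_scale)
    have A_lin: "A g (linpart u) = A g u" if "g \<in> t0" for g u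
      unfolding A_def by (rule linpart_brk_linpart[OF lin0[OF that]])
    have A_pow: "(A g ^^ m) (linpart u) = linpart ((poisson_bracket r g ^^ m) u)" if "g \<in> t0" for g m u
      using linpart_ad_pow[OF lin0[OF that]] by (simp add: A_def[abs_def])
    have A0: "A g 0 = 0" for g using A_scale[of g 0 0] by (simp add: pscale_zero_left)
    have A_pow0: "(A g ^^ m) 0 = 0" for g m by (induction m) (simp_all add: A0)
    have A_pop: "A (pm g) (linpart u) = (A g ^^ CHAR('k)) (linpart u)" if g: "g \<in> t0" and u: "u \<in> trunc_polys (2 * r)" for g u
    proof -
      have pg: "pm g \<in> t0" using abelian_p_subalgebraD(3)[OF \<open>abelian_p_subalgebra t0\<close> g] by (simp add: poisson_simps)
      have "A (pm g) (linpart u) = linpart (poisson_bracket r (pm g) u)"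
        by (simp only: A_lin[OF pg]) (simp only: A_def)
      also have "\<dots> = linpart ((poisson_bracket r g ^^ CHAR('k)) u)"
        using brk_pop[of g u] tc[OF g] u by (simp add: poisson_simps)
      finally show ?thesis by (simp add: A_pow[OF g])
    qed
    have A_comm: "A g (A h u) = A h (A g u)" if g: "g \<in> t0" and h: "h \<in> t0" for g h u
    proof -
      have "poisson_bracket r g h = 0" using abelian_p_subalgebraD(4)[OF \<open>abelian_p_subalgebra t0\<close> g h] by (simp add: poisson_simps)
      then have "poisson_bracket r g (poisson_bracket r h u) = poisson_bracket r h (poisson_bracket r g u)"
        using poisson_bracket_jacobi[of r g h u] by (simp add: poisson_bracket_def partial_deriv_def)
      then show ?thesis
        unfolding A_def using linpart_brk_linpart[OF lin0[OF g]] linpart_brk_linpart[OF lin0[OF h]] by simp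
    qed
    define V where "V = linpart ` trunc_polys (2 * r)"
    have VI: "linpart u \<in> V" for u
      unfolding V_def by (rule image_eqI[of _ _ "linpart u"]) (simp_all add: linpart_idem linpart_closed)
    have V_lin: "linpart v = v" if "v \<in> V" for v using that by (auto simp: V_def linpart_idem)
    have Vc: "V \<subseteq> trunc_polys (2 * r)" by (auto simp: V_def linpart_closed)
    have AV: "A g u \<in> V" for g u unfolding A_def by (rule VI)
    have subV: "subspace V"
    proof (rule subspaceI)
      show "0 \<in> V" using VI[of 0] by simp
      show "u + v \<in> V" if "u \<in> V" "v \<in> V" for u v using VI[of "u + v"] V_lin that by (simp add: linpart_add)
      show "scl L c u \<in> V" if "u \<in> V" for c u using VI[of "pscale c u"] V_lin that by (simp add: linpart_scale poisson_simps)
    qed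
    \<comment> \<open>on its image, the operator of the toral element \<open>f\<close> is invertible\<close>
    obtain u0 where u0: "A f u0 \<noteq> 0"
      using toral_faithful_on_linear_parts[OF tc[OF f(1)] f(2) lin0[OF f(1)]] constC f(3) unfolding A_def by metis
    let ?S = "A f ` V"
    have Sv: "A f u0 \<in> ?S" using A_lin[OF f(1), of u0] VI[of u0] by (metis image_eqI)
    have subS: "subspace ?S"
    proof (rule subspaceI)
      show "0 \<in> ?S" using A0 subspace_0[OF subV] by (metis image_eqI)
      show "x + y \<in> ?S" if "x \<in> ?S" "y \<in> ?S" for x y
        using that subspace_add[OF subV] by (auto simp: A_add[symmetric])
      show "scl L c x \<in> ?S" if "x \<in> ?S" for c x
        using that subspace_scale[OF subV, of _ c] by (auto simp: poisson_simps A_scale[symmetric])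
    qed
    have Sc: "?S \<subseteq> carrier L" using AV Vc by (auto simp: poisson_simps)
    have "\<exists>u\<in>?S. u \<noteq> 0 \<and> (\<exists>\<mu>. A f u = scl L \<mu> u)"
      by (rule exists_eigenvector[OF subS Sc Sv u0]) (use AV in \<open>auto simp: A_add A_scale poisson_simps\<close>)
    then obtain u a where u: "u \<in> ?S" "u \<noteq> 0" "A f u = pscale a u" by (auto simp: poisson_simps)
    have a: "a \<noteq> 0"
    proof
      assume a0: "a = 0"
      obtain x where x: "x \<in> V" "u = A f x" using u(1) by blast
      obtain m where m: "CHAR('k) = Suc (Suc m)" by (rule that[of "CHAR('k) - 2"]) (use p_gt_1 in simp)
      have "A f (A f x) = 0" using u(3) a0 x(2) by (simp add: pscale_zero_left)
      then have "(A f ^^ CHAR('k)) x = 0" unfolding m using A_pow0 by (simp add: funpow_Suc_right del: funpow.simps)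
      moreover have "x \<in> trunc_polys (2 * r)" using x(1) Vc by blast
      ultimately have "A f x = 0" using A_pop[OF f(1), of x] f(2) V_lin[OF x(1)] by simp
      then show False using u(2) x(2) by simp
    qed
    \<comment> \<open>an eigenvector of all of \<open>t0\<close> is sought among the eigenvectors of \<open>f\<close> with the same nonzero eigenvalue\<close>
    let ?S1 = "{x \<in> V. A f x = pscale a x}"
    have uS1: "u \<in> ?S1" using u AV by auto
    have subS1: "subspace ?S1"
    proof (rule subspaceI)
      show "0 \<in> ?S1" using subspace_0[OF subV] A0 by (simp add: pscale_zero_right)
      show "x + y \<in> ?S1" if "x \<in> ?S1" "y \<in> ?S1" for x y
        using that subspace_add[OF subV] by (auto simp: A_add pscale_right_distrib)
      show "scl L c x \<in> ?S1" if "x \<in> ?S1" for c x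
        using that subspace_scale[OF subV, of x c]
        by (auto simp: poisson_simps A_scale pscale_pscale mult.commute)
    qed
    obtain e where e: "toral_frame (dim t0) e" "t0 = family_span (dim t0) e" using frame_of_torus[OF tor] by blast
    have et: "e i \<in> t0" if "i < dim t0" for i using family_span_base[OF that, of e] e(2) by simp
    have "\<exists>v\<in>?S1. v \<noteq> 0 \<and> (\<forall>i<dim t0. \<exists>\<mu>. A (e i) v = scl L \<mu> v)"
    proof (rule exists_common_eigenvector[OF subS1 _ uS1 u(2)])
      show "?S1 \<subseteq> carrier L" using Vc by (auto simp: poisson_simps)
      show "A (e i) x \<in> ?S1" if "i < dim t0" "x \<in> ?S1" for i x
        using that A_comm[OF f(1) et[OF that(1)], of x] AV by (simp add: A_scale)
      show "A (e i) (A (e j) x) = A (e j) (A (e i) x)" if "i < dim t0" "j < dim t0" for i j x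
        using A_comm et that by blast
    qed (auto simp: A_add A_scale poisson_simps)
    then obtain v where v: "v \<in> V" "A f v = pscale a v" "v \<noteq> 0" "\<forall>i<dim t0. \<exists>\<mu>. A (e i) v = pscale \<mu> v"
      by (auto simp: poisson_simps)
    then obtain \<mu> where \<mu>: "\<And>i. i < dim t0 \<Longrightarrow> A (e i) v = pscale (\<mu> i) v" by metis
    have weight: "\<exists>\<nu>. A g v = pscale \<nu> v" if g: "g \<in> t0" for g
    proof -
      have "g \<in> family_span (dim t0) e" using g by (subst e(2)[symmetric])
      then obtain c where c: "g = (\<Sum>i<dim t0. pscale (c i) (e i))" unfolding family_span_def by (auto simp: poisson_simps)
      have "\<exists>\<nu>. A (\<Sum>i<m. pscale (c i) (e i)) v = pscale \<nu> v" if "m \<le> dim t0" for m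
        using that
      proof (induction m)
        case 0
        have "A (pscale 0 0) v = pscale 0 (A 0 v)" by (rule A_scalel)
        then have "A 0 v = pscale 0 v" by (simp add: pscale_zero_left)
        then show ?case by (intro exI[of _ 0]) simp
      next
        case (Suc m)
        then obtain \<nu> where "A (\<Sum>i<m. pscale (c i) (e i)) v = pscale \<nu> v" by auto
        then have "A (\<Sum>i<Suc m. pscale (c i) (e i)) v = pscale (\<nu> + c m * \<mu> m) v"
          using Suc.prems \<mu>[of m]
          by (simp add: A_addl A_scalel pscale_left_distrib pscale_pscale)
        then show ?case by blast
      qed
      then show ?thesis unfolding c by blast
    qed
    \<comment> \<open>the kernel of the weight of \<open>v\<close>, to which the induction hypothesis applies\<close>
    let ?t1 = "{g \<in> t0. A g v = 0}"
    have vc: "v \<in> trunc_polys (2 * r)" using v(1) Vc by blast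
    have sub1: "subspace ?t1"
    proof (rule subspaceI)
      have "A (pscale 0 0) v = 0" unfolding A_scalel by (simp add: pscale_zero_left)
      then show "0 \<in> ?t1" using subspace_0[OF sub] by (simp add: pscale_zero_left)
      show "g + h \<in> ?t1" if "g \<in> ?t1" "h \<in> ?t1" for g h using that subspace_add[OF sub] by (simp add: A_addl)
      show "scl L c g \<in> ?t1" if "g \<in> ?t1" for c g
        using that subspace_scale[OF sub, of g c] by (simp add: poisson_simps A_scalel pscale_zero_right)
    qed
    have A1: "abelian_p_subalgebra ?t1"
      unfolding abelian_p_subalgebra_def p_subalgebra_def
    proof (intro conjI ballI)
      show "?t1 \<subseteq> carrier L" using tc by (auto simp: poisson_simps)
      show "subspace ?t1" by (rule sub1)
      fix x y assume "x \<in> ?t1" "y \<in> ?t1"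
      then show "brk L x y = 0" using abelian_p_subalgebraD(4)[OF \<open>abelian_p_subalgebra t0\<close>] by blast
      then show "brk L x y \<in> ?t1" using subspace_0[OF sub1] by simp
    next
      fix x assume x: "x \<in> ?t1"
      obtain m where m: "CHAR('k) = Suc m" by (rule that[of "CHAR('k) - 1"]) (use char_pos in simp)
      have "(A x ^^ CHAR('k)) v = 0" unfolding m using x A_pow0 by (simp add: funpow_Suc_right del: funpow.simps)
      then have "A (pm x) v = 0" using A_pop[of x v] x vc V_lin[OF v(1)] by simp
      then show "pop L x \<in> ?t1" using x abelian_p_subalgebraD(3)[OF \<open>abelian_p_subalgebra t0\<close>, of x] by (simp add: poisson_simps)
    qed
    have tor1: "torus L ?t1" by (rule torusI_injective[OF A1]) (use torus_pop_injective[OF tor] in blast)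
    have c1: "?t1 \<subseteq> carrier L" by (rule abelian_p_subalgebraD(1)[OF A1])
    obtain b where b: "family_independent (dim ?t1) b" "?t1 = family_span (dim ?t1) b" "\<forall>i<dim ?t1. b i \<in> ?t1"
      using exists_basis_of_subspace[OF sub1 c1] by (elim exE conjE) (rule that, assumption+)
    have bspan: "x \<in> family_span (dim ?t1) b \<longleftrightarrow> x \<in> ?t1" for x using b(2) by blast
    let ?b = "b(dim ?t1 := f)"
    have "f \<notin> ?t1" using v(2,3) a by (simp add: pscale_eq_0_iff)
    then have indb: "family_independent (Suc (dim ?t1)) ?b"
      by (intro family_independent_Suc b(1)) (simp add: bspan)
    have bt: "?b i \<in> t0" if "i < Suc (dim ?t1)" for i using that b(3) f(1) by (auto simp: less_Suc_eq)
    have lt: "Suc (dim ?t1) \<le> dim t0"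
      by (rule subspace_family_bound[OF sub abelian_p_subalgebraD(1)[OF \<open>abelian_p_subalgebra t0\<close>] indb bt])
    have "x \<in> family_span (Suc (dim ?t1)) ?b" if x: "x \<in> t0" for x
    proof -
      obtain \<nu> where \<nu>: "A x v = pscale \<nu> v" using weight[OF x] by blast
      have fs: "f \<in> family_span (Suc (dim ?t1)) ?b"
        using family_span_base[of "dim ?t1" "Suc (dim ?t1)" ?b] by simp
      have "A (x + pscale (- (\<nu> / a)) f) v = pscale (\<nu> + - (\<nu> / a) * a) v"
        by (simp only: A_addl A_scalel \<nu> v(2) pscale_left_distrib pscale_pscale)
      then have "x + pscale (- (\<nu> / a)) f \<in> ?t1"
        using a x f(1) subspace_add[OF sub x subspace_scale[OF sub f(1)], of "- (\<nu> / a)"]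
        by (simp add: poisson_simps pscale_zero_left)
      then have "x + pscale (- (\<nu> / a)) f \<in> family_span (dim ?t1) b" by (simp only: bspan)
      moreover have "family_span (dim ?t1) b \<subseteq> family_span (Suc (dim ?t1)) ?b"
      proof (rule family_span_minimal[OF subspace_family_span])
        fix i assume "i < dim ?t1"
        then show "b i \<in> family_span (Suc (dim ?t1)) ?b"
          using family_span_base[of i "Suc (dim ?t1)" ?b] by simp
      qed
      ultimately have "x + pscale (- (\<nu> / a)) f + scl L (\<nu> / a) f \<in> family_span (Suc (dim ?t1)) ?b"
        using subspace_add[OF subspace_family_span _ subspace_scale[OF subspace_family_span fs, of "\<nu> / a"]] by blast
      moreover have "x + pscale (- (\<nu> / a)) f + scl L (\<nu> / a) f = x"
        unfolding poisson_simps add.assoc pscale_left_distrib[symmetric]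
        by (simp add: pscale_zero_left)
      ultimately show ?thesis by simp
    qed
    then have le: "dim t0 \<le> Suc (dim ?t1)"
      using e(1) et by (intro family_independent_bound[of _ e]) (auto simp: toral_frame_def)
    have nspan: "v \<notin> family_span n w"
    proof
      assume "v \<in> family_span n w"
      moreover have "family_span n w \<subseteq> {x. A f x = 0}"
      proof (rule family_span_minimal)
        show "subspace {x. A f x = 0}"
          by (rule subspaceI) (auto simp: A0 A_add A_scale poisson_simps pscale_zero_right)
        show "w i \<in> {x. A f x = 0}" if "i < n" for i using kill[OF f(1) that] by (simp add: A_def)
      qed
      ultimately have "A f v = 0" by blast
      then show False using v(2,3) a by (simp add: pscale_eq_0_iff)
    qed
    \<comment> \<open>\<open>f\<close> kills \<open>w i\<close> and scales \<open>v\<close> by \<open>a\<close>, and the constant term of a bracket with \<open>f\<close> vanishes\<close>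
    have isov: "const_term (poisson_bracket r v (w i)) = 0" if i: "i < n" for i
    proof -
      have "a * const_term (poisson_bracket r v (w i)) = const_term (poisson_bracket r (A f v) (w i))"
        by (simp add: v(2) poisson_bracket_pscale_left const_term_pscale)
      also have "\<dots> = const_term (poisson_bracket r (poisson_bracket r f v) (w i))"
        unfolding A_def by (rule const_term_brk_linpart(1))
      also have "\<dots> = const_term (poisson_bracket r f (poisson_bracket r v (w i))) - const_term (poisson_bracket r v (poisson_bracket r f (w i)))"
        using arg_cong[OF poisson_bracket_jacobi[of r f v "w i"], of const_term] by (simp add: const_term_add)
      also have "const_term (poisson_bracket r f (poisson_bracket r v (w i))) = 0"
        by (rule const_term_brk_no_linear(1)[OF lin0[OF f(1)]])
      also have "const_term (poisson_bracket r v (poisson_bracket r f (w i))) = 0"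
        by (rule const_term_brk_no_linear(2)[OF kill[OF f(1) i]])
      finally show ?thesis using a by simp
    qed
    have cneg: "const_term (- x) = - const_term x" for x :: "'k mpoly" by (simp add: const_term_def lookup_uminus)
    have "dim ?t1 + Suc n \<le> r + 1"
    proof (rule less.hyps[where ?t0.0 = ?t1 and n = "Suc n" and w = "w(n := v)"])
      show "dim ?t1 < dim t0" using lt by simp
      show "torus L ?t1" by (rule tor1)
      show "linpart g = 0" if "g \<in> ?t1" for g using lin0 that by blast
      show "family_independent (Suc n) (w(n := v))" by (rule family_independent_Suc[OF indw nspan])
      show "linpart ((w(n := v)) i) = (w(n := v)) i" if "i < Suc n" for i
        using that linw V_lin[OF v(1)] by (auto simp: less_Suc_eq)
      show "const_term (poisson_bracket r ((w(n := v)) i) ((w(n := v)) j)) = 0" if "i < Suc n" "j < Suc n" for i j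
      proof -
        have "const_term (poisson_bracket r (w l) v) = 0" if "l < n" for l
          using isov[OF that] unfolding poisson_bracket_antisym[of r "w l" v] cneg by simp
        then show ?thesis using that iso isov by (auto simp: less_Suc_eq poisson_bracket_self const_term_def)
      qed
      show "linpart (poisson_bracket r g ((w(n := v)) i)) = 0" if "g \<in> ?t1" "i < Suc n" for g i
        using that kill by (auto simp: less_Suc_eq A_def)
    qed
    then show ?thesis using le by simp
  qed
qed

text \<open>
  Split the torus into the subtorus without linear parts and the space of linear parts. The latter is isotropic,
  because the torus is commutative, and is killed by the subtorus.
\<close>

theorem torus_dim_le:
  assumes t: "torus L t" shows "dim t \<le> r + 1"
proof -
  have A: "abelian_p_subalgebra t" using torus_abelian[OF t] .
  note sub = abelian_p_subalgebraD(2)[OF A] and car = abelian_p_subalgebraD(1)[OF A]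
  have tc: "f \<in> trunc_polys (2 * r)" if "f \<in> t" for f using car that by (auto simp: poisson_simps)
  let ?t0 = "{f \<in> t. linpart f = 0}" and ?W = "linpart ` t"
  have brk0: "poisson_bracket r f g = 0" if "f \<in> t" "g \<in> t" for f g
    using abelian_p_subalgebraD(4)[OF A that] by (simp add: poisson_simps)
  have sub0: "subspace ?t0"
  proof (rule subspaceI)
    show "0 \<in> ?t0" using subspace_0[OF sub] by simp
    show "x + y \<in> ?t0" if "x \<in> ?t0" "y \<in> ?t0" for x y using that subspace_add[OF sub] by (simp add: linpart_add)
    show "scl L c x \<in> ?t0" if "x \<in> ?t0" for c x
      using that subspace_scale[OF sub, of x c] by (simp add: poisson_simps linpart_scale pscale_zero_right)
  qed
  have A0: "abelian_p_subalgebra ?t0"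
    unfolding abelian_p_subalgebra_def p_subalgebra_def
  proof (intro conjI ballI)
    show "?t0 \<subseteq> carrier L" using car by blast
    show "subspace ?t0" by (rule sub0)
    fix x y assume "x \<in> ?t0" "y \<in> ?t0"
    then show "brk L x y = 0" using abelian_p_subalgebraD(4)[OF A] by blast
    then show "brk L x y \<in> ?t0" using subspace_0[OF sub0] by simp
  next
    fix x assume x: "x \<in> ?t0"
    then show "pop L x \<in> ?t0"
      using linpart_pop[of x] tc abelian_p_subalgebraD(3)[OF A, of x] by (simp add: poisson_simps)
  qed
  have tor0: "torus L ?t0" by (rule torusI_injective[OF A0]) (use torus_pop_injective[OF t] in blast)
  have subW: "subspace ?W"
  proof (rule subspaceI)
    show "0 \<in> ?W" using subspace_0[OF sub] linpart_0 by (metis image_eqI)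
    show "x + y \<in> ?W" if "x \<in> ?W" "y \<in> ?W" for x y
      using that subspace_add[OF sub] by (auto simp: linpart_add[symmetric])
    show "scl L c x \<in> ?W" if "x \<in> ?W" for c x
      using that subspace_scale[OF sub, of _ c] by (auto simp: poisson_simps linpart_scale[symmetric])
  qed
  have Wc: "?W \<subseteq> carrier L" by (auto simp: linpart_closed poisson_simps)
  obtain w where w: "family_independent (dim ?W) w" "?W = family_span (dim ?W) w" "\<forall>i<dim ?W. w i \<in> ?W"
    using exists_basis_of_subspace[OF subW Wc] by (elim exE conjE) (rule that, assumption+)
  have "\<forall>i. \<exists>u. i < dim ?W \<longrightarrow> u \<in> t \<and> linpart u = w i" using w(3) by (metis imageE)
  then obtain u where u: "\<And>i. i < dim ?W \<Longrightarrow> u i \<in> t \<and> linpart (u i) = w i" by metis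
  have bound: "dim ?t0 + dim ?W \<le> r + 1"
  proof (rule torus_isotropic_bound[OF tor0 _ w(1)])
    fix i assume i: "i < dim ?W"
    show "linpart (w i) = w i" using u[OF i] linpart_idem by metis
    show "linpart (poisson_bracket r f (w i)) = 0" if "f \<in> ?t0" for f
      using linpart_brk_linpart[of f "u i"] that u[OF i] brk0[of f "u i"] by simp
    fix j assume j: "j < dim ?W"
    have "const_term (poisson_bracket r (linpart (u i)) (linpart (u j))) = const_term (poisson_bracket r (u i) (u j))"
      by (simp only: const_term_brk_linpart)
    then show "const_term (poisson_bracket r (w i) (w j)) = 0"
      using u[OF i] u[OF j] brk0[of "u i" "u j"] by (simp add: const_term_def)
  qed simp
  obtain b where b: "?t0 = family_span (dim ?t0) b" "\<forall>i<dim ?t0. b i \<in> ?t0"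
    using exists_basis_of_subspace[OF sub0 abelian_p_subalgebraD(1)[OF A0]] by (elim exE conjE) (rule that, assumption+)
  let ?g = "\<lambda>i. if i < dim ?t0 then b i else u (i - dim ?t0)"
  let ?F = "family_span (dim ?t0 + dim ?W) ?g"
  have bF: "?t0 \<subseteq> ?F"
  proof -
    have "b i \<in> ?F" if "i < dim ?t0" for i using family_span_base[of i "dim ?t0 + dim ?W" ?g] that by simp
    then have "family_span (dim ?t0) b \<subseteq> ?F" by (rule family_span_minimal[OF subspace_family_span])
    then show ?thesis by (simp only: b(1)[symmetric])
  qed
  have uF: "u i \<in> ?F" if "i < dim ?W" for i
    using family_span_base[of "dim ?t0 + i" "dim ?t0 + dim ?W" ?g] that by simp
  have tF: "x \<in> ?F" if x: "x \<in> t" for x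
  proof -
    have "linpart x \<in> family_span (dim ?W) w" using x w(2) by blast
    then obtain c where c: "linpart x = (\<Sum>i<dim ?W. pscale (c i) (w i))" unfolding family_span_def by (auto simp: poisson_simps)
    let ?y = "\<Sum>i<dim ?W. pscale (c i) (u i)"
    have lsum: "linpart (\<Sum>i<m. pscale (c i) (u i)) = (\<Sum>i<m. pscale (c i) (linpart (u i)))" for m
      by (induction m) (simp_all add: linpart_add linpart_scale)
    have "linpart ?y = linpart x" unfolding lsum c using u by (intro sum.cong) auto
    moreover have yt: "?y \<in> t" using u subspace_scale[OF sub] by (intro subspace_sum[OF sub]) (auto simp: poisson_simps)
    ultimately have "x - ?y \<in> ?t0"
      using subspace_diff[OF sub x yt] linpart_add[of "x - ?y" ?y] by simp
    then have "x - ?y \<in> ?F" using bF by blast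
    moreover have "?y \<in> ?F"
      using uF subspace_scale[OF subspace_family_span] by (intro subspace_sum[OF subspace_family_span]) (auto simp: poisson_simps)
    ultimately have "(x - ?y) + ?y \<in> ?F" by (rule subspace_add[OF subspace_family_span])
    then show ?thesis by simp
  qed
  obtain e where e: "family_independent (dim t) e" "\<forall>i<dim t. e i \<in> t"
    using exists_basis_of_subspace[OF sub car] by (elim exE conjE) (rule that, assumption+)
  then have "dim t \<le> dim ?t0 + dim ?W" using tF by (intro family_independent_bound[OF e(1)]) blast
  then show ?thesis using bound by simp
qed

end

section \<open>Powers of companion elements\<close>

lemma poisson_bracket_sum_left:
  fixes h :: "nat \<Rightarrow> 'k::field mpoly" and n :: nat
  shows "poisson_bracket r (\<Sum>i<n. h i) g = (\<Sum>i<n. poisson_bracket r (h i) g)"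
  by (induction n) (simp_all add: poisson_bracket_add_left poisson_bracket_def[of r 0] partial_deriv_def)

lemma poisson_bracket_pscale_right:
  "poisson_bracket r g (pscale c u) = pscale c (poisson_bracket r g (u :: 'k::field mpoly))"
proof (rule poly_mapping_eqI)
  fix a
  have "poisson_bracket r g (pscale c u) = - pscale c (poisson_bracket r u g)"
    by (subst poisson_bracket_antisym) (simp add: poisson_bracket_pscale_left)
  moreover have "poisson_bracket r g u = - poisson_bracket r u g" by (rule poisson_bracket_antisym)
  ultimately show "lookup (poisson_bracket r g (pscale c u)) a = lookup (pscale c (poisson_bracket r g u)) a"
    by (simp add: lookup_pscale)
qed

lemma tmult_add: "tmult (f + g) h = tmult f h + tmult g h" "tmult h (f + g) = tmult h f + tmult h g"
  by (simp_all add: tmult_def distrib_left distrib_right ptrunc_add)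

lemma tmult_pscale: "tmult (pscale c f) h = pscale c (tmult f h)"
  unfolding tmult_def ptrunc_pscale[symmetric] by (simp add: pscale_def mult.assoc)

lemma tmult_sum: "tmult (\<Sum>i\<in>I. f i) h = (\<Sum>i\<in>I. tmult (f i) h)"
  by (simp add: tmult_def sum_distrib_right ptrunc_sum)

lemma tmult_0 [simp]: "tmult 0 h = 0" "tmult h 0 = 0"
  by (simp_all add: tmult_def)

lemma tmult_mult_right: "tmult f (g * h) = tmult (tmult f g) h"
  by (simp add: tmult_def ptrunc_mult_left mult.assoc)

lemma tmult_ptrunc_right: "tmult f (ptrunc g) = tmult f g"
  by (simp add: tmult_def ptrunc_mult_right)

lemma ord_ge_partial_other:
  assumes "ord_ge n d f" "j \<notin> {1..n}" shows "ord_ge n d (partial_deriv j f)"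
  unfolding ord_ge_def
proof
  fix a assume "a \<in> keys (partial_deriv j f)"
  then have "a + pvar j \<in> keys f" by (auto simp: in_keys_iff lookup_partial_deriv)
  moreover have "tdeg n (pvar j) = 0" using assms(2) by (auto simp: tdeg_def lookup_single when_def)
  ultimately show "d \<le> tdeg n a" using assms(1) by (auto simp: ord_ge_def tdeg_add dest!: bspec)
qed

lemma ord_ge_add: "ord_ge n d f \<Longrightarrow> ord_ge n d g \<Longrightarrow> ord_ge n d (f + g)"
  using keys_add[of f g] by (fastforce simp: ord_ge_def)

lemma ord_ge_pscale: "ord_ge n d f \<Longrightarrow> ord_ge n d (pscale c f)"
  by (auto simp: ord_ge_def in_keys_iff lookup_pscale)

lemma digit_split:
  assumes "a < (b :: nat)" shows "(a + b * c) mod b = a" "(a + b * c) div b = c"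
  using assms by auto

lemma exp_nonzero: "(a :: nat \<Rightarrow>\<^sub>0 nat) \<noteq> 0 \<Longrightarrow> \<exists>j. lookup a j \<noteq> 0"
  by (metis lookup_zero poly_mapping_eqI)

text \<open>The exponents of \<open>X_{r+1}, \<dots>, X_{r+n}\<close> are the base-\<open>p\<close> digits of \<open>m\<close>.\<close>

primrec digit_exp :: "nat \<Rightarrow> nat \<Rightarrow> nat \<Rightarrow> nat \<Rightarrow> (nat \<Rightarrow>\<^sub>0 nat)" where
  "digit_exp p r 0 m = 0"
| "digit_exp p r (Suc n) m = digit_exp p r n (m mod p ^ n) + Poly_Mapping.single (Suc n + r) (m div p ^ n)"

lemma digit_exp_range: "lookup (digit_exp p r n m) j \<noteq> 0 \<Longrightarrow> j \<in> {Suc r..r + n}"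
proof (induction n arbitrary: m)
  case (Suc n)
  show ?case
  proof (cases "j = Suc n + r")
    case False
    then have "lookup (digit_exp p r n (m mod p ^ n)) j \<noteq> 0" using Suc.prems by (simp add: lookup_add lookup_single when_def)
    then have "j \<in> {Suc r..r + n}" by (rule Suc.IH)
    then show ?thesis by simp
  qed simp
qed simp

lemma digit_exp_outside: "j \<notin> {Suc r..r + n} \<Longrightarrow> lookup (digit_exp p r n m) j = 0"
  using digit_exp_range by blast

lemma digit_exp_less:
  assumes "p > (0::nat)" "m < p ^ n" shows "lookup (digit_exp p r n m) j < p"
  using assms(2)
proof (induction n arbitrary: m)
  case (Suc n)
  show ?case
  proof (cases "j = Suc n + r")
    case True
    then have "lookup (digit_exp p r n (m mod p ^ n)) j = 0" by (intro digit_exp_outside) auto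
    then show ?thesis using True Suc.prems assms(1) by (simp add: lookup_add less_mult_imp_div_less)
  next
    case False
    then show ?thesis using Suc.IH[of "m mod p ^ n"] assms(1) by (simp add: lookup_add lookup_single when_def)
  qed
qed (use assms in simp)

lemma digit_exp_inj:
  assumes p: "p > (0::nat)" and "m < p ^ n" "m' < p ^ n" "digit_exp p r n m = digit_exp p r n m'"
  shows "m = m'"
  using assms(2-)
proof (induction n arbitrary: m m')
  case (Suc n)
  have top: "lookup (digit_exp p r (Suc n) x) (Suc n + r) = x div p ^ n" for x
    using digit_exp_outside[of "Suc n + r" r n p "x mod p ^ n"] by (simp add: lookup_add)
  have div: "m div p ^ n = m' div p ^ n" using top[of m] top[of m'] Suc.prems(3) by (simp only:)
  then have "digit_exp p r n (m mod p ^ n) = digit_exp p r n (m' mod p ^ n)" using Suc.prems(3) by simp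
  then have "m mod p ^ n = m' mod p ^ n" using Suc.IH p by simp
  with div show ?case by (metis div_mult_mod_eq)
qed simp

lemma digit_exp_full:
  assumes "p > (0::nat)" "j \<in> {Suc r..r + n}"
  shows "lookup (digit_exp p r n (p ^ n - 1)) j = p - 1"
  using assms(2)
proof (induction n)
  case (Suc n)
  have "p ^ Suc n - 1 = (p ^ n - 1) + p ^ n * (p - 1)" using assms(1) by (simp add: algebra_simps)
  moreover have "((p ^ n - 1) + p ^ n * (p - 1)) mod p ^ n = p ^ n - 1" "((p ^ n - 1) + p ^ n * (p - 1)) div p ^ n = p - 1"
    using assms(1) by (intro digit_split; simp)+
  ultimately have e: "digit_exp p r (Suc n) (p ^ Suc n - 1) = digit_exp p r n (p ^ n - 1) + Poly_Mapping.single (Suc n + r) (p - 1)"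
    by (simp only: digit_exp.simps)
  show ?case
  proof (cases "j = Suc n + r")
    case True
    then show ?thesis using digit_exp_outside[of j r n p "p ^ n - 1"] unfolding e by (simp add: lookup_add)
  next
    case False
    then have "j \<in> {Suc r..r + n}" using Suc.prems by auto
    then show ?thesis using False Suc.IH unfolding e by (simp add: lookup_add lookup_single when_def)
  qed
qed simp

lemma digit_exp_0: "digit_exp p r n 0 = 0"
  by (induction n) simp_all

lemma digit_exp_power:
  assumes "p > (1::nat)" "i < n" shows "digit_exp p r n (p ^ i) = pvar (Suc i + r)"
  using assms(2)
proof (induction n)
  case (Suc n)
  show ?case
  proof (cases "i = n")
    case True
    then show ?thesis using assms(1) by (simp add: digit_exp_0)
  next
    case False
    then have "p ^ i < p ^ n" using Suc.prems assms(1) by (intro power_strict_increasing) auto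
    then show ?thesis using False Suc by simp
  qed
qed simp

lemma tmult_single_eq_0:
  assumes "lookup (a + b) j \<ge> CHAR('k)"
  shows "tmult (Poly_Mapping.single a c) (Poly_Mapping.single b d :: 'k::field mpoly) = 0"
  using assms by (auto simp: tmult_def mult_single ptrunc_single not_less[symmetric])

context restricted_poisson
begin

text \<open>
  The divided power monomial with exponent vector \<open>digit_exp p r n m\<close>, in the variables
  \<open>y_i = X_{r+1+i}\<close> for \<open>i < n\<close>.
\<close>

primrec ymon :: "nat \<Rightarrow> nat \<Rightarrow> 'k mpoly" where
  "ymon 0 m = 1"
| "ymon (Suc n) m = ymon n (m mod CHAR('k) ^ n) *
     Poly_Mapping.single (Poly_Mapping.single (Suc n + r) (m div CHAR('k) ^ n)) (inverse (of_nat (fact (m div CHAR('k) ^ n))))"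

lemma fact_nonzero: "d < CHAR('k) \<Longrightarrow> (of_nat (fact d) :: 'k) \<noteq> 0"
proof (induction d)
  case (Suc d)
  have "of_nat (fact (Suc d)) = of_nat (Suc d) * (of_nat (fact d) :: 'k)" by (simp only: fact_Suc of_nat_mult of_nat_id)
  then show ?case using Suc of_nat_nonzero[of "Suc d"] by (simp del: of_nat_Suc)
qed simp

lemma ymon_single:
  assumes "m < CHAR('k) ^ n"
  shows "\<exists>c. c \<noteq> 0 \<and> ymon n m = Poly_Mapping.single (digit_exp CHAR('k) r n m) c"
  using assms
proof (induction n arbitrary: m)
  case 0
  then show ?case by (intro exI[of _ 1]) simp
next
  case (Suc n)
  obtain c where c: "c \<noteq> 0" "ymon n (m mod CHAR('k) ^ n) = Poly_Mapping.single (digit_exp CHAR('k) r n (m mod CHAR('k) ^ n)) c"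
    using Suc.IH[of "m mod CHAR('k) ^ n"] char_pos by auto
  have "m div CHAR('k) ^ n < CHAR('k)" using Suc.prems by (simp add: less_mult_imp_div_less)
  then have "c * inverse (of_nat (fact (m div CHAR('k) ^ n))) \<noteq> 0" using c(1) fact_nonzero by simp
  moreover have "ymon (Suc n) m = Poly_Mapping.single (digit_exp CHAR('k) r (Suc n) m) (c * inverse (of_nat (fact (m div CHAR('k) ^ n))))"
    by (simp add: c(2) mult_single)
  ultimately show ?case by blast
qed

lemma ymon_0 [simp]: "ymon n 0 = 1"
  by (induction n) simp_all

lemma ymon_stable: "m < CHAR('k) ^ n \<Longrightarrow> ymon (Suc n) m = ymon n m"
  by simp

lemma ymon_power: "i < n \<Longrightarrow> ymon n (CHAR('k) ^ i) = pmonom (pvar (Suc i + r))"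
proof (induction n)
  case (Suc n)
  show ?case
  proof (cases "i = n")
    case True
    then show ?thesis using p_gt_1 by simp
  next
    case False
    then have "CHAR('k) ^ i < CHAR('k) ^ n" using Suc.prems p_gt_1 by (intro power_strict_increasing) auto
    then show ?thesis using False Suc by simp
  qed
qed simp

lemma ptrunc_ymon: "m < CHAR('k) ^ n \<Longrightarrow> ptrunc (ymon n m) = ymon n m"
  using ymon_single[of m n] digit_exp_less[OF char_pos, of m n r] by (auto simp: ptrunc_single)

lemma ymon_trunc:
  assumes "m < CHAR('k) ^ r" shows "ymon r m \<in> trunc_polys (2 * r)"
proof -
  obtain c where c: "ymon r m = Poly_Mapping.single (digit_exp CHAR('k) r r m) c" using ymon_single[OF assms] by blast
  have "keys (digit_exp CHAR('k) r r m) \<subseteq> {1..2 * r}"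
  proof
    fix j assume "j \<in> keys (digit_exp CHAR('k) r r m)"
    then have "j \<in> {Suc r..r + r}" by (intro digit_exp_range) (simp add: in_keys_iff)
    then show "j \<in> {1..2 * r}" by simp
  qed
  then show ?thesis using digit_exp_less[OF char_pos assms, of r] unfolding c by (auto simp: trunc_polys_def trunc_exps_def)
qed

lemma partial_deriv_ymon_outside:
  assumes "j \<notin> {Suc r..r + n}" shows "partial_deriv j (ymon n m) = 0"
  using assms
proof (induction n arbitrary: m)
  case 0
  show ?case using partial_deriv_const[of j 1] by simp
next
  case (Suc n)
  then have "partial_deriv j (ymon n x) = 0" for x by auto
  then show ?case using Suc.prems by (auto simp: partial_deriv_mult partial_deriv_single lookup_single when_def)
qed

text \<open>
  The monomial \<open>ymon n (p ^ n - 1)\<close> contains every \<open>y_i\<close> with \<open>i < n\<close> to the power \<open>p - 1\<close>.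
\<close>

lemma tmult_full_ymon:
  assumes j: "j \<in> {Suc r..r + n}" "lookup b j > 0"
  shows "tmult (ymon n (CHAR('k) ^ n - 1)) (Poly_Mapping.single b d) = 0"
proof -
  obtain c where c: "ymon n (CHAR('k) ^ n - 1) = Poly_Mapping.single (digit_exp CHAR('k) r n (CHAR('k) ^ n - 1)) c"
    using ymon_single[of "CHAR('k) ^ n - 1" n] char_pos by auto
  have "lookup (digit_exp CHAR('k) r n (CHAR('k) ^ n - 1) + b) j \<ge> CHAR('k)"
    using j digit_exp_full[OF char_pos j(1)] by (simp add: lookup_add)
  then show ?thesis unfolding c by (rule tmult_single_eq_0)
qed

lemma tmult_full_ymon_ymon:
  assumes m: "0 < m" "m < CHAR('k) ^ n"
  shows "tmult (ymon n (CHAR('k) ^ n - 1)) (ymon n m) = 0"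
proof -
  obtain c where c: "ymon n m = Poly_Mapping.single (digit_exp CHAR('k) r n m) c" using ymon_single[OF m(2)] by blast
  have "digit_exp CHAR('k) r n m \<noteq> digit_exp CHAR('k) r n 0" using digit_exp_inj[OF char_pos m(2)] m by fastforce
  then have "\<exists>j. lookup (digit_exp CHAR('k) r n m) j \<noteq> 0" by (intro exp_nonzero) (simp add: digit_exp_0)
  then obtain j where "lookup (digit_exp CHAR('k) r n m) j \<noteq> 0" by blast
  then show ?thesis unfolding c using digit_exp_range by (intro tmult_full_ymon) auto
qed

text \<open>
  With divided powers, the derivation \<open>\<Sum>i. y_0^(p-1) \<dots> y_(i-1)^(p-1) \<partial>/\<partial>y_i\<close> counts down like an odometer:
  \<open>\<partial>/\<partial>y_i\<close> takes one from the digit \<open>i\<close>, and its coefficient resets the lower digits to \<open>p - 1\<close> if they are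
  all zero and annihilates the monomial otherwise.
\<close>

lemma odometer:
  assumes "m < CHAR('k) ^ n"
  shows "(\<Sum>i<n. tmult (ymon n (CHAR('k) ^ i - 1)) (partial_deriv (Suc i + r) (ymon n m))) = (if m = 0 then 0 else ymon n (m - 1))"
  using assms
proof (induction n arbitrary: m)
  case (Suc n)
  let ?p = "CHAR('k)"
  let ?m0 = "m mod ?p ^ n" and ?d = "m div ?p ^ n"
  let ?y = "\<lambda>d. Poly_Mapping.single (Poly_Mapping.single (Suc n + r) d) (inverse (of_nat (fact d))) :: 'k mpoly"
  have ym: "ymon (Suc n) m = ymon n ?m0 * ?y ?d" by simp
  have d: "?d < ?p" using Suc.prems by (simp add: less_mult_imp_div_less)
  have m0: "?m0 < ?p ^ n" using char_pos by simp
  have m: "m = ?m0 + ?p ^ n * ?d" by simp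
  have small: "ymon (Suc n) (?p ^ i - 1) = ymon n (?p ^ i - 1)" if "i \<le> n" for i
  proof (rule ymon_stable)
    have "?p ^ i \<le> ?p ^ n" using that p_gt_1 by (intro power_increasing) auto
    then show "?p ^ i - 1 < ?p ^ n" using char_pos by (metis One_nat_def diff_less le_eq_less_or_eq less_imp_diff_less less_one zero_less_power)
  qed
  \<comment> \<open>the lower digits are counted down by the induction hypothesis, while the top digit stays\<close>
  have low: "tmult (ymon (Suc n) (?p ^ i - 1)) (partial_deriv (Suc i + r) (ymon (Suc n) m)) =
      tmult (tmult (ymon n (?p ^ i - 1)) (partial_deriv (Suc i + r) (ymon n ?m0))) (?y ?d)" if "i < n" for i
  proof -
    have "partial_deriv (Suc i + r) (?y ?d) = 0" using that by (auto simp: partial_deriv_single lookup_single when_def)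
    then have "partial_deriv (Suc i + r) (ymon (Suc n) m) = partial_deriv (Suc i + r) (ymon n ?m0) * ?y ?d"
      unfolding ym partial_deriv_mult by simp
    then show ?thesis using small[of i] that by (simp only: tmult_mult_right less_imp_le)
  qed
  have yd: "partial_deriv (Suc n + r) (?y ?d) = (if ?d = 0 then 0 else ?y (?d - 1))"
  proof (cases "?d = 0")
    case False
    then obtain e where e: "?d = Suc e" by (metis not0_implies_Suc)
    then have "(of_nat (Suc e) :: 'k) \<noteq> 0" using of_nat_nonzero[of "Suc e"] d by simp
    moreover have "of_nat (fact (Suc e)) = of_nat (Suc e) * (of_nat (fact e) :: 'k)" by (simp only: fact_Suc of_nat_mult of_nat_id)
    ultimately have "of_nat (Suc e) * inverse (of_nat (fact (Suc e)) :: 'k) = inverse (of_nat (fact e))"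
      by (simp add: inverse_eq_divide del: of_nat_Suc fact_Suc)
    moreover have "Poly_Mapping.single (Suc n + r) (Suc e) - pvar (Suc n + r) = Poly_Mapping.single (Suc n + r) e"
      by (rule poly_mapping_eqI) (simp add: lookup_minus lookup_single when_def)
    ultimately show ?thesis unfolding e by (simp add: partial_deriv_single del: of_nat_Suc fact_Suc)
  next
    case True
    show ?thesis unfolding True partial_deriv_single by simp
  qed
  \<comment> \<open>the top digit is counted down if all lower digits are zero\<close>
  have top: "tmult (ymon (Suc n) (?p ^ n - 1)) (partial_deriv (Suc n + r) (ymon (Suc n) m)) =
      (if ?m0 = 0 \<and> ?d \<noteq> 0 then ymon (Suc n) (m - 1) else 0)"
  proof -
    have "partial_deriv (Suc n + r) (ymon n ?m0) = 0" by (rule partial_deriv_ymon_outside) simp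
    then have pd: "partial_deriv (Suc n + r) (ymon (Suc n) m) = ymon n ?m0 * partial_deriv (Suc n + r) (?y ?d)"
      unfolding ym partial_deriv_mult by simp
    have t: "tmult (ymon (Suc n) (?p ^ n - 1)) (partial_deriv (Suc n + r) (ymon (Suc n) m)) =
        tmult (tmult (ymon n (?p ^ n - 1)) (ymon n ?m0)) (if ?d = 0 then 0 else ?y (?d - 1))"
      by (simp only: pd small[OF order_refl] tmult_mult_right yd)
    show ?thesis
    proof (cases "?m0 = 0")
      case False
      then show ?thesis unfolding t using tmult_full_ymon_ymon[OF _ m0] by simp
    next
      case True
      show ?thesis
      proof (cases "?d = 0")
        case True
        then show ?thesis unfolding t by simp
      next
        case False
        then obtain e where e: "?d = Suc e" by (metis not0_implies_Suc)
        have "m = ?p ^ n * Suc e" using m True e by simp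
        then have m1: "m - 1 = (?p ^ n - 1) + ?p ^ n * e" using char_pos by (simp add: algebra_simps)
        have "(m - 1) mod ?p ^ n = ?p ^ n - 1" "(m - 1) div ?p ^ n = e"
          unfolding m1 using char_pos by (intro digit_split; simp)+
        then have ym1: "ymon (Suc n) (m - 1) = ymon n (?p ^ n - 1) * ?y e" by (simp only: ymon.simps)
        have "tmult (ymon (Suc n) (?p ^ n - 1)) (partial_deriv (Suc n + r) (ymon (Suc n) m)) = ptrunc (ymon n (?p ^ n - 1) * ?y e)"
          unfolding t using True e by (simp add: tmult_def ptrunc_mult_left)
        also have "\<dots> = ymon (Suc n) (m - 1)"
          unfolding ym1[symmetric] by (rule ptrunc_ymon) (use Suc.prems in simp)
        finally show ?thesis using True e by simp
      qed
    qed
  qed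
  have "(\<Sum>i<n. tmult (ymon (Suc n) (?p ^ i - 1)) (partial_deriv (Suc i + r) (ymon (Suc n) m))) =
      tmult (\<Sum>i<n. tmult (ymon n (?p ^ i - 1)) (partial_deriv (Suc i + r) (ymon n ?m0))) (?y ?d)"
    unfolding tmult_sum by (rule sum.cong[OF refl]) (rule low, simp)
  also have "\<dots> = tmult (if ?m0 = 0 then 0 else ymon n (?m0 - 1)) (?y ?d)" by (simp only: Suc.IH[OF m0])
  also have "\<dots> = (if ?m0 = 0 then 0 else ymon (Suc n) (m - 1))"
  proof (cases "?m0 = 0")
    case False
    have m1: "m - 1 = (?m0 - 1) + ?p ^ n * ?d" using m False by linarith
    have "(m - 1) mod ?p ^ n = ?m0 - 1" "(m - 1) div ?p ^ n = ?d"
      using m0 False by (subst m1, intro digit_split, simp)+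
    then have ym1: "ymon (Suc n) (m - 1) = ymon n (?m0 - 1) * ?y ?d" by (simp only: ymon.simps)
    have "ptrunc (ymon (Suc n) (m - 1)) = ymon (Suc n) (m - 1)" by (rule ptrunc_ymon) (use Suc.prems in simp)
    then show ?thesis using False unfolding tmult_def ym1 by simp
  qed simp
  finally have "(\<Sum>i<Suc n. tmult (ymon (Suc n) (?p ^ i - 1)) (partial_deriv (Suc i + r) (ymon (Suc n) m))) =
      (if ?m0 = 0 then 0 else ymon (Suc n) (m - 1)) + (if ?m0 = 0 \<and> ?d \<noteq> 0 then ymon (Suc n) (m - 1) else 0)"
    by (simp only: sum.lessThan_Suc top)
  moreover have "m = 0 \<longleftrightarrow> ?m0 = 0 \<and> ?d = 0"
  proof
    assume "?m0 = 0 \<and> ?d = 0"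
    then have "?m0 + ?p ^ n * ?d = 0" by (simp only: mult_0_right add_0)
    then show "m = 0" by (simp only: m[symmetric])
  qed simp
  ultimately show ?case by (cases "?m0 = 0"; cases "?d = 0") (simp_all only: if_True if_False simp_thms add_0_right add_0_left)
qed simp

lemma poisson_bracket_pvar_left:
  fixes g :: "'k mpoly"
  assumes "i < r" shows "poisson_bracket r (pmonom (pvar (Suc i))) g = ptrunc (partial_deriv (Suc i + r) g)"
  using brk_pvar(2)[of "Suc i" g] assms poisson_bracket_antisym[of r "pmonom (pvar (Suc i))" g] by simp

text \<open>
  These elements are linear in \<open>x_i = X_{i+1}\<close> for \<open>i < r\<close>, so that their brackets with functions of the \<open>y_i\<close>
  are derivations. In the basis of divided power monomials these derivations are companion matrices: for
  \<open>a = 0\<close> this is the odometer, and the \<open>a i\<close> are corrections at the powers of \<open>p\<close>.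
\<close>

definition companion :: "(nat \<Rightarrow> 'k) \<Rightarrow> 'k mpoly" where
  "companion a = (\<Sum>i<r. tmult (ymon r (CHAR('k) ^ i - 1) + pscale (a i) (ymon r (CHAR('k) ^ r - 1))) (pmonom (pvar (Suc i))))"

lemma power_le_q: "i < r \<Longrightarrow> CHAR('k) ^ i < CHAR('k) ^ r"
  using p_gt_1 by (intro power_strict_increasing) auto

lemma ymon_commute:
  assumes "m < CHAR('k) ^ r" "\<And>i. i \<in> {1..r} \<Longrightarrow> partial_deriv i g = 0"
  shows "poisson_bracket r (ymon r m) g = 0"
  unfolding poisson_bracket_def using assms partial_deriv_ymon_outside[of _ r m] by (simp add: sum.neutral)

text \<open>
  The product of \<open>v = ymon r (p ^ r - 1)\<close>, which has full exponents, with a monomial vanishes unless the latter is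
  constant. So the correction by \<open>v\<close> is felt only by the variables \<open>y_i = ymon r (p ^ i)\<close>.
\<close>

lemma companion_bracket_ymon:
  assumes m: "m < CHAR('k) ^ r"
  shows "poisson_bracket r (companion a) (ymon r m) =
    (if m = 0 then 0 else ymon r (m - 1)) + (\<Sum>i<r. if m = CHAR('k) ^ i then pscale (a i) (ymon r (CHAR('k) ^ r - 1)) else 0)"
proof -
  let ?p = "CHAR('k)" and ?v = "ymon r (CHAR('k) ^ r - 1)" and ?D = "\<lambda>i. partial_deriv (Suc i + r) (ymon r m)"
  have q: "?p ^ r - 1 < ?p ^ r" using char_pos by simp
  have pd: "partial_deriv i (ymon r m) = 0" if "i \<in> {1..r}" for i using that by (intro partial_deriv_ymon_outside) auto
  have c0: "poisson_bracket r (ymon r (?p ^ i - 1) + pscale (a i) ?v) (ymon r m) = 0" if "i < r" for i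
    using ymon_commute[OF q pd] ymon_commute[OF _ pd, of "?p ^ i - 1"] power_le_q[OF that]
    by (simp add: poisson_bracket_add_left poisson_bracket_pscale_left pscale_zero_right)
  have vD: "tmult ?v (?D i) = (if m = ?p ^ i then ?v else 0)" if i: "i < r" for i
  proof (cases "m = ?p ^ i")
    case True
    have "?D i = 1" unfolding True ymon_power[OF i] by (simp add: partial_deriv_pvar)
    then show ?thesis using True ptrunc_ymon[OF q] by (simp add: tmult_def)
  next
    case False
    obtain c where c: "ymon r m = Poly_Mapping.single (digit_exp ?p r r m) c" using ymon_single[OF m] by blast
    let ?e = "digit_exp ?p r r m"
    have D: "?D i = Poly_Mapping.single (?e - pvar (Suc i + r)) (of_nat (lookup ?e (Suc i + r)) * c)"
      unfolding c by (rule partial_deriv_single)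
    show ?thesis
    proof (cases "lookup ?e (Suc i + r) = 0")
      case True
      then show ?thesis using False D by simp
    next
      case nz: False
      have "?e \<noteq> pvar (Suc i + r)"
        using digit_exp_inj[OF char_pos m power_le_q[OF i]] False digit_exp_power[OF p_gt_1 i, of r] by metis
      then have "?e - pvar (Suc i + r) \<noteq> 0" using exp_decompose[of ?e "Suc i + r"] nz by (metis add_0 gr0I)
      then have "\<exists>j. lookup (?e - pvar (Suc i + r)) j \<noteq> 0" by (rule exp_nonzero)
      then obtain j where j: "lookup (?e - pvar (Suc i + r)) j \<noteq> 0" by blast
      then have "j \<in> {Suc r..r + r}" by (intro digit_exp_range[of ?p r r m]) (auto simp: lookup_minus)
      then show ?thesis using False tmult_full_ymon[of j r] j unfolding D by simp
    qed
  qed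
  have "poisson_bracket r (companion a) (ymon r m) =
      (\<Sum>i<r. tmult (ymon r (?p ^ i - 1) + pscale (a i) ?v) (?D i))"
    unfolding companion_def poisson_bracket_sum_left
  proof (rule sum.cong[OF refl])
    fix i assume "i \<in> {..<r}"
    then have i: "i < r" by simp
    show "poisson_bracket r (tmult (ymon r (?p ^ i - 1) + pscale (a i) ?v) (pmonom (pvar (Suc i)))) (ymon r m) =
        tmult (ymon r (?p ^ i - 1) + pscale (a i) ?v) (?D i)"
      by (simp only: poisson_bracket_tmult_left c0[OF i] poisson_bracket_pvar_left[OF i] tmult_ptrunc_right tmult_0 add_0_right)
  qed
  also have "\<dots> = (\<Sum>i<r. tmult (ymon r (?p ^ i - 1)) (?D i)) + (\<Sum>i<r. pscale (a i) (tmult ?v (?D i)))"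
    by (simp only: tmult_add tmult_pscale sum.distrib)
  also have "(\<Sum>i<r. tmult (ymon r (?p ^ i - 1)) (?D i)) = (if m = 0 then 0 else ymon r (m - 1))" by (rule odometer[OF m])
  also have "(\<Sum>i<r. pscale (a i) (tmult ?v (?D i))) = (\<Sum>i<r. if m = ?p ^ i then pscale (a i) ?v else 0)"
  proof (rule sum.cong[OF refl])
    fix i assume "i \<in> {..<r}"
    then have "tmult ?v (?D i) = (if m = ?p ^ i then ?v else 0)" by (intro vD) simp
    then show "pscale (a i) (tmult ?v (?D i)) = (if m = ?p ^ i then pscale (a i) ?v else 0)"
      by (cases "m = ?p ^ i") (simp_all only: if_True if_False simp_thms pscale_zero_right)
  qed
  finally show ?thesis .
qed

lemma companion_closed: "companion a \<in> trunc_polys (2 * r)"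
proof -
  have "tmult (ymon r m) (pmonom (pvar (Suc i))) \<in> trunc_polys (2 * r)" if "m < CHAR('k) ^ r" "i < r" for m i
    unfolding tmult_def using ymon_trunc[OF that(1)] pvar_trunc[of "Suc i"] that(2)
    by (intro polys_in_ptrunc polys_in_mult) (auto simp: trunc_polys_altdef)
  then show ?thesis
    unfolding companion_def using char_pos power_le_q
    by (auto simp: tmult_add tmult_pscale less_imp_diff_less
        intro!: trunc_polys_sum trunc_polys_add
         trunc_polys_scale)
qed

text \<open>
  The ideal generated by the \<open>x_i\<close> is coisotropic, as the \<open>x_i\<close> commute with each other. It is spanned by
  monomials, which the \<open>p\<close>-map fixes or kills, hence by Jacobson's formula it is closed under the \<open>p\<close>-map.
\<close>

lemma x_ideal_bracket:
  assumes "ord_ge r 1 f" "ord_ge r 1 (g :: 'k mpoly)" shows "ord_ge r 1 (poisson_bracket r f g)"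
proof -
  have l: "ord_ge r 1 (u * v)" if "ord_ge r 1 u" for u v :: "'k mpoly"
    using ord_ge_mult[OF that, of 0 v] by (simp add: ord_ge_def[of _ 0])
  have o: "ord_ge r 1 (partial_deriv (i + r) f)" "ord_ge r 1 (partial_deriv (i + r) g)" if "i \<in> {1..r}" for i
    using that assms by (auto intro!: ord_ge_partial_other)
  have "ord_ge r 1 (partial_deriv i f * partial_deriv (i + r) g)" "ord_ge r 1 (partial_deriv (i + r) f * partial_deriv i g)" if "i \<in> {1..r}" for i
    using l[OF o(2)[OF that], of "partial_deriv i f"] l[OF o(1)[OF that]] by (simp_all add: mult.commute)
  then have "ord_ge r 1 (partial_deriv i f * partial_deriv (i + r) g - partial_deriv (i + r) f * partial_deriv i g)" if "i \<in> {1..r}" for i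
    using that by (intro ord_ge_diff) blast+
  then show ?thesis unfolding poisson_bracket_def by (intro ord_ge_ptrunc ord_ge_sum) blast
qed

lemma x_ideal_pop_add:
  assumes f: "f \<in> trunc_polys (2 * r)" "ord_ge r 1 f" "ord_ge r 1 (pm f)" and g: "g \<in> trunc_polys (2 * r)" "ord_ge r 1 g" "ord_ge r 1 (pm g)"
  shows "ord_ge r 1 (pm (f + g))"
proof -
  have z: "ord_ge r 1 (0 :: 'k mpoly)" by (simp add: ord_ge_def)
  have ad: "ord_ge r 1 (ad_coeff (poisson_bracket r) f g n j)" for n j
  proof (induction n arbitrary: j)
    case (Suc n)
    have "ord_ge r 1 (poisson_bracket r f (ad_coeff (poisson_bracket r) f g n (j - 1)))"
      "ord_ge r 1 (poisson_bracket r g (ad_coeff (poisson_bracket r) f g n j))"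
      using x_ideal_bracket[OF f(2) Suc] x_ideal_bracket[OF g(2) Suc] by blast+
    then show ?case using z by (cases "j = 0") (simp_all add: ord_ge_add)
  qed (use f z in auto)
  have "pm (f + g) = pm f + pm g + (\<Sum>i = 1..CHAR('k) - 1. jacobson_term L i f g)"
    using p_map f(1) g(1) unfolding is_p_map_def poisson_simps by blast
  moreover have "ord_ge r 1 (jacobson_term L i f g)" for i
    unfolding jacobson_term_def poisson_simps by (intro ord_ge_pscale ad)
  ultimately show ?thesis using f g by (auto intro!: ord_ge_add ord_ge_sum)
qed

lemma pm_pmonom:
  "a \<in> trunc_exps CHAR('k) (2 * r) \<Longrightarrow>
    pm (pmonom a) = (if a \<in> {0} \<union> {pvar i + pvar (i + r) |i. 1 \<le> i \<and> i \<le> r} then pmonom a else 0)"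
  using p_map_pm unfolding poisson_p_map_def by blast

lemma x_ideal_pop:
  assumes f: "f \<in> trunc_polys (2 * r)" "ord_ge r 1 f" shows "ord_ge r 1 (pm f)"
proof -
  let ?g = "\<lambda>A. \<Sum>a\<in>A. pscale (lookup f a) (pmonom a)"
  have z: "ord_ge r 1 (0 :: 'k mpoly)" by (simp add: ord_ge_def)
  have mono: "pscale c (pmonom a) \<in> trunc_polys (2 * r) \<and> ord_ge r 1 (pscale c (pmonom a)) \<and> ord_ge r 1 (pm (pscale c (pmonom a)))"
    if a: "a \<in> keys f" for a and c :: 'k
  proof -
    have ae: "a \<in> trunc_exps CHAR('k) (2 * r)" using a f by (auto simp: trunc_polys_def)
    then have mt: "(pmonom a :: 'k mpoly) \<in> trunc_polys (2 * r)" by (auto simp: trunc_polys_def)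
    have o: "ord_ge r 1 (pmonom a :: 'k mpoly)" using f(2) a by (auto simp: ord_ge_def)
    have "ord_ge r 1 (pm (pmonom a))" unfolding pm_pmonom[OF ae] using o z by auto
    moreover have "pm (pscale c (pmonom a)) = pscale (c ^ CHAR('k)) (pm (pmonom a))"
      using pop_scale[of "pmonom a" c] mt by (simp add: poisson_simps)
    ultimately show ?thesis
      using o mt subspace_scale[OF carrier_subspace, of "pmonom a" c] by (auto simp: poisson_simps intro: ord_ge_pscale)
  qed
  have "?g A \<in> trunc_polys (2 * r) \<and> ord_ge r 1 (?g A) \<and> ord_ge r 1 (pm (?g A))" if "finite A" "A \<subseteq> keys f" for A
    using that
  proof (induction A)
    case empty
    then show ?case using pop_0 subspace_0[OF carrier_subspace] z by (simp add: poisson_simps)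
  next
    case (insert a A)
    have m: "pscale (lookup f a) (pmonom a) \<in> trunc_polys (2 * r)" "ord_ge r 1 (pscale (lookup f a) (pmonom a))"
        "ord_ge r 1 (pm (pscale (lookup f a) (pmonom a)))"
      using mono[of a "lookup f a"] insert.prems by auto
    have IH: "?g A \<in> trunc_polys (2 * r)" "ord_ge r 1 (?g A)" "ord_ge r 1 (pm (?g A))" using insert by auto
    have "?g (insert a A) = pscale (lookup f a) (pmonom a) + ?g A" using insert.hyps by simp
    moreover have "pscale (lookup f a) (pmonom a) + ?g A \<in> trunc_polys (2 * r)"
      using subspace_add[OF carrier_subspace] m(1) IH(1) by (simp add: poisson_simps)
    ultimately show ?case using x_ideal_pop_add[OF m IH] ord_ge_add[OF m(2) IH(2)] by simp
  qed
  then have "ord_ge r 1 (pm (?g (keys f)))" by simp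
  then show ?thesis using mpoly_eq_sum_monomials[of f] by simp
qed

text \<open>
  Brackets with the \<open>y_i\<close> are the derivatives with respect to the \<open>x_i\<close>.
\<close>

lemma x_ideal_commutes_with_y:
  fixes f :: "'k mpoly"
  assumes f: "f \<in> trunc_polys (2 * r)" "ord_ge r 1 f" and com: "\<And>i. i < r \<Longrightarrow> poisson_bracket r f (pmonom (pvar (Suc i + r))) = 0"
  shows "f = 0"
proof (rule ccontr)
  assume "f \<noteq> 0"
  then obtain a where a: "a \<in> keys f" by (metis all_not_in_conv keys_eq_empty)
  then have "tdeg r a \<noteq> 0" using f(2) by (auto simp: ord_ge_def)
  then obtain i where i: "i \<in> {1..r}" "lookup a i > 0" unfolding tdeg_def by (metis neq0_conv sum.neutral)
  have la: "lookup a j < CHAR('k)" for j using a f(1) by (auto simp: trunc_polys_def trunc_exps_def)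
  have "ptrunc (partial_deriv i f) = 0"
  proof -
    have "Suc (i - 1) = i" "i - 1 < r" using i(1) by auto
    then show ?thesis using com[of "i - 1"] brk_pvar(1)[OF i(1), of f] by (simp only:)
  qed
  then have "lookup (ptrunc (partial_deriv i f)) (a - pvar i) = 0" by simp
  moreover have "\<forall>j. lookup (a - pvar i) j < CHAR('k)"
    using la by (auto simp: lookup_minus intro: le_less_trans[OF diff_le_self])
  ultimately have "of_nat (lookup (a - pvar i) i + 1) * lookup f a = 0"
    using exp_decompose[OF i(2)] by (simp add: lookup_ptrunc lookup_partial_deriv)
  moreover have "lookup (a - pvar i) i + 1 = lookup a i" using i(2) by (simp add: lookup_minus)
  ultimately show False using a of_nat_nonzero[OF i(2) la] by (simp add: in_keys_iff)
qed

lemma companion_x_ideal: "ord_ge r 1 (companion a)"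
proof -
  have "ord_ge r 1 (pmonom (pvar (Suc i)) :: 'k mpoly)" if "i < r" for i
    using that tdeg_pvar[of "Suc i" r] by (simp add: ord_ge_def)
  then have "ord_ge r 1 (u * pmonom (pvar (Suc i)))" if "i < r" for i and u :: "'k mpoly"
    using ord_ge_mult[of r 0 u 1] that by (simp add: ord_ge_def[of _ 0])
  then show ?thesis unfolding companion_def tmult_def by (intro ord_ge_sum ord_ge_ptrunc) auto
qed

text \<open>
  Adding a multiple of the cyclic vector \<open>v\<close> puts the constant \<open>b\<close> into the relation between the powers.
\<close>

definition companion_element :: "(nat \<Rightarrow> 'k) \<Rightarrow> 'k \<Rightarrow> 'k mpoly" where
  "companion_element a b = companion a + pscale b (ymon r (CHAR('k) ^ r - 1))"

context
  fixes a :: "nat \<Rightarrow> 'k"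
begin

private abbreviation (input) N where "N \<equiv> poisson_bracket r (companion a)"
private abbreviation (input) v where "v \<equiv> ymon r (CHAR('k) ^ r - 1)"

lemma q_pos: "0 < CHAR('k) ^ r" "CHAR('k) ^ r - 1 < CHAR('k) ^ r"
  using char_pos by auto

lemma v_trunc: "v \<in> trunc_polys (2 * r)"
  by (rule ymon_trunc[OF q_pos(2)])

lemma Nv_trunc: "(N ^^ k) v \<in> trunc_polys (2 * r)"
  using ad_pow_closed[of "companion a" v k] companion_closed v_trunc by (simp add: poisson_simps)

lemma N_0: "N 0 = 0"
  using brk_0_right[of "companion a"] companion_closed by (simp add: poisson_simps)

lemma N_scale: "N (pscale c g) = pscale c (N g)"
  by (rule poisson_bracket_pscale_right)

lemma N_sum: "N (\<Sum>i<n. h i) = (\<Sum>i<n. N (h i))" for n :: nat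
  by (induction n) (simp_all add: N_0 poisson_bracket_add_right)

text \<open>
  Solving the companion relations for the divided powers, from the top one downwards. This shows that
  \<open>v\<close> is a cyclic vector and gives the characteristic polynomial of \<open>N\<close>.
\<close>

lemma ymon_from_top:
  assumes "k \<le> (CHAR('k) ^ r) - 1"
  shows "ymon r ((CHAR('k) ^ r) - 1 - k) + (\<Sum>i<r. if (CHAR('k) ^ r) - 1 - k < CHAR('k) ^ i then pscale (a i) ((N ^^ (CHAR('k) ^ i - 1 - ((CHAR('k) ^ r) - 1 - k))) v) else 0) =
    (N ^^ k) v"
  using assms
proof (induction k)
  case 0
  have "(\<Sum>i<r. if (CHAR('k) ^ r) - 1 - 0 < CHAR('k) ^ i then pscale (a i) ((N ^^ (CHAR('k) ^ i - 1 - ((CHAR('k) ^ r) - 1 - 0))) v) else 0) = 0"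
    using power_le_q by (intro sum.neutral) fastforce
  then show ?case by simp
next
  case (Suc k)
  let ?m = "(CHAR('k) ^ r) - 1 - k"
  have m: "(CHAR('k) ^ r) - 1 - Suc k = ?m - 1" "0 < ?m" "?m < (CHAR('k) ^ r)" using Suc.prems q_pos by auto
  have one: "N (if ?m < CHAR('k) ^ i then pscale (a i) ((N ^^ (CHAR('k) ^ i - 1 - ?m)) v) else 0) +
      (if ?m = CHAR('k) ^ i then pscale (a i) v else 0) =
      (if ?m - 1 < CHAR('k) ^ i then pscale (a i) ((N ^^ (CHAR('k) ^ i - 1 - (?m - 1))) v) else 0)" for i
  proof (cases "?m < CHAR('k) ^ i")
    case True
    then have e: "CHAR('k) ^ i - 1 - (?m - 1) = Suc (CHAR('k) ^ i - 1 - ?m)" using m(2) by linarith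
    have "?m - 1 < CHAR('k) ^ i" "?m \<noteq> CHAR('k) ^ i" using True by auto
    then show ?thesis using True by (simp only: e if_True if_False N_scale funpow.simps o_apply add_0_right simp_thms)
  next
    case False
    show ?thesis
    proof (cases "?m = CHAR('k) ^ i")
      case True
      have e: "CHAR('k) ^ i - 1 - (?m - 1) = 0" "?m - 1 < CHAR('k) ^ i" using True m(2) by linarith+
      show ?thesis unfolding e(1) using False e(2) True by (simp only: if_True if_False N_0 funpow.simps id_apply add_0 simp_thms)
    next
      case neq: False
      have "\<not> ?m - 1 < CHAR('k) ^ i" using False neq by linarith
      then show ?thesis using False neq by (simp only: if_False N_0 add_0 simp_thms)
    qed
  qed
  have "(N ^^ Suc k) v = N (ymon r ?m + (\<Sum>i<r. if ?m < CHAR('k) ^ i then pscale (a i) ((N ^^ (CHAR('k) ^ i - 1 - ?m)) v) else 0))"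
    using Suc by simp
  also have "\<dots> = ymon r (?m - 1) + (\<Sum>i<r. if ?m = CHAR('k) ^ i then pscale (a i) v else 0) +
      (\<Sum>i<r. N (if ?m < CHAR('k) ^ i then pscale (a i) ((N ^^ (CHAR('k) ^ i - 1 - ?m)) v) else 0))"
    using m(2) by (simp only: poisson_bracket_add_right N_sum companion_bracket_ymon[OF m(3)] if_False not_gr_zero[symmetric] simp_thms)
  also have "\<dots> = ymon r (?m - 1) + (\<Sum>i<r. N (if ?m < CHAR('k) ^ i then pscale (a i) ((N ^^ (CHAR('k) ^ i - 1 - ?m)) v) else 0) +
      (if ?m = CHAR('k) ^ i then pscale (a i) v else 0))"
    by (simp only: sum.distrib ac_simps)
  finally show ?case unfolding one m(1) by (rule sym)
qed

text \<open>
  Above the highest corrected index \<open>p ^ (r - 1)\<close>, the operator only counts down.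
\<close>

lemma N_top:
  assumes "k + CHAR('k) ^ (r - 1) < (CHAR('k) ^ r)" shows "(N ^^ k) v = ymon r ((CHAR('k) ^ r) - 1 - k)"
proof -
  have "\<not> (CHAR('k) ^ r) - 1 - k < CHAR('k) ^ i" if "i < r" for i
  proof -
    have "CHAR('k) ^ i \<le> CHAR('k) ^ (r - 1)" using that p_gt_1 by (intro power_increasing) auto
    then show ?thesis using assms by linarith
  qed
  then have "(\<Sum>i<r. if (CHAR('k) ^ r) - 1 - k < CHAR('k) ^ i then pscale (a i) ((N ^^ (CHAR('k) ^ i - 1 - ((CHAR('k) ^ r) - 1 - k))) v) else 0) = 0"
    by (intro sum.neutral) auto
  then show ?thesis using ymon_from_top[of k] assms by simp
qed

lemma three_powers: "3 * CHAR('k) ^ (r - 1) \<le> (CHAR('k) ^ r)"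
proof -
  have "(CHAR('k) ^ r) = CHAR('k) * CHAR('k) ^ (r - 1)" using r_pos by (metis Suc_diff_le diff_Suc_1 power_Suc le_add_diff_inverse2 Suc_eq_plus1)
  then show ?thesis using char_ge_3 by simp
qed

lemma N_bottom: "1 + (\<Sum>i<r. pscale (a i) ((N ^^ (CHAR('k) ^ i - 1)) v)) = (N ^^ ((CHAR('k) ^ r) - 1)) v"
  using ymon_from_top[of "(CHAR('k) ^ r) - 1"] char_pos by simp

lemma N_relation: "(N ^^ (CHAR('k) ^ r)) v = (\<Sum>i<r. pscale (a i) ((N ^^ (CHAR('k) ^ i)) v))"
proof -
  have e: "N ((N ^^ (CHAR('k) ^ i - 1)) v) = (N ^^ (CHAR('k) ^ i)) v" for i
  proof -
    obtain l where "CHAR('k) ^ i = Suc l" by (rule that[of "CHAR('k) ^ i - 1"]) (use char_pos in simp)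
    then show ?thesis by simp
  qed
  have N1: "N 1 = 0" using companion_bracket_ymon[OF q_pos(1), of a] char_pos by (simp add: sum.neutral)
  have "(N ^^ (CHAR('k) ^ r)) v = N ((N ^^ (CHAR('k) ^ r - 1)) v)" by (rule e[symmetric])
  also have "\<dots> = N (1 + (\<Sum>i<r. pscale (a i) ((N ^^ (CHAR('k) ^ i - 1)) v)))" by (simp only: N_bottom)
  also have "\<dots> = (\<Sum>i<r. pscale (a i) ((N ^^ (CHAR('k) ^ i)) v))"
    by (simp only: poisson_bracket_add_right N_sum N_scale e N1 add_0)
  finally show ?thesis .
qed

lemma brk_companion_pow:
  assumes "g \<in> trunc_polys (2 * r)"
  shows "poisson_bracket r ((pm ^^ j) (companion a)) g = (N ^^ (CHAR('k) ^ j)) g"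
  using brk_pow[of "companion a" g j] companion_closed assms by (simp add: poisson_simps)

lemma companion_pow_closed: "(pm ^^ j) (companion a) \<in> trunc_polys (2 * r)"
  using pow_closed[of "companion a" j] companion_closed by (simp add: poisson_simps)

text \<open>
  The difference of the two sides lies in the ideal of the \<open>x_i\<close>. It commutes with \<open>v\<close>, hence with the functions
  of the \<open>y_i\<close>, which \<open>N\<close> generates from \<open>v\<close>. But an element that commutes with the \<open>y_i\<close> does not involve the
  \<open>x_i\<close>.
\<close>

lemma companion_pow_relation: "(pm ^^ r) (companion a) = (\<Sum>i<r. pscale (a i) ((pm ^^ i) (companion a)))"
proof -
  let ?F = "(pm ^^ r) (companion a) - (\<Sum>i<r. pscale (a i) ((pm ^^ i) (companion a)))"
  have sumc: "(\<Sum>i<r. pscale (a i) ((pm ^^ i) (companion a))) \<in> trunc_polys (2 * r)"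
    by (intro trunc_polys_sum trunc_polys_scale
      companion_pow_closed)
  have Fc: "?F \<in> trunc_polys (2 * r)"
    using subspace_diff[OF carrier_subspace] companion_pow_closed sumc by (simp add: poisson_simps)
  have pow_ideal: "ord_ge r 1 ((pm ^^ j) (companion a))" for j
    by (induction j) (auto intro: companion_x_ideal x_ideal_pop companion_pow_closed)
  have Fi: "ord_ge r 1 ?F" by (intro ord_ge_diff ord_ge_sum ord_ge_pscale pow_ideal)
  have diff_left: "poisson_bracket r (f - h) g = poisson_bracket r f g - poisson_bracket r h g" for f h g :: "'k mpoly"
    using poisson_bracket_add_left[of r "f - h" h g] by simp
  have F: "poisson_bracket r ?F g = (N ^^ (CHAR('k) ^ r)) g - (\<Sum>i<r. pscale (a i) ((N ^^ (CHAR('k) ^ i)) g))" if "g \<in> trunc_polys (2 * r)" for g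
    by (simp only: diff_left poisson_bracket_sum_left poisson_bracket_pscale_left brk_companion_pow[OF that])
  have Fv: "poisson_bracket r ?F v = 0" using F[OF v_trunc] N_relation by simp
  have FN: "poisson_bracket r ?F ((N ^^ k) v) = 0" for k
  proof (induction k)
    case (Suc k)
    have "poisson_bracket r ?F (N g) = N (poisson_bracket r ?F g)" if g: "g \<in> trunc_polys (2 * r)" for g
    proof -
      have Ng: "N g \<in> trunc_polys (2 * r)" by (rule poisson_bracket_closed[OF companion_closed g])
      have "(N ^^ m) (N g) = N ((N ^^ m) g)" for m by (metis funpow_swap1)
      moreover have "N (g1 - g2) = N g1 - N g2" for g1 g2 using poisson_bracket_add_right[of r "companion a" "g1 - g2" g2] by simp
      ultimately show ?thesis by (simp only: F[OF g] F[OF Ng] N_sum N_scale)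
    qed
    then have "poisson_bracket r ?F (N ((N ^^ k) v)) = 0" using Suc Nv_trunc N_0 by simp
    then show ?case by simp
  qed (simp add: Fv)
  have Fy: "poisson_bracket r ?F (ymon r m) = 0" if "m < (CHAR('k) ^ r)" for m
  proof -
    have Fsum: "poisson_bracket r ?F (\<Sum>i<n. h i) = (\<Sum>i<n. poisson_bracket r ?F (h i))" for h and n :: nat
      using brk_0_right[of ?F] Fc by (induction n) (simp_all add: poisson_bracket_add_right poisson_simps)
    have z: "(if c then pscale d ((N ^^ l) v) else 0) = pscale (if c then d else 0) ((N ^^ l) v)" for c d l
      by (simp add: pscale_zero_left)
    have "(CHAR('k) ^ r) - 1 - ((CHAR('k) ^ r) - 1 - m) = m" using that by simp
    then have "ymon r m + (\<Sum>i<r. pscale (if m < CHAR('k) ^ i then a i else 0) ((N ^^ (CHAR('k) ^ i - 1 - m)) v)) = (N ^^ ((CHAR('k) ^ r) - 1 - m)) v"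
      using ymon_from_top[of "(CHAR('k) ^ r) - 1 - m"] unfolding z by simp
    then have "poisson_bracket r ?F (ymon r m + (\<Sum>i<r. pscale (if m < CHAR('k) ^ i then a i else 0) ((N ^^ (CHAR('k) ^ i - 1 - m)) v))) = 0"
      by (simp only: FN)
    then show ?thesis
      by (simp only: poisson_bracket_add_right Fsum poisson_bracket_pscale_right FN pscale_zero_right sum.neutral_const add_0_right)
  qed
  have "?F = 0"
  proof (rule x_ideal_commutes_with_y[OF Fc Fi])
    fix i assume "i < r"
    then show "poisson_bracket r ?F (pmonom (pvar (Suc i + r))) = 0"
      using Fy[OF power_le_q] ymon_power by simp
  qed
  then show ?thesis by simp
qed

lemma pm_ymon:
  assumes "0 < m" "m < (CHAR('k) ^ r)" shows "pm (pscale c (ymon r m)) = 0"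
proof -
  obtain d where d: "ymon r m = Poly_Mapping.single (digit_exp CHAR('k) r r m) d" using ymon_single[OF assms(2)] by blast
  let ?e = "digit_exp CHAR('k) r r m"
  have "ymon r m = pscale d (pmonom ?e)" unfolding d by (simp add: pscale_def mult_single)
  then have y: "pscale c (ymon r m) = pscale (c * d) (pmonom ?e)" by (simp add: pscale_def mult_single mult.assoc[symmetric])
  have et: "?e \<in> trunc_exps CHAR('k) (2 * r)"
    unfolding trunc_exps_def
  proof (intro CollectI conjI allI subsetI)
    fix j assume "j \<in> keys ?e"
    then have "j \<in> {Suc r..r + r}" by (intro digit_exp_range[of "CHAR('k)" r r m]) (simp add: in_keys_iff)
    then show "j \<in> {1..2 * r}" by simp
  qed (rule digit_exp_less[OF char_pos assms(2)])
  then have ec: "(pmonom ?e :: 'k mpoly) \<in> trunc_polys (2 * r)" by (auto simp: trunc_polys_def)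
  have "?e \<noteq> 0"
  proof
    assume "?e = 0"
    then have "?e = digit_exp CHAR('k) r r 0" by (simp only: digit_exp_0)
    then have "m = 0" by (rule digit_exp_inj[OF char_pos assms(2) q_pos(1)])
    then show False using assms(1) by simp
  qed
  moreover have "?e \<noteq> pvar i + pvar (i + r)" if "1 \<le> i" "i \<le> r" for i
  proof
    assume "?e = pvar i + pvar (i + r)"
    then have "lookup ?e i \<noteq> 0" by (simp add: lookup_add)
    then show False using digit_exp_range[of "CHAR('k)" r r m i] that by simp
  qed
  ultimately have "pm (pmonom ?e) = 0" unfolding pm_pmonom[OF et] by auto
  then show ?thesis unfolding y using pop_scale[of "pmonom ?e" "c * d"] ec
    by (simp add: poisson_simps pscale_zero_right)
qed

text \<open>
  \<open>N\<close> maps functions of the \<open>y_i\<close> to such functions.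
\<close>

lemma y_functions_commute: "poisson_bracket r (ymon r m) ((N ^^ k) v) = 0" if m: "m < (CHAR('k) ^ r)" for m k
proof -
  let ?W = "family_span (CHAR('k) ^ r) (ymon r)"
  have "N g \<in> ?W" if "g \<in> ?W" for g
  proof -
    have "?W \<subseteq> {g \<in> ?W. N g \<in> ?W}"
    proof (rule family_span_minimal)
      show "subspace {g \<in> ?W. N g \<in> ?W}"
        using subspace_0[OF subspace_family_span, of "CHAR('k) ^ r" "ymon r"] N_0
          subspace_add[OF subspace_family_span, of _ "CHAR('k) ^ r" "ymon r"] subspace_scale[OF subspace_family_span, of _ "CHAR('k) ^ r" "ymon r"]
        by (intro subspaceI) (auto simp: poisson_bracket_add_right N_scale poisson_simps)
      fix l assume l: "l < (CHAR('k) ^ r)"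
      have base: "ymon r l' \<in> ?W" if "l' < (CHAR('k) ^ r)" for l' by (rule family_span_base[OF that])
      have zero: "0 \<in> ?W" by (rule subspace_0[OF subspace_family_span])
      have "(if l = 0 then 0 else ymon r (l - 1)) \<in> ?W" using zero base[of "l - 1"] l by simp
      moreover have "(if l = CHAR('k) ^ i then pscale (a i) v else 0) \<in> ?W" for i
        using zero subspace_scale[OF subspace_family_span base[OF q_pos(2)], of "a i"] by (simp add: poisson_simps)
      ultimately have "N (ymon r l) \<in> ?W"
        unfolding companion_bracket_ymon[OF l] by (intro subspace_add[OF subspace_family_span] subspace_sum[OF subspace_family_span])
      then show "ymon r l \<in> {g \<in> ?W. N g \<in> ?W}" using family_span_base[OF l] by blast
    qed
    then show ?thesis using that by blast
  qed
  then have "(N ^^ k) v \<in> ?W" using family_span_base[OF q_pos(2), of "ymon r"] by (induction k) auto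
  moreover have "?W \<subseteq> {g \<in> carrier L. brk L (ymon r m) g = 0}"
  proof (rule family_span_minimal)
    show "subspace {g \<in> carrier L. brk L (ymon r m) g = 0}"
      by (rule subspace_centralizer) (simp add: poisson_simps ymon_trunc[OF m])
    fix l assume l: "l < (CHAR('k) ^ r)"
    have "partial_deriv i (ymon r l) = 0" if "i \<in> {1..r}" for i using that by (intro partial_deriv_ymon_outside) auto
    then show "ymon r l \<in> {g \<in> carrier L. brk L (ymon r m) g = 0}"
      using ymon_trunc[OF l] ymon_commute[OF m] by (simp add: poisson_simps)
  qed
  ultimately show ?thesis by (auto simp: poisson_simps)
qed

text \<open>
  By \<open>pop_add_semicommuting\<close>, the \<open>p\<close>-map adds \<open>(ad F)^(p-1) G\<close> when it is applied to \<open>F + G\<close>, where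
  \<open>F = (pm ^^ j) (companion a)\<close> acts as \<open>N ^ (p ^ j)\<close> and \<open>G = b N ^ (p ^ j - 1) v\<close> is a multiple of a monomial in the \<open>y_i\<close>
  that is not constant, so that \<open>pm G = 0\<close>.
\<close>

lemma companion_element_pow:
  assumes "j \<le> r"
  shows "(pm ^^ j) (companion_element a b) = (pm ^^ j) (companion a) + pscale b ((N ^^ (CHAR('k) ^ j - 1)) v)"
  using assms
proof (induction j)
  case (Suc j)
  let ?F = "(pm ^^ j) (companion a)" and ?k = "CHAR('k) ^ j - 1"
  let ?G = "pscale b ((N ^^ ?k) v)"
  have j: "j < r" using Suc.prems by simp
  have pj: "CHAR('k) ^ j \<le> CHAR('k) ^ (r - 1)" "0 < CHAR('k) ^ j" using j p_gt_1 by (auto intro!: power_increasing)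
  have Gy: "(N ^^ ?k) v = ymon r ((CHAR('k) ^ r) - CHAR('k) ^ j)"
  proof -
    have "?k + CHAR('k) ^ (r - 1) < CHAR('k) ^ r" using pj three_powers by linarith
    moreover have "CHAR('k) ^ r - 1 - ?k = CHAR('k) ^ r - CHAR('k) ^ j" using pj(2) by linarith
    ultimately show ?thesis using N_top[of ?k] by (simp only:)
  qed
  have small: "0 < (CHAR('k) ^ r) - CHAR('k) ^ j" "(CHAR('k) ^ r) - CHAR('k) ^ j < (CHAR('k) ^ r)" using pj power_le_q[OF j] by auto
  have Gc: "?G \<in> trunc_polys (2 * r)"
    using subspace_scale[OF carrier_subspace] Nv_trunc by (simp add: poisson_simps)
  have adF: "(poisson_bracket r ?F ^^ m) ?G = pscale b ((N ^^ (CHAR('k) ^ j * m + ?k)) v)" for m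
  proof (induction m)
    case (Suc m)
    have "(poisson_bracket r ?F ^^ Suc m) ?G = pscale b (poisson_bracket r ?F ((N ^^ (CHAR('k) ^ j * m + ?k)) v))"
      using Suc by (simp add: poisson_bracket_pscale_right)
    also have "poisson_bracket r ?F ((N ^^ (CHAR('k) ^ j * m + ?k)) v) = (N ^^ (CHAR('k) ^ j + (CHAR('k) ^ j * m + ?k))) v"
      unfolding brk_companion_pow[OF Nv_trunc] by (simp only: funpow_add o_apply)
    also have "CHAR('k) ^ j + (CHAR('k) ^ j * m + ?k) = CHAR('k) ^ j * Suc m + ?k" by simp
    finally show ?case .
  qed simp
  have com: "poisson_bracket r ?G ((poisson_bracket r ?F ^^ m) ?G) = 0" for m
    unfolding adF unfolding Gy
    by (simp only: poisson_bracket_pscale_left poisson_bracket_pscale_right y_functions_commute[OF small(2)] pscale_zero_right)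
  have "pm (?F + ?G) = pm ?F + pm ?G + (poisson_bracket r ?F ^^ (CHAR('k) - 1)) ?G"
    using pop_add_semicommuting[of ?F ?G] companion_pow_closed Gc com by (simp add: poisson_simps)
  also have "pm ?G = 0" unfolding Gy by (rule pm_ymon[OF small])
  also have "(poisson_bracket r ?F ^^ (CHAR('k) - 1)) ?G = pscale b ((N ^^ (CHAR('k) ^ Suc j - 1)) v)"
  proof -
    have "CHAR('k) ^ j * (CHAR('k) - 1) + ?k = CHAR('k) ^ Suc j - 1"
      using pj(2) p_gt_1 by (simp add: algebra_simps)
    then show ?thesis unfolding adF by simp
  qed
  finally show ?case using Suc.IH j by simp
qed (simp add: companion_element_def)

text \<open>
  For the terms that contain \<open>b\<close>, the relation is \<open>N ^ (q - 1) v = 1 + \<Sum>i<r. a i N ^ (p ^ i - 1) v\<close> with \<open>q = p ^ r\<close>.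
\<close>

theorem companion_element_relation:
  "(pm ^^ r) (companion_element a b) = (\<Sum>i<r. pscale (a i) ((pm ^^ i) (companion_element a b))) + Poly_Mapping.single 0 b"
proof -
  let ?h = "\<lambda>i. (N ^^ (CHAR('k) ^ i - 1)) v"
  have "pscale b (1 + (\<Sum>i<r. pscale (a i) (?h i))) = Poly_Mapping.single 0 b + (\<Sum>i<r. pscale (a i) (pscale b (?h i)))"
    by (simp add: pscale_right_distrib pscale_sum_right
       pscale_pscale mult.commute) (simp add: pscale_def)
  then have "pscale b ((N ^^ ((CHAR('k) ^ r) - 1)) v) = Poly_Mapping.single 0 b + (\<Sum>i<r. pscale (a i) (pscale b (?h i)))"
    unfolding N_bottom .
  then have "(pm ^^ r) (companion_element a b) = (\<Sum>i<r. pscale (a i) ((pm ^^ i) (companion a))) +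
      (Poly_Mapping.single 0 b + (\<Sum>i<r. pscale (a i) (pscale b (?h i))))"
    using companion_element_pow[of r b] companion_pow_relation by simp
  also have "\<dots> = (\<Sum>i<r. pscale (a i) ((pm ^^ i) (companion a) + pscale b (?h i))) + Poly_Mapping.single 0 b"
    by (simp add: pscale_right_distrib sum.distrib)
  also have "(\<Sum>i<r. pscale (a i) ((pm ^^ i) (companion a) + pscale b (?h i))) = (\<Sum>i<r. pscale (a i) ((pm ^^ i) (companion_element a b)))"
    by (rule sum.cong[OF refl]) (simp add: companion_element_pow)
  finally show ?thesis .
qed

text \<open>
  Bracketing with \<open>v\<close> turns the powers into \<open>N ^ (p ^ i) v\<close>, which are distinct divided power monomials.
\<close>

theorem companion_element_independent:
  "family_independent (Suc r) (\<lambda>i. if i < r then (pm ^^ i) (companion_element a b) else 1)"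
  unfolding family_independent_def unfolding poisson_simps
proof (intro allI impI)
  fix c i assume "(\<Sum>i<Suc r. pscale (c i) (if i < r then (pm ^^ i) (companion_element a b) else 1)) = 0" and i: "i < Suc r"
  then have rel: "(\<Sum>i<r. pscale (c i) ((pm ^^ i) (companion_element a b))) + pscale (c r) 1 = 0" by simp
  have brk: "poisson_bracket r ((pm ^^ i) (companion_element a b)) v = ymon r ((CHAR('k) ^ r) - 1 - CHAR('k) ^ i)" if i: "i < r" for i
  proof -
    have pj: "CHAR('k) ^ i \<le> CHAR('k) ^ (r - 1)" "0 < CHAR('k) ^ i" using i p_gt_1 by (auto intro!: power_increasing)
    have "poisson_bracket r ((N ^^ (CHAR('k) ^ i - 1)) v) v = - poisson_bracket r v ((N ^^ (CHAR('k) ^ i - 1)) v)" by (rule poisson_bracket_antisym)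
    then have "poisson_bracket r ((N ^^ (CHAR('k) ^ i - 1)) v) v = 0" using y_functions_commute[OF q_pos(2)] by simp
    then have "poisson_bracket r ((pm ^^ i) (companion_element a b)) v = (N ^^ (CHAR('k) ^ i)) v"
      using i by (simp add: companion_element_pow poisson_bracket_add_left poisson_bracket_pscale_left brk_companion_pow[OF v_trunc]
         pscale_zero_right)
    then show ?thesis using N_top[of "CHAR('k) ^ i"] pj three_powers by simp
  qed
  have "poisson_bracket r 1 v = 0" using ymon_commute[OF q_pos(1), of v] partial_deriv_ymon_outside[of _ r "(CHAR('k) ^ r) - 1"] by simp
  then have "(\<Sum>i<r. pscale (c i) (poisson_bracket r ((pm ^^ i) (companion_element a b)) v)) = 0"
    using arg_cong[OF rel, of "\<lambda>x. poisson_bracket r x v"] brk_0_left[of v] v_trunc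
    by (simp add: poisson_bracket_add_left poisson_bracket_sum_left poisson_bracket_pscale_left pscale_zero_right poisson_simps)
  then have z: "(\<Sum>i<r. pscale (c i) (ymon r ((CHAR('k) ^ r) - 1 - CHAR('k) ^ i))) = 0" using brk by simp
  have cl: "c l = 0" if l: "l < r" for l
  proof -
    let ?e = "\<lambda>i. digit_exp CHAR('k) r r ((CHAR('k) ^ r) - 1 - CHAR('k) ^ i)"
    have lt: "(CHAR('k) ^ r) - 1 - CHAR('k) ^ i < (CHAR('k) ^ r)" for i using q_pos by linarith
    have "\<forall>i. \<exists>d. d \<noteq> 0 \<and> ymon r ((CHAR('k) ^ r) - 1 - CHAR('k) ^ i) = Poly_Mapping.single (?e i) d" using ymon_single[OF lt] by blast
    then obtain d where d: "\<And>i. d i \<noteq> 0" "\<And>i. ymon r ((CHAR('k) ^ r) - 1 - CHAR('k) ^ i) = Poly_Mapping.single (?e i) (d i)" by metis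
    have "?e i = ?e l \<longleftrightarrow> i = l" if "i < r" for i
    proof
      assume "?e i = ?e l"
      then have "(CHAR('k) ^ r) - 1 - CHAR('k) ^ i = (CHAR('k) ^ r) - 1 - CHAR('k) ^ l" by (rule digit_exp_inj[OF char_pos lt lt])
      then have "CHAR('k) ^ i = CHAR('k) ^ l" using power_le_q[OF \<open>i < r\<close>] power_le_q[OF l] by linarith
      then show "i = l" using p_gt_1 by (simp add: power_inject_exp)
    qed simp
    then have "lookup (\<Sum>i<r. pscale (c i) (ymon r ((CHAR('k) ^ r) - 1 - CHAR('k) ^ i))) (?e l) = (\<Sum>i<r. if i = l then c i * d i else 0)"
      unfolding lookup_sum d(2) lookup_pscale lookup_single by (intro sum.cong) (auto simp: when_def)
    then show ?thesis using z l d(1)[of l] by simp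
  qed
  then have "pscale (c r) 1 = 0" using rel by (simp add: pscale_zero_left)
  then have "c r = 0" by (simp add: pscale_eq_0_iff)
  then show "c i = 0" using cl i by (auto simp: less_Suc_eq)
qed

end

end

section \<open>Families of toral frames\<close>

context restricted_poisson
begin

lemma one_central: "poisson_bracket r 1 g = 0" "poisson_bracket r g 1 = (0 :: 'k mpoly)"
proof -
  have "partial_deriv i (1 :: 'k mpoly) = 0" for i using partial_deriv_const[of i 1] by simp
  then show "poisson_bracket r 1 g = 0" "poisson_bracket r g 1 = (0 :: 'k mpoly)"
    by (simp_all add: poisson_bracket_def)
qed

lemma pm_one: "pm 1 = 1"
proof -
  have "0 \<in> trunc_exps CHAR('k) (2 * r)" using char_pos by (simp add: trunc_exps_def)
  then show ?thesis using pm_pmonom[of 0] by simp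
qed

lemma one_trunc: "(1 :: 'k mpoly) \<in> trunc_polys (2 * r)"
  using ymon_trunc[of 0] char_pos by simp

lemma const_scale: "Poly_Mapping.single 0 c = pscale c 1"
  by (simp add: pscale_def)

text \<open>
  The entry \<open>r\<close> of the frame is \<open>1\<close>, with coefficient \<open>z r\<close>. If the \<open>e i\<close> are toral and commute, then the condition for
  \<open>j = 0\<close> implies the others; conversely the \<open>e i\<close> are determined by the conditions for \<open>j < r\<close>, a linear system whose matrix
  is a Moore matrix. The condition for \<open>j = r\<close> says that \<open>z 0, \<dots>, z (r - 1)\<close> are roots of the additive polynomial
  \<open>T ^ (p ^ r) - \<Sum>j<r. a j T ^ (p ^ j)\<close>, whose value at \<open>z r\<close> is \<open>b\<close>.
\<close>

definition companion_frame :: "(nat \<Rightarrow> 'k) \<Rightarrow> (nat \<Rightarrow> 'k mpoly) \<Rightarrow> bool" where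
  "companion_frame z e \<longleftrightarrow> e r = 1 \<and> (\<forall>i<r. e i \<in> trunc_polys (2 * r)) \<and>
     (\<exists>a b. \<forall>j\<le>r. (pm ^^ j) (companion_element a b) = (\<Sum>i<Suc r. pscale (z i ^ (CHAR('k) ^ j)) (e i)))"

lemma companion_element_closed: "companion_element a b \<in> trunc_polys (2 * r)"
  unfolding companion_element_def
  by (intro trunc_polys_add trunc_polys_scale
    companion_closed v_trunc)

lemma companion_element_pow_closed: "(pm ^^ j) (companion_element a b) \<in> trunc_polys (2 * r)"
  using pow_closed[of "companion_element a b" j] companion_element_closed by (simp add: poisson_simps)

lemma companion_frame_members:
  assumes C: "left_inverse_matrix r C (\<lambda>j l. z l ^ (CHAR('k) ^ j))" and er: "e r = 1"
    and rel: "\<And>j. j \<le> r \<Longrightarrow> (pm ^^ j) (companion_element a b) = (\<Sum>i<Suc r. pscale (z i ^ (CHAR('k) ^ j)) (e i))"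
    and i: "i < r"
  shows "(\<Sum>j<r. pscale (C i j) ((pm ^^ j) (companion_element a b) - pscale (z r ^ (CHAR('k) ^ j)) 1)) = e i"
proof -
  have "(pm ^^ j) (companion_element a b) - pscale (z r ^ (CHAR('k) ^ j)) 1 = (\<Sum>l<r. pscale (z l ^ (CHAR('k) ^ j)) (e l))" if "j < r" for j
    using rel[of j] that er by simp
  then show ?thesis using invert_linear_system[OF C _ i, of _ e] by (simp add: poisson_simps)
qed

text \<open>
  Applying the \<open>p\<close>-map to the expansion of a power and comparing with that of the next power gives a linear
  system for the elements \<open>pm (e i) - e i\<close>. Its matrix is the Moore matrix of the \<open>z i ^ p\<close>, so they vanish.
\<close>

lemma companion_frame_toral:
  assumes z: "Fp_independent r z" and e: "companion_frame z e"
  shows "toral_frame (Suc r) e"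
proof -
  obtain a b where rel: "\<And>j. j \<le> r \<Longrightarrow> (pm ^^ j) (companion_element a b) = (\<Sum>i<Suc r. pscale (z i ^ (CHAR('k) ^ j)) (e i))"
    using e unfolding companion_frame_def by blast
  have er: "e r = 1" and ec: "e i \<in> trunc_polys (2 * r)" if "i < Suc r" for i
    using e that one_trunc by (auto simp: companion_frame_def less_Suc_eq)
  have er: "e r = 1" using e by (simp add: companion_frame_def)
  let ?X = "companion_element a b"
  let ?u = "\<lambda>j. if j < r then (pm ^^ j) ?X else 1"
  \<comment> \<open>the commutative span of the powers and \<open>1\<close>, which contains the frame because the Moore matrix is invertible\<close>
  let ?U = "family_span (Suc r) ?u"
  have uc: "?u j \<in> carrier L" for j using companion_element_pow_closed one_trunc by (simp add: poisson_simps)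
  have uU: "?u j \<in> ?U" if "j < Suc r" for j using family_span_base[OF that, of ?u] .
  have uu: "brk L (?u i) (?u j) = 0" for i j
    using brk_powers_commute[of ?X i j] companion_element_closed by (simp add: one_central poisson_simps)
  have Uc: "?U \<subseteq> carrier L" by (rule family_span_minimal[OF carrier_subspace uc])
  have uU0: "brk L (?u i) w = 0" if "w \<in> ?U" for w i
    using family_span_minimal[OF subspace_centralizer[OF uc], of "Suc r" ?u i] uu uc that by blast
  have UU: "brk L w w' = 0" if w: "w \<in> ?U" "w' \<in> ?U" for w w'
  proof -
    have "brk L w (?u i) = 0" for i using brk_commute_0[OF uc _ uU0[OF w(1)]] w(1) Uc by blast
    then show ?thesis using family_span_minimal[OF subspace_centralizer[of w], of "Suc r" ?u] uc w Uc by blast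
  qed
  obtain C where C: "left_inverse_matrix r C (\<lambda>j l. z l ^ (CHAR('k) ^ j))" using Moore_inverse_exists[OF char_pos z] by blast
  have eU: "e i \<in> ?U" if "i < Suc r" for i
  proof (cases "i = r")
    case True
    then show ?thesis using uU[of r] er by simp
  next
    case False
    then have i: "i < r" using that by simp
    have "pscale (C i j) ((pm ^^ j) ?X - pscale (z r ^ (CHAR('k) ^ j)) 1) \<in> ?U" if "j < r" for j
      using subspace_scale[OF subspace_family_span subspace_diff[OF subspace_family_span uU[of j]
          subspace_scale[OF subspace_family_span uU[of r], of "z r ^ (CHAR('k) ^ j)"]], of "C i j"] that by (simp add: poisson_simps)
    then have "(\<Sum>j<r. pscale (C i j) ((pm ^^ j) ?X - pscale (z r ^ (CHAR('k) ^ j)) 1)) \<in> ?U"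
      by (intro subspace_sum[OF subspace_family_span]) auto
    then show ?thesis by (simp only: companion_frame_members[where z = z and e = e, OF C er rel i])
  qed
  have com: "brk L (e i) (e j) = 0" if "i < Suc r" "j < Suc r" for i j using UU eU that by blast
  have tor: "pm (e i) = e i" if i: "i < r" for i
  proof -
    have "Fp_independent r (\<lambda>i. z i ^ (CHAR('k) ^ 1))" by (rule Fp_independent_frobenius[OF char_pos z])
    then obtain C' where C': "left_inverse_matrix r C' (\<lambda>j l. (z l ^ (CHAR('k) ^ 1)) ^ (CHAR('k) ^ j))"
      using Moore_inverse_exists[OF char_pos] by blast
    have "0 = (\<Sum>l<r. scl L ((z l ^ (CHAR('k) ^ 1)) ^ (CHAR('k) ^ j)) (pm (e l) - e l))" if j: "j < r" for j
    proof -
      have p: "(z l ^ (CHAR('k) ^ j)) ^ CHAR('k) = z l ^ (CHAR('k) ^ Suc j)" "(z l ^ (CHAR('k) ^ 1)) ^ (CHAR('k) ^ j) = z l ^ (CHAR('k) ^ Suc j)" for l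
        by (simp_all add: power_mult[symmetric] mult.commute)
      have "pm ((pm ^^ j) ?X) = pop L (\<Sum>l<Suc r. scl L (z l ^ (CHAR('k) ^ j)) (e l))"
        using rel[of j] j by (simp add: poisson_simps)
      also have "\<dots> = (\<Sum>l<Suc r. scl L ((z l ^ (CHAR('k) ^ j)) ^ CHAR('k)) (pop L (e l)))"
        by (rule pop_sum_commuting) (use ec com in \<open>auto simp: poisson_simps\<close>)
      finally have "(pm ^^ Suc j) ?X = (\<Sum>l<Suc r. pscale (z l ^ (CHAR('k) ^ Suc j)) (pm (e l)))"
        by (simp only: p poisson_simps funpow.simps o_apply)
      moreover have "(pm ^^ Suc j) ?X = (\<Sum>l<Suc r. pscale (z l ^ (CHAR('k) ^ Suc j)) (e l))" using rel[of "Suc j"] j by (simp only: Suc_leI)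
      ultimately have "(\<Sum>l<r. pscale (z l ^ (CHAR('k) ^ Suc j)) (pm (e l))) = (\<Sum>l<r. pscale (z l ^ (CHAR('k) ^ Suc j)) (e l))"
        by (simp add: er pm_one)
      then show ?thesis unfolding p poisson_simps pscale_right_diff_distrib sum_subtractf by simp
    qed
    then have "(\<Sum>j<r. scl L (C' i j) 0) = pm (e i) - e i" by (rule invert_linear_system[OF C' _ i])
    then show ?thesis by simp
  qed
  have "family_independent (Suc r) e"
  proof (rule family_independent_if_spans[OF companion_element_independent])
    fix j assume j: "j < Suc r"
    show "?u j \<in> family_span (Suc r) e"
    proof (cases "j = r")
      case True
      then show ?thesis using family_span_base[of r "Suc r" e] er by simp
    next
      case False
      then show ?thesis using rel[of j] j family_spanI[of "\<lambda>i. z i ^ (CHAR('k) ^ j)" e "Suc r"] by (simp add: poisson_simps)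
    qed
  qed
  then show ?thesis
    unfolding toral_frame_def using ec com tor er pm_one by (auto simp: poisson_simps less_Suc_eq)
qed

lemma companion_element_cong:
  assumes "\<And>i. i < r \<Longrightarrow> a i = a' i" shows "companion_element a b = companion_element a' b"
  using assms unfolding companion_element_def companion_def by (intro arg_cong2[where f = plus] sum.cong) auto

text \<open>
  The additive polynomial that defines \<open>a\<close> and \<open>b\<close> is determined by its roots and by its value at \<open>z r\<close>.
\<close>

lemma companion_frame_unique:
  assumes z: "Fp_independent r z" and e: "companion_frame z e" and e': "companion_frame z e'" and i: "i < Suc r"
  shows "e i = e' i"
proof -
  have ab: "(\<forall>l<r. z l ^ (CHAR('k) ^ r) = (\<Sum>j<r. a j * z l ^ (CHAR('k) ^ j))) \<and>
      z r ^ (CHAR('k) ^ r) = (\<Sum>j<r. a j * z r ^ (CHAR('k) ^ j)) + b"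
    if er: "e r = 1" and ind: "family_independent (Suc r) e"
      and rel: "\<forall>j\<le>r. (pm ^^ j) (companion_element a b) = (\<Sum>i<Suc r. pscale (z i ^ (CHAR('k) ^ j)) (e i))" for a b e
  proof -
    have "(\<Sum>i<Suc r. scl L (z i ^ (CHAR('k) ^ r)) (e i)) = (pm ^^ r) (companion_element a b)" using rel by (simp add: poisson_simps)
    also have "\<dots> = (\<Sum>j<r. pscale (a j) (\<Sum>i<Suc r. pscale (z i ^ (CHAR('k) ^ j)) (e i))) + pscale b 1"
      unfolding companion_element_relation const_scale using rel by simp
    also have "(\<Sum>j<r. pscale (a j) (\<Sum>i<Suc r. pscale (z i ^ (CHAR('k) ^ j)) (e i))) =
        (\<Sum>i<Suc r. pscale (\<Sum>j<r. a j * z i ^ (CHAR('k) ^ j)) (e i))"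
      unfolding pscale_sum_right pscale_sum_left pscale_pscale
      by (rule sum.swap)
    also have "pscale b 1 = (\<Sum>i<Suc r. pscale (if i = r then b else 0) (e i))"
      using er by (simp add: pscale_zero_left)
    also have "(\<Sum>i<Suc r. pscale (\<Sum>j<r. a j * z i ^ (CHAR('k) ^ j)) (e i)) + (\<Sum>i<Suc r. pscale (if i = r then b else 0) (e i)) =
        (\<Sum>i<Suc r. scl L ((\<Sum>j<r. a j * z i ^ (CHAR('k) ^ j)) + (if i = r then b else 0)) (e i))"
      by (simp only: sum.distrib[symmetric] pscale_left_distrib poisson_simps)
    finally have "z l ^ (CHAR('k) ^ r) = (\<Sum>j<r. a j * z l ^ (CHAR('k) ^ j)) + (if l = r then b else 0)" if "l < Suc r" for l
      using family_independentD[OF ind _ that, of "\<lambda>i. z i ^ (CHAR('k) ^ r)"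
        "\<lambda>i. (\<Sum>j<r. a j * z i ^ (CHAR('k) ^ j)) + (if i = r then b else 0)"] by simp
    then show ?thesis by auto
  qed
  obtain a b where rel: "\<forall>j\<le>r. (pm ^^ j) (companion_element a b) = (\<Sum>i<Suc r. pscale (z i ^ (CHAR('k) ^ j)) (e i))"
    using e unfolding companion_frame_def by blast
  obtain a' b' where rel': "\<forall>j\<le>r. (pm ^^ j) (companion_element a' b') = (\<Sum>i<Suc r. pscale (z i ^ (CHAR('k) ^ j)) (e' i))"
    using e' unfolding companion_frame_def by blast
  have er: "e r = 1" "e' r = 1" using e e' by (auto simp: companion_frame_def)
  have ind: "family_independent (Suc r) e" "family_independent (Suc r) e'"
    using companion_frame_toral[OF z] e e' by (auto simp: toral_frame_def)
  note 1 = ab[OF er(1) ind(1) rel] and 2 = ab[OF er(2) ind(2) rel']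
  have "(\<Sum>j<r. (a j - a' j) * z l ^ (CHAR('k) ^ j)) = 0" if "l < r" for l
  proof -
    have "(\<Sum>j<r. a j * z l ^ (CHAR('k) ^ j)) = (\<Sum>j<r. a' j * z l ^ (CHAR('k) ^ j))" using 1 2 that by metis
    then show ?thesis by (simp add: left_diff_distrib sum_subtractf)
  qed
  then have aa: "a j = a' j" if "j < r" for j using Moore_nonsingular[OF char_pos z _ that, of "\<lambda>j. a j - a' j"] by simp
  then have "(\<Sum>j<r. a j * z r ^ (CHAR('k) ^ j)) = (\<Sum>j<r. a' j * z r ^ (CHAR('k) ^ j))" by (intro sum.cong) auto
  then have "b = b'" using 1 2 by (metis add_left_cancel)
  then have X: "companion_element a' b' = companion_element a b" using companion_element_cong[of a a' b] aa by simp
  obtain C where C: "left_inverse_matrix r C (\<lambda>j l. z l ^ (CHAR('k) ^ j))" using Moore_inverse_exists[OF char_pos z] by blast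
  show ?thesis
  proof (cases "i = r")
    case False
    then have "i < r" using i by simp
    then show ?thesis
      using companion_frame_members[where z = z and e = e, OF C er(1), of a b i]
        companion_frame_members[where z = z and e = e', OF C er(2), of a' b' i] rel rel' unfolding X by simp
  qed (simp add: er)
qed

text \<open>
  An affine transformation of \<open>z\<close> with coefficients in the prime field commutes with the Frobenius map, so it
  can be transferred to the frame while the element with the expansions stays the same.
\<close>

lemma companion_frame_transform:
  assumes e: "companion_frame z e" and A: "\<And>l i. l < Suc r \<Longrightarrow> i < Suc r \<Longrightarrow> A l i \<in> \<int>"
    and Ar: "\<And>i. i < Suc r \<Longrightarrow> A r i = (if i = r then 1 else 0)"
    and z: "\<And>i. i < Suc r \<Longrightarrow> z i = (\<Sum>l<Suc r. A l i * z' l)"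
  shows "companion_frame z' (\<lambda>l. \<Sum>i<Suc r. pscale (A l i) (e i))"
proof -
  obtain a b where rel: "\<And>j. j \<le> r \<Longrightarrow> (pm ^^ j) (companion_element a b) = (\<Sum>i<Suc r. pscale (z i ^ (CHAR('k) ^ j)) (e i))"
    using e unfolding companion_frame_def by blast
  have er: "e r = 1" using e by (simp add: companion_frame_def)
  have ec: "e i \<in> trunc_polys (2 * r)" if "i < Suc r" for i
    using e that one_trunc by (auto simp: companion_frame_def less_Suc_eq)
  have "(\<Sum>i<Suc r. pscale (A r i) (e i)) = 1"
  proof -
    have "(\<Sum>i<Suc r. pscale (A r i) (e i)) = (\<Sum>i<Suc r. if i = r then e i else 0)"
      using Ar by (intro sum.cong) (auto simp: pscale_zero_left pscale_one)
    then show ?thesis by (simp add: er)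
  qed
  moreover have "(\<Sum>i<Suc r. pscale (A l i) (e i)) \<in> trunc_polys (2 * r)" for l
    using ec by (intro trunc_polys_sum trunc_polys_scale) auto
  moreover have "(pm ^^ j) (companion_element a b) = (\<Sum>l<Suc r. pscale (z' l ^ (CHAR('k) ^ j)) (\<Sum>i<Suc r. pscale (A l i) (e i)))" if j: "j \<le> r" for j
  proof -
    have zi: "z i ^ (CHAR('k) ^ j) = (\<Sum>l<Suc r. z' l ^ (CHAR('k) ^ j) * A l i)" if i: "i < Suc r" for i
      unfolding z[OF i] frobenius_sum[OF char_pos]
      using A i by (intro sum.cong) (auto simp: power_mult_distrib frobenius_fixed_Ints[OF char_pos] mult.commute)
    have "(pm ^^ j) (companion_element a b) = (\<Sum>i<Suc r. pscale (\<Sum>l<Suc r. z' l ^ (CHAR('k) ^ j) * A l i) (e i))"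
      unfolding rel[OF j] using zi by (intro sum.cong) auto
    also have "\<dots> = (\<Sum>l<Suc r. pscale (z' l ^ (CHAR('k) ^ j)) (\<Sum>i<Suc r. pscale (A l i) (e i)))"
      unfolding pscale_sum_right pscale_sum_left pscale_pscale
      by (rule sum.swap)
    finally show ?thesis .
  qed
  ultimately show ?thesis unfolding companion_frame_def by blast
qed

text \<open>
  The solution of \<open>z i ^ (p ^ r) = \<Sum>j<r. a j * z i ^ (p ^ j)\<close> for \<open>i < r\<close>, where \<open>C\<close> is the inverse of the Moore matrix.
\<close>

definition relation_coeff :: "(nat \<Rightarrow> nat \<Rightarrow> 'k) \<Rightarrow> (nat \<Rightarrow> 'k) \<Rightarrow> nat \<Rightarrow> 'k" where
  "relation_coeff C z j = (\<Sum>l<r. C l j * z l ^ (CHAR('k) ^ r))"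

definition relation_const :: "(nat \<Rightarrow> nat \<Rightarrow> 'k) \<Rightarrow> (nat \<Rightarrow> 'k) \<Rightarrow> 'k" where
  "relation_const C z = z r ^ (CHAR('k) ^ r) - (\<Sum>j<r. relation_coeff C z j * z r ^ (CHAR('k) ^ j))"

text \<open>
  An explicit frame, which is a rational function of \<open>z\<close> if \<open>C\<close> is the inverse of the Moore matrix of \<open>z\<close>.
\<close>

definition frame_of :: "(nat \<Rightarrow> nat \<Rightarrow> 'k) \<Rightarrow> (nat \<Rightarrow> 'k) \<Rightarrow> nat \<Rightarrow> 'k mpoly" where
  "frame_of C z i = (if i < r then \<Sum>j<r. pscale (C i j)
      ((pm ^^ j) (companion_element (relation_coeff C z) (relation_const C z)) - pscale (z r ^ (CHAR('k) ^ j)) 1) else 1)"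

text \<open>
  For \<open>j < r\<close> the expansion holds by construction of the frame, and for \<open>j = r\<close> by \<open>companion_element_relation\<close> and the
  choice of the coefficients.
\<close>

lemma companion_frame_of:
  assumes C: "left_inverse_matrix r C (\<lambda>j l. z l ^ (CHAR('k) ^ j))"
  shows "companion_frame z (frame_of C z)"
proof -
  define a where "a = relation_coeff C z"
  define b where "b = relation_const C z"
  let ?X = "companion_element a b"
  define Y where "Y j = (pm ^^ j) ?X - pscale (z r ^ (CHAR('k) ^ j)) 1" for j
  have e: "frame_of C z i = (\<Sum>j<r. pscale (C i j) (Y j))" if "i < r" for i using that by (simp add: frame_of_def Y_def a_def b_def)
  have er: "frame_of C z r = 1" by (simp add: frame_of_def)
  have Yc: "Y j \<in> trunc_polys (2 * r)" for j
    unfolding Y_def by (intro trunc_polys_diff trunc_polys_scale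
      companion_element_pow_closed one_trunc)
  have low: "(pm ^^ j) ?X = (\<Sum>i<Suc r. pscale (z i ^ (CHAR('k) ^ j)) (frame_of C z i))" if j: "j < r" for j
  proof -
    have "(\<Sum>i<r. pscale (z i ^ (CHAR('k) ^ j)) (frame_of C z i)) = Y j"
      using invert_linear_system[OF left_inverse_matrix_commute[OF C] _ j, of "frame_of C z" Y] e by (simp add: poisson_simps)
    then show ?thesis by (simp add: er Y_def)
  qed
  have zq: "(\<Sum>j<r. a j * z i ^ (CHAR('k) ^ j)) = z i ^ (CHAR('k) ^ r)" if i: "i < r" for i
  proof -
    have "(\<Sum>j<r. a j * z i ^ (CHAR('k) ^ j)) = (\<Sum>j<r. \<Sum>l<r. z l ^ (CHAR('k) ^ r) * (C l j * z i ^ (CHAR('k) ^ j)))"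
      unfolding a_def relation_coeff_def unfolding sum_distrib_right by (simp only: ac_simps)
    also have "\<dots> = (\<Sum>l<r. z l ^ (CHAR('k) ^ r) * (\<Sum>j<r. C l j * z i ^ (CHAR('k) ^ j)))"
      by (subst sum.swap) (simp add: sum_distrib_left)
    also have "\<dots> = (\<Sum>l<r. if l = i then z l ^ (CHAR('k) ^ r) else 0)"
      using left_inverse_matrixD[OF C _ i] by (intro sum.cong) auto
    finally show ?thesis using i by simp
  qed
  have zr: "(\<Sum>j<r. a j * z r ^ (CHAR('k) ^ j)) + b = z r ^ (CHAR('k) ^ r)" by (simp add: b_def relation_const_def a_def)
  have "(pm ^^ r) ?X = (\<Sum>j<r. pscale (a j) (\<Sum>i<Suc r. pscale (z i ^ (CHAR('k) ^ j)) (frame_of C z i))) + pscale b 1"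
    unfolding companion_element_relation const_scale using low by simp
  also have "(\<Sum>j<r. pscale (a j) (\<Sum>i<Suc r. pscale (z i ^ (CHAR('k) ^ j)) (frame_of C z i))) =
        (\<Sum>i<Suc r. pscale (\<Sum>j<r. a j * z i ^ (CHAR('k) ^ j)) (frame_of C z i))"
    unfolding pscale_sum_right pscale_sum_left pscale_pscale
    by (rule sum.swap)
  also have "\<dots> = (\<Sum>i<r. pscale (z i ^ (CHAR('k) ^ r)) (frame_of C z i)) + pscale (\<Sum>j<r. a j * z r ^ (CHAR('k) ^ j)) 1"
    by (simp add: zq er)
  finally have "(pm ^^ r) ?X = (\<Sum>i<r. pscale (z i ^ (CHAR('k) ^ r)) (frame_of C z i)) + pscale ((\<Sum>j<r. a j * z r ^ (CHAR('k) ^ j)) + b) 1"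
    by (simp only: pscale_left_distrib add.assoc)
  then have top: "(pm ^^ r) ?X = (\<Sum>i<Suc r. pscale (z i ^ (CHAR('k) ^ r)) (frame_of C z i))" by (simp add: zr er)
  have "(pm ^^ j) ?X = (\<Sum>i<Suc r. pscale (z i ^ (CHAR('k) ^ j)) (frame_of C z i))" if "j \<le> r" for j
    using low top that by (cases "j = r") auto
  moreover have "frame_of C z i \<in> trunc_polys (2 * r)" if "i < r" for i
    unfolding e[OF that] using Yc
    by (intro trunc_polys_sum trunc_polys_scale) auto
  ultimately show ?thesis unfolding companion_frame_def using er by blast
qed

lemma regular_companion_element:
  assumes a: "\<And>i. i < r \<Longrightarrow> regular_at s0 (\<lambda>s. a s i)" and b: "regular_at s0 b"
  shows "regular_curve s0 (\<lambda>s. companion_element (a s) (b s))"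
proof -
  have tc: "tmult (ymon r m) (pmonom (pvar (Suc i))) \<in> carrier L" if "m < CHAR('k) ^ r" "i < r" for m i
    unfolding tmult_def poisson_simps using ymon_trunc[OF that(1)] pvar_trunc[of "Suc i"] that(2)
    by (intro polys_in_ptrunc polys_in_mult) (auto simp: trunc_polys_altdef)
  have small: "CHAR('k) ^ i - 1 < CHAR('k) ^ r" if "i < r" for i using power_le_q[OF that] by (simp add: less_imp_diff_less)
  have "companion_element (a s) (b s) = (\<Sum>i<r. tmult (ymon r (CHAR('k) ^ i - 1)) (pmonom (pvar (Suc i))) +
      scl L (a s i) (tmult (ymon r (CHAR('k) ^ r - 1)) (pmonom (pvar (Suc i))))) + scl L (b s) (ymon r (CHAR('k) ^ r - 1))" for s
    unfolding companion_element_def companion_def poisson_simps tmult_add tmult_pscale ..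
  then show ?thesis
    using a b tc small q_pos(2) v_trunc
    by (auto intro!: regular_curve.add regular_curve_sum regular_curve.scale regular_curve.const simp: poisson_simps(1))
qed

lemma regular_frame_of:
  assumes C: "\<And>i j. i < r \<Longrightarrow> j < r \<Longrightarrow> regular_at s0 (\<lambda>s. C s i j)" and z: "\<And>i. i < Suc r \<Longrightarrow> regular_at s0 (\<lambda>s. z s i)"
  shows "regular_curve s0 (\<lambda>s. frame_of (C s) (z s) i)"
proof (cases "i < r")
  case True
  have rc: "regular_at s0 (\<lambda>s. relation_coeff (C s) (z s) j)" if "j < r" for j
    unfolding relation_coeff_def using C z that by (intro regular_at_sum regular_at_mult regular_at_power) auto
  have rk: "regular_at s0 (\<lambda>s. relation_const (C s) (z s))"
    unfolding relation_const_def using rc z by (intro regular_at_diff regular_at_sum regular_at_mult regular_at_power) auto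
  have X: "regular_curve s0 (\<lambda>s. (pop L ^^ j) (companion_element (relation_coeff (C s) (z s)) (relation_const (C s) (z s))))" for j
    by (intro regular_curve_pow regular_companion_element rc rk)
  have one: "regular_curve s0 (\<lambda>s. scl L (- (z s r ^ (CHAR('k) ^ j))) 1)" for j
    using z one_trunc by (intro regular_curve.scale regular_at_uminus regular_at_power regular_curve.const) (auto simp: poisson_simps)
  have "frame_of (C s) (z s) i = (\<Sum>j<r. scl L (C s i j) ((pop L ^^ j) (companion_element (relation_coeff (C s) (z s)) (relation_const (C s) (z s))) +
      scl L (- (z s r ^ (CHAR('k) ^ j))) 1))" for s
    using True by (simp add: frame_of_def poisson_simps pscale_minus_left)
  moreover have "regular_curve s0 (\<lambda>s. \<Sum>j<r. scl L (C s i j) ((pop L ^^ j) (companion_element (relation_coeff (C s) (z s)) (relation_const (C s) (z s))) +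
      scl L (- (z s r ^ (CHAR('k) ^ j))) 1))"
    by (intro regular_curve_sum regular_curve.scale regular_curve.add X one C True) simp
  ultimately show ?thesis by simp
next
  case False
  then show ?thesis using one_trunc by (simp add: frame_of_def regular_curve.const poisson_simps)
qed

definition frame :: "(nat \<Rightarrow> 'k) \<Rightarrow> nat \<Rightarrow> 'k mpoly" where
  "frame z = (SOME e. companion_frame z e)"

lemma companion_frame_frame:
  assumes "Fp_independent r z" shows "companion_frame z (frame z)"
proof -
  obtain C where "left_inverse_matrix r C (\<lambda>j l. z l ^ (CHAR('k) ^ j))" using Moore_inverse_exists[OF char_pos assms] by blast
  then have "companion_frame z (frame_of C z)" by (rule companion_frame_of)
  then show ?thesis unfolding frame_def by (rule someI[of "companion_frame z"])
qed

lemma frame_toral: "Fp_independent r z \<Longrightarrow> toral_frame (Suc r) (frame z)"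
  using companion_frame_toral companion_frame_frame by blast

definition frame_embedding :: "(nat \<Rightarrow> 'k mpoly) \<Rightarrow> (nat \<Rightarrow> 'k) \<Rightarrow> 'k mpoly \<Rightarrow> 'k mpoly" where
  "frame_embedding y z = linear_ext (Suc r) y (frame z)"

text \<open>
  Along the line from \<open>z0\<close> to \<open>z1\<close>, the Moore determinant vanishes at finitely many points only, and elsewhere the
  frame is regular.
\<close>

lemma frame_embedding_connected:
  assumes y: "toral_frame (Suc r) y" and z0: "Fp_independent r z0" and z1: "Fp_independent r z1"
  shows "connected_component_of (zariski_topology L (family_span (Suc r) y)) (frame_embedding y z0) (frame_embedding y z1)"
proof -
  define z where "z s i = z0 i + s * (z1 i - z0 i)" for s i
  define B where "B s j l = z s l ^ (CHAR('k) ^ j)" for s j l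
  have zreg: "regular_at s0 (\<lambda>s. z s i)" for s0 i
    unfolding z_def by (intro regular_at_add regular_at_mult regular_at_const regular_at_id)
  have Breg: "regular_at s0 (\<lambda>s. B s j l)" for s0 j l unfolding B_def by (intro regular_at_power zreg)
  have zz: "z 0 = z0" "z 1 = z1" by (auto simp: z_def)
  \<comment> \<open>outside this finite set, the embeddings of the points of the line are defined\<close>
  define E where "E = {s. \<not> Fp_independent r (z s)}"
  have det: "det (mat r r (\<lambda>(j, l). B s j l)) \<noteq> 0" if "s \<notin> E" for s
    using Moore_det_nonzero[OF char_pos, of r "z s"] that unfolding B_def E_def by blast
  have local_inverse: "\<exists>C E'. (\<forall>i<r. \<forall>j<r. regular_at s0 (\<lambda>s. C s i j)) \<and> finite E' \<and> s0 \<notin> E' \<and>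
      (\<forall>s. s \<notin> E' \<longrightarrow> left_inverse_matrix r (C s) (B s))" if "s0 \<notin> E" for s0
    unfolding left_inverse_matrix_def by (rule regular_at_inverse_matrix[OF Breg det[OF that]])
  have indep: "Fp_independent r (z s)" if "left_inverse_matrix r C (B s)" for s C
    using Fp_independent_if_Moore_inverse[OF char_pos, of r C "z s"] that unfolding B_def by blast
  have "0 \<notin> E" "1 \<notin> E" using z0 z1 by (simp_all add: E_def zz)
  have "finite E"
  proof -
    obtain C E' where "finite E'" "\<forall>s. s \<notin> E' \<longrightarrow> left_inverse_matrix r (C s) (B s)" using local_inverse[OF \<open>0 \<notin> E\<close>] by blast
    moreover have "E \<subseteq> E'" using calculation(2) indep unfolding E_def by blast
    ultimately show ?thesis by (metis finite_subset)
  qed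
  have "connected_component_of (zariski_topology L (family_span (Suc r) y)) (frame_embedding y (z 0)) (frame_embedding y (z 1))"
  proof (rule connected_rational_curve[where E = E])
    show "frame_embedding y (z s) \<in> torus_embeddings L (family_span (Suc r) y)" if "s \<notin> E" for s
      unfolding frame_embedding_def using linear_ext_embedding[OF y frame_toral] that by (simp add: E_def)
    fix \<xi> x s0
    assume \<xi>: "Vector_Spaces.linear (scl L) (*) \<xi>" and x: "x \<in> family_span (Suc r) y" and s0: "s0 \<notin> E"
    obtain C E' where C: "\<And>i j. i < r \<Longrightarrow> j < r \<Longrightarrow> regular_at s0 (\<lambda>s. C s i j)" and E': "finite E'" "s0 \<notin> E'"
      and inv: "\<And>s. s \<notin> E' \<Longrightarrow> left_inverse_matrix r (C s) (B s)" using local_inverse[OF s0] by blast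
    have eq: "frame_of (C s) (z s) i = frame (z s) i" if "s \<notin> E'" "i < Suc r" for s i
    proof -
      have ind: "Fp_independent r (z s)" using indep inv that(1) by blast
      have "companion_frame (z s) (frame_of (C s) (z s))" using inv[OF that(1)] unfolding B_def by (rule companion_frame_of)
      then show ?thesis using companion_frame_unique[OF ind _ companion_frame_frame[OF ind] that(2)] by blast
    qed
    have "regular_at s0 (\<lambda>s. \<xi> (frame (z s) i))" if i: "i < Suc r" for i
    proof (rule regular_at_cong_cofinite[OF _ E'])
      show "regular_at s0 (\<lambda>s. \<xi> (frame_of (C s) (z s) i))"
        by (rule regular_at_regular_curve[OF regular_frame_of \<xi>]) (rule C zreg; assumption)+
      show "\<xi> (frame_of (C s) (z s) i) = \<xi> (frame (z s) i)" if "s \<notin> E'" for s using eq[OF that i] by simp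
    qed
    moreover have "\<xi> (frame_embedding y (z s) x) = (\<Sum>i<Suc r. coords (Suc r) y x i * \<xi> (frame (z s) i))" for s
      unfolding frame_embedding_def linear_ext_def using x by (simp only: restrict_apply' linear_functional_sum[OF \<xi>])
    ultimately show "regular_at s0 (\<lambda>s. \<xi> (frame_embedding y (z s) x))"
      by (simp only:) (intro regular_at_sum regular_at_mult regular_at_const, simp)
  qed (use \<open>finite E\<close> \<open>0 \<notin> E\<close> \<open>1 \<notin> E\<close> in auto)
  then show ?thesis unfolding zz .
qed

text \<open>
  Composition with \<open>g\<close> transforms the frame of \<open>z'\<close> by an affine matrix over the prime field. By
  \<open>companion_frame_transform\<close> the result is the frame of another point \<open>z\<close>, and all frames are connected.
\<close>

lemma frame_embedding_stable:
  assumes y: "toral_frame (Suc r) y" and yr: "y r = 1" and z': "Fp_independent r z'"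
    and t: "t = family_span (Suc r) y" and g: "g \<in> carrier (Aut_p L t)" and g1: "g 1 = 1"
  shows "connected_component_of (zariski_topology L t) (compose t (frame_embedding y z') g) (frame_embedding y z')"
proof -
  \<comment> \<open>the matrices of \<open>g\<close> and of its inverse\<close>
  define A where "A l i = coords (Suc r) y (g (y l)) i" for l i
  define D where "D m l = coords (Suc r) y (inv_into t g (y m)) l" for m l
  have ind: "family_independent (Suc r) y" using y by (simp add: toral_frame_def)
  have tor: "torus L t" unfolding t by (rule torus_of_frame[OF y])
  have At: "abelian_p_subalgebra t" by (rule torus_abelian[OF tor])
  note sub = abelian_p_subalgebraD(2)[OF At]
  have yt: "y i \<in> t" if "i < Suc r" for i unfolding t by (rule family_span_base[OF that])
  have gt: "g x \<in> t" if "x \<in> t" for x using Aut_pD(1)[OF g] that by blast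
  have gA: "g (y l) = (\<Sum>i<Suc r. scl L (A l i) (y i))" if "l < Suc r" for l
    using sum_coords[of "g (y l)" "Suc r" y] gt[OF yt[OF that]] unfolding t A_def by simp
  have AZ: "A l i \<in> \<int>" if "l < Suc r" "i < Suc r" for l i
  proof -
    have "pop L (g (y l)) = g (y l)"
      using Aut_pD(7)[OF g yt[OF that(1)]] y that(1) by (simp add: toral_frame_def)
    then have "pop L (\<Sum>i<Suc r. scl L (A l i) (y i)) = (\<Sum>i<Suc r. scl L (A l i) (y i))"
      unfolding gA[OF that(1)] .
    then show ?thesis
      using toral_iff_coordinates[OF At ind, of "A l"] yt y that(2) by (simp only: toral_frame_def) blast
  qed
  have Ar: "A r i = (if i = r then 1 else 0)" if "i < Suc r" for i
    using coords_frame_member[OF ind _ that, of r] by (simp add: yr g1 A_def)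
  \<comment> \<open>the point with \<open>frame_embedding y z \<circ> g = frame_embedding y z'\<close>\<close>
  define z where "z i = (\<Sum>l<Suc r. A l i * z' l)" for i
  have DA: "(\<Sum>l<Suc r. D m l * A l i) = (if i = m then 1 else 0)" if m: "m < Suc r" and i: "i < Suc r" for m i
  proof -
    have bij: "bij_betw g t t" by (rule Aut_pD(2)[OF g])
    have ht: "inv_into t g (y m) \<in> t" using bij_betw_apply[OF bij_betw_inv_into[OF bij] yt[OF m]] .
    have "(\<Sum>i<Suc r. scl L (if i = m then 1 else 0) (y i)) = y m" by (rule family_member_sum[OF m])
    also have "y m = g (inv_into t g (y m))" using bij_betw_inv_into_right[OF bij yt[OF m]] by simp
    also have "inv_into t g (y m) = (\<Sum>l<Suc r. scl L (D m l) (y l))"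
      using sum_coords[of "inv_into t g (y m)" "Suc r" y] ht unfolding t D_def by simp
    also have "g \<dots> = (\<Sum>l<Suc r. scl L (D m l) (g (y l)))" by (rule Aut_p_sum[OF g sub yt])
    also have "\<dots> = (\<Sum>l<Suc r. scl L (D m l) (\<Sum>i<Suc r. scl L (A l i) (y i)))"
      by (rule sum.cong[OF refl]) (simp only: gA lessThan_iff)
    also have "\<dots> = (\<Sum>i<Suc r. scl L (\<Sum>l<Suc r. D m l * A l i) (y i))"
      unfolding scale_sum_right scale_sum_left scale_scale by (rule sum.swap)
    finally show ?thesis using family_independentD[OF ind _ i, of "\<lambda>i. if i = m then 1 else 0" "\<lambda>i. \<Sum>l<Suc r. D m l * A l i"] by (simp only:)
  qed
  have z: "Fp_independent r z"
    unfolding Fp_independent_def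
  proof (intro allI impI)
    fix c m assume c: "\<forall>i<r. c i \<in> \<int>" "(\<Sum>i<r. c i * z i) = 0" and m: "m < r"
    let ?b = "\<lambda>l. \<Sum>i<r. A l i * c i"
    have "?b r = 0" using Ar by (intro sum.neutral) auto
    then have "(\<Sum>l<r. ?b l * z' l) = (\<Sum>l<Suc r. ?b l * z' l)" by simp
    also have "\<dots> = (\<Sum>i<r. c i * z i)"
      unfolding z_def sum_distrib_left sum_distrib_right by (subst sum.swap) (simp only: ac_simps)
    finally have "(\<Sum>l<r. ?b l * z' l) = 0" using c(2) by simp
    moreover have "?b l \<in> \<int>" if "l < r" for l
      using AZ[of l] that c(1) by (intro Ints_sum Ints_mult) auto
    ultimately have b0: "?b l = 0" if "l < r" for l
      using Fp_independentD[OF z', of ?b l] that by blast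
    have "c m = (\<Sum>i<r. (if i = m then 1 else 0) * c i)" using m by (simp add: if_distrib[of "\<lambda>x. x * _"] sum.delta cong: if_cong)
    also have "\<dots> = (\<Sum>i<r. (\<Sum>l<Suc r. D m l * A l i) * c i)" using DA[of m] m by (intro sum.cong) auto
    also have "\<dots> = (\<Sum>l<Suc r. D m l * ?b l)"
      unfolding sum_distrib_left sum_distrib_right by (subst sum.swap) (simp only: ac_simps)
    also have "\<dots> = 0" using b0 \<open>?b r = 0\<close> by (intro sum.neutral) (auto simp: less_Suc_eq)
    finally show "c m = 0" .
  qed
  have tr: "frame z' l = (\<Sum>i<Suc r. pscale (A l i) (frame z i))" if l: "l < Suc r" for l
  proof -
    have "companion_frame z' (\<lambda>l. \<Sum>i<Suc r. pscale (A l i) (frame z i))"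
      by (rule companion_frame_transform[where A = A, OF companion_frame_frame[OF z] AZ Ar]) (simp_all only: z_def)
    then show ?thesis using companion_frame_unique[OF z' companion_frame_frame[OF z'] _ l] by blast
  qed
  have psi: "frame_embedding y w \<in> torus_embeddings L t" if "Fp_independent r w" for w
    unfolding frame_embedding_def t by (rule linear_ext_embedding[OF y frame_toral[OF that]])
  have eq: "compose t (frame_embedding y z) g = frame_embedding y z'"
  proof
    fix x
    show "compose t (frame_embedding y z) g x = frame_embedding y z' x"
    proof (cases "x \<in> t")
      case True
      let ?c = "coords (Suc r) y x"
      have x: "x = (\<Sum>l<Suc r. scl L (?c l) (y l))" using sum_coords[of x "Suc r" y] True unfolding t by simp
      have "g x = (\<Sum>l<Suc r. scl L (?c l) (g (y l)))" by (subst x) (rule Aut_p_sum[OF g sub yt])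
      also have "\<dots> = (\<Sum>l<Suc r. scl L (?c l) (\<Sum>i<Suc r. scl L (A l i) (y i)))"
        by (rule sum.cong[OF refl]) (simp only: gA lessThan_iff)
      also have "\<dots> = (\<Sum>i<Suc r. scl L (\<Sum>l<Suc r. ?c l * A l i) (y i))"
        unfolding scale_sum_right scale_sum_left scale_scale by (rule sum.swap)
      finally have "frame_embedding y z (g x) = (\<Sum>i<Suc r. scl L (\<Sum>l<Suc r. ?c l * A l i) (frame z i))"
        unfolding frame_embedding_def by (simp only: linear_ext_sum[OF ind])
      also have "\<dots> = (\<Sum>l<Suc r. scl L (?c l) (\<Sum>i<Suc r. scl L (A l i) (frame z i)))"
        unfolding scale_sum_right scale_sum_left scale_scale by (rule sum.swap)
      also have "\<dots> = (\<Sum>l<Suc r. scl L (?c l) (frame z' l))"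
        by (rule sum.cong[OF refl]) (simp only: tr lessThan_iff poisson_simps)
      also have "\<dots> = frame_embedding y z' x"
        unfolding frame_embedding_def by (subst (2) x) (simp only: linear_ext_sum[OF ind])
      finally show ?thesis using True by (simp only: compose_eq)
    next
      case False
      then show ?thesis using embeddingD(7)[OF psi[OF z']] by (simp add: compose_def extensional_def)
    qed
  qed
  have "connected_component_of (zariski_topology L t) (compose t (frame_embedding y z') g) (compose t (frame_embedding y z) g)"
  proof (rule connected_component_of_compose)
    show "g \<in> t \<rightarrow> t" by (rule Aut_pD(1)[OF g])
    show "compose t \<phi> g \<in> torus_embeddings L t" if "\<phi> \<in> torus_embeddings L t" for \<phi>
      using embedding_compose[OF _ that g] tor by (simp add: torus_def)
    show "connected_component_of (zariski_topology L t) (frame_embedding y z') (frame_embedding y z)"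
      unfolding t by (rule frame_embedding_connected[OF y z' z])
  qed
  then show ?thesis unfolding eq .
qed

text \<open>
  The bound of \<open>torus_dim_le\<close> is attained by the frames.
\<close>

lemma max_torus_dim_poisson: "max_torus_dim L = Suc r"
proof (rule antisym)
  have "{dim t |t. torus L t} \<subseteq> {..r + 1}" using torus_dim_le by blast
  then have fin: "finite {dim t |t. torus L t}" by (rule finite_subset) simp
  obtain z :: "nat \<Rightarrow> 'k" where z: "Fp_independent r z" using exists_Fp_independent[OF char_pos] by blast
  note tor = torus_of_frame[OF frame_toral[OF z]]
  show "max_torus_dim L \<le> Suc r"
    unfolding max_torus_dim_def
  proof (rule Max.boundedI[OF fin])
    show "{dim t |t. torus L t} \<noteq> {}" using tor by blast
    fix d assume "d \<in> {dim t |t. torus L t}"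
    then obtain u where "torus L u" "d = dim u" by blast
    then show "d \<le> Suc r" using torus_dim_le[of u] by simp
  qed
  have "dim (family_span (Suc r) (frame z)) = Suc r" using frame_toral[OF z] by (intro dim_family_span) (simp add: toral_frame_def)
  then show "Suc r \<le> max_torus_dim L" using dim_torus_le_max[OF tor] by simp
qed

text \<open>
  Otherwise the central toral element \<open>1\<close> could be added to the torus.
\<close>

lemma one_in_max_torus:
  assumes t: "max_dim_torus L t" shows "1 \<in> t"
proof (rule ccontr)
  assume n: "1 \<notin> t"
  have tor: "torus L t" and dim: "dim t = Suc r" using t by (simp_all add: max_dim_torus_def max_torus_dim_poisson)
  obtain y where y: "toral_frame (Suc r) y" "t = family_span (Suc r) y" using frame_of_torus[OF tor] unfolding dim by blast
  have "family_independent (Suc (Suc r)) (y(Suc r := 1))"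
    using y n by (intro family_independent_Suc) (auto simp: toral_frame_def)
  then have fr: "toral_frame (Suc (Suc r)) (y(Suc r := 1))"
    using y(1) one_trunc pm_one one_central by (auto simp: toral_frame_def poisson_simps less_Suc_eq)
  then have "dim (family_span (Suc (Suc r)) (y(Suc r := 1))) = Suc (Suc r)" by (intro dim_family_span) (simp add: toral_frame_def)
  then show False using torus_dim_le[OF torus_of_frame[OF fr]] by simp
qed

lemma max_torus_frame:
  assumes t: "max_dim_torus L t"
  shows "\<exists>y. toral_frame (Suc r) y \<and> y r = 1 \<and> t = family_span (Suc r) y"
proof -
  have tor: "torus L t" and dim: "dim t = Suc r" using t by (simp_all add: max_dim_torus_def max_torus_dim_poisson)
  have S: "{1} \<subseteq> toral_elements t" using one_in_max_torus[OF t] pm_one by (simp add: toral_elements_def poisson_simps)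
  have indS: "independent {1 :: 'k mpoly}" by simp
  obtain B where B: "{1} \<subseteq> B" "B \<subseteq> toral_elements t" "independent B" "span B = t" "finite B" "card B = Suc r"
    using torus_toral_basis_extend[OF tor S indS] unfolding dim by (elim exE conjE) (rule that, assumption+)
  have "finite (B - {1})" "card (B - {1}) = r" using B by auto
  then obtain f where f: "bij_betw f {..<r} (B - {1})" using ex_bij_betw_nat_finite[of "B - {1}"] by (auto simp: atLeast0LessThan)
  define y where "y i = (if i < r then f i else 1)" for i
  have yB: "y ` {..<Suc r} = B"
    using bij_betw_imp_surj_on[OF f] B(1) by (auto simp: y_def lessThan_Suc)
  have inj: "inj_on y {..<Suc r}" by (rule eq_card_imp_inj_on) (simp_all only: yB B(6) finite_lessThan card_lessThan)
  have ind: "family_independent (Suc r) y" unfolding family_independent_iff yB using inj B(3) by blast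
  have yt: "y i \<in> toral_elements t" if "i < Suc r" for i using that yB B(2) by blast
  have At: "abelian_p_subalgebra t" by (rule torus_abelian[OF tor])
  have "toral_frame (Suc r) y"
    unfolding toral_frame_def using yt ind abelian_p_subalgebraD(1,4)[OF At] by (auto simp: toral_elements_def)
  moreover have "t = family_span (Suc r) y" unfolding family_span_eq yB by (rule B(4)[symmetric])
  ultimately show ?thesis by (intro exI[of _ y]) (simp add: y_def)
qed

end

section \<open>The stabilizer of the component of the inclusion\<close>

context restricted_poisson
begin

text \<open>
  The image of an embedding is a torus of maximal dimension, hence contains \<open>1\<close>.
\<close>

lemma embedding_hits_one:
  assumes t: "max_dim_torus L t" and \<phi>: "\<phi> \<in> torus_embeddings L t"
  shows "\<exists>x\<in>toral_elements t. \<phi> x = 1"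
proof -
  obtain y where y: "toral_frame (Suc r) y" "t = family_span (Suc r) y" using max_torus_frame[OF t] by blast
  have fr: "toral_frame (Suc r) (\<lambda>i. \<phi> (y i))" and img: "\<phi> ` t = family_span (Suc r) (\<lambda>i. \<phi> (y i))"
    using embedding_frame[OF y(1)] \<phi> unfolding y(2) by blast+
  have "dim (family_span (Suc r) (\<lambda>i. \<phi> (y i))) = Suc r" using fr by (intro dim_family_span) (simp add: toral_frame_def)
  then have "max_dim_torus L (\<phi> ` t)"
    unfolding max_dim_torus_def img max_torus_dim_poisson using torus_of_frame[OF fr] by blast
  then have "1 \<in> \<phi> ` t" by (rule one_in_max_torus)
  then obtain x where x: "x \<in> t" "\<phi> x = 1" by auto
  have "pop L x \<in> t" using t x(1) by (auto simp: max_dim_torus_def torus_def p_subalgebra_def)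
  moreover have "\<phi> (pop L x) = \<phi> x" using embeddingD(5)[OF \<phi> x(1)] x(2) pm_one by (simp add: poisson_simps)
  ultimately have "pop L x = x" using inj_onD[OF embeddingD(6)[OF \<phi>]] x(1) by blast
  then show ?thesis using x by (auto simp: toral_elements_def)
qed

text \<open>
  The coefficients of a polynomial are linear forms, and they separate points.
\<close>

lemma closedin_maps_to:
  assumes x: "x \<in> t"
  shows "closedin (zariski_topology L t) {\<phi> \<in> torus_embeddings L t. \<phi> x = c}"
proof -
  let ?f = "\<lambda>a \<phi>. lookup (\<phi> x) a + - lookup c a"
  have "vector_space ((*) :: 'k \<Rightarrow> 'k \<Rightarrow> 'k)" by unfold_locales (auto simp: algebra_simps)
  then have lin: "Vector_Spaces.linear (scl L) (*) (\<lambda>u. lookup u a)" for a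
    using vector_space_pscale by (simp add: Vector_Spaces.linear_iff poisson_simps lookup_add lookup_pscale)
  have "?f a \<in> hom_poly_funs L t" for a
    by (rule hom_poly_funs.add[OF hom_poly_funs.coord[OF lin x] hom_poly_funs.const])
  then have "openin (zariski_topology L t) {\<phi> \<in> torus_embeddings L t. ?f a \<phi> \<noteq> 0}" for a by (rule openin_principal_open)
  then have "openin (zariski_topology L t) (\<Union>a. {\<phi> \<in> torus_embeddings L t. ?f a \<phi> \<noteq> 0})" by (intro openin_Union) auto
  moreover have "(\<Union>a. {\<phi> \<in> torus_embeddings L t. ?f a \<phi> \<noteq> 0}) =
      topspace (zariski_topology L t) - {\<phi> \<in> torus_embeddings L t. \<phi> x = c}"
    using poly_mapping_eqI[of _ c] by auto
  ultimately show ?thesis unfolding closedin_def by auto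
qed

text \<open>
  The closed sets of the embeddings that map a given toral element to \<open>1\<close> partition the variety of embeddings.
  As there are finitely many toral elements, these sets are also open.
\<close>

lemma connected_fixes_one:
  assumes t: "max_dim_torus L t" and con: "connected_component_of (zariski_topology L t) \<phi> \<psi>" and \<phi>: "\<phi> 1 = 1"
  shows "\<psi> 1 = 1"
proof -
  let ?X = "zariski_topology L t" and ?S = "\<lambda>x. {\<phi> \<in> torus_embeddings L t. \<phi> x = 1}"
  have one: "1 \<in> t" by (rule one_in_max_torus[OF t])
  obtain y where y: "toral_frame (Suc r) y" "t = family_span (Suc r) y" using max_torus_frame[OF t] by blast
  have fin: "finite (toral_elements t)" unfolding y(2) by (rule finite_toral_elements[OF y(1)])
  have cl: "closedin ?X (?S x)" if "x \<in> t" for x by (rule closedin_maps_to[OF that])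
  have "closedin ?X (\<Union>x\<in>toral_elements t - {1}. ?S x)"
    using fin cl by (intro closedin_Union) (auto simp: toral_elements_def)
  moreover have "(\<Union>x\<in>toral_elements t - {1}. ?S x) = topspace ?X - ?S 1"
  proof
    have "x = 1" if "\<phi> \<in> torus_embeddings L t" "\<phi> x = 1" "\<phi> 1 = 1" "x \<in> toral_elements t" for \<phi> x
      using inj_onD[OF embeddingD(6)[OF that(1)], of x 1] that one by (simp add: toral_elements_def)
    then show "(\<Union>x\<in>toral_elements t - {1}. ?S x) \<subseteq> topspace ?X - ?S 1" by auto
    show "topspace ?X - ?S 1 \<subseteq> (\<Union>x\<in>toral_elements t - {1}. ?S x)"
    proof
      fix \<phi> assume "\<phi> \<in> topspace ?X - ?S 1"
      then have \<phi>: "\<phi> \<in> torus_embeddings L t" "\<phi> 1 \<noteq> 1" by auto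
      obtain x where x: "x \<in> toral_elements t" "\<phi> x = 1" using embedding_hits_one[OF t \<phi>(1)] by blast
      then have "x \<in> toral_elements t - {1}" using \<phi>(2) by auto
      then show "\<phi> \<in> (\<Union>x\<in>toral_elements t - {1}. ?S x)" using x(2) \<phi>(1) by blast
    qed
  qed
  ultimately have "openin ?X (topspace ?X - (topspace ?X - ?S 1))" by (simp only: closedin_def)
  moreover have "topspace ?X - (topspace ?X - ?S 1) = ?S 1" by auto
  ultimately have op: "openin ?X (?S 1)" by (simp only:)
  obtain C where C: "connectedin ?X C" "\<phi> \<in> C" "\<psi> \<in> C" using con unfolding connected_component_of_def by blast
  have top: "C \<subseteq> torus_embeddings L t" using connectedin_subset_topspace[OF C(1)] by simp
  have op': "openin ?X (topspace ?X - ?S 1)" using cl[OF one] by (simp add: closedin_def)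
  show ?thesis
  proof (rule ccontr)
    assume "\<psi> 1 \<noteq> 1"
    then have "\<psi> \<in> (topspace ?X - ?S 1) \<inter> C" using C(3) top by auto
    moreover have "\<phi> \<in> ?S 1 \<inter> C" using C(2) top \<phi> by auto
    moreover have "C \<subseteq> ?S 1 \<union> (topspace ?X - ?S 1)" "?S 1 \<inter> (topspace ?X - ?S 1) \<inter> C = {}" using top by auto
    ultimately have "\<exists>E1 E2. openin ?X E1 \<and> openin ?X E2 \<and> C \<subseteq> E1 \<union> E2 \<and> E1 \<inter> E2 \<inter> C = {} \<and> E1 \<inter> C \<noteq> {} \<and> E2 \<inter> C \<noteq> {}"
      using op op' by (intro exI[of _ "?S 1"] exI[of _ "topspace ?X - ?S 1"]) auto
    then show False using C(1)[unfolded connectedin, THEN conjunct2] by (rule notE[rotated])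
  qed
qed

text \<open>
  As \<open>Aut_p L t\<close> acts transitively on the components, the component of the inclusion is moved by some \<open>g0\<close> to that of
  a frame embedding. Both embeddings fix \<open>1\<close>, hence \<open>g0\<close> fixes \<open>1\<close> as well, and the frame embedding is connected to its
  composition with \<open>g0\<close>.
\<close>

theorem S_set_poisson:
  assumes t: "max_dim_torus L t"
  shows "S_set L t = {g \<in> carrier (Aut_p L t). g 1 = 1}"
proof -
  let ?X = "zariski_topology L t" and ?i = "\<lambda>x\<in>t. x" and ?con = "connected_component_of (zariski_topology L t)"
  obtain y where y: "toral_frame (Suc r) y" "y r = 1" "t = family_span (Suc r) y" using max_torus_frame[OF t] by blast
  have tor: "torus L t" using t by (simp add: max_dim_torus_def)
  then have pt: "p_subalgebra L t" by (simp add: torus_def)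
  have one: "1 \<in> t" by (rule one_in_max_torus[OF t])
  have i: "?i \<in> torus_embeddings L t" by (rule inclusion_embedding[OF pt])
  have ind: "family_independent (Suc r) y" using y(1) by (simp add: toral_frame_def)
  obtain z :: "nat \<Rightarrow> 'k" where z: "Fp_independent r z" using exists_Fp_independent[OF char_pos] by blast
  let ?psi = "frame_embedding y z"
  have psi: "?psi \<in> torus_embeddings L t"
    unfolding frame_embedding_def y(3) by (rule linear_ext_embedding[OF y(1) frame_toral[OF z]])
  have psi1: "?psi 1 = 1"
    using linear_ext_base[OF ind, of r "frame z"] companion_frame_frame[OF z] by (simp add: frame_embedding_def y(2) companion_frame_def)
  have move: "?con (compose t \<phi> g) (compose t \<psi> g)" if "?con \<phi> \<psi>" "g \<in> carrier (Aut_p L t)" for \<phi> \<psi> g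
    by (rule connected_component_of_compose[OF Aut_pD(1)[OF that(2)] embedding_compose[OF pt _ that(2)] that(1)])
  have stable: "?con (compose t ?psi g) ?psi" if "g \<in> carrier (Aut_p L t)" "g 1 = 1" for g
    by (rule frame_embedding_stable[OF y(1,2) z y(3) that])
  \<comment> \<open>\<open>g0\<close> fixes \<open>1\<close>, so that the inclusion is connected to the frame embedding itself\<close>
  obtain g0 where g0: "g0 \<in> carrier (Aut_p L t)" "?con ?i (compose t ?psi g0)"
    using Aut_p_transitive_on_components[OF t _ i psi] max_torus_dim_poisson by auto
  have i1: "?i 1 = 1" using one by simp
  have "compose t ?psi g0 1 = 1" by (rule connected_fixes_one[OF t g0(2)]) (rule i1)
  then have "?psi (g0 1) = ?psi 1" using one psi1 by (simp add: compose_eq)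
  moreover have "g0 1 \<in> t" using Aut_pD(1)[OF g0(1)] one by blast
  ultimately have "g0 1 = 1" using inj_onD[OF embeddingD(6)[OF psi]] one by blast
  then have ipsi: "?con ?i ?psi" using connected_component_of_trans[OF g0(2) stable[OF g0(1)]] by blast
  note sym = connected_component_of_sym[THEN iffD1] and trans = connected_component_of_trans
  have fix_i: "?con ?i (compose t ?i g)" if g: "g \<in> carrier (Aut_p L t)" "g 1 = 1" for g
    by (rule sym[OF trans[OF trans[OF move[OF ipsi g(1)] stable[OF g]] sym[OF ipsi]]])
  have fixes_all: "?con ?i (compose t \<phi> g)" if g: "g \<in> carrier (Aut_p L t)" "g 1 = 1" and \<phi>: "?con ?i \<phi>" for g \<phi>
    by (rule trans[OF fix_i[OF g] move[OF \<phi> g(1)]])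
  have "g \<in> S_set L t \<longleftrightarrow> g 1 = 1" if g: "g \<in> carrier (Aut_p L t)" for g
  proof
    assume "g \<in> S_set L t"
    then have "aut_action t g ` inclusion_component L t = inclusion_component L t" by (simp add: S_set_def stabilizer_def)
    moreover have "?i \<in> inclusion_component L t" using i by (simp add: inclusion_component_def connected_component_of_refl)
    ultimately have "?con ?i (aut_action t g ?i)" unfolding inclusion_component_def by blast
    then have "aut_action t g ?i 1 = 1" by (rule connected_fixes_one[OF t]) (rule i1)
    then have "Aut_inv t g 1 = 1" using one Aut_inv_simps(1)[OF g one] by (simp add: aut_action_eq compose_eq)
    then show "g 1 = 1" using Aut_inv_simps(2)[OF g one] by simp
  next
    assume g1: "g 1 = 1"
    have inv1: "Aut_inv t g 1 = 1" using Aut_inv_simps(3)[OF g one] g1 by simp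
    have invA: "Aut_inv t g \<in> carrier (Aut_p L t)" by (rule Aut_inv_closed[OF pt g])
    have "aut_action t g ` inclusion_component L t = inclusion_component L t"
    proof
      show "aut_action t g ` inclusion_component L t \<subseteq> inclusion_component L t"
        unfolding inclusion_component_def using fixes_all[OF invA inv1] by (auto simp: aut_action_eq)
      show "inclusion_component L t \<subseteq> aut_action t g ` inclusion_component L t"
      proof
        fix \<phi> assume \<phi>: "\<phi> \<in> inclusion_component L t"
        then have con: "?con ?i \<phi>" by (simp add: inclusion_component_def)
        then have "\<phi> \<in> torus_embeddings L t" using connected_component_in_topspace[of ?X ?i \<phi>] by simp
        then have "\<phi> = aut_action t g (compose t \<phi> g)"
          using Aut_inv_simps[OF g] embeddingD(7)[of \<phi> t] by (auto simp: aut_action_eq compose_def extensional_def)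
        moreover have "compose t \<phi> g \<in> inclusion_component L t"
          using fixes_all[OF g g1 con] by (simp add: inclusion_component_def)
        ultimately show "\<phi> \<in> aut_action t g ` inclusion_component L t" by (rule image_eqI)
      qed
    qed
    then show "g \<in> S_set L t" using g by (simp add: S_set_def stabilizer_def)
  qed
  moreover have "S_set L t \<subseteq> carrier (Aut_p L t)" by (auto simp: S_set_def stabilizer_def)
  ultimately show ?thesis by blast
qed

subsection \<open>Automorphisms that fix the unit as affine maps\<close>

context
  fixes t :: "'k mpoly set" and y :: "nat \<Rightarrow> 'k mpoly"
  assumes y: "toral_frame (Suc r) y" and yr: "y r = 1" and ty: "t = family_span (Suc r) y"
begin

definition fixing_one :: "('k mpoly \<Rightarrow> 'k mpoly) set" where
  "fixing_one = {g \<in> carrier (Aut_p L t). g 1 = 1}"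

definition entry :: "('k mpoly \<Rightarrow> 'k mpoly) \<Rightarrow> nat \<Rightarrow> nat \<Rightarrow> 'k" where
  "entry g l i = coords (Suc r) y (g (y l)) i"

text \<open>
  On the toral basis \<open>y\<close>, an automorphism \<open>g\<close> with \<open>g 1 = 1\<close> acts by \<open>y l \<mapsto> \<Sum>i<r. M l i y i + v l\<close>. The rows of the
  matrix belong to the arguments, which makes \<open>g \<mapsto> (M, v)\<close> reverse products.
\<close>

definition linear_matrix :: "('k mpoly \<Rightarrow> 'k mpoly) \<Rightarrow> 'k mat" where
  "linear_matrix g = mat r r (\<lambda>(l, i). entry g l i)"

definition translation_vec :: "('k mpoly \<Rightarrow> 'k mpoly) \<Rightarrow> 'k vec" where
  "translation_vec g = vec r (\<lambda>l. entry g l r)"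

lemma ind_y: "family_independent (Suc r) y"
  using y by (simp add: toral_frame_def)

lemma torus_t: "torus L t"
  unfolding ty by (rule torus_of_frame[OF y])

lemma p_sub_t: "p_subalgebra L t"
  using torus_t by (simp add: torus_def)

lemma sub_t: "subspace t"
  using p_sub_t by (simp add: p_subalgebra_def)

lemma y_in_t: "i < Suc r \<Longrightarrow> y i \<in> t"
  unfolding ty by (rule family_span_base)

lemma one_in_t: "1 \<in> t"
  using y_in_t[of r] yr by simp

lemma Aut_maps: "g \<in> carrier (Aut_p L t) \<Longrightarrow> x \<in> t \<Longrightarrow> g x \<in> t"
  using Aut_pD(1)[of g t] by blast

lemma entry_sum: "g \<in> carrier (Aut_p L t) \<Longrightarrow> l < Suc r \<Longrightarrow> g (y l) = (\<Sum>i<Suc r. scl L (entry g l i) (y i))"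
  using sum_coords[of "g (y l)" "Suc r" y] Aut_maps[OF _ y_in_t] unfolding ty entry_def by simp

lemma entry_unique:
  assumes "g (y l) = (\<Sum>i<Suc r. scl L (c i) (y i))" "i < Suc r"
  shows "entry g l i = c i"
  unfolding entry_def assms(1) by (rule coords_sum[OF ind_y assms(2)])

lemma entry_Ints:
  assumes g: "g \<in> carrier (Aut_p L t)" and "l < Suc r" "i < Suc r" shows "entry g l i \<in> \<int>"
proof -
  have "pop L (g (y l)) = g (y l)"
    using Aut_pD(7)[OF g y_in_t[OF assms(2)]] y assms(2) by (simp add: toral_frame_def)
  then have "pop L (\<Sum>i<Suc r. scl L (entry g l i) (y i)) = (\<Sum>i<Suc r. scl L (entry g l i) (y i))"
    unfolding entry_sum[OF g assms(2)] .
  then show ?thesis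
    using toral_iff_coordinates[OF torus_abelian[OF torus_t] ind_y, of "entry g l"] y_in_t y assms(3)
    by (simp only: toral_frame_def) blast
qed

lemma entry_last:
  assumes "g 1 = 1" "i < Suc r" shows "entry g r i = (if i = r then 1 else 0)"
  using coords_frame_member[OF ind_y _ assms(2), of r] by (simp add: entry_def yr assms(1))

lemma entry_compose:
  assumes g: "g \<in> carrier (Aut_p L t)" and f: "f \<in> carrier (Aut_p L t)" and l: "l < Suc r" and i: "i < Suc r"
  shows "entry (compose t g f) l i = (\<Sum>m<Suc r. entry f l m * entry g m i)"
proof (rule entry_unique[OF _ i])
  have "compose t g f (y l) = g (\<Sum>m<Suc r. scl L (entry f l m) (y m))"
    using y_in_t[OF l] by (simp only: compose_eq entry_sum[OF f l])
  also have "\<dots> = (\<Sum>m<Suc r. scl L (entry f l m) (g (y m)))" by (rule Aut_p_sum[OF g sub_t y_in_t])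
  also have "\<dots> = (\<Sum>m<Suc r. scl L (entry f l m) (\<Sum>i<Suc r. scl L (entry g m i) (y i)))"
    by (rule sum.cong[OF refl]) (simp only: entry_sum[OF g] lessThan_iff)
  also have "\<dots> = (\<Sum>i<Suc r. scl L (\<Sum>m<Suc r. entry f l m * entry g m i) (y i))"
    unfolding scale_sum_right scale_sum_left scale_scale by (rule sum.swap)
  finally show "compose t g f (y l) = (\<Sum>i<Suc r. scl L (\<Sum>m<Suc r. entry f l m * entry g m i) (y i))" .
qed

lemma linear_matrix_carrier: "linear_matrix g \<in> carrier_mat r r"
  by (simp add: linear_matrix_def)

lemma translation_vec_carrier: "translation_vec g \<in> carrier_vec r"
  by (simp add: translation_vec_def)

lemma affine_compose:
  assumes g: "g \<in> fixing_one" and f: "f \<in> fixing_one"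
  shows "linear_matrix (compose t g f) = linear_matrix f * linear_matrix g"
    and "translation_vec (compose t g f) = translation_vec f + linear_matrix f *\<^sub>v translation_vec g"
proof -
  have gA: "g \<in> carrier (Aut_p L t)" "g 1 = 1" and fA: "f \<in> carrier (Aut_p L t)" using g f by (auto simp: fixing_one_def)
  show "linear_matrix (compose t g f) = linear_matrix f * linear_matrix g"
    by (rule eq_matI) (auto simp: linear_matrix_def scalar_prod_def atLeast0LessThan entry_compose[OF gA(1) fA] entry_last[of g, OF gA(2)])
  show "translation_vec (compose t g f) = translation_vec f + linear_matrix f *\<^sub>v translation_vec g"
    by (rule eq_vecI) (auto simp: translation_vec_def linear_matrix_def scalar_prod_def atLeast0LessThan entry_compose[OF gA(1) fA] entry_last[of g, OF gA(2)])
qed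

lemma affine_id: "linear_matrix (\<lambda>x\<in>t. x) = 1\<^sub>m r"
proof (rule eq_matI)
  fix l i assume "l < dim_row (1\<^sub>m r :: 'k mat)" "i < dim_col (1\<^sub>m r :: 'k mat)"
  then show "linear_matrix (\<lambda>x\<in>t. x) $$ (l, i) = 1\<^sub>m r $$ (l, i)"
    using coords_frame_member[OF ind_y, of l i] y_in_t[of l] by (auto simp: linear_matrix_def entry_def)
qed (simp_all add: linear_matrix_def)

lemma fixing_one_inv:
  assumes "g \<in> fixing_one" shows "Aut_inv t g \<in> fixing_one"
proof -
  have g: "g \<in> carrier (Aut_p L t)" "g 1 = 1" using assms by (auto simp: fixing_one_def)
  have "Aut_inv t g (g 1) = 1" by (rule Aut_inv_simps(3)[OF g(1) one_in_t])
  then show ?thesis using g Aut_inv_closed[OF p_sub_t g(1)] by (simp add: fixing_one_def)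
qed

lemma affine_injective:
  assumes g: "g \<in> fixing_one" and f: "f \<in> fixing_one"
    and eq: "linear_matrix g = linear_matrix f" "translation_vec g = translation_vec f"
  shows "g = f"
proof
  have gA: "g \<in> carrier (Aut_p L t)" "g 1 = 1" and fA: "f \<in> carrier (Aut_p L t)" "f 1 = 1" using g f by (auto simp: fixing_one_def)
  have e: "entry g l i = entry f l i" if "l < Suc r" "i < Suc r" for l i
  proof (cases "l = r")
    case True
    then show ?thesis using entry_last[of g, OF gA(2) that(2)] entry_last[of f, OF fA(2) that(2)] by simp
  next
    case False
    then have l: "l < r" using that(1) by simp
    show ?thesis
    proof (cases "i = r")
      case True
      have "translation_vec g $ l = entry g l r" "translation_vec f $ l = entry f l r" using l by (simp_all add: translation_vec_def)
      then show ?thesis using eq(2) True by simp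
    next
      case False
      then have i: "i < r" using that(2) by simp
      have "linear_matrix g $$ (l, i) = entry g l i" "linear_matrix f $$ (l, i) = entry f l i" using l i by (simp_all add: linear_matrix_def)
      then show ?thesis using eq(1) by simp
    qed
  qed
  have gf: "g (y l) = f (y l)" if "l < Suc r" for l
    unfolding entry_sum[OF gA(1) that] entry_sum[OF fA(1) that] using e[OF that] by (intro sum.cong) auto
  fix x
  show "g x = f x"
  proof (cases "x \<in> t")
    case True
    then have x: "(\<Sum>l<Suc r. scl L (coords (Suc r) y x l) (y l)) = x" unfolding ty by (rule sum_coords)
    have "g (\<Sum>l<Suc r. scl L (coords (Suc r) y x l) (y l)) = f (\<Sum>l<Suc r. scl L (coords (Suc r) y x l) (y l))"
    proof -
      have "g (\<Sum>l<Suc r. scl L (coords (Suc r) y x l) (y l)) = (\<Sum>l<Suc r. scl L (coords (Suc r) y x l) (g (y l)))"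
        by (rule Aut_p_sum[OF gA(1) sub_t y_in_t])
      also have "\<dots> = (\<Sum>l<Suc r. scl L (coords (Suc r) y x l) (f (y l)))"
        by (rule sum.cong[OF refl]) (simp only: gf lessThan_iff)
      also have "\<dots> = f (\<Sum>l<Suc r. scl L (coords (Suc r) y x l) (y l))"
        by (rule Aut_p_sum[OF fA(1) sub_t y_in_t, symmetric])
      finally show ?thesis .
    qed
    then show ?thesis unfolding x .
  next
    case False
    then show ?thesis using Aut_pD(3)[OF gA(1)] Aut_pD(3)[OF fA(1)] by (simp add: extensional_def)
  qed
qed

lemma carrier_GL_Fp:
  "M \<in> carrier (GL_Fp r) \<longleftrightarrow> (M \<in> carrier_mat r r \<and> elements_mat M \<subseteq> prime_field) \<and>
     (\<exists>N. (N \<in> carrier_mat r r \<and> elements_mat N \<subseteq> prime_field) \<and> N * M = 1\<^sub>m r \<and> M * N = 1\<^sub>m r)"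
  by (auto simp: GL_Fp_def units_of_def Units_def)

lemma linear_matrix_GL:
  assumes g: "g \<in> fixing_one" shows "linear_matrix g \<in> carrier (GL_Fp r)"
proof -
  have gA: "g \<in> carrier (Aut_p L t)" using g by (auto simp: fixing_one_def)
  have el: "elements_mat (linear_matrix h) \<subseteq> prime_field" if h: "h \<in> fixing_one" for h
  proof
    fix c assume "c \<in> elements_mat (linear_matrix h)"
    then obtain i j where "i < r" "j < r" "c = linear_matrix h $$ (i, j)" by (auto simp: linear_matrix_def dest!: elements_matD)
    then show "c \<in> prime_field" using entry_Ints[of h i j] h by (simp add: linear_matrix_def prime_field_def fixing_one_def)
  qed
  note inv = fixing_one_inv[OF g]
  have "compose t g (Aut_inv t g) = (\<lambda>x\<in>t. x)" "compose t (Aut_inv t g) g = (\<lambda>x\<in>t. x)"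
    using Aut_inv_simps[OF gA] by (auto simp: compose_def)
  then have "linear_matrix (Aut_inv t g) * linear_matrix g = 1\<^sub>m r" "linear_matrix g * linear_matrix (Aut_inv t g) = 1\<^sub>m r"
    using affine_compose(1)[OF g inv] affine_compose(1)[OF inv g] affine_id by simp_all
  then show ?thesis unfolding carrier_GL_Fp using el[OF g] el[OF inv] linear_matrix_carrier by blast
qed

lemma translation_vec_Fp:
  assumes g: "g \<in> fixing_one" shows "translation_vec g \<in> carrier (vec_Fp r)"
proof -
  have "c \<in> prime_field" if c: "c \<in> set\<^sub>v (translation_vec g)" for c
  proof -
    obtain i where "translation_vec g $ i = c" "i < dim_vec (translation_vec g)" using c[unfolded vec_set_def] by auto
    then have "i < r" "c = translation_vec g $ i" by (auto simp: translation_vec_def)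
    then show ?thesis using entry_Ints[of g i r] g by (simp add: translation_vec_def prime_field_def fixing_one_def)
  qed
  then show ?thesis using translation_vec_carrier by (auto simp: vec_Fp_def)
qed

text \<open>
  Inverting \<open>M\<close> shows that the toral elements with the prescribed coordinates span \<open>t\<close> again.
\<close>

lemma affine_surjective:
  assumes M: "M \<in> carrier (GL_Fp r)" and v: "v \<in> carrier (vec_Fp r)"
  shows "\<exists>g\<in>fixing_one. linear_matrix g = M \<and> translation_vec g = v"
proof -
  obtain N where MN: "M \<in> carrier_mat r r" "elements_mat M \<subseteq> prime_field" "N \<in> carrier_mat r r" "N * M = 1\<^sub>m r"
    using M unfolding carrier_GL_Fp by blast
  have vc: "v \<in> carrier_vec r" "set\<^sub>v v \<subseteq> prime_field" using v by (auto simp: vec_Fp_def)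
  define c where "c l i = (if l < r then if i < r then M $$ (l, i) else v $ l else if i = r then 1 else 0)" for l i
  have cZ: "c l i \<in> \<int>" if "l < Suc r" "i < Suc r" for l i
  proof -
    have "M $$ (l, i) \<in> \<int>" if "l < r" "i < r"
      using elements_matI[OF MN(1) that refl] MN(2) by (auto simp: prime_field_def)
    moreover have "v $ l \<in> \<int>" if "l < r" using vc vec_setI[of v l "v $ l"] that by (auto simp: prime_field_def)
    ultimately show ?thesis by (simp add: c_def)
  qed
  define y' where "y' l = (\<Sum>i<Suc r. scl L (c l i) (y i))" for l
  have y'r: "y' r = 1"
    unfolding y'_def c_def using family_member_sum[of r "Suc r" y] by (simp add: yr)
  have y't: "y' l \<in> t" for l unfolding y'_def using y_in_t by (intro subspace_sum[OF sub_t] subspace_scale[OF sub_t]) auto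
  note At = abelian_p_subalgebraD[OF torus_abelian[OF torus_t]]
  have toral: "pop L (y' l) = y' l" if "l < Suc r" for l
    unfolding y'_def using toral_iff_coordinates[OF torus_abelian[OF torus_t] ind_y, of "c l"] cZ[OF that] y_in_t y
    by (simp only: toral_frame_def) blast
  have inv: "left_inverse_matrix r (\<lambda>i j. N $$ (i, j)) (\<lambda>i j. M $$ (i, j))"
    unfolding left_inverse_matrix_def
  proof (intro allI impI)
    fix i l assume il: "i < r" "l < r"
    have "(N * M) $$ (i, l) = (\<Sum>j<r. N $$ (i, j) * M $$ (j, l))" using il MN(1,3) by (simp add: scalar_prod_def atLeast0LessThan)
    then show "(\<Sum>j<r. N $$ (i, j) * M $$ (j, l)) = (if i = l then 1 else 0)" unfolding MN(4) using il by simp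
  qed
  have y'base: "y' l \<in> family_span (Suc r) y'" if "l < Suc r" for l using family_span_base[OF that] .
  have indy': "family_independent (Suc r) y'"
  proof (rule family_independent_if_spans[OF ind_y])
    fix m assume m: "m < Suc r"
    show "y m \<in> family_span (Suc r) y'"
    proof (cases "m = r")
      case True
      then show ?thesis using y'base[of r] y'r yr by simp
    next
      case False
      then have mr: "m < r" using m by simp
      have "y' l - scl L (v $ l) 1 = (\<Sum>i<r. scl L (M $$ (l, i)) (y i))" if "l < r" for l
        using that by (simp add: y'_def c_def yr)
      then have "(\<Sum>l<r. scl L (N $$ (m, l)) (y' l - scl L (v $ l) 1)) = y m" by (rule invert_linear_system[OF inv _ mr])
      moreover have "y' l - scl L (v $ l) 1 \<in> family_span (Suc r) y'" if "l < r" for l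
        using y'base[of l] subspace_scale[OF subspace_family_span y'base[of r], of "v $ l"] that
        by (intro subspace_diff[OF subspace_family_span]) (simp_all add: y'r)
      then have "(\<Sum>l<r. scl L (N $$ (m, l)) (y' l - scl L (v $ l) 1)) \<in> family_span (Suc r) y'"
        by (intro subspace_sum[OF subspace_family_span] subspace_scale[OF subspace_family_span]) auto
      ultimately show ?thesis by simp
    qed
  qed
  have frame': "toral_frame (Suc r) y'"
    unfolding toral_frame_def using y't At(1,4) toral indy' by blast
  have span': "family_span (Suc r) y' = t"
    unfolding ty by (rule family_span_full[OF indy']) (use y't ty in blast)
  define g where "g = linear_ext (Suc r) y y'"
  have ge: "g \<in> torus_embeddings L t" unfolding g_def ty by (rule linear_ext_embedding[OF y frame'])
  have img: "g ` t = t" using linear_ext_image[OF ind_y, of y'] unfolding g_def span' ty[symmetric] .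
  have gA: "g \<in> carrier (Aut_p L t)"
  proof (rule Aut_pI)
    show "bij_betw g t t" using embeddingD(6)[OF ge] img by (simp add: bij_betw_def)
  qed (use embeddingD[OF ge] img in auto)
  have gy: "g (y l) = y' l" if "l < Suc r" for l unfolding g_def by (rule linear_ext_base[OF ind_y that])
  have "g 1 = 1" using gy[of r] by (simp add: yr y'r)
  then have "g \<in> fixing_one" using gA by (simp add: fixing_one_def)
  moreover have ent: "entry g l i = c l i" if "l < Suc r" "i < Suc r" for l i
    by (rule entry_unique[OF _ that(2)]) (use gy[OF that(1)] in \<open>simp only: y'_def\<close>)
  moreover have "linear_matrix g = M" by (rule eq_matI) (use ent MN(1) in \<open>auto simp: linear_matrix_def c_def\<close>)
  moreover have "translation_vec g = v" by (rule eq_vecI) (use ent vc(1) in \<open>auto simp: translation_vec_def c_def\<close>)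
  ultimately show ?thesis by blast
qed

text \<open>
  Passing to inverses turns the reversal of products into a homomorphism.
\<close>

lemma affine_group_iso:
  assumes S: "S_set L t = fixing_one"
  shows "S_group L t \<cong> (GL_Fp_semidirect r :: ('k mat \<times> 'k vec) monoid)"
proof -
  let ?G = "S_group L t" and ?H = "GL_Fp_semidirect r :: ('k mat \<times> 'k vec) monoid"
  let ?\<Phi> = "\<lambda>g. (linear_matrix (Aut_inv t g), translation_vec (Aut_inv t g))"
  have car: "carrier ?G = fixing_one" by (simp add: S_group_def S)
  have carH: "carrier ?H = carrier (GL_Fp r) \<times> carrier (vec_Fp r)" by (simp add: GL_Fp_semidirect_def semidirect_product_def)
  have A: "g \<in> carrier (Aut_p L t)" if "g \<in> fixing_one" for g using that by (simp add: fixing_one_def)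
  have mult: "g \<otimes>\<^bsub>?G\<^esub> f = compose t g f" if "g \<in> fixing_one" "f \<in> fixing_one" for g f
    using Aut_pD(2,3)[OF A[OF that(1)]] Aut_pD(2,3)[OF A[OF that(2)]]
    by (simp add: S_group_def Aut_p_def BijGroup_def Bij_def)
  have multH: "(M, v) \<otimes>\<^bsub>?H\<^esub> (M', v') = (M * M', v + M *\<^sub>v v')" for M M' v v'
    by (simp add: GL_Fp_semidirect_def semidirect_product_def GL_Fp_def vec_Fp_def units_of_def)
  have inv_inv: "Aut_inv t (Aut_inv t g) = g" if "g \<in> fixing_one" for g by (rule Aut_inv_inv[OF p_sub_t A[OF that]])
  have "?\<Phi> \<in> hom ?G ?H"
  proof (rule homI)
    fix g assume "g \<in> carrier ?G"
    then have "Aut_inv t g \<in> fixing_one" using fixing_one_inv car by simp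
    then show "?\<Phi> g \<in> carrier ?H" using linear_matrix_GL translation_vec_Fp carH by simp
  next
    fix g f assume "g \<in> carrier ?G" "f \<in> carrier ?G"
    then have gf: "g \<in> fixing_one" "f \<in> fixing_one" using car by simp_all
    have "Aut_inv t (g \<otimes>\<^bsub>?G\<^esub> f) = compose t (Aut_inv t f) (Aut_inv t g)"
      unfolding mult[OF gf] by (rule Aut_inv_compose[OF p_sub_t A[OF gf(1)] A[OF gf(2)]])
    then show "?\<Phi> (g \<otimes>\<^bsub>?G\<^esub> f) = ?\<Phi> g \<otimes>\<^bsub>?H\<^esub> ?\<Phi> f"
      unfolding multH using affine_compose[OF fixing_one_inv[OF gf(2)] fixing_one_inv[OF gf(1)]] by (simp only:)
  qed
  moreover have "bij_betw ?\<Phi> (carrier ?G) (carrier ?H)"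
    unfolding bij_betw_def car carH
  proof
    show "inj_on ?\<Phi> fixing_one"
    proof (rule inj_onI)
      fix g f assume gf: "g \<in> fixing_one" "f \<in> fixing_one" and "?\<Phi> g = ?\<Phi> f"
      then have "Aut_inv t g = Aut_inv t f"
        using affine_injective[OF fixing_one_inv[OF gf(1)] fixing_one_inv[OF gf(2)]] by simp
      then have "Aut_inv t (Aut_inv t g) = Aut_inv t (Aut_inv t f)" by (simp only:)
      then show "g = f" unfolding inv_inv[OF gf(1)] inv_inv[OF gf(2)] .
    qed
    show "?\<Phi> ` fixing_one = carrier (GL_Fp r) \<times> carrier (vec_Fp r)"
    proof
      show "?\<Phi> ` fixing_one \<subseteq> carrier (GL_Fp r) \<times> carrier (vec_Fp r)"
        using linear_matrix_GL translation_vec_Fp fixing_one_inv by blast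
      show "(carrier (GL_Fp r) \<times> carrier (vec_Fp r) :: ('k mat \<times> 'k vec) set) \<subseteq> ?\<Phi> ` fixing_one"
      proof
        fix Mv :: "'k mat \<times> 'k vec" assume "Mv \<in> carrier (GL_Fp r) \<times> carrier (vec_Fp r)"
        then obtain M v where Mv: "Mv = (M, v)" "M \<in> carrier (GL_Fp r)" "v \<in> carrier (vec_Fp r)" by blast
        obtain g where g: "g \<in> fixing_one" "linear_matrix g = M" "translation_vec g = v" using affine_surjective[OF Mv(2,3)] by blast
        then have "Mv = ?\<Phi> (Aut_inv t g)" using Mv(1) inv_inv by simp
        then show "Mv \<in> ?\<Phi> ` fixing_one" using fixing_one_inv[OF g(1)] by (rule image_eqI)
      qed
    qed
  qed
  ultimately have "?\<Phi> \<in> Group.iso ?G ?H" by (simp add: Group.iso_def)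
  then show ?thesis by (rule is_isoI)
qed

end

end

theorem theorem5p1p2:
  fixes r :: nat
    and pm :: "'k::alg_closed_field mpoly \<Rightarrow> 'k mpoly"
    and t :: "'k mpoly set"
  assumes "CHAR('k) \<ge> 3"
    and "r \<ge> 1"
    and "poisson_p_map r pm"
    and "max_dim_torus (poisson_algebra r pm) t"
  shows "S_group (poisson_algebra r pm) t \<cong> (GL_Fp_semidirect r :: ('k mat \<times> 'k vec) monoid)
    \<and> S_set (poisson_algebra r pm) t = {g \<in> carrier (Aut_p (poisson_algebra r pm) t). g 1 = 1}"
proof -
  interpret restricted_poisson r pm by unfold_locales (rule assms(1-3))+
  have S: "S_set L t = {g \<in> carrier (Aut_p L t). g 1 = 1}" by (rule S_set_poisson[OF assms(4)])
  obtain y where y: "toral_frame (Suc r) y" "y r = 1" "t = family_span (Suc r) y" using max_torus_frame[OF assms(4)] by blast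
  have "S_set L t = fixing_one t" unfolding S fixing_one_def[OF y] ..
  then have "S_group L t \<cong> (GL_Fp_semidirect r :: ('k mat \<times> 'k vec) monoid)" by (rule affine_group_iso[OF y])
  with S show ?thesis by blast
qed

end
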